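(* Let $C$ be a complete integral curve of arithmetic genus $g\ge2$ over an algebraically closed field $k$, let $G\subset C$ be its Gorenstein locus, and $C'\subset\mathbb P^{g-1}$ its canonical model. If $C$ is nonhyperelliptic, then the canonical map $\kappa\colon G\to C'$ is an open embedding.
   Context: The field $k$ has arbitrary characteristic. $\omega$ is the dualizing sheaf of $C$. $C$ is hyperelliptic if there is a map $C\to\mathbb P^1$ of degree $2$, and nonhyperelliptic otherwise. The Gorenstein locus $G$ is the largest open subset of $C$ on which $\omega$ is invertible (equivalently, where the local rings of $C$ are Gorenstein). For an integral scheme $A$ and a map $\alpha\colon A\to C$, put $\mathcal O_A\omega:=\alpha^*\omega/\mathrm{Torsion}(\alpha^*\omega)$. Let $\nu\colon\bar C\to C$ be the normalization. The $g$-dimensional space $H^0(\omega)$ generates $\omega$, so $\mathcal O_{\bar C}\omega$ is invertible and generated by $H^0(\omega)$; this defines a nondegenerate map $\bar\kappa\colon\bar C\to\mathbb P^{g-1}$, whose image is the canonical model $C'$. Blowup with respect to $\omega$: for $n\ge0$ set $\omega^n:=\mathrm{Sym}^n\omega/\mathrm{Torsion}(\mathrm{Sym}^n\omega)$, and let $\hat C:=\mathrm{Proj}(\bigoplus_n\omega^n)$ with structure map $\beta\colon\hat C\to C$. Then $\hat C$ is an integral curve, $\beta$ is birational, and $\mathcal O_{\hat C}\omega$ is invertible and generated by $H^0(\omega)$. The normalization factors uniquely as $\nu=\beta\hat\nu$ with $\hat\nu\colon\bar C\to\hat C$, and $\bar\kappa$ factors uniquely as $\bar\kappa=\hat\kappa\hat\nu$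 with $\hat\kappa\colon\hat C\to C'$. The map $\beta$ restricts to an isomorphism $\beta^{-1}G\to G$, and $\kappa\colon G\to C'$ is the composition of $\hat\kappa$ with the inverse of this isomorphism. (If $C$ is Gorenstein, $\kappa$ is the map defined by $H^0(\omega)$.) *)

theory Defs
  imports
    "HOL-Analysis.Abstract_Topology"
    "HOL-Algebra.Module"
    "HOL-Computational_Algebra.Polynomial"
begin

text \<open>
  An integral separated scheme of finite type over a field \<open>k\<close> is rendered as its schema in the
  sense of Chevalley (EGA I, section 8): the set \<open>X\<close> of its local rings, viewed as subrings of
  a field, namely the type \<open>'a\<close>, which contains the function field.  A point is its local
  ring, the generic point is the function field, and the structure sheaf has the sections \<open>\<Inter>U\<close>
  over a nonempty open set \<open>U\<close>.  A dominant morphism \<open>X \<rightarrow> Y\<close>, with the function field of \<open>Y\<close> a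
  subfield of that of \<open>X\<close>, is the map that sends a point \<open>x\<close> of \<open>X\<close> to the point of \<open>Y\<close> dominated
  by \<open>x\<close>.  The ground field \<open>k\<close> is a subset of \<open>'a\<close>.
\<close>

section \<open>Subrings of a field\<close>

definition is_subring :: "'a::field set \<Rightarrow> bool" where
  "is_subring A \<longleftrightarrow> 1 \<in> A \<and> (\<forall>x\<in>A. \<forall>y\<in>A. x - y \<in> A \<and> x * y \<in> A)"

definition is_subfield :: "'a::field set \<Rightarrow> bool" where
  "is_subfield L \<longleftrightarrow> is_subring L \<and> (\<forall>x\<in>L. inverse x \<in> L)"

definition alg_closed_subfield :: "'a::field set \<Rightarrow> bool" where
  "alg_closed_subfield k \<longleftrightarrow> is_subfield k \<and>
     (\<forall>p::'a poly. (\<forall>i. coeff p i \<in> k) \<and> degree p > 0 \<longrightarrow> (\<exists>z\<in>k. poly p z = 0))"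

definition frac :: "'a::field set \<Rightarrow> 'a set" where
  "frac A = {a / b |a b. a \<in> A \<and> b \<in> A \<and> b \<noteq> 0}"

definition alg_gen :: "'a::field set \<Rightarrow> 'a set \<Rightarrow> 'a set" where
  "alg_gen A S = \<Inter>{B. is_subring B \<and> A \<subseteq> B \<and> S \<subseteq> B}"

definition finite_type :: "'a::field set \<Rightarrow> 'a set \<Rightarrow> bool" where
  "finite_type k A \<longleftrightarrow> (\<exists>S. finite S \<and> A = alg_gen k S)"

definition submod_gen :: "'a::field set \<Rightarrow> 'a set \<Rightarrow> 'a set" where
  "submod_gen A S = \<Inter>{M. S \<subseteq> M \<and> 0 \<in> M \<and> (\<forall>x\<in>M. \<forall>y\<in>M. x + y \<in> M) \<and> (\<forall>a\<in>A. \<forall>x\<in>M. a * x \<in> M)}"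

definition scale_set :: "'a::field \<Rightarrow> 'a set \<Rightarrow> 'a set" where
  "scale_set w A = {w * a |a. a \<in> A}"

definition prime_ideal_of :: "'a::field set \<Rightarrow> 'a set \<Rightarrow> bool" where
  "prime_ideal_of A P \<longleftrightarrow> P \<subseteq> A \<and> 0 \<in> P \<and> 1 \<notin> P \<and> (\<forall>x\<in>P. \<forall>y\<in>P. x + y \<in> P) \<and>
     (\<forall>a\<in>A. \<forall>x\<in>P. a * x \<in> P) \<and> (\<forall>a\<in>A. \<forall>b\<in>A. a * b \<in> P \<longrightarrow> a \<in> P \<or> b \<in> P)"

definition localization :: "'a::field set \<Rightarrow> 'a set \<Rightarrow> 'a set" where
  "localization A P = {a / s |a s. a \<in> A \<and> s \<in> A - P}"

definition spec :: "'a::field set \<Rightarrow> 'a set set" where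
  "spec A = {localization A P |P. prime_ideal_of A P}"

definition max_ideal :: "'a::field set \<Rightarrow> 'a set" where
  "max_ideal x = {a \<in> x. a = 0 \<or> inverse a \<notin> x}"

definition dominates :: "'a::field set \<Rightarrow> 'a set \<Rightarrow> bool" where
  "dominates y x \<longleftrightarrow> x \<subseteq> y \<and> max_ideal y \<inter> x = max_ideal x"

definition valuation_ring :: "'a::field set \<Rightarrow> 'a set \<Rightarrow> bool" where
  "valuation_ring L V \<longleftrightarrow> is_subring V \<and> V \<subseteq> L \<and> (\<forall>a\<in>L. a \<in> V \<or> inverse a \<in> V)"

definition integral_over :: "'a::field set \<Rightarrow> 'a \<Rightarrow> bool" where
  "integral_over A a \<longleftrightarrow> (\<exists>p::'a poly. lead_coeff p = 1 \<and> (\<forall>i. coeff p i \<in> A) \<and> poly p a = 0)"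

definition transcendental_over :: "'a::field set \<Rightarrow> 'a \<Rightarrow> bool" where
  "transcendental_over k a \<longleftrightarrow> (\<forall>p::'a poly. (\<forall>i. coeff p i \<in> k) \<and> poly p a = 0 \<longrightarrow> p = 0)"

definition extension_degree :: "'a::field set \<Rightarrow> 'a set \<Rightarrow> nat \<Rightarrow> bool" where
  "extension_degree L M n \<longleftrightarrow> (\<exists>S\<subseteq>M. finite S \<and> card S = n \<and>
     (\<forall>x\<in>M. \<exists>!c. c \<in> S \<rightarrow>\<^sub>E L \<and> x = (\<Sum>s\<in>S. c s * s)))"


section \<open>Integral schemes, topology and morphisms\<close>

definition function_field :: "'a::field set set \<Rightarrow> 'a set" where
  "function_field X = \<Union>X"

text \<open>
  The last condition is separatedness: the affine charts are glued along everything that they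
  have in common, and a valuation ring has at most one center.
\<close>

definition integral_scheme :: "'a::field set \<Rightarrow> 'a set set \<Rightarrow> bool" where
  "integral_scheme k X \<longleftrightarrow>
     (\<exists>\<A>. finite \<A> \<and> \<A> \<noteq> {} \<and> (\<forall>A\<in>\<A>. finite_type k A) \<and> X = (\<Union>A\<in>\<A>. spec A)) \<and>
     (\<forall>x\<in>X. frac x = function_field X) \<and>
     (\<forall>V. valuation_ring (function_field X) V \<longrightarrow>
        (\<forall>x\<in>X. \<forall>y\<in>X. dominates V x \<and> dominates V y \<longrightarrow> x = y))"

definition complete_scheme :: "'a::field set \<Rightarrow> 'a set set \<Rightarrow> bool" where
  "complete_scheme k X \<longleftrightarrow>
     (\<forall>V. valuation_ring (function_field X) V \<and> k \<subseteq> V \<longrightarrow> (\<exists>x\<in>X. dominates V x))"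

text \<open>A point \<open>x\<close> is a specialization of \<open>y\<close> iff \<open>x \<subseteq> y\<close>.\<close>

definition one_dimensional :: "'a::field set set \<Rightarrow> bool" where
  "one_dimensional X \<longleftrightarrow> (\<exists>x\<in>X. \<exists>y\<in>X. x \<subset> y) \<and> \<not> (\<exists>x\<in>X. \<exists>y\<in>X. \<exists>z\<in>X. x \<subset> y \<and> y \<subset> z)"

definition complete_integral_curve :: "'a::field set \<Rightarrow> 'a set set \<Rightarrow> bool" where
  "complete_integral_curve k C \<longleftrightarrow> integral_scheme k C \<and> complete_scheme k C \<and> one_dimensional C"

text \<open>
  A finitely generated subalgebra \<open>A\<close> all of whose localizations are points of \<open>X\<close> is the
  coordinate ring of an affine open subset, and every nonempty affine open subset is of this form.
\<close>

definition affine_opens :: "'a::field set \<Rightarrow> 'a set set \<Rightarrow> 'a set set set" where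
  "affine_opens k X = {spec A |A. finite_type k A \<and> spec A \<subseteq> X}"

definition zariski :: "'a::field set \<Rightarrow> 'a set set \<Rightarrow> 'a set topology" where
  "zariski k X = topology_generated_by (affine_opens k X)"

definition nonempty_opens :: "'a::field set \<Rightarrow> 'a set set \<Rightarrow> 'a set set set" where
  "nonempty_opens k X = {U. openin (zariski k X) U \<and> U \<noteq> {}}"

definition is_morphism :: "'a::field set set \<Rightarrow> 'a set set \<Rightarrow> ('a set \<Rightarrow> 'a set) \<Rightarrow> bool" where
  "is_morphism X Y \<phi> \<longleftrightarrow> (\<forall>x\<in>X. \<phi> x \<in> Y \<and> dominates x (\<phi> x))"

definition center :: "'a::field set set \<Rightarrow> 'a set \<Rightarrow> 'a set" where
  "center Y x = (THE y. y \<in> Y \<and> dominates x y)"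

text \<open>
  The map on stalks at \<open>x\<close> is the inclusion of \<open>\<phi> x\<close> into \<open>x\<close>, so it is an isomorphism
  iff \<open>\<phi> x = x\<close>.
\<close>

definition open_embedding ::
  "'a::field set \<Rightarrow> 'a set set \<Rightarrow> 'a set set \<Rightarrow> ('a set \<Rightarrow> 'a set) \<Rightarrow> bool" where
  "open_embedding k X Y \<phi> \<longleftrightarrow> is_morphism X Y \<phi> \<and>
     embedding_map (zariski k X) (zariski k Y) \<phi> \<and> openin (zariski k Y) (\<phi> ` X) \<and>
     (\<forall>x\<in>X. \<phi> x = x)"

definition projective_line :: "'a::field set \<Rightarrow> 'a \<Rightarrow> 'a set set" where
  "projective_line k f = spec (alg_gen k {f}) \<union> spec (alg_gen k {inverse f})"

text \<open>
  A dominant map \<open>C \<rightarrow> P\<^sup>1\<close> is given by the pullback \<open>f\<close> of the coordinate function; its degree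
  is the degree of the extension of function fields.
\<close>

definition hyperelliptic :: "'a::field set \<Rightarrow> 'a set set \<Rightarrow> bool" where
  "hyperelliptic k C \<longleftrightarrow> (\<exists>f\<in>function_field C. transcendental_over k f \<and>
     is_morphism C (projective_line k f) (center (projective_line k f)) \<and>
     extension_degree (function_field (projective_line k f)) (function_field C) 2)"

definition normalization :: "'a::field set \<Rightarrow> 'a set set \<Rightarrow> 'a set set" where
  "normalization k X = \<Union>{spec {a \<in> frac A. integral_over A a} |A. finite_type k A \<and> spec A \<subseteq> X}"


section \<open>Sheaves of modules\<close>

text \<open>
  Any two nonempty open subsets of an integral scheme meet, and sections over the empty set carry
  no information; so sheaves are given by their values on nonempty open subsets only.
\<close>

record ('a, 'm) sheaf =
  sect :: "'a set set \<Rightarrow> ('a, 'm) module"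
  restr :: "'a set set \<Rightarrow> 'a set set \<Rightarrow> 'm \<Rightarrow> 'm"

definition ring_of :: "'a::field set \<Rightarrow> 'a ring" where
  "ring_of A = \<lparr>carrier = A, monoid.mult = (*), one = 1, zero = 0, add = (+)\<rparr>"

definition linear_maps :: "'a set \<Rightarrow> ('a, 'm) module \<Rightarrow> ('a, 'n) module \<Rightarrow> ('m \<Rightarrow> 'n) set" where
  "linear_maps A M N = {h \<in> carrier M \<rightarrow>\<^sub>E carrier N.
     (\<forall>s\<in>carrier M. \<forall>t\<in>carrier M. h (s \<oplus>\<^bsub>M\<^esub> t) = h s \<oplus>\<^bsub>N\<^esub> h t) \<and>
     (\<forall>a\<in>A. \<forall>s\<in>carrier M. h (a \<odot>\<^bsub>M\<^esub> s) = a \<odot>\<^bsub>N\<^esub> h s)}"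

definition sheaf_of_modules :: "'a::field set \<Rightarrow> 'a set set \<Rightarrow> ('a, 'm) sheaf \<Rightarrow> bool" where
  "sheaf_of_modules k X F \<longleftrightarrow>
     (\<forall>U\<in>nonempty_opens k X. Module.module (ring_of (\<Inter>U)) (sect F U)) \<and>
     (\<forall>U\<in>nonempty_opens k X. \<forall>V\<in>nonempty_opens k X. V \<subseteq> U \<longrightarrow>
        restrict (restr F U V) (carrier (sect F U)) \<in> linear_maps (\<Inter>U) (sect F U) (sect F V)) \<and>
     (\<forall>U\<in>nonempty_opens k X. \<forall>s\<in>carrier (sect F U). restr F U U s = s) \<and>
     (\<forall>U\<in>nonempty_opens k X. \<forall>V\<in>nonempty_opens k X. \<forall>W\<in>nonempty_opens k X. W \<subseteq> V \<and> V \<subseteq> U \<longrightarrow>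
        (\<forall>s\<in>carrier (sect F U). restr F V W (restr F U V s) = restr F U W s)) \<and>
     (\<forall>U\<in>nonempty_opens k X. \<forall>\<V>\<subseteq>nonempty_opens k X. \<Union>\<V> = U \<longrightarrow>
        (\<forall>f. (\<forall>V\<in>\<V>. f V \<in> carrier (sect F V)) \<and>
             (\<forall>V\<in>\<V>. \<forall>W\<in>\<V>. restr F V (V \<inter> W) (f V) = restr F W (V \<inter> W) (f W)) \<longrightarrow>
             (\<exists>!s. s \<in> carrier (sect F U) \<and> (\<forall>V\<in>\<V>. restr F U V s = f V))))"

text \<open>
  Coherence: on every affine open subset \<open>U = spec A\<close> the module \<open>F(U)\<close> is finitely generated, and
  for every nonzero \<open>f\<close> in \<open>A\<close>, with \<open>D(f) = spec A[1/f]\<close>, the canonical map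
  \<open>F(U)[1/f] \<rightarrow> F(D(f))\<close> is bijective.
\<close>

definition coherent :: "'a::field set \<Rightarrow> 'a set set \<Rightarrow> ('a, 'm) sheaf \<Rightarrow> bool" where
  "coherent k X F \<longleftrightarrow> sheaf_of_modules k X F \<and>
     (\<forall>A. finite_type k A \<and> spec A \<subseteq> X \<longrightarrow>
        (\<exists>S. finite S \<and> S \<subseteq> carrier (sect F (spec A)) \<and>
           (\<forall>N. submodule N (ring_of A) (sect F (spec A)) \<and> S \<subseteq> N \<longrightarrow>
              N = carrier (sect F (spec A)))) \<and>
        (\<forall>f\<in>A - {0}. let U = spec A; D = spec {a / f ^ n |a n. a \<in> A} in
           (\<forall>s\<in>carrier (sect F U). restr F U D s = \<zero>\<^bsub>sect F D\<^esub> \<longrightarrow>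
              (\<exists>n. f ^ n \<odot>\<^bsub>sect F U\<^esub> s = \<zero>\<^bsub>sect F U\<^esub>)) \<and>
           (\<forall>t\<in>carrier (sect F D). \<exists>n. \<exists>s\<in>carrier (sect F U).
              restr F U D s = f ^ n \<odot>\<^bsub>sect F D\<^esub> t)))"

definition sheaf_homs ::
  "'a::field set \<Rightarrow> 'a set set \<Rightarrow> ('a, 'm) sheaf \<Rightarrow> ('a, 'n) sheaf \<Rightarrow> ('a set set \<Rightarrow> 'm \<Rightarrow> 'n) set" where
  "sheaf_homs k X F G = {\<phi> \<in> (\<Pi>\<^sub>E U\<in>nonempty_opens k X. linear_maps (\<Inter>U) (sect F U) (sect G U)).
     \<forall>U\<in>nonempty_opens k X. \<forall>V\<in>nonempty_opens k X. V \<subseteq> U \<longrightarrow>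
       (\<forall>s\<in>carrier (sect F U). restr G U V (\<phi> U s) = \<phi> V (restr F U V s))}"


section \<open>First cohomology and duality\<close>

text \<open>
  \<open>H\<^sup>1\<close> is Cech cohomology with respect to the cover by all affine open subsets; for coherent
  sheaves on a separated scheme this is sheaf cohomology.
\<close>

definition cech_cochains1 ::
  "'a::field set \<Rightarrow> 'a set set \<Rightarrow> ('a, 'm) sheaf \<Rightarrow> ('a set set \<times> 'a set set \<Rightarrow> 'm) set" where
  "cech_cochains1 k X F =
     (\<Pi>\<^sub>E (U, V)\<in>affine_opens k X \<times> affine_opens k X. carrier (sect F (U \<inter> V)))"

definition cech_cocycles1 ::
  "'a::field set \<Rightarrow> 'a set set \<Rightarrow> ('a, 'm) sheaf \<Rightarrow> ('a set set \<times> 'a set set \<Rightarrow> 'm) set" where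
  "cech_cocycles1 k X F = {c \<in> cech_cochains1 k X F.
     \<forall>U\<in>affine_opens k X. \<forall>V\<in>affine_opens k X. \<forall>W\<in>affine_opens k X. let T = U \<inter> V \<inter> W in
       restr F (U \<inter> W) T (c (U, W)) =
         restr F (U \<inter> V) T (c (U, V)) \<oplus>\<^bsub>sect F T\<^esub> restr F (V \<inter> W) T (c (V, W))}"

definition cech_coboundaries1 ::
  "'a::field set \<Rightarrow> 'a set set \<Rightarrow> ('a, 'm) sheaf \<Rightarrow> ('a set set \<times> 'a set set \<Rightarrow> 'm) set" where
  "cech_coboundaries1 k X F = {c \<in> cech_cochains1 k X F.
     \<exists>b\<in>\<Pi> U\<in>affine_opens k X. carrier (sect F U).
       \<forall>U\<in>affine_opens k X. \<forall>V\<in>affine_opens k X.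
         c (U, V) = restr F V (U \<inter> V) (b V) \<ominus>\<^bsub>sect F (U \<inter> V)\<^esub> restr F U (U \<inter> V) (b U)}"

text \<open>The \<open>k\<close>-dual of \<open>H\<^sup>1\<close>, as the linear forms on the cocycles that vanish on the coboundaries.\<close>

definition H1_dual ::
  "'a::field set \<Rightarrow> 'a set set \<Rightarrow> ('a, 'm) sheaf \<Rightarrow> (('a set set \<times> 'a set set \<Rightarrow> 'm) \<Rightarrow> 'a) set" where
  "H1_dual k X F = {l \<in> cech_cocycles1 k X F \<rightarrow>\<^sub>E k.
     (\<forall>c\<in>cech_cocycles1 k X F. \<forall>d\<in>cech_cocycles1 k X F.
        l (\<lambda>(U, V)\<in>affine_opens k X \<times> affine_opens k X.
             c (U, V) \<oplus>\<^bsub>sect F (U \<inter> V)\<^esub> d (U, V)) = l c + l d) \<and>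
     (\<forall>a\<in>k. \<forall>c\<in>cech_cocycles1 k X F.
        l (\<lambda>(U, V)\<in>affine_opens k X \<times> affine_opens k X.
             a \<odot>\<^bsub>sect F (U \<inter> V)\<^esub> c (U, V)) = a * l c) \<and>
     (\<forall>c\<in>cech_coboundaries1 k X F. l c = 0)}"

text \<open>
  An \<open>O\<^sub>X\<close>-submodule of the constant sheaf of rational functions, given by its stalks \<open>E x\<close>.
\<close>

definition sections :: "('a::field set \<Rightarrow> 'a set) \<Rightarrow> 'a set set \<Rightarrow> 'a set" where
  "sections E U = (\<Inter>x\<in>U. E x)"

definition fractional_sheaf :: "('a::field set \<Rightarrow> 'a set) \<Rightarrow> ('a, 'a) sheaf" where
  "fractional_sheaf E =
     \<lparr>sect = (\<lambda>U. \<lparr>carrier = sections E U, monoid.mult = (*), one = 1, zero = 0, add = (+), module.smult = (*)\<rparr>),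
      restr = (\<lambda>U V s. s)\<rparr>"

definition coherent_fractional :: "'a::field set \<Rightarrow> 'a set set \<Rightarrow> ('a set \<Rightarrow> 'a set) \<Rightarrow> bool" where
  "coherent_fractional k X E \<longleftrightarrow> coherent k X (fractional_sheaf E) \<and>
     (\<forall>x\<in>X. E x \<subseteq> function_field X \<and>
        E x = \<Union>{sections E U |U. U \<in> nonempty_opens k X \<and> x \<in> U})"

definition structure_sheaf :: "('a::field, 'a) sheaf" where
  "structure_sheaf = fractional_sheaf (\<lambda>x. x)"

text \<open>
  The arithmetic genus \<open>1 - \<chi>(O\<^sub>C)\<close> of a complete integral curve over an algebraically closed field
  is the dimension of \<open>H\<^sup>1(O\<^sub>C)\<close>, since \<open>H\<^sup>0(O\<^sub>C) = k\<close>.  Here \<open>S\<close> represents a basis.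
\<close>

definition has_arithmetic_genus :: "'a::field set \<Rightarrow> 'a set set \<Rightarrow> nat \<Rightarrow> bool" where
  "has_arithmetic_genus k C g \<longleftrightarrow>
     (\<exists>S\<subseteq>cech_cocycles1 k C structure_sheaf. finite S \<and> card S = g \<and>
        (\<forall>z\<in>cech_cocycles1 k C structure_sheaf. \<exists>!r. r \<in> S \<rightarrow>\<^sub>E k \<and>
           (\<lambda>p\<in>affine_opens k C \<times> affine_opens k C. z p - (\<Sum>s\<in>S. r s * s p))
             \<in> cech_coboundaries1 k C structure_sheaf))"

text \<open>
  A dualizing sheaf comes with a trace \<open>t : H\<^sup>1(\<omega>) \<rightarrow> k\<close> such that for every coherent \<open>F\<close> the
  pairing \<open>Hom(F, \<omega>) \<times> H\<^sup>1(F) \<rightarrow> H\<^sup>1(\<omega>) \<rightarrow> k\<close> induces an isomorphism of \<open>Hom(F, \<omega>)\<close> with the dual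
  of \<open>H\<^sup>1(F)\<close>.  On an integral curve it is torsion-free of rank 1, hence isomorphic to a
  submodule of the constant sheaf of rational functions, and \<open>\<omega>\<close> is taken as such a submodule.
  Over an infinite \<open>k\<close>, every coherent sheaf is isomorphic to one with sections in the function
  field as a mere set, for reasons of cardinality; so \<open>F\<close> ranges over all coherent sheaves.
\<close>

definition dualizing_sheaf :: "'a::field set \<Rightarrow> 'a set set \<Rightarrow> ('a set \<Rightarrow> 'a set) \<Rightarrow> bool" where
  "dualizing_sheaf k C \<omega> \<longleftrightarrow> coherent_fractional k C \<omega> \<and>
     (\<exists>t\<in>H1_dual k C (fractional_sheaf \<omega>). \<forall>F :: ('a, 'a) sheaf. coherent k C F \<longrightarrow>
        bij_betw
          (\<lambda>\<phi>. \<lambda>c\<in>cech_cocycles1 k C F.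
             t (\<lambda>(U, V)\<in>affine_opens k C \<times> affine_opens k C. \<phi> (U \<inter> V) (c (U, V))))
          (sheaf_homs k C F (fractional_sheaf \<omega>)) (H1_dual k C F))"


section \<open>The canonical model and the canonical map\<close>

definition global_sections :: "'a::field set set \<Rightarrow> ('a set \<Rightarrow> 'a set) \<Rightarrow> 'a set" where
  "global_sections C \<omega> = sections \<omega> C"

definition invertible_on :: "'a::field set \<Rightarrow> ('a set \<Rightarrow> 'a set) \<Rightarrow> 'a set set \<Rightarrow> bool" where
  "invertible_on k \<omega> U \<longleftrightarrow> (\<forall>x\<in>U. \<exists>V\<in>nonempty_opens k U. x \<in> V \<and>
     (\<exists>w. w \<noteq> 0 \<and> (\<forall>y\<in>V. \<omega> y = scale_set w y)))"

definition gorenstein_locus :: "'a::field set \<Rightarrow> 'a set set \<Rightarrow> ('a set \<Rightarrow> 'a set) \<Rightarrow> 'a set set" where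
  "gorenstein_locus k C \<omega> = \<Union>{U. openin (zariski k C) U \<and> invertible_on k \<omega> U}"

text \<open>
  The stalk at \<open>y\<close> of the pullback of \<open>\<omega>\<close> modulo torsion, along a birational map to \<open>C\<close>.
\<close>

definition pullback_stalk :: "'a::field set set \<Rightarrow> ('a set \<Rightarrow> 'a set) \<Rightarrow> 'a set \<Rightarrow> 'a set" where
  "pullback_stalk C \<omega> y = submod_gen y (\<omega> (center C y))"

text \<open>
  The map to projective space defined by sections \<open>H\<close> that generate an invertible sheaf \<open>L\<close>.  If
  \<open>v\<close> generates the stalk of \<open>L\<close> at \<open>y\<close>, then \<open>y\<close> is mapped into the standard affine piece where
  \<open>v\<close> does not vanish, by \<open>X\<^sub>u / X\<^sub>v \<mapsto> u / v\<close>.  The closure of the image, with its reduced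
  structure, has the coordinate ring \<open>k[u / v | u \<in> H]\<close> there, and the image of \<open>y\<close> is given as a
  point of that closure, that is, by its local ring there.
\<close>

definition chart_ring :: "'a::field set \<Rightarrow> 'a set \<Rightarrow> 'a \<Rightarrow> 'a set" where
  "chart_ring k H v = alg_gen k {u / v |u. u \<in> H}"

definition projective_map ::
  "'a::field set \<Rightarrow> 'a set \<Rightarrow> ('a set \<Rightarrow> 'a set) \<Rightarrow> 'a set \<Rightarrow> 'a set" where
  "projective_map k H L y = (THE z. \<exists>v\<in>H. v \<noteq> 0 \<and> L y = scale_set v y \<and>
     z = localization (chart_ring k H v) (max_ideal y \<inter> chart_ring k H v))"

definition kappa_bar :: "'a::field set \<Rightarrow> 'a set set \<Rightarrow> ('a set \<Rightarrow> 'a set) \<Rightarrow> 'a set \<Rightarrow> 'a set" where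
  "kappa_bar k C \<omega> = projective_map k (global_sections C \<omega>) (pullback_stalk C \<omega>)"

definition canonical_model :: "'a::field set \<Rightarrow> 'a set set \<Rightarrow> ('a set \<Rightarrow> 'a set) \<Rightarrow> 'a set set" where
  "canonical_model k C \<omega> = kappa_bar k C \<omega> ` normalization k C"

text \<open>
  For a fractional ideal \<open>M\<close>, the torsion-free quotient of its \<open>n\<close>-th symmetric power is the
  product \<open>M\<^sup>n\<close>.  The scheme \<open>Proj\<close> of their direct sum is the union of the spectra of the
  homogeneous localizations at the elements \<open>w\<close> of degree 1.
\<close>

primrec module_power :: "'a::field set \<Rightarrow> 'a set \<Rightarrow> nat \<Rightarrow> 'a set" where
  "module_power A M 0 = A"
| "module_power A M (Suc n) = submod_gen A {x * y |x y. x \<in> M \<and> y \<in> module_power A M n}"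

definition homogeneous_localization :: "'a::field set \<Rightarrow> 'a set \<Rightarrow> 'a \<Rightarrow> 'a set" where
  "homogeneous_localization A M w = {a / w ^ n |a n. a \<in> module_power A M n}"

definition blowup :: "'a::field set \<Rightarrow> 'a set set \<Rightarrow> ('a set \<Rightarrow> 'a set) \<Rightarrow> 'a set set" where
  "blowup k C \<omega> = \<Union>{spec (homogeneous_localization A (sections \<omega> (spec A)) w) |A w.
     finite_type k A \<and> spec A \<subseteq> C \<and> w \<in> sections \<omega> (spec A) \<and> w \<noteq> 0}"

definition kappa_hat :: "'a::field set \<Rightarrow> 'a set set \<Rightarrow> ('a set \<Rightarrow> 'a set) \<Rightarrow> 'a set \<Rightarrow> 'a set" where
  "kappa_hat k C \<omega> = center (canonical_model k C \<omega>)"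

text \<open>Here \<open>center C\<close> is the structure map \<open>\<beta>\<close> of the blowup.\<close>

definition kappa :: "'a::field set \<Rightarrow> 'a set set \<Rightarrow> ('a set \<Rightarrow> 'a set) \<Rightarrow> 'a set \<Rightarrow> 'a set" where
  "kappa k C \<omega> = kappa_hat k C \<omega> \<circ>
     the_inv_into {y \<in> blowup k C \<omega>. center C y \<in> gorenstein_locus k C \<omega>} (center C)"

end

theory Submission
  imports Defs
begin

text \<open>
  Points are local rings, so the claim is that each Gorenstein point \<open>P\<close> is itself a point of the canonical
  model: then \<open>\<kappa>\<close> is the inclusion of the Gorenstein locus, which is open in the model
  (\<open>kappa_identity\<close>, \<open>kappa_open_embedding\<close>).  For a closed Gorenstein point \<open>P\<close>, choose a global section \<open>v\<close>
  of \<open>\<omega>\<close> that generates the stalk at \<open>P\<close>.  The point of the model below \<open>P\<close> is the local ring \<open>z\<close> of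
  \<open>R = k[h / v]\<close>, with \<open>h\<close> ranging over the space \<open>H\<close> of global sections, at the center of \<open>P\<close>; it is to be
  shown that \<open>z = P\<close>.

  As in the smooth case, this follows from two facts.  Sections separate tangent vectors at \<open>P\<close>:
  the quotients \<open>h / v\<close> in the maximal ideal of \<open>P\<close> generate this ideal (\<open>max_ideal_generated\<close>).
  And sections separate \<open>P\<close> from all other places: every valuation ring that dominates \<open>z\<close> dominates \<open>P\<close>
  (\<open>center_is_P\<close>).  By the second, \<open>P\<close> is integral over \<open>z\<close>, hence a finite module, and by the first and
  Nakayama's lemma it is equal to \<open>z\<close> (\<open>local_ring_of_model\<close>).

  If one of the two facts fails, the curve is hyperelliptic.  Instead of the theorem of Riemann and Roch, the
  argument uses the following form of duality (\<open>multiplier_exists\<close>).  Let \<open>G\<close> be a coherent subsheaf of the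
  constant sheaf \<open>K\<close>, and \<open>F\<close> a subsheaf of colength one, at a closed point \<open>Q\<close>, with the same global sections.
  Then \<open>H\<^sup>1(F)\<close> has a nonzero class that dies in \<open>H\<^sup>1(G)\<close>, and a linear form that detects it is, by duality,
  a homomorphism from \<open>F\<close> to \<open>\<omega>\<close> that does not extend to \<open>G\<close>: a rational function \<open>f\<close>
  with \<open>f F \<subseteq> \<omega>\<close>.

  Here \<open>G\<close> is the subsheaf of \<open>\<omega>\<close> of sections vanishing at \<open>P\<close>, and \<open>F\<close> has the same space \<open>W\<close> of global
  sections, of codimension one in \<open>H\<close>.  Since \<open>f\<close> is not constant, \<open>f W\<close> is not contained in \<open>W\<close>; as
  \<open>f W \<subseteq> H\<close>, this gives \<open>W + f W = H\<close>, and with \<open>v \<in> W + f W\<close> the poles of \<open>f\<close> are determined: they form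
  a divisor of degree two.  That the function field then is an extension of \<open>k(f)\<close> of degree two is shown by a
  direct count of functions by pole order (\<open>hyperellipticI\<close>).  To control the poles of \<open>f\<close> at singular
  points, one needs that every multiplier of a stalk of \<open>\<omega>\<close> is in the local ring (\<open>multiplier_in_stalk\<close>),
  and the existence of \<open>v\<close> requires that \<open>H\<close> generates \<open>\<omega>\<close> (\<open>H_generates\<close>).  Both are further
  applications of duality in the above form, with sheaves \<open>F\<close> such that \<open>f\<close> would preserve \<open>H\<close>, or with
  enlargements \<open>G\<close> of the structure sheaf.

  The geometry of the curve rests on valuation rings, which exist by Chevalley's theorem (\<open>chevalley\<close>).
  A surface has chains of points of length two below the generic point, which can be produced from valuation
  rings; so the function field of the curve is algebraic over \<open>k(y)\<close> for every \<open>y\<close> outside \<open>k\<close>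
  (\<open>transcendence_degree_one\<close>, \<open>dependence\<close>).  This yields finiteness of zeros and poles, residue
  fields equal to \<open>k\<close>, and the description of the normalization by valuation rings (\<open>normalization_eq\<close>).
\<close>

section \<open>Subrings, submodules and local rings inside a field\<close>

lemma subringD:
  assumes "is_subring A"
  shows "1 \<in> A" "0 \<in> A" "x \<in> A \<Longrightarrow> y \<in> A \<Longrightarrow> x - y \<in> A" "x \<in> A \<Longrightarrow> y \<in> A \<Longrightarrow> x * y \<in> A"
    "x \<in> A \<Longrightarrow> - x \<in> A" "x \<in> A \<Longrightarrow> y \<in> A \<Longrightarrow> x + y \<in> A" "x \<in> A \<Longrightarrow> x ^ n \<in> A"
proof -
  show 1: "1 \<in> A" and d: "\<And>x y. x \<in> A \<Longrightarrow> y \<in> A \<Longrightarrow> x - y \<in> A"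
    and m: "\<And>x y. x \<in> A \<Longrightarrow> y \<in> A \<Longrightarrow> x * y \<in> A"
    using assms by (auto simp: is_subring_def)
  show 0: "0 \<in> A" using d[OF 1 1] by simp
  show u: "\<And>x. x \<in> A \<Longrightarrow> - x \<in> A" using d[OF 0] by simp
  show "\<And>x y. x \<in> A \<Longrightarrow> y \<in> A \<Longrightarrow> x + y \<in> A" using d u by (metis diff_minus_eq_add)
  show "x \<in> A \<Longrightarrow> x ^ n \<in> A" by (induction n) (auto simp: 1 m)
qed

lemma subring_sum:
  "is_subring A \<Longrightarrow> (\<And>i. i \<in> I \<Longrightarrow> f i \<in> A) \<Longrightarrow> sum f I \<in> A"
  by (induction I rule: infinite_finite_induct) (auto simp: subringD)

lemma subring_prod:
  "is_subring A \<Longrightarrow> (\<And>i. i \<in> I \<Longrightarrow> f i \<in> A) \<Longrightarrow> prod f I \<in> A"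
  by (induction I rule: infinite_finite_induct) (auto simp: subringD)

lemma subring_Inter: "(\<And>B. B \<in> \<B> \<Longrightarrow> is_subring B) \<Longrightarrow> is_subring (\<Inter>\<B>)"
  by (auto simp: is_subring_def)

lemma subring_UNIV: "is_subring UNIV"
  by (simp add: is_subring_def)

lemma alg_gen_subring: "is_subring (alg_gen A S)"
  unfolding alg_gen_def by (rule subring_Inter) auto

lemma alg_gen_base: "A \<subseteq> alg_gen A S" and alg_gen_gens: "S \<subseteq> alg_gen A S"
  by (auto simp: alg_gen_def)

lemma alg_gen_least: "is_subring B \<Longrightarrow> A \<subseteq> B \<Longrightarrow> S \<subseteq> B \<Longrightarrow> alg_gen A S \<subseteq> B"
  by (auto simp: alg_gen_def)

lemma alg_gen_mono: "A \<subseteq> A' \<Longrightarrow> S \<subseteq> S' \<Longrightarrow> alg_gen A S \<subseteq> alg_gen A' S'"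
  unfolding alg_gen_def by (rule Inter_anti_mono) auto

lemma alg_gen_Un: "alg_gen (alg_gen A S) T = alg_gen A (S \<union> T)"
proof
  show "alg_gen (alg_gen A S) T \<subseteq> alg_gen A (S \<union> T)"
    using alg_gen_gens[of "S \<union> T" A]
    by (intro alg_gen_least alg_gen_subring alg_gen_mono) auto
  show "alg_gen A (S \<union> T) \<subseteq> alg_gen (alg_gen A S) T"
    using alg_gen_base[of A S] alg_gen_gens[of S A] alg_gen_base[of "alg_gen A S" T]
      alg_gen_gens[of T "alg_gen A S"]
    by (intro alg_gen_least alg_gen_subring) auto
qed

lemma alg_gen_empty: "is_subring A \<Longrightarrow> alg_gen A {} = A"
  using alg_gen_base[of A "{}"] alg_gen_least[of A A "{}"] by auto

definition poly_over :: "'a::field set \<Rightarrow> 'a poly \<Rightarrow> bool" where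
  "poly_over A p \<longleftrightarrow> (\<forall>i. coeff p i \<in> A)"

lemma poly_over_pCons: "0 \<in> A \<Longrightarrow> poly_over A (pCons a p) \<longleftrightarrow> a \<in> A \<and> poly_over A p"
  unfolding poly_over_def by (auto simp: coeff_pCons split: nat.splits)

lemma poly_over_0: "0 \<in> A \<Longrightarrow> poly_over A 0"
  by (simp add: poly_over_def)

lemma poly_over_mono: "poly_over A p \<Longrightarrow> A \<subseteq> B \<Longrightarrow> poly_over B p"
  by (auto simp: poly_over_def)

lemma poly_over_arith:
  assumes "is_subring A" "poly_over A p" "poly_over A q"
  shows "poly_over A (p + q)" "poly_over A (p - q)" "poly_over A (p * q)"
  using assms
  by (auto simp: poly_over_def subringD coeff_mult intro!: subring_sum)

lemma poly_over_smult: "is_subring A \<Longrightarrow> c \<in> A \<Longrightarrow> poly_over A p \<Longrightarrow> poly_over A (smult c p)"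
  by (auto simp: poly_over_def subringD)

lemma poly_over_monom: "is_subring A \<Longrightarrow> c \<in> A \<Longrightarrow> poly_over A (monom c n)"
  by (auto simp: poly_over_def subringD)

lemma poly_over_eval:
  "is_subring B \<Longrightarrow> poly_over B p \<Longrightarrow> x \<in> B \<Longrightarrow> poly p x \<in> B"
  by (induction p) (auto simp: poly_over_pCons subringD)

lemma poly_over_eval': "is_subring B \<Longrightarrow> A \<subseteq> B \<Longrightarrow> poly_over A p \<Longrightarrow> x \<in> B \<Longrightarrow> poly p x \<in> B"
  using poly_over_eval poly_over_mono by blast

lemma alg_gen_single:
  assumes "is_subring A"
  shows "alg_gen A {y} = {poly p y |p. poly_over A p}"
proof
  have "is_subring {poly p y |p. poly_over A p}"
    unfolding is_subring_def
  proof (intro conjI ballI)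
    show "1 \<in> {poly p y |p. poly_over A p}"
      using poly_over_monom[OF assms subringD(1)[OF assms], of 0]
      by (auto intro!: exI[of _ "monom 1 0"] simp: poly_monom)
    fix u v assume "u \<in> {poly p y |p. poly_over A p}" "v \<in> {poly p y |p. poly_over A p}"
    then obtain p q where "u = poly p y" "poly_over A p" "v = poly q y" "poly_over A q" by auto
    then show "u - v \<in> {poly p y |p. poly_over A p}" "u * v \<in> {poly p y |p. poly_over A p}"
      using poly_over_arith[OF assms, of p q] by (metis (mono_tags, lifting) mem_Collect_eq poly_diff poly_mult)+
  qed
  then show "alg_gen A {y} \<subseteq> {poly p y |p. poly_over A p}"
  proof (rule alg_gen_least)
    show "A \<subseteq> {poly p y |p. poly_over A p}"
    proof
      fix a assume "a \<in> A"
      then show "a \<in> {poly p y |p. poly_over A p}"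
        using poly_over_monom[OF assms, of a 0] by (auto intro!: exI[of _ "monom a 0"] simp: poly_monom)
    qed
    show "{y} \<subseteq> {poly p y |p. poly_over A p}"
      using poly_over_monom[OF assms subringD(1)[OF assms], of 1]
      by (auto intro!: exI[of _ "monom 1 1"] simp: poly_monom)
  qed
  show "{poly p y |p. poly_over A p} \<subseteq> alg_gen A {y}"
    using poly_over_eval'[OF alg_gen_subring alg_gen_base, of A _ y "{y}"] alg_gen_gens[of "{y}" A] by auto
qed

lemma power_mult_poly_inverse:
  fixes x :: "'a::field"
  assumes "x \<noteq> 0" "degree p \<le> e"
  shows "x ^ e * poly p (inverse x) = (\<Sum>i\<le>degree p. coeff p i * x ^ (e - i))"
  unfolding poly_altdef sum_distrib_left
proof (rule sum.cong[OF refl])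
  fix i assume "i \<in> {..degree p}"
  then have "x ^ e = x ^ (e - i) * x ^ i" using assms(2) by (simp flip: power_add)
  then show "x ^ e * (coeff p i * inverse x ^ i) = coeff p i * x ^ (e - i)"
    using assms(1) by (simp add: power_inverse)
qed

definition is_submod :: "'a::field set \<Rightarrow> 'a set \<Rightarrow> bool" where
  "is_submod A M \<longleftrightarrow> 0 \<in> M \<and> (\<forall>x\<in>M. \<forall>y\<in>M. x + y \<in> M) \<and> (\<forall>a\<in>A. \<forall>x\<in>M. a * x \<in> M)"

lemma is_submodD:
  assumes "is_submod A M"
  shows "0 \<in> M" "x \<in> M \<Longrightarrow> y \<in> M \<Longrightarrow> x + y \<in> M" "a \<in> A \<Longrightarrow> x \<in> M \<Longrightarrow> a * x \<in> M"
  using assms by (auto simp: is_submod_def)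

lemma is_submod_diff:
  assumes "is_subring A" "is_submod A M"
  shows "x \<in> M \<Longrightarrow> - x \<in> M" "x \<in> M \<Longrightarrow> y \<in> M \<Longrightarrow> x - y \<in> M"
proof -
  show *: "x \<in> M \<Longrightarrow> - x \<in> M" for x
    using is_submodD(3)[OF assms(2), of "-1" x] subringD[OF assms(1)] by simp
  show "x \<in> M \<Longrightarrow> y \<in> M \<Longrightarrow> x - y \<in> M"
    using is_submodD(2)[OF assms(2), of x "- y"] * by simp
qed

lemma is_submod_sum: "is_submod A M \<Longrightarrow> (\<And>i. i \<in> I \<Longrightarrow> f i \<in> M) \<Longrightarrow> sum f I \<in> M"
  by (induction I rule: infinite_finite_induct) (auto simp: is_submodD)

lemma is_submod_Int: "is_submod A M \<Longrightarrow> is_submod A N \<Longrightarrow> is_submod A (M \<inter> N)"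
  by (auto simp: is_submod_def)

lemma is_submod_mono: "is_submod B M \<Longrightarrow> A \<subseteq> B \<Longrightarrow> is_submod A M"
  by (auto simp: is_submod_def)

lemma is_submod_self: "is_subring A \<Longrightarrow> is_submod A A"
  by (auto simp: is_submod_def subringD)

lemma is_submod_superring: "is_subring B \<Longrightarrow> A \<subseteq> B \<Longrightarrow> is_submod A B"
  using is_submod_self is_submod_mono by blast

lemma submod_gen_submod: "is_submod A (submod_gen A S)"
  by (auto simp: submod_gen_def is_submod_def)

lemma submod_gen_gens: "S \<subseteq> submod_gen A S"
  by (auto simp: submod_gen_def)

lemma submod_gen_least: "is_submod A M \<Longrightarrow> S \<subseteq> M \<Longrightarrow> submod_gen A S \<subseteq> M"
  by (auto simp: submod_gen_def is_submod_def)

lemma submod_gen_mono: "A \<subseteq> A' \<Longrightarrow> S \<subseteq> S' \<Longrightarrow> submod_gen A S \<subseteq> submod_gen A' S'"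
  by (intro submod_gen_least is_submod_mono[OF submod_gen_submod] order_trans[OF _ submod_gen_gens])

lemma submod_gen_self: "is_submod A M \<Longrightarrow> submod_gen A M = M"
  using submod_gen_least[of A M M] submod_gen_gens[of M A] by auto

definition adjoin :: "'a::field set \<Rightarrow> 'a set \<Rightarrow> 'a \<Rightarrow> 'a set" where
  "adjoin A J g = {j + a * g |j a. j \<in> J \<and> a \<in> A}"

lemma adjoinI: "j \<in> J \<Longrightarrow> a \<in> A \<Longrightarrow> j + a * g \<in> adjoin A J g"
  by (auto simp: adjoin_def)

lemma adjoinE: "x \<in> adjoin A J g \<Longrightarrow> (\<And>j a. j \<in> J \<Longrightarrow> a \<in> A \<Longrightarrow> x = j + a * g \<Longrightarrow> P) \<Longrightarrow> P"
  by (auto simp: adjoin_def)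

lemma adjoin_submod:
  assumes "is_submod A I" "is_submod A J"
  shows "is_submod A (adjoin I J g)"
  unfolding is_submod_def
proof (intro conjI ballI)
  show "0 \<in> adjoin I J g"
    using adjoinI[OF is_submodD(1)[OF assms(2)] is_submodD(1)[OF assms(1)], of g] by simp
next
  fix x y assume "x \<in> adjoin I J g" "y \<in> adjoin I J g"
  then obtain j a j' a' where *: "j \<in> J" "a \<in> I" "j' \<in> J" "a' \<in> I" "x = j + a * g" "y = j' + a' * g"
    by (auto elim!: adjoinE)
  then have eq: "x + y = (j + j') + (a + a') * g" by (simp add: algebra_simps)
  show "x + y \<in> adjoin I J g"
    unfolding eq using * is_submodD(2)[OF assms(2)] is_submodD(2)[OF assms(1)] by (intro adjoinI) auto
next
  fix x b assume "b \<in> A" "x \<in> adjoin I J g"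
  then obtain j a where *: "j \<in> J" "a \<in> I" "x = j + a * g"
    by (auto elim!: adjoinE)
  then have eq: "b * x = b * j + (b * a) * g" by (simp add: algebra_simps)
  show "b * x \<in> adjoin I J g"
    unfolding eq using * \<open>b \<in> A\<close> is_submodD(3)[OF assms(2)] is_submodD(3)[OF assms(1)] by (intro adjoinI) auto
qed

lemma adjoin_incl:
  assumes "is_subring A" "is_submod A J"
  shows "J \<subseteq> adjoin A J g" "g \<in> adjoin A J g"
  using adjoinI[of _ J 0 A g] adjoinI[of 0 J 1 A g] subringD[OF assms(1)] is_submodD[OF assms(2)]
  by auto

lemma adjoin_least: "is_submod A M \<Longrightarrow> J \<subseteq> M \<Longrightarrow> g \<in> M \<Longrightarrow> adjoin A J g \<subseteq> M"
  by (auto elim!: adjoinE simp: is_submodD)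

lemma submod_gen_insert:
  assumes "is_subring A"
  shows "submod_gen A (insert g S) = adjoin A (submod_gen A S) g"
proof
  show "submod_gen A (insert g S) \<subseteq> adjoin A (submod_gen A S) g"
    using adjoin_incl[OF assms submod_gen_submod[of A S], of g] submod_gen_gens[of S A]
    by (intro submod_gen_least adjoin_submod is_submod_self assms submod_gen_submod) auto
  show "adjoin A (submod_gen A S) g \<subseteq> submod_gen A (insert g S)"
    using submod_gen_gens[of "insert g S" A]
    by (intro adjoin_least submod_gen_submod submod_gen_mono) auto
qed

lemma submod_gen_empty: "submod_gen A {} = {0}"
  using submod_gen_least[of A "{0}" "{}"] is_submodD(1)[OF submod_gen_submod[of A "{}"]]
  by (auto simp: is_submod_def)

lemma mem_adjoin_self:
  assumes one: "1 \<notin> I" and J: "is_submod A J" and g: "g \<in> adjoin I J g"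
    and u: "\<And>a. a \<in> I \<Longrightarrow> inverse (1 - a) \<in> A"
  shows "g \<in> J"
proof -
  obtain j a where ja: "j \<in> J" "a \<in> I" "g = j + a * g" using g by (auto elim!: adjoinE)
  have "1 - a \<noteq> 0" using ja(2) one by auto
  moreover have "(1 - a) * g = j" using ja(3) by (simp add: algebra_simps)
  ultimately have "g = inverse (1 - a) * j" by (auto simp flip: mult.assoc)
  then show ?thesis using is_submodD(3)[OF J] u ja by simp
qed

lemma adjoin_ideal_mult:
  assumes I: "is_submod A I" "I \<subseteq> A" and J: "is_submod A J" and a: "a \<in> I" and s: "s \<in> adjoin A J g"
  shows "a * s \<in> adjoin I J g"
proof -
  obtain j c where jc: "j \<in> J" "c \<in> A" "s = j + c * g" using s by (auto elim!: adjoinE)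
  have "a * s = a * j + (c * a) * g" using jc by (simp add: algebra_simps)
  moreover have "a * j \<in> J" "c * a \<in> I"
    using is_submodD(3)[OF J] is_submodD(3)[OF I(1)] a I(2) jc by auto
  ultimately show ?thesis by (simp add: adjoinI)
qed

definition fin_gen :: "'a::field set \<Rightarrow> 'a set \<Rightarrow> bool" where
  "fin_gen A M \<longleftrightarrow> (\<exists>S. finite S \<and> M = submod_gen A S)"

lemma fin_gen_submod: "fin_gen A M \<Longrightarrow> is_submod A M"
  using submod_gen_submod by (auto simp: fin_gen_def)

text \<open>Nakayama's lemma for an ideal \<open>I\<close> such that \<open>1 + I\<close> consists of units.  By the induction hypothesis
  for \<open>J + A g\<close> all other generators lie in \<open>J + A g\<close>; so \<open>g\<close> lies in \<open>J + I g\<close>, and hence in \<open>J\<close>.\<close>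

lemma nakayama:
  assumes A: "is_subring A" and I: "is_submod A I" "I \<subseteq> A" and u: "\<And>a. a \<in> I \<Longrightarrow> inverse (1 - a) \<in> A"
    and one: "1 \<notin> I"
    and "finite S" "is_submod A J" "S \<subseteq> submod_gen A (J \<union> {a * s |a s. a \<in> I \<and> s \<in> S})"
  shows "S \<subseteq> J"
  using assms(6-8)
proof (induction S arbitrary: J)
  case (insert g S)
  let ?J = "adjoin A J g"
  have J': "is_submod A ?J" by (rule adjoin_submod[OF is_submod_self[OF A] insert.prems(1)])
  note inc = adjoin_incl[OF A insert.prems(1), of g]
  have "submod_gen A (J \<union> {a * s |a s. a \<in> I \<and> s \<in> insert g S})
      \<subseteq> submod_gen A (?J \<union> {a * s |a s. a \<in> I \<and> s \<in> S})"
  proof (rule submod_gen_least[OF submod_gen_submod], rule subsetI)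
    fix x assume x: "x \<in> J \<union> {a * s |a s. a \<in> I \<and> s \<in> insert g S}"
    have "x \<in> ?J \<union> {a * s |a s. a \<in> I \<and> s \<in> S}"
      using x inc I(2) is_submodD(3)[OF J'] by blast
    then show "x \<in> submod_gen A (?J \<union> {a * s |a s. a \<in> I \<and> s \<in> S})"
      by (rule subsetD[OF submod_gen_gens])
  qed
  moreover have "S \<subseteq> submod_gen A (J \<union> {a * s |a s. a \<in> I \<and> s \<in> insert g S})"
    using insert.prems(2) by (rule order_trans[OF subset_insertI])
  ultimately have SJ: "S \<subseteq> ?J"
    by (rule insert.IH[OF J' order_trans[rotated]])
  define M where "M = adjoin I J g"
  have Msub: "is_submod A M"
    unfolding M_def by (rule adjoin_submod[OF I(1) insert.prems(1)])
  have "J \<subseteq> M" using is_submodD(1)[OF I(1)] by (force simp: M_def adjoin_def)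
  have "a * s \<in> M" if "a \<in> I" "s \<in> insert g S" for a s
    unfolding M_def using that SJ inc by (intro adjoin_ideal_mult[OF I insert.prems(1)]) auto
  then have "submod_gen A (J \<union> {a * s |a s. a \<in> I \<and> s \<in> insert g S}) \<subseteq> M"
    using \<open>J \<subseteq> M\<close> by (intro submod_gen_least[OF Msub]) auto
  then have "g \<in> M"
    using insert.prems(2) by auto
  then have "g \<in> J" unfolding M_def by (rule mem_adjoin_self[OF one insert.prems(1)]) (rule u)
  then have "?J \<subseteq> J" using insert.prems(1) by (intro adjoin_least) auto
  then show ?case using SJ \<open>g \<in> J\<close> by auto
qed auto

text \<open>A proper submodule of a finitely generated module is contained in one of colength one.  Adjoin
  generators until the next one, \<open>g\<close>, gives the whole module \<open>M\<close>; then \<open>N = J + I g\<close> contains \<open>I M\<close>,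
  and it is proper by Nakayama's argument.\<close>

lemma maximal_submodule:
  assumes A: "is_subring A" and I: "is_submod A I" "I \<subseteq> A" and u: "\<And>a. a \<in> I \<Longrightarrow> inverse (1 - a) \<in> A"
    and one: "1 \<notin> I" and k: "is_subring k" "k \<subseteq> A" and Ak: "\<And>a. a \<in> A \<Longrightarrow> \<exists>c\<in>k. a - c \<in> I"
    and "finite S" "is_submod A J" "J \<subseteq> M" "M = submod_gen A (J \<union> S)" "J \<noteq> M"
  shows "\<exists>N e. is_submod A N \<and> J \<subseteq> N \<and> N \<subseteq> M \<and> e \<in> M \<and> e \<notin> N \<and> (\<forall>x\<in>M. \<exists>c\<in>k. x - c * e \<in> N) \<and>
    (\<forall>a\<in>I. \<forall>x\<in>M. a * x \<in> N)"
  using assms(9-13)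
proof (induction S arbitrary: J)
  case empty
  then show ?case by (simp add: submod_gen_self)
next
  case (insert g S)
  let ?J = "adjoin A J g"
  have J': "is_submod A ?J" by (rule adjoin_submod[OF is_submod_self[OF A] insert.prems(1)])
  note inc = adjoin_incl[OF A insert.prems(1), of g]
  have Mg: "is_submod A M" "g \<in> M" "S \<subseteq> M"
    using insert.prems submod_gen_submod submod_gen_gens[of "J \<union> insert g S" A] by auto
  have JM: "?J \<subseteq> M" using Mg insert.prems by (intro adjoin_least) auto
  have M: "M = submod_gen A (?J \<union> S)"
  proof
    show "submod_gen A (?J \<union> S) \<subseteq> M" using JM Mg by (intro submod_gen_least) auto
    show "M \<subseteq> submod_gen A (?J \<union> S)"
      unfolding insert.prems(3) using inc by (intro submod_gen_mono) auto
  qed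
  show ?case
  proof (cases "?J = M")
    case False
    then show ?thesis using insert.IH[OF J' JM M] inc(1) by blast
  next
    case True
    define N where "N = adjoin I J g"
    have Nsub: "is_submod A N"
      unfolding N_def by (rule adjoin_submod[OF I(1) insert.prems(1)])
    have JN: "J \<subseteq> N" using is_submodD(1)[OF I(1)] by (force simp: N_def adjoin_def)
    have "N \<subseteq> M" using True I(2) by (auto simp: N_def elim!: adjoinE intro: adjoinI)
    have gN: "g \<notin> N"
    proof
      assume "g \<in> N"
      then have "g \<in> J" unfolding N_def by (rule mem_adjoin_self[OF one insert.prems(1)]) (rule u)
      then have "?J \<subseteq> J" using insert.prems(1) by (intro adjoin_least) auto
      then show False using True insert.prems by auto
    qed
    have "\<exists>c\<in>k. x - c * g \<in> N" if "x \<in> M" for x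
    proof -
      obtain j a where ja: "j \<in> J" "a \<in> A" "x = j + a * g"
        using \<open>x \<in> M\<close> unfolding True[symmetric] by (rule adjoinE)
      obtain c where "c \<in> k" "a - c \<in> I" using Ak ja(2) by blast
      moreover have "x - c * g = j + (a - c) * g" using ja by (simp add: algebra_simps)
      ultimately show ?thesis using ja(1) adjoinI[of j J "a - c" I g] by (intro bexI[of _ c]) (simp_all only: N_def)
    qed
    moreover have "b * x \<in> N" if "b \<in> I" "x \<in> M" for b x
      unfolding N_def using that True by (intro adjoin_ideal_mult[OF I insert.prems(1)]) auto
    ultimately show ?thesis using Nsub JN \<open>N \<subseteq> M\<close> gN \<open>g \<in> M\<close> by blast
  qed
qed

text \<open>A submodule \<open>N\<close> of colength at most one in a finitely generated module is finitely generated.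
  For algebras of finite type this holds without the basis theorem: the corrections \<open>x - c e \<in> N\<close> of
  the generators \<open>x\<close> of the module, and of the products \<open>t e\<close> with the generators \<open>t\<close> of the algebra,
  span a submodule \<open>F\<close> of \<open>N\<close> such that \<open>F + k e\<close> is the whole module.\<close>

lemma fin_gen_colength_one:
  assumes kf: "is_subfield k" and "finite T" and A: "A = alg_gen k T" and M: "fin_gen A M"
    and N: "is_submod A N" "N \<subseteq> M" and e: "e \<in> M" "\<And>x. x \<in> M \<Longrightarrow> \<exists>c\<in>k. x - c * e \<in> N"
  shows "fin_gen A N"
proof -
  have k: "is_subring k" using kf by (simp add: is_subfield_def)
  obtain S where S: "finite S" "M = submod_gen A S" using M by (auto simp: fin_gen_def)
  have As: "is_subring A" "k \<subseteq> A" "T \<subseteq> A"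
    using A alg_gen_subring alg_gen_base alg_gen_gens by blast+
  have Mm: "is_submod A M" using S submod_gen_submod by auto
  obtain cc where cc: "\<And>x. x \<in> M \<Longrightarrow> cc x \<in> k \<and> x - cc x * e \<in> N"
    using e(2) by metis
  define D where "D = (\<lambda>x. x - cc x * e) ` (S \<union> (\<lambda>t. t * e) ` T)"
  have SM: "S \<union> (\<lambda>t. t * e) ` T \<subseteq> M"
    using S submod_gen_gens[of S A] e(1) As is_submodD(3)[OF Mm] by auto
  have D: "finite D" "D \<subseteq> N" using S \<open>finite T\<close> cc SM by (auto simp: D_def)
  define F where "F = submod_gen A D"
  have F: "is_submod A F" "F \<subseteq> N" "D \<subseteq> F"
    unfolding F_def by (rule submod_gen_submod submod_gen_least[OF N(1) D(2)] submod_gen_gens)+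
  define G where "G = adjoin k F e"
  have G: "is_submod k G" "F \<subseteq> G" "e \<in> G"
    unfolding G_def
    using adjoin_submod[OF is_submod_self[OF k]] adjoin_incl[OF k] is_submod_mono[OF F(1) As(2)] by auto
  \<comment> \<open>The multipliers of \<open>G\<close> form a ring that contains \<open>k\<close> and \<open>T\<close>, hence \<open>A\<close>.\<close>
  define B where "B = {a. \<forall>x\<in>G. a * x \<in> G}"
  have "is_subring B"
  proof -
    have "(a - b) * x \<in> G" if "a \<in> B" "b \<in> B" "x \<in> G" for a b x
      using that is_submod_diff(2)[OF k G(1), of "a * x" "b * x"] by (auto simp: B_def left_diff_distrib)
    then show ?thesis
      by (auto simp: is_subring_def B_def mult.assoc)
  qed
  moreover have "k \<subseteq> B" using is_submodD(3)[OF G(1)] by (auto simp: B_def)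
  moreover have "T \<subseteq> B"
  proof
    fix t assume t: "t \<in> T"
    have "t * x \<in> G" if "x \<in> G" for x
    proof -
      obtain j c where jc: "j \<in> F" "c \<in> k" "x = j + c * e" using \<open>x \<in> G\<close> unfolding G_def by (rule adjoinE)
      have "t * e - cc (t * e) * e \<in> F" using F(3) t by (auto simp: D_def)
      moreover have "t * e = (t * e - cc (t * e) * e) + cc (t * e) * e" by simp
      moreover have "cc (t * e) \<in> k" using cc SM t by auto
      ultimately have "t * e \<in> G"
        using G(2,3) is_submodD(2)[OF G(1), of "t * e - cc (t * e) * e" "cc (t * e) * e"]
          is_submodD(3)[OF G(1), of "cc (t * e)" e] by auto
      then have "c * (t * e) \<in> G" using is_submodD(3)[OF G(1)] jc by auto
      moreover have "t * j \<in> G" using G(2) is_submodD(3)[OF F(1)] As(3) t jc by auto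
      ultimately show ?thesis using is_submodD(2)[OF G(1)] jc by (auto simp: algebra_simps)
    qed
    then show "t \<in> B" by (auto simp: B_def)
  qed
  ultimately have "A \<subseteq> B" using A alg_gen_least by blast
  then have "is_submod A G" using G(1) by (auto simp: is_submod_def B_def)
  moreover have "S \<subseteq> G"
  proof
    fix s assume s: "s \<in> S"
    have "s - cc s * e \<in> F" "cc s \<in> k" using F(3) s cc SM by (auto simp: D_def)
    then show "s \<in> G" unfolding G_def adjoin_def
      by (intro CollectI exI[of _ "s - cc s * e"] exI[of _ "cc s"]) auto
  qed
  ultimately have MG: "M \<subseteq> G" using S submod_gen_least by blast
  show ?thesis
  proof (cases "e \<in> N")
    case True
    then have "N = submod_gen A (insert e D)"
    proof -
      have "G \<subseteq> submod_gen A (insert e D)"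
        unfolding G_def submod_gen_insert[OF As(1)] F_def adjoin_def using As(2) by blast
      moreover have "submod_gen A (insert e D) \<subseteq> N"
        using True D N by (intro submod_gen_least) auto
      ultimately show ?thesis using MG N by auto
    qed
    then show ?thesis using D by (auto simp: fin_gen_def)
  next
    case False
    have no: "c = 0" if "c \<in> k" "c * e \<in> N" for c
    proof (rule ccontr)
      assume "c \<noteq> 0"
      moreover have "inverse c \<in> A" using kf that As(2) by (auto simp: is_subfield_def)
      ultimately have "e \<in> N" using is_submodD(3)[OF N(1), of "inverse c" "c * e"] that by (simp flip: mult.assoc)
      then show False using False by simp
    qed
    have "N \<subseteq> F"
    proof
      fix x assume x: "x \<in> N"
      then obtain j c where jc: "j \<in> F" "c \<in> k" "x = j + c * e"
        using MG N by (auto simp: G_def elim!: adjoinE)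
      then have "c * e \<in> N" using x F is_submod_diff(2)[OF As(1) N(1), of x j] by auto
      then have "c = 0" using no jc by auto
      then show "x \<in> F" using jc by simp
    qed
    then have "N = submod_gen A D" using F by (auto simp: F_def)
    then show ?thesis using D by (auto simp: fin_gen_def)
  qed
qed

section \<open>Local rings and localizations\<close>

definition local_ring :: "'a::field set \<Rightarrow> bool" where
  "local_ring x \<longleftrightarrow> is_subring x \<and> is_submod x (max_ideal x)"

lemma max_ideal_iff: "a \<in> max_ideal x \<longleftrightarrow> a \<in> x \<and> (a = 0 \<or> inverse a \<notin> x)"
  by (simp add: max_ideal_def)

lemma max_ideal_subset: "max_ideal x \<subseteq> x"
  by (auto simp: max_ideal_def)

lemma unitD: "a \<in> x \<Longrightarrow> a \<notin> max_ideal x \<Longrightarrow> a \<noteq> 0" "a \<in> x \<Longrightarrow> a \<notin> max_ideal x \<Longrightarrow> inverse a \<in> x"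
  by (auto simp: max_ideal_iff)

lemma unitI: "a \<noteq> 0 \<Longrightarrow> inverse a \<in> x \<Longrightarrow> a \<notin> max_ideal x"
  by (simp add: max_ideal_iff)

lemma local_ring_subring: "local_ring x \<Longrightarrow> is_subring x"
  by (simp add: local_ring_def)

lemma local_ring_max: "local_ring x \<Longrightarrow> is_submod x (max_ideal x)"
  by (simp add: local_ring_def)

lemma one_notin_max: "is_subring x \<Longrightarrow> 1 \<notin> max_ideal x"
  by (simp add: max_ideal_iff subringD)

lemma local_ring_one_minus:
  assumes "local_ring x" "m \<in> max_ideal x"
  shows "1 - m \<notin> max_ideal x" "1 - m \<in> x" "inverse (1 - m) \<in> x"
proof -
  have s: "is_subring x" using assms local_ring_subring by auto
  show 1: "1 - m \<notin> max_ideal x"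
  proof
    assume "1 - m \<in> max_ideal x"
    then have "(1 - m) + m \<in> max_ideal x"
      using is_submodD(2)[OF local_ring_max[OF assms(1)]] assms(2) by blast
    then show False using one_notin_max[OF s] by simp
  qed
  show 2: "1 - m \<in> x" using s assms by (simp add: subringD max_ideal_iff)
  show "inverse (1 - m) \<in> x" using unitD(2)[OF 2 1] .
qed

lemma local_ring_prime:
  assumes "local_ring x" "a \<in> x" "b \<in> x" "a * b \<in> max_ideal x"
  shows "a \<in> max_ideal x \<or> b \<in> max_ideal x"
proof (rule ccontr)
  assume "\<not> ?thesis"
  then have "a \<noteq> 0" "b \<noteq> 0" "inverse a \<in> x" "inverse b \<in> x" using assms unitD by auto
  then have "a * b \<noteq> 0" "inverse (a * b) \<in> x"
    using subringD(4)[OF local_ring_subring[OF assms(1)]] by auto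
  then show False using assms(4) unitI by blast
qed

lemma local_ring_power_prime:
  assumes "local_ring x" "a \<in> x" "a ^ n \<in> max_ideal x"
  shows "a \<in> max_ideal x"
  using assms(3)
proof (induction n)
  case 0
  then show ?case using one_notin_max[OF local_ring_subring[OF assms(1)]] by simp
next
  case (Suc n)
  then show ?case
    using local_ring_prime[OF assms(1,2), of "a ^ n"] subringD(7)[OF local_ring_subring[OF assms(1)] assms(2)] by auto
qed

lemma subfield_subring: "is_subfield L \<Longrightarrow> is_subring L"
  by (simp add: is_subfield_def)

lemma subfield_inverse: "is_subfield L \<Longrightarrow> x \<in> L \<Longrightarrow> inverse x \<in> L"
  by (simp add: is_subfield_def)

lemma subfield_divide: "is_subfield L \<Longrightarrow> x \<in> L \<Longrightarrow> y \<in> L \<Longrightarrow> x / y \<in> L"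
  by (simp add: is_subfield_def divide_inverse subringD)

lemma subfield_max_ideal: "is_subfield L \<Longrightarrow> max_ideal L = {0}"
  by (auto simp: max_ideal_iff is_subfield_def subringD)

lemma subfield_local: "is_subfield L \<Longrightarrow> local_ring L"
  by (simp add: local_ring_def subfield_max_ideal subfield_subring is_submod_def)

lemma is_subfieldI:
  assumes "is_subring L" "\<And>x. x \<in> L \<Longrightarrow> x \<noteq> 0 \<Longrightarrow> inverse x \<in> L"
  shows "is_subfield L"
  unfolding is_subfield_def using assms by (metis inverse_zero)

lemma frac_subfield:
  assumes "is_subring A"
  shows "is_subfield (frac A)"
proof (rule is_subfieldI)
  note A = subringD[OF assms]
  show "is_subring (frac A)"
    unfolding is_subring_def
  proof (intro conjI ballI)
    show "1 \<in> frac A" unfolding frac_def using A(1) by (intro CollectI exI[of _ 1]) auto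
    fix x y assume "x \<in> frac A" "y \<in> frac A"
    then obtain a b c d where *: "a \<in> A" "b \<in> A" "b \<noteq> 0" "x = a / b" "c \<in> A" "d \<in> A" "d \<noteq> 0" "y = c / d"
      by (auto simp: frac_def)
    then have "x - y = (a * d - c * b) / (b * d)" by (simp add: field_simps)
    moreover have "a * d - c * b \<in> A" "b * d \<in> A" "b * d \<noteq> 0" using * A by auto
    ultimately show "x - y \<in> frac A" unfolding frac_def by blast
    have "x * y = (a * c) / (b * d)" using * by simp
    moreover have "a * c \<in> A" using * A by auto
    ultimately show "x * y \<in> frac A" unfolding frac_def using \<open>b * d \<in> A\<close> \<open>b * d \<noteq> 0\<close> by blast
  qed
  fix x assume "x \<in> frac A" "x \<noteq> 0"
  then obtain a b where "a \<in> A" "b \<in> A" "x = a / b" "a \<noteq> 0"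
    by (auto simp: frac_def)
  then show "inverse x \<in> frac A" by (auto simp: frac_def)
qed

lemma frac_incl: "is_subring A \<Longrightarrow> A \<subseteq> frac A"
  unfolding frac_def using subringD(1)[of A] by (force intro: exI[of _ 1])

lemma frac_least: "is_subfield L \<Longrightarrow> A \<subseteq> L \<Longrightarrow> frac A \<subseteq> L"
  unfolding frac_def by (blast intro: subfield_divide)

lemma frac_self: "is_subfield L \<Longrightarrow> frac L = L"
  using frac_least[of L L] frac_incl[of L] by (auto simp: is_subfield_def)

lemma frac_mono: "A \<subseteq> B \<Longrightarrow> frac A \<subseteq> frac B"
  by (auto simp: frac_def)

definition loc :: "'a::field set \<Rightarrow> 'a set \<Rightarrow> 'a set" where
  "loc B x = localization B (max_ideal x \<inter> B)"

lemma loc_iff: "u \<in> loc B x \<longleftrightarrow> (\<exists>a\<in>B. \<exists>s\<in>B. s \<notin> max_ideal x \<and> u = a / s)"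
  by (auto simp: loc_def localization_def)

lemma locE:
  assumes "u \<in> loc B x"
  obtains a s where "a \<in> B" "s \<in> B" "s \<notin> max_ideal x" "u = a / s"
  using assms by (auto simp: loc_iff)

lemma localization_char:
  assumes "is_subring B" "prime_ideal_of B P"
  shows "local_ring (localization B P)" "B \<subseteq> localization B P" "max_ideal (localization B P) \<inter> B = P"
proof -
  note B = subringD[OF assms(1)]
  let ?L = "localization B P"
  have P: "P \<subseteq> B" "0 \<in> P" "1 \<notin> P" "\<And>x y. x \<in> P \<Longrightarrow> y \<in> P \<Longrightarrow> x + y \<in> P"
    "\<And>a x. a \<in> B \<Longrightarrow> x \<in> P \<Longrightarrow> a * x \<in> P" "\<And>a b. a \<in> B \<Longrightarrow> b \<in> B \<Longrightarrow> a * b \<in> P \<Longrightarrow> a \<in> P \<or> b \<in> P"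
    using assms(2) by (auto simp: prime_ideal_of_def)
  have mem: "u \<in> ?L \<longleftrightarrow> (\<exists>a\<in>B. \<exists>s\<in>B. s \<notin> P \<and> u = a / s)" for u
    by (auto simp: localization_def)
  have memI: "a / s \<in> ?L" if "a \<in> B" "s \<in> B" "s \<notin> P" for a s using mem that by auto
  have nz: "s \<noteq> 0" if "s \<notin> P" for s using that P by auto
  show inc: "B \<subseteq> ?L" using memI[of _ 1] B P by auto
  have sub: "is_subring ?L"
    unfolding is_subring_def
  proof (intro conjI ballI)
    show "1 \<in> ?L" using inc B by auto
    fix x y assume "x \<in> ?L" "y \<in> ?L"
    then obtain a b c d where *: "a \<in> B" "b \<in> B" "b \<notin> P" "x = a / b" "c \<in> B" "d \<in> B" "d \<notin> P" "y = c / d"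
      by (auto simp: mem)
    have "b * d \<notin> P" using * P(6)[of b d] by auto
    have "x - y = (a * d - c * b) / (b * d)" using * nz by (simp add: field_simps)
    then show "x - y \<in> ?L" using memI[of "a * d - c * b" "b * d"] * B \<open>b * d \<notin> P\<close> by auto
    have "x * y = (a * c) / (b * d)" using * by simp
    then show "x * y \<in> ?L" using memI[of "a * c" "b * d"] * B \<open>b * d \<notin> P\<close> by auto
  qed
  have max: "a / s \<in> max_ideal ?L \<longleftrightarrow> a \<in> P" if as: "a \<in> B" "s \<in> B" "s \<notin> P" for a s
  proof
    assume "a \<in> P"
    have "inverse (a / s) \<notin> ?L" if "a \<noteq> 0"
    proof
      assume "inverse (a / s) \<in> ?L"
      then obtain c d where cd: "c \<in> B" "d \<in> B" "d \<notin> P" "s / a = c / d" by (auto simp: mem)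
      then have "s * d = c * a" using that nz by (simp add: field_simps)
      then have "s * d \<in> P" using P(5) cd \<open>a \<in> P\<close> by auto
      then show False using P(6) as cd by auto
    qed
    then show "a / s \<in> max_ideal ?L" using memI as by (auto simp: max_ideal_iff)
  next
    assume "a / s \<in> max_ideal ?L"
    then show "a \<in> P" using memI[of s a] as P(2) nz by (auto simp: max_ideal_iff)
  qed
  show "max_ideal ?L \<inter> B = P" using max[of _ 1] B P by auto
  have "is_submod ?L (max_ideal ?L)"
    unfolding is_submod_def
  proof (intro conjI ballI)
    show "0 \<in> max_ideal ?L" using max[of 0 1] B P by auto
    fix x y assume x: "x \<in> max_ideal ?L" and "y \<in> max_ideal ?L"
    then obtain a b c d where *: "a \<in> B" "b \<in> B" "b \<notin> P" "x = a / b" "c \<in> B" "d \<in> B" "d \<notin> P" "y = c / d"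
      using max_ideal_subset mem by (metis subsetD)
    then have "a \<in> P" "c \<in> P" using max x \<open>y \<in> _\<close> by auto
    have "b * d \<notin> P" using * P(6)[of b d] by auto
    have eq: "x + y = (d * a + b * c) / (b * d)" using * nz by (simp add: field_simps)
    show "x + y \<in> max_ideal ?L"
      unfolding eq using * B P \<open>a \<in> P\<close> \<open>c \<in> P\<close> \<open>b * d \<notin> P\<close> by (subst max) auto
  next
    fix x y assume "x \<in> ?L" and y: "y \<in> max_ideal ?L"
    then obtain a b c d where *: "a \<in> B" "b \<in> B" "b \<notin> P" "x = a / b" "c \<in> B" "d \<in> B" "d \<notin> P" "y = c / d"
      using max_ideal_subset mem by (metis subsetD)
    then have "c \<in> P" using max y by auto
    have "b * d \<notin> P" using * P(6)[of b d] by auto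
    have eq: "x * y = (a * c) / (b * d)" using * by simp
    show "x * y \<in> max_ideal ?L"
      unfolding eq using * B P \<open>c \<in> P\<close> \<open>b * d \<notin> P\<close> by (subst max) auto
  qed
  then show "local_ring ?L" using sub by (simp add: local_ring_def)
qed

lemma max_ideal_prime:
  assumes "local_ring x" "is_subring B" "B \<subseteq> x"
  shows "prime_ideal_of B (max_ideal x \<inter> B)"
proof -
  note B = subringD[OF assms(2)] and m = is_submodD[OF local_ring_max[OF assms(1)]]
  have "a \<in> max_ideal x \<or> b \<in> max_ideal x" if "a \<in> B" "b \<in> B" "a * b \<in> max_ideal x" for a b
    using local_ring_prime[OF assms(1)] that assms(3) by blast
  moreover have "a * b \<in> max_ideal x" if "a \<in> B" "b \<in> max_ideal x" for a b
    using m(3) that assms(3) by blast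
  moreover have "1 \<notin> max_ideal x" using one_notin_max[OF local_ring_subring[OF assms(1)]] .
  ultimately show ?thesis
    unfolding prime_ideal_of_def by (auto intro: B m(1,2))
qed

lemma dominatesD: "dominates y x \<Longrightarrow> x \<subseteq> y" "dominates y x \<Longrightarrow> max_ideal y \<inter> x = max_ideal x"
  by (simp_all add: dominates_def)

lemma dominates_refl: "dominates x x"
  by (auto simp: dominates_def max_ideal_iff)

lemma dominates_trans: "dominates z y \<Longrightarrow> dominates y x \<Longrightarrow> dominates z x"
  by (auto simp: dominates_def)

lemma dominates_max_iff: "dominates y x \<Longrightarrow> a \<in> x \<Longrightarrow> a \<in> max_ideal y \<longleftrightarrow> a \<in> max_ideal x"
  by (auto simp: dominates_def)

lemma dominatesI': "x \<subseteq> y \<Longrightarrow> max_ideal x \<subseteq> max_ideal y \<Longrightarrow> dominates y x"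
  by (auto simp: dominates_def max_ideal_iff)

lemma loc_props:
  assumes "local_ring x" "is_subring B" "B \<subseteq> x"
  shows "local_ring (loc B x)" "B \<subseteq> loc B x" "loc B x \<subseteq> x" "dominates x (loc B x)" "loc B x \<in> spec B"
proof -
  note p = max_ideal_prime[OF assms]
  show l: "local_ring (loc B x)" and "B \<subseteq> loc B x"
    using localization_char[OF assms(2) p] by (auto simp: loc_def)
  show sub: "loc B x \<subseteq> x"
  proof
    fix u assume "u \<in> loc B x"
    then obtain a s where as: "a \<in> B" "s \<in> B" "s \<notin> max_ideal x" "u = a / s" by (rule locE)
    then show "u \<in> x"
      using assms subringD(4)[OF local_ring_subring[OF assms(1)], of a "inverse s"] unitD(2)[of s x]
      by (auto simp: divide_inverse)
  qed
  show "dominates x (loc B x)"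
  proof (rule dominatesI'[OF sub], rule subsetI)
    fix u assume u: "u \<in> max_ideal (loc B x)"
    then obtain a s where as: "a \<in> B" "s \<in> B" "s \<notin> max_ideal x" "u = a / s"
      using max_ideal_subset by (blast elim: locE)
    have "s \<noteq> 0" using as assms unitD by auto
    have "s * u \<in> max_ideal (loc B x)"
      using is_submodD(3)[OF local_ring_max[OF l], of s u] \<open>B \<subseteq> loc B x\<close> as u by auto
    then have "a \<in> max_ideal (loc B x) \<inter> B" using as \<open>s \<noteq> 0\<close> by simp
    then have "a \<in> max_ideal x"
      using localization_char(3)[OF assms(2) p] by (auto simp: loc_def)
    then have "inverse s * a \<in> max_ideal x"
      using is_submodD(3)[OF local_ring_max[OF assms(1)]] as assms(3) unitD(2)[of s x] by auto
    then show "u \<in> max_ideal x" using as by (simp add: divide_inverse mult.commute)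
  qed
  show "loc B x \<in> spec B" using p by (auto simp: loc_def spec_def)
qed

lemma specD:
  assumes "is_subring B" "x \<in> spec B"
  shows "local_ring x" "B \<subseteq> x" "loc B x = x"
  using assms localization_char[of B] by (auto simp: spec_def loc_def)

lemma spec_iff:
  assumes "is_subring B"
  shows "x \<in> spec B \<longleftrightarrow> local_ring x \<and> B \<subseteq> x \<and> loc B x = x"
  using specD[OF assms] loc_props(5)[of x B] assms by metis

lemma loc_cong: "max_ideal x \<inter> B = max_ideal y \<inter> B \<Longrightarrow> loc B x = loc B y"
  by (simp add: loc_def)

lemma loc_dominates: "dominates y x \<Longrightarrow> B \<subseteq> x \<Longrightarrow> loc B y = loc B x"
  by (rule loc_cong) (auto simp: dominates_def max_ideal_iff)

lemma loc_least:
  assumes "is_subring y" "dominates x y" "B \<subseteq> y"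
  shows "loc B x \<subseteq> y"
proof
  fix u assume "u \<in> loc B x"
  then obtain a s where as: "a \<in> B" "s \<in> B" "s \<notin> max_ideal x" "u = a / s" by (rule locE)
  then have "inverse s \<in> y" using unitD(2)[of s y] assms dominates_max_iff[OF assms(2), of s] by auto
  then show "u \<in> y" using subringD(4)[OF assms(1), of a "inverse s"] as assms(3) by (auto simp: divide_inverse)
qed

lemma loc_eq:
  assumes "local_ring x" "is_subring B" "B \<subseteq> x" "is_subring B'" "B' \<subseteq> x" "B \<subseteq> loc B' x" "B' \<subseteq> loc B x"
  shows "loc B x = loc B' x"
  using loc_least[OF local_ring_subring[OF loc_props(1)[OF assms(1,2,3)]] loc_props(4)[OF assms(1,2,3)] assms(7)]
    loc_least[OF local_ring_subring[OF loc_props(1)[OF assms(1,4,5)]] loc_props(4)[OF assms(1,4,5)] assms(6)]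
  by auto

lemma frac_loc:
  assumes "local_ring x" "is_subring B" "B \<subseteq> x"
  shows "frac (loc B x) = frac B"
proof
  show "frac B \<subseteq> frac (loc B x)" using loc_props(2)[OF assms] by (rule frac_mono)
  have "loc B x \<subseteq> frac B"
    using unitD(1)[of _ x] assms(3) unfolding frac_def by (blast elim!: locE)
  then show "frac (loc B x) \<subseteq> frac B"
    by (rule frac_least[OF frac_subfield[OF assms(2)]])
qed

lemma frac_in_spec:
  assumes "is_subring A"
  shows "frac A \<in> spec A"
  unfolding spec_iff[OF assms]
proof (intro conjI)
  show "local_ring (frac A)" using subfield_local frac_subfield assms by blast
  show "A \<subseteq> frac A" using frac_incl assms by blast
  show "loc A (frac A) = frac A"
    unfolding set_eq_iff loc_iff subfield_max_ideal[OF frac_subfield[OF assms]] by (auto simp: frac_def)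
qed

section \<open>Valuation rings and integral closure\<close>

lemma valuationD:
  assumes "valuation_ring L V"
  shows "is_subring V" "V \<subseteq> L" "a \<in> L \<Longrightarrow> a \<notin> V \<Longrightarrow> inverse a \<in> V"
  using assms by (auto simp: valuation_ring_def)

lemma valuation_local:
  assumes L: "is_subfield L" and V: "valuation_ring L V"
  shows "local_ring V"
proof -
  note v = valuationD[OF V]
  note r = subringD[OF v(1)]
  have "a * b \<in> max_ideal V" if "a \<in> V" "b \<in> max_ideal V" for a b
  proof (cases "a * b = 0")
    case False
    have "inverse (a * b) \<notin> V"
    proof
      assume "inverse (a * b) \<in> V"
      then have "a * inverse (a * b) \<in> V" using r that by auto
      moreover have "a * inverse (a * b) = inverse b" using False by (simp add: field_simps)
      ultimately have "inverse b \<in> V" by metis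
      then show False using that False by (auto simp: max_ideal_iff)
    qed
    then show ?thesis using r that by (auto simp: max_ideal_iff)
  qed (use r that in \<open>auto simp: max_ideal_iff\<close>)
  note m = this
  have "a + b \<in> max_ideal V" if ab: "a \<in> max_ideal V" "b \<in> max_ideal V" for a b
  proof (cases "a = 0 \<or> b = 0")
    case False
    have abV: "a \<in> V" "b \<in> V" using ab by (auto simp: max_ideal_iff)
    then have "a / b \<in> L" using v(2) L by (intro subfield_divide) auto
    then consider "a / b \<in> V" | "inverse (a / b) \<in> V" using v(3) by blast
    then show ?thesis
    proof cases
      case 1
      have eq: "a + b = (a / b + 1) * b" using False by (simp add: field_simps)
      show ?thesis unfolding eq using 1 r ab by (intro m) auto
    next
      case 2
      have eq: "a + b = (1 + b / a) * a" using False by (simp add: field_simps)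
      show ?thesis unfolding eq using 2 r ab by (intro m) auto
    qed
  qed (use ab in auto)
  then show ?thesis using m v(1) r by (auto simp: local_ring_def is_submod_def max_ideal_iff)
qed

lemma valuation_max:
  assumes "is_subfield L" "valuation_ring L V" "a \<in> L" "a \<notin> V"
  shows "inverse a \<in> max_ideal V"
  using assms valuationD(3)[OF assms(2-4)] by (auto simp: max_ideal_iff subringD valuationD)

lemma valuation_subfield: "is_subfield L \<Longrightarrow> valuation_ring L L"
  by (simp add: valuation_ring_def is_subfield_def)

lemma submod_gen_extension_chain:
  assumes "\<C> \<noteq> {}" "\<And>B C. B \<in> \<C> \<Longrightarrow> C \<in> \<C> \<Longrightarrow> B \<subseteq> C \<or> C \<subseteq> B" "x \<in> submod_gen (\<Union>\<C>) S"
  shows "\<exists>B\<in>\<C>. x \<in> submod_gen B S"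
proof -
  have "is_submod (\<Union>\<C>) {x. \<exists>B\<in>\<C>. x \<in> submod_gen B S}"
    unfolding is_submod_def
  proof (intro conjI ballI)
    show "0 \<in> {x. \<exists>B\<in>\<C>. x \<in> submod_gen B S}"
      using assms(1) is_submodD(1)[OF submod_gen_submod] by auto
    fix u v assume "u \<in> {x. \<exists>B\<in>\<C>. x \<in> submod_gen B S}" "v \<in> {x. \<exists>B\<in>\<C>. x \<in> submod_gen B S}"
    then obtain B C where *: "B \<in> \<C>" "C \<in> \<C>" "u \<in> submod_gen B S" "v \<in> submod_gen C S" by auto
    then obtain D where "D \<in> \<C>" "B \<subseteq> D" "C \<subseteq> D" using assms(2)[of B C] by blast
    then have "u + v \<in> submod_gen D S"
      using * submod_gen_mono[of B D S S] submod_gen_mono[of C D S S] is_submodD(2)[OF submod_gen_submod] by blast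
    then show "u + v \<in> {x. \<exists>B\<in>\<C>. x \<in> submod_gen B S}" using \<open>D \<in> \<C>\<close> by auto
  next
    fix a v assume "a \<in> \<Union>\<C>" "v \<in> {x. \<exists>B\<in>\<C>. x \<in> submod_gen B S}"
    then obtain B C where *: "B \<in> \<C>" "C \<in> \<C>" "a \<in> B" "v \<in> submod_gen C S" by auto
    then obtain D where "D \<in> \<C>" "B \<subseteq> D" "C \<subseteq> D" using assms(2)[of B C] by blast
    then have "a * v \<in> submod_gen D S"
      using * submod_gen_mono[of C D S S] is_submodD(3)[OF submod_gen_submod, of a D v S] by blast
    then show "a * v \<in> {x. \<exists>B\<in>\<C>. x \<in> submod_gen B S}" using \<open>D \<in> \<C>\<close> by auto
  qed
  moreover have "S \<subseteq> {x. \<exists>B\<in>\<C>. x \<in> submod_gen B S}" using assms(1) subsetD[OF submod_gen_gens] by auto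
  ultimately show ?thesis using submod_gen_least[of "\<Union>\<C>" "{x. \<exists>B\<in>\<C>. x \<in> submod_gen B S}" S] assms(3) by auto
qed

lemma submod_gen_adjoin_poly:
  assumes "is_subring B" "x \<in> submod_gen (alg_gen B {y}) S"
  shows "\<exists>p. poly_over (submod_gen B S) p \<and> poly p y = x"
proof -
  let ?I = "submod_gen B S" and ?M = "{poly p y |p. poly_over (submod_gen B S) p}"
  note I = is_submodD[OF submod_gen_submod[of B S]]
  have "is_submod (alg_gen B {y}) ?M"
    unfolding is_submod_def
  proof (intro conjI ballI)
    show "0 \<in> ?M" using I(1) by (intro CollectI exI[of _ 0]) (auto simp: poly_over_def)
    fix u v assume "u \<in> ?M" "v \<in> ?M"
    then obtain p q where "u = poly p y" "poly_over ?I p" "v = poly q y" "poly_over ?I q" by auto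
    then show "u + v \<in> ?M" using I(2) by (intro CollectI exI[of _ "p + q"]) (auto simp: poly_over_def)
  next
    fix u v assume "u \<in> alg_gen B {y}" "v \<in> ?M"
    then obtain p q where "u = poly p y" "poly_over B p" "v = poly q y" "poly_over ?I q"
      by (auto simp: alg_gen_single[OF assms(1)])
    then show "u * v \<in> ?M"
      by (intro CollectI exI[of _ "p * q"])
        (auto simp: poly_over_def coeff_mult intro!: is_submod_sum[OF submod_gen_submod] I)
  qed
  moreover have "S \<subseteq> ?M"
  proof
    fix s assume "s \<in> S"
    then have "s \<in> ?I" by (rule subsetD[OF submod_gen_gens])
    then show "s \<in> ?M" using I(1) by (intro CollectI exI[of _ "monom s 0"]) (auto simp: poly_over_def poly_monom)
  qed
  ultimately have "submod_gen (alg_gen B {y}) S \<subseteq> ?M" by (rule submod_gen_least)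
  then show ?thesis using assms(2) by auto
qed

text \<open>Chevalley's extension theorem.  A ring \<open>B\<close> that is maximal among those in which the given ideal
  stays proper is a valuation ring: otherwise the ideal becomes the unit ideal in both \<open>B[x]\<close> and
  \<open>B[1/x]\<close>, and then Nakayama's lemma kills the module spanned by the powers of \<open>x\<close> up to the sum of
  the degrees of the two relations.\<close>

theorem chevalley:
  assumes K: "is_subfield K" and A: "is_subring A" "A \<subseteq> K" and a: "\<aa> \<subseteq> A" "1 \<notin> submod_gen A \<aa>"
  shows "\<exists>V. valuation_ring K V \<and> A \<subseteq> V \<and> \<aa> \<subseteq> max_ideal V"
proof -
  define \<B> where "\<B> = {B. is_subring B \<and> A \<subseteq> B \<and> B \<subseteq> K \<and> 1 \<notin> submod_gen B \<aa>}"
  have "\<exists>B\<in>\<B>. \<forall>X\<in>\<B>. B \<subseteq> X \<longrightarrow> X = B"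
  proof (rule subset_Zorn_nonempty)
    show "\<B> \<noteq> {}" using A a by (auto simp: \<B>_def)
    fix \<C> assume C: "\<C> \<noteq> {}" "subset.chain \<B> \<C>"
    then have CB: "\<C> \<subseteq> \<B>" and ch: "\<And>B C. B \<in> \<C> \<Longrightarrow> C \<in> \<C> \<Longrightarrow> B \<subseteq> C \<or> C \<subseteq> B"
      by (auto simp: subset_chain_def)
    have "is_subring (\<Union>\<C>)"
      unfolding is_subring_def
    proof (intro conjI ballI)
      show "1 \<in> \<Union>\<C>" using C CB subringD(1) by (fastforce simp: \<B>_def)
      fix u v assume "u \<in> \<Union>\<C>" "v \<in> \<Union>\<C>"
      then obtain B C where "B \<in> \<C>" "C \<in> \<C>" "u \<in> B" "v \<in> C" by auto
      then obtain D where D: "D \<in> \<C>" "u \<in> D" "v \<in> D" using ch[of B C] by blast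
      then have "is_subring D" using CB by (auto simp: \<B>_def)
      then show "u - v \<in> \<Union>\<C>" "u * v \<in> \<Union>\<C>" using D subringD by blast+
    qed
    moreover have "1 \<notin> submod_gen (\<Union>\<C>) \<aa>"
      using submod_gen_extension_chain[OF C(1) ch, of 1 \<aa>] CB by (auto simp: \<B>_def)
    ultimately show "\<Union>\<C> \<in> \<B>" using C CB by (auto simp: \<B>_def)
  qed
  then obtain B where B: "is_subring B" "A \<subseteq> B" "B \<subseteq> K" "1 \<notin> submod_gen B \<aa>"
    and maxB0: "\<forall>X\<in>\<B>. B \<subseteq> X \<longrightarrow> X = B"
    by (auto simp: \<B>_def)
  have maxB: "1 \<in> submod_gen X \<aa>" if "is_subring X" "B \<subseteq> X" "X \<subseteq> K" "X \<noteq> B" for X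
    using maxB0 that B(2) unfolding \<B>_def by blast
  define \<bb> where "\<bb> = submod_gen B \<aa>"
  have b: "is_submod B \<bb>" "\<aa> \<subseteq> \<bb>" "\<bb> \<subseteq> B" "1 \<notin> \<bb>"
    unfolding \<bb>_def
    by (rule submod_gen_submod submod_gen_gens B
        submod_gen_least[OF is_submod_self[OF B(1)] order_trans[OF a(1) B(2)]])+
  have maxB': "\<exists>p. poly_over \<bb> p \<and> poly p y = 1" if "y \<in> K" "y \<notin> B" for y
  proof -
    have "1 \<in> submod_gen (alg_gen B {y}) \<aa>"
    proof (rule maxB)
      show "alg_gen B {y} \<subseteq> K" using B that K by (intro alg_gen_least) (auto simp: is_subfield_def)
      show "alg_gen B {y} \<noteq> B" using that alg_gen_gens[of "{y}" B] by auto
    qed (rule alg_gen_subring alg_gen_base)+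
    then show ?thesis using submod_gen_adjoin_poly[OF B(1)] by (auto simp: \<bb>_def)
  qed
  \<comment> \<open>Clearing denominators in a relation \<open>p (1 / (1 - c)) = 1\<close> puts a power of \<open>1 - c\<close>, which is \<open>1\<close> modulo
    the ideal, into the ideal.\<close>
  have unit: "inverse (1 - c) \<in> B" if c: "c \<in> \<bb>" for c
  proof (rule ccontr)
    let ?y = "inverse (1 - c)"
    assume n: "?y \<notin> B"
    have c1: "1 - c \<noteq> 0" using c b by auto
    have 1: "1 - c \<in> B" using c b subringD[OF B(1)] by auto
    have "?y \<in> K" using 1 B(3) K by (auto simp: is_subfield_def)
    then obtain p where p: "poly_over \<bb> p" "poly p ?y = 1" using maxB' n by blast
    have pw: "(1 - c) ^ j - 1 \<in> \<bb>" for j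
    proof (induction j)
      case (Suc j)
      have "(1 - c) ^ Suc j - 1 = (1 - c) * ((1 - c) ^ j - 1) + (- 1) * c" by (simp add: algebra_simps)
      moreover have "(- 1) * c \<in> \<bb>" using is_submod_diff(1)[OF B(1) b(1)] c by simp
      ultimately show ?case using Suc is_submodD(2,3)[OF b(1)] 1 by metis
    qed (use is_submodD(1)[OF b(1)] in simp)
    have "(1 - c) ^ degree p = (1 - c) ^ degree p * poly p ?y" using p by simp
    also have "\<dots> = (\<Sum>i\<le>degree p. coeff p i * (1 - c) ^ (degree p - i))"
      by (rule power_mult_poly_inverse[OF c1 order_refl])
    also have "\<dots> = (\<Sum>i\<le>degree p. (1 - c) ^ (degree p - i) * coeff p i)" by (simp add: mult.commute)
    also have "\<dots> \<in> \<bb>"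
      using p(1) is_submodD(3)[OF b(1)] subringD(7)[OF B(1) 1]
      by (intro is_submod_sum[OF b(1)]) (auto simp: poly_over_def)
    finally have "(1 - c) ^ degree p - ((1 - c) ^ degree p - 1) \<in> \<bb>"
      using is_submod_diff(2)[OF B(1) b(1)] pw by blast
    then show False using b by simp
  qed
  have "x \<in> B \<or> inverse x \<in> B" if xK: "x \<in> K" for x
  proof (rule ccontr)
    assume no: "\<not> ?thesis"
    then have x0: "x \<noteq> 0" using subringD[OF B(1)] by auto
    obtain p where p: "poly_over \<bb> p" "poly p x = 1" using maxB' no xK by blast
    obtain q where q: "poly_over \<bb> q" "poly q (inverse x) = 1"
      using maxB' no xK subfield_inverse[OF K xK] by blast
    have "degree p > 0"
    proof (rule ccontr)
      assume "\<not> ?thesis"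
      then obtain c where "p = [:c:]" by (metis degree_eq_zeroE gr0I)
      then show False using p b by (auto simp: poly_over_def dest: spec[of _ 0])
    qed
    define S where "S = (\<lambda>i. x ^ i) ` {..<degree p + degree q}"
    have "S \<subseteq> {0}"
    proof (rule nakayama[OF B(1) b(1,3) unit b(4)])
      show "finite S" by (simp add: S_def)
      show "is_submod B {0}" by (simp add: is_submod_def)
      let ?M = "submod_gen B ({0} \<union> {a * s |a s. a \<in> \<bb> \<and> s \<in> S})"
      have gen: "c * x ^ i \<in> ?M" if "c \<in> \<bb>" "i < degree p + degree q" for c i
        using that by (intro subsetD[OF submod_gen_gens]) (auto simp: S_def)
      show "S \<subseteq> ?M"
      proof
        fix s assume "s \<in> S"
        then obtain e where e: "s = x ^ e" "e < degree p + degree q" by (auto simp: S_def)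
        show "s \<in> ?M"
        proof (cases "e < degree q")
          case True
          have "s = x ^ e * poly p x" using p e by simp
          also have "\<dots> = (\<Sum>i\<le>degree p. coeff p i * x ^ (i + e))"
            by (simp add: poly_altdef sum_distrib_left power_add algebra_simps)
          also have "\<dots> \<in> ?M"
            using p(1) True by (intro is_submod_sum[OF submod_gen_submod] gen) (auto simp: poly_over_def)
          finally show ?thesis .
        next
          case False
          have "s = x ^ e * poly q (inverse x)" using q e by simp
          also have "\<dots> = (\<Sum>i\<le>degree q. coeff q i * x ^ (e - i))"
            using False by (intro power_mult_poly_inverse[OF x0]) simp
          also have "\<dots> \<in> ?M"
            using q(1) e by (intro is_submod_sum[OF submod_gen_submod] gen) (auto simp: poly_over_def)
          finally show ?thesis .
        qed
      qed
    qed
    moreover have "x ^ 0 \<in> S" using \<open>degree p > 0\<close> unfolding S_def by (intro imageI) simp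
    ultimately show False by auto
  qed
  then have "valuation_ring K B" using B by (auto simp: valuation_ring_def)
  moreover have "\<aa> \<subseteq> max_ideal B"
  proof
    fix c assume c: "c \<in> \<aa>"
    have "inverse c \<notin> B" if "c \<noteq> 0"
      using is_submodD(3)[OF b(1), of "inverse c" c] c b that by auto
    then show "c \<in> max_ideal B" using c a B by (auto simp: max_ideal_iff)
  qed
  ultimately show ?thesis using B by blast
qed

lemma dominating_valuation:
  assumes "is_subfield K" "local_ring x" "x \<subseteq> K"
  obtains V where "valuation_ring K V" "dominates V x"
proof -
  have "1 \<notin> submod_gen x (max_ideal x)"
    using submod_gen_self[OF local_ring_max] one_notin_max local_ring_subring assms by blast
  then obtain V where "valuation_ring K V" "x \<subseteq> V" "max_ideal x \<subseteq> max_ideal V"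
    using chevalley[OF assms(1) local_ring_subring[OF assms(2)] assms(3) max_ideal_subset] by auto
  then show ?thesis using that dominatesI' by blast
qed

text \<open>The integral closure of a ring \<open>B\<close> in \<open>K\<close>, as the intersection of the valuation rings above it;
  over a field, this is the algebraic closure in \<open>K\<close>.\<close>

definition closure_in :: "'a::field set \<Rightarrow> 'a set \<Rightarrow> 'a set" where
  "closure_in K B = K \<inter> \<Inter>{V. valuation_ring K V \<and> B \<subseteq> V}"

lemma closure_inD: "x \<in> closure_in K B \<Longrightarrow> valuation_ring K V \<Longrightarrow> B \<subseteq> V \<Longrightarrow> x \<in> V"
  by (auto simp: closure_in_def)

lemma closure_in_subset: "closure_in K B \<subseteq> K"
  by (auto simp: closure_in_def)

lemma closure_in_incl: "B \<subseteq> K \<Longrightarrow> B \<subseteq> closure_in K B"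
  by (auto simp: closure_in_def)

lemma closure_in_idem: "B \<subseteq> closure_in K C \<Longrightarrow> closure_in K B \<subseteq> closure_in K C"
  unfolding closure_in_def by blast

lemma closure_in_subring: "is_subfield K \<Longrightarrow> is_subring (closure_in K B)"
  unfolding closure_in_def by (auto simp: is_subring_def is_subfield_def valuation_ring_def)

lemma closure_in_poly:
  assumes "is_subfield K" "is_subring B" "B \<subseteq> K" "x \<in> closure_in K B"
  shows "x \<in> alg_gen B {inverse x}"
proof (cases "x = 0")
  case True
  then show ?thesis using alg_gen_subring subringD by blast
next
  case False
  let ?C = "alg_gen B {inverse x}"
  have xK: "x \<in> K" using assms(4) by (auto simp: closure_in_def)
  have CK: "?C \<subseteq> K" using assms(1,3) xK by (intro alg_gen_least) (auto simp: is_subfield_def)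
  have "1 \<in> submod_gen ?C {inverse x}"
  proof (rule ccontr)
    assume "1 \<notin> submod_gen ?C {inverse x}"
    then obtain V where V: "valuation_ring K V" "?C \<subseteq> V" "{inverse x} \<subseteq> max_ideal V"
      using chevalley[OF assms(1) alg_gen_subring CK alg_gen_gens] by blast
    then have "x \<in> V" using assms(4) alg_gen_base[of B "{inverse x}"] by (auto simp: closure_in_def)
    then show False using V False by (auto simp: max_ideal_iff)
  qed
  then obtain a where "a \<in> ?C" "1 = a * inverse x"
    by (auto simp: submod_gen_insert[OF alg_gen_subring] submod_gen_empty elim!: adjoinE)
  then show ?thesis using False by (simp add: field_simps)
qed

lemma closure_in_polyE:
  assumes "is_subfield K" "is_subring B" "B \<subseteq> K" "x \<in> closure_in K B"
  obtains p where "poly_over B p" "x = poly p (inverse x)"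
  using closure_in_poly[OF assms] by (auto simp: alg_gen_single[OF assms(2)])

lemma closure_in_integral:
  assumes "is_subfield K" "is_subring B" "B \<subseteq> K" "x \<in> K"
  shows "x \<in> closure_in K B \<longleftrightarrow> integral_over B x"
proof
  assume x: "x \<in> closure_in K B"
  show "integral_over B x"
  proof (cases "x = 0")
    case True
    then show ?thesis
      using subringD[OF assms(2)] unfolding integral_over_def
      by (intro exI[of _ "[:0, 1:]"]) (auto simp: coeff_pCons split: nat.splits)
  next
    case False
    obtain p where p: "poly_over B p" "x = poly p (inverse x)"
      using closure_in_polyE[OF assms(1-3) x] by blast
    let ?n = "degree p"
    define q where "q = monom 1 (Suc ?n) - reflect_poly p"
    have r0: "coeff (reflect_poly p) (Suc ?n) = 0" by (simp add: coeff_reflect_poly)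
    have "degree q \<le> Suc ?n"
      unfolding q_def using degree_reflect_poly_le[of p] by (intro degree_diff_le) (auto simp: degree_monom_le)
    moreover have "coeff q (Suc ?n) = 1" using r0 by (simp add: q_def)
    ultimately have "lead_coeff q = 1" using le_degree[of q "Suc ?n"] by (metis antisym zero_neq_one)
    moreover have "\<forall>i. coeff q i \<in> B"
      using p(1) subringD[OF assms(2)] by (auto simp: q_def coeff_reflect_poly poly_over_def)
    moreover have "poly q x = 0"
      using p(2) poly_reflect_poly_nz[OF False, of p] by (simp add: q_def poly_monom)
    ultimately show ?thesis unfolding integral_over_def by blast
  qed
next
  assume "integral_over B x"
  then obtain q where q: "lead_coeff q = 1" "\<forall>i. coeff q i \<in> B" "poly q x = 0"
    by (auto simp: integral_over_def)
  show "x \<in> closure_in K B"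
    unfolding closure_in_def
  proof (intro IntI InterI assms(4))
    fix V assume "V \<in> {V. valuation_ring K V \<and> B \<subseteq> V}"
    then have V: "valuation_ring K V" "B \<subseteq> V" by auto
    note r = subringD[OF valuationD(1)[OF V(1)]]
    show "x \<in> V"
    proof (rule ccontr)
      assume x: "x \<notin> V"
      then have i: "inverse x \<in> V" "x \<noteq> 0" using valuationD(3)[OF V(1)] assms(4) r by auto
      obtain a t where at: "reflect_poly q = pCons a t" by (rule pCons_cases)
      have a: "a = 1" using q(1) at coeff_0_reflect_poly[of q] by simp
      have "coeff t j \<in> V" for j
      proof -
        have "coeff t j = coeff (reflect_poly q) (Suc j)" using at by simp
        then show ?thesis using q(2) V(2) r(2) by (auto simp: coeff_reflect_poly)
      qed
      then have tV: "poly t (inverse x) \<in> V"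
        using poly_over_eval[OF valuationD(1)[OF V(1)] _ i(1)] by (simp add: poly_over_def)
      have "poly (reflect_poly q) (inverse x) = 0"
        using q(3) i(2) poly_reflect_poly_nz[of "inverse x" q] by simp
      then have "1 + inverse x * poly t (inverse x) = 0" using at a by simp
      then have "x * (1 + inverse x * poly t (inverse x)) = 0" by simp
      then have "x + (x * inverse x) * poly t (inverse x) = 0" by (simp add: distrib_left mult.assoc)
      then have "x = - poly t (inverse x)" using i(2) by (simp add: eq_neg_iff_add_eq_0)
      then show False using x r(5)[OF tV] by simp
    qed
  qed
qed

section \<open>Algebraic dependence over an algebraically closed subfield\<close>

lemma alg_closed_subfieldD:
  assumes "alg_closed_subfield k"
  shows "is_subfield k" "is_subring k" "poly_over k p \<Longrightarrow> degree p > 0 \<Longrightarrow> \<exists>z\<in>k. poly p z = 0"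
  using assms by (auto simp: alg_closed_subfield_def is_subfield_def poly_over_def)

lemma poly_over_synthetic_div:
  assumes "is_subring k" "z \<in> k"
  shows "poly_over k p \<Longrightarrow> poly_over k (synthetic_div p z)"
proof (induction p)
  case (pCons a p)
  then show ?case
    using subringD(2)[OF assms(1)] poly_over_eval[OF assms(1) _ assms(2), of p]
    by (simp add: synthetic_div_pCons poly_over_pCons)
qed (use subringD(2)[OF assms(1)] in \<open>simp add: poly_over_def\<close>)

text \<open>The polynomial splits into linear factors over \<open>k\<close>, and one of them lies in the prime ideal.\<close>

lemma alg_closed_residue:
  assumes k: "alg_closed_subfield k" and x: "local_ring x" "k \<subseteq> x" "a \<in> x"
    and "poly_over k p" "p \<noteq> 0" "poly p a \<in> max_ideal x"
  shows "\<exists>c\<in>k. a - c \<in> max_ideal x"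
  using assms(5-7)
proof (induction "degree p" arbitrary: p)
  case 0
  then obtain c where c: "p = [:c:]" by (metis degree_eq_zeroE)
  then have "c \<in> k" "c \<noteq> 0" using 0 subringD(2)[OF alg_closed_subfieldD(2)[OF k]] by (auto simp: poly_over_pCons)
  then have "inverse c \<in> x" using x(2) subfield_inverse[OF alg_closed_subfieldD(1)[OF k]] by auto
  then have "c \<notin> max_ideal x" using \<open>c \<noteq> 0\<close> by (intro unitI)
  then show ?case using 0 c by simp
next
  case (Suc n)
  then obtain z where z: "z \<in> k" "poly p z = 0" using alg_closed_subfieldD(3)[OF k, of p] by auto
  define q where "q = synthetic_div p z"
  have p: "p = [:-z, 1:] * q" using synthetic_div_correct'[of z p] z by (simp add: q_def)
  have "q \<noteq> 0" using p Suc.prems(2) by (metis mult_zero_right)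
  then have q: "poly_over k q" "q \<noteq> 0" "degree q = n"
    using poly_over_synthetic_div[OF alg_closed_subfieldD(2)[OF k] z(1) Suc.prems(1)] Suc.hyps(2)
    by (simp_all add: q_def degree_synthetic_div)
  have "poly p a = (a - z) * poly q a" by (subst p) (simp add: algebra_simps)
  moreover have "a - z \<in> x" "poly q a \<in> x"
    using x z subringD[OF local_ring_subring[OF x(1)]] poly_over_eval'[OF local_ring_subring[OF x(1)] x(2) q(1) x(3)]
    by auto
  ultimately consider "a - z \<in> max_ideal x" | "poly q a \<in> max_ideal x"
    using local_ring_prime[OF x(1), of "a - z" "poly q a"] Suc.prems(3) by auto
  then show ?case
  proof cases
    case 2
    then show ?thesis using Suc.hyps(1)[of q] q by simp
  qed (use z in blast)
qed

lemma UNIV_local: "local_ring (UNIV :: 'a::field set)" "max_ideal (UNIV :: 'a set) = {0}"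
proof -
  show "max_ideal (UNIV :: 'a set) = {0}" by (auto simp: max_ideal_iff)
  then show "local_ring (UNIV :: 'a set)" by (simp add: local_ring_def subring_UNIV is_submod_def)
qed

lemma alg_closed_root:
  assumes "alg_closed_subfield k" "poly_over k p" "p \<noteq> 0" "poly p a = 0"
  shows "a \<in> k"
  using alg_closed_residue[OF assms(1) UNIV_local(1) _ _ assms(2,3)] assms(4) by (auto simp: UNIV_local)

lemma closure_field_iff:
  assumes K: "is_subfield K" and L: "is_subfield L" "L \<subseteq> K" and x: "x \<in> K"
  shows "x \<in> closure_in K L \<longleftrightarrow> (\<exists>p. p \<noteq> 0 \<and> poly_over L p \<and> poly p x = 0)"
proof
  assume "x \<in> closure_in K L"
  then have "integral_over L x" using closure_in_integral[OF K subfield_subring[OF L(1)] L(2) x] by simp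
  then obtain p where p: "lead_coeff p = 1" "\<forall>i. coeff p i \<in> L" "poly p x = 0"
    by (auto simp: integral_over_def)
  then have "p \<noteq> 0" by auto
  then show "\<exists>p. p \<noteq> 0 \<and> poly_over L p \<and> poly p x = 0" using p by (auto simp: poly_over_def)
next
  assume "\<exists>p. p \<noteq> 0 \<and> poly_over L p \<and> poly p x = 0"
  then obtain p where p: "p \<noteq> 0" "poly_over L p" "poly p x = 0" by auto
  define q where "q = smult (inverse (lead_coeff p)) p"
  have "lead_coeff q = 1" using p(1) by (simp add: q_def)
  moreover have "poly_over L q"
    unfolding q_def using p(2) L(1)
    by (intro poly_over_smult subfield_inverse subfield_subring) (auto simp: poly_over_def)
  moreover have "poly q x = 0" using p by (simp add: q_def)
  ultimately have "integral_over L x" by (auto simp: integral_over_def poly_over_def)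
  then show "x \<in> closure_in K L" using closure_in_integral[OF K subfield_subring[OF L(1)] L(2) x] by simp
qed

lemma closure_alg_closed:
  assumes "is_subfield K" "alg_closed_subfield k" "k \<subseteq> K"
  shows "closure_in K k = k"
proof
  show "k \<subseteq> closure_in K k" using closure_in_incl assms by blast
  show "closure_in K k \<subseteq> k"
  proof
    fix x assume x: "x \<in> closure_in K k"
    then have "x \<in> K" using closure_in_subset by blast
    then show "x \<in> k"
      using closure_field_iff[OF assms(1) alg_closed_subfieldD(1)[OF assms(2)] assms(3)] x
        alg_closed_root[OF assms(2)] by blast
  qed
qed

lemma closure_field_subfield:
  assumes K: "is_subfield K" and L: "is_subfield L" "L \<subseteq> K"
  shows "is_subfield (closure_in K L)"
proof (rule is_subfieldI[OF closure_in_subring[OF K]])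
  fix x assume x: "x \<in> closure_in K L" "x \<noteq> 0"
  then have xK: "x \<in> K" using closure_in_subset by blast
  then obtain p where p: "p \<noteq> 0" "poly_over L p" "poly p x = 0"
    using closure_field_iff[OF K L] x by blast
  have "reflect_poly p \<noteq> 0" using p(1) by simp
  moreover have "poly_over L (reflect_poly p)"
    using p(2) subringD(2)[OF subfield_subring[OF L(1)]] by (auto simp: poly_over_def coeff_reflect_poly)
  moreover have "poly (reflect_poly p) (inverse x) = 0"
    using p x by (simp add: poly_reflect_poly_nz)
  ultimately show "inverse x \<in> closure_in K L"
    using closure_field_iff[OF K L subfield_inverse[OF K xK]] by blast
qed

lemma common_denominator:
  assumes "is_subring A" "finite U" "U \<subseteq> frac A"
  shows "\<exists>d\<in>A. d \<noteq> 0 \<and> (\<forall>u\<in>U. d * u \<in> A)"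
  using assms(2,3)
proof (induction U)
  case empty
  then show ?case using subringD(1)[OF assms(1)] by (intro bexI[of _ 1]) auto
next
  case (insert u U)
  then obtain d where d: "d \<in> A" "d \<noteq> 0" "\<forall>u\<in>U. d * u \<in> A" by auto
  obtain a b where ab: "a \<in> A" "b \<in> A" "b \<noteq> 0" "u = a / b" using insert.prems by (auto simp: frac_def)
  have "(b * d) * u = d * a" using ab by simp
  moreover have "(b * d) * v \<in> A" if "v \<in> U" for v
    using subringD(4)[OF assms(1) ab(2), of "d * v"] d that by (simp add: mult.assoc)
  ultimately show ?case
    using d ab subringD(4)[OF assms(1)] by (intro bexI[of _ "b * d"]) auto
qed

text \<open>Algebraic dependence in a form that is symmetric in \<open>y\<close> and \<open>b\<close>; this gives the exchange of one
  transcendental element for another.\<close>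

definition alg_dependent :: "'a::field set \<Rightarrow> 'a \<Rightarrow> 'a \<Rightarrow> bool" where
  "alg_dependent k y b \<longleftrightarrow> (\<exists>N c. (\<forall>i j. c i j \<in> k) \<and> (\<exists>i\<le>N. \<exists>j\<le>N. c i j \<noteq> 0) \<and>
     (\<Sum>i\<le>(N::nat). \<Sum>j\<le>N. c i j * y ^ i * b ^ j) = 0)"

lemma alg_dependent_sym:
  assumes "alg_dependent k y b"
  shows "alg_dependent k b y"
proof -
  obtain N c where *: "\<And>i j. c i j \<in> k" "\<exists>i\<le>N. \<exists>j\<le>N. c i j \<noteq> 0"
    "(\<Sum>i\<le>(N::nat). \<Sum>j\<le>N. c i j * y ^ i * b ^ j) = 0"
    using assms unfolding alg_dependent_def by auto
  have "(\<Sum>i\<le>N. \<Sum>j\<le>N. c j i * b ^ i * y ^ j) = 0"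
    using *(3) by (subst sum.swap) (simp add: ac_simps)
  then show ?thesis unfolding alg_dependent_def
    using * by (intro exI[of _ N] exI[of _ "\<lambda>i j. c j i"]) auto
qed

lemma poly_as_sum:
  fixes p :: "'a::field poly"
  assumes "degree p \<le> N"
  shows "poly p x = (\<Sum>i\<le>N. coeff p i * x ^ i)"
  unfolding poly_altdef by (rule sum.mono_neutral_left) (use assms in \<open>auto intro: coeff_eq_0\<close>)

lemma closure_imp_alg_dependent:
  assumes K: "is_subfield K" and k: "is_subring k" "k \<subseteq> K" and y: "y \<in> K"
    and b: "b \<in> closure_in K (frac (alg_gen k {y}))"
  shows "alg_dependent k y b"
proof -
  let ?D = "alg_gen k {y}"
  have D: "is_subring ?D" by (rule alg_gen_subring)
  have "?D \<subseteq> K" using K k y by (intro alg_gen_least) (auto simp: is_subfield_def)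
  then have LK: "frac ?D \<subseteq> K" using K by (intro frac_least)
  have bK: "b \<in> K" using b closure_in_subset by blast
  obtain p where p: "p \<noteq> 0" "poly_over (frac ?D) p" "poly p b = 0"
    using closure_field_iff[OF K frac_subfield[OF D] LK bK] b by blast
  obtain d where d: "d \<noteq> 0" "\<forall>u\<in>coeff p ` {..degree p}. d * u \<in> ?D"
    using common_denominator[OF D, of "coeff p ` {..degree p}"] p(2) by (auto simp: poly_over_def)
  have "\<exists>f. poly_over k f \<and> d * coeff p j = poly f y" for j
  proof (cases "j \<le> degree p")
    case True
    then show ?thesis using d by (auto simp: alg_gen_single[OF k(1)])
  next
    case False
    then show ?thesis using subringD(2)[OF k(1)] by (intro exI[of _ 0]) (auto simp: coeff_eq_0 poly_over_def)
  qed
  then obtain f where f: "\<And>j. poly_over k (f j)" "\<And>j. d * coeff p j = poly (f j) y" by metis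
  define N where "N = degree p + (\<Sum>j\<le>degree p. degree (f j))"
  have N: "degree (f j) \<le> N" if "j \<le> degree p" for j
    using member_le_sum[of j "{..degree p}" "\<lambda>j. degree (f j)"] that by (simp add: N_def)
  define c where "c = (\<lambda>i j. if j \<le> degree p then coeff (f j) i else 0)"
  have "0 = d * poly p b" using p by simp
  also have "\<dots> = (\<Sum>j\<le>degree p. (d * coeff p j) * b ^ j)"
    by (simp add: poly_altdef sum_distrib_left mult.assoc)
  also have "\<dots> = (\<Sum>j\<le>degree p. \<Sum>i\<le>N. c i j * y ^ i * b ^ j)"
    by (intro sum.cong refl) (simp add: f(2) poly_as_sum[OF N] sum_distrib_right c_def)
  also have "\<dots> = (\<Sum>j\<le>N. \<Sum>i\<le>N. c i j * y ^ i * b ^ j)"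
    by (rule sum.mono_neutral_left) (auto simp: N_def c_def)
  finally have "(\<Sum>i\<le>N. \<Sum>j\<le>N. c i j * y ^ i * b ^ j) = 0" by (subst sum.swap) simp
  moreover have "\<forall>i j. c i j \<in> k" using f(1) subringD(2)[OF k(1)] by (auto simp: c_def poly_over_def)
  moreover have "\<exists>i\<le>N. \<exists>j\<le>N. c i j \<noteq> 0"
  proof -
    have "poly (f (degree p)) y \<noteq> 0" using f(2)[of "degree p"] p(1) d(1) by auto
    then have "f (degree p) \<noteq> 0" by auto
    then have "c (degree (f (degree p))) (degree p) \<noteq> 0" by (simp add: c_def)
    then show ?thesis using N[of "degree p"] by (intro exI[of _ "degree (f (degree p))"] conjI exI[of _ "degree p"]) (auto simp: N_def)
  qed
  ultimately show ?thesis unfolding alg_dependent_def by blast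
qed

lemma alg_dependent_imp_closure:
  assumes K: "is_subfield K" and k: "alg_closed_subfield k" "k \<subseteq> K" and y: "y \<in> K" "y \<notin> k" and b: "b \<in> K"
    and dep: "alg_dependent k y b"
  shows "b \<in> closure_in K (frac (alg_gen k {y}))"
proof -
  let ?D = "alg_gen k {y}"
  note ks = alg_closed_subfieldD[OF k(1)]
  have D: "is_subring ?D" by (rule alg_gen_subring)
  have "?D \<subseteq> K" using K k y by (intro alg_gen_least) (auto simp: is_subfield_def)
  then have LK: "frac ?D \<subseteq> K" using K by (intro frac_least)
  obtain N c where c: "\<And>i j. c i j \<in> k" "\<exists>i\<le>N. \<exists>j\<le>N. c i j \<noteq> 0"
    "(\<Sum>i\<le>(N::nat). \<Sum>j\<le>N. c i j * y ^ i * b ^ j) = 0"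
    using dep unfolding alg_dependent_def by auto
  define f where "f = (\<lambda>j. \<Sum>i\<le>N. monom (c i j) i)"
  have cf: "coeff (f j) i = (if i \<le> N then c i j else 0)" for i j
    by (simp add: f_def coeff_sum if_distrib sum.delta)
  have fk: "poly_over k (f j)" for j using c(1) subringD(2)[OF ks(2)] by (auto simp: poly_over_def cf)
  define p where "p = (\<Sum>j\<le>N. monom (poly (f j) y) j)"
  have cp: "coeff p j = (if j \<le> N then poly (f j) y else 0)" for j
    by (simp add: p_def coeff_sum if_distrib sum.delta)
  have "poly (f j) y \<in> frac ?D" for j
    using frac_incl[OF D] fk by (auto simp: alg_gen_single[OF ks(2)])
  then have "poly_over (frac ?D) p"
    using subringD(2)[OF subfield_subring[OF frac_subfield[OF D]]] by (auto simp: poly_over_def cp)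
  moreover have "p \<noteq> 0"
  proof -
    obtain i j where ij: "i \<le> N" "j \<le> N" "c i j \<noteq> 0" using c(2) by auto
    then have "f j \<noteq> 0" using cf[of j i] by auto
    then have "poly (f j) y \<noteq> 0" using alg_closed_root[OF k(1) fk] y by blast
    then show ?thesis using cp[of j] ij by auto
  qed
  moreover have "poly p b = 0"
  proof -
    have "poly p b = (\<Sum>j\<le>N. \<Sum>i\<le>N. c i j * y ^ i * b ^ j)"
      by (simp add: p_def f_def poly_sum poly_monom sum_distrib_right)
    also have "\<dots> = 0" using c(3) by (subst sum.swap) simp
    finally show ?thesis .
  qed
  ultimately show ?thesis
    using closure_field_iff[OF K frac_subfield[OF D] LK b] by blast
qed

text \<open>A relation between \<open>a\<close> and \<open>b\<close>, divided by the largest possible power of \<open>b\<close>, has a nonzero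
  polynomial \<open>p\<close> in \<open>a\<close> as its term without \<open>b\<close>.\<close>

lemma alg_dependent_reduced:
  assumes k: "is_subring k" and dep: "alg_dependent k b a" and b: "b \<noteq> 0"
  shows "\<exists>p u. poly_over k p \<and> p \<noteq> 0 \<and> u \<in> alg_gen k {a, b} \<and> poly p a = b * u"
proof -
  obtain N c where c: "\<And>i j. c i j \<in> k" "\<exists>i\<le>N. \<exists>j\<le>N. c i j \<noteq> 0"
    "(\<Sum>i\<le>(N::nat). \<Sum>j\<le>N. c i j * b ^ i * a ^ j) = 0"
    using dep unfolding alg_dependent_def by auto
  define m where "m = (LEAST i. i \<le> N \<and> (\<exists>j\<le>N. c i j \<noteq> 0))"
  have m: "m \<le> N" "\<exists>j\<le>N. c m j \<noteq> 0"
    using LeastI_ex[of "\<lambda>i. i \<le> N \<and> (\<exists>j\<le>N. c i j \<noteq> 0)"] c(2) by (auto simp: m_def)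
  have low: "c i j = 0" if "i < m" "j \<le> N" for i j
    using not_less_Least[of i "\<lambda>i. i \<le> N \<and> (\<exists>j\<le>N. c i j \<noteq> 0)"] that m(1) by (auto simp: m_def)
  define f where "f = (\<lambda>i. \<Sum>j\<le>N. monom (c i j) j)"
  have cf: "coeff (f i) j = (if j \<le> N then c i j else 0)" for i j
    by (simp add: f_def coeff_sum if_distrib sum.delta)
  have fk: "poly_over k (f j)" for j using c(1) subringD(2)[OF k] by (auto simp: poly_over_def cf)
  have fa: "poly (f i) a = (\<Sum>j\<le>N. c i j * a ^ j)" for i
    by (simp add: f_def poly_sum poly_monom)
  let ?R = "alg_gen k {a, b}"
  have R: "is_subring ?R" "k \<subseteq> ?R" "a \<in> ?R" "b \<in> ?R"
    using alg_gen_subring[of k "{a, b}"] alg_gen_base[of k "{a, b}"] alg_gen_gens[of "{a, b}" k] by auto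
  define u where "u = - (\<Sum>i\<in>{Suc m..N}. poly (f i) a * b ^ (i - Suc m))"
  have "u \<in> ?R"
    unfolding u_def
    using poly_over_eval'[OF R(1,2) fk R(3)] R by (intro subringD(5)[OF R(1)] subring_sum subringD(4)[OF R(1)] subringD(7)[OF R(1)])
  moreover have "poly (f m) a = b * u"
  proof -
    have "0 = (\<Sum>i\<le>N. poly (f i) a * b ^ i)"
      using c(3) by (simp add: fa sum_distrib_right sum_distrib_left ac_simps)
    also have "\<dots> = (\<Sum>i\<in>{m..N}. poly (f i) a * b ^ i)"
    proof (rule sum.mono_neutral_right)
      show "\<forall>i\<in>{..N} - {m..N}. poly (f i) a * b ^ i = 0"
        using low by (auto simp: fa intro!: sum.neutral)
    qed auto
    also have "\<dots> = poly (f m) a * b ^ m + (\<Sum>i\<in>{Suc m..N}. poly (f i) a * b ^ i)"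
      using m(1) by (simp add: sum.atLeast_Suc_atMost)
    also have "(\<Sum>i\<in>{Suc m..N}. poly (f i) a * b ^ i) = b ^ m * (b * - u)"
      unfolding u_def minus_minus sum_distrib_left
    proof (rule sum.cong[OF refl])
      fix i assume "i \<in> {Suc m..N}"
      then have "b ^ i = b ^ m * (b * b ^ (i - Suc m))"
        by (simp flip: power_add power_Suc)
      then show "poly (f i) a * b ^ i = b ^ m * (b * (poly (f i) a * b ^ (i - Suc m)))" by simp
    qed
    also have "poly (f m) a * b ^ m + b ^ m * (b * - u) = b ^ m * (poly (f m) a - b * u)"
      by (simp add: algebra_simps)
    finally have "b ^ m * (poly (f m) a - b * u) = 0" by (rule sym)
    then show ?thesis using b by auto
  qed
  moreover have "f m \<noteq> 0"
  proof -
    obtain j where "j \<le> N" "c m j \<noteq> 0" using m(2) by auto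
    then have "coeff (f m) j \<noteq> 0" by (simp add: cf)
    then show ?thesis by auto
  qed
  ultimately show ?thesis using fk by blast
qed

lemma alg_closed_infinite:
  assumes "alg_closed_subfield k"
  shows "infinite k"
proof
  assume fin: "finite k"
  note k = alg_closed_subfieldD[OF assms]
  define p where "p = (\<Prod>a\<in>k. [:- a, 1:]) + 1"
  have *: "poly_over k (\<Prod>a\<in>F. [:- a, 1:])" if "F \<subseteq> k" "finite F" for F
    using that(2,1)
  proof (induction F rule: finite_induct)
    case empty
    show ?case using poly_over_monom[OF k(2) subringD(1)[OF k(2)], of 0] by (simp add: monom_0 one_pCons)
  next
    case (insert a F)
    have "poly_over k [:- a, 1:]" using insert.prems subringD[OF k(2)] by (simp add: poly_over_pCons poly_over_0)
    then show ?case
      unfolding prod.insert[OF insert.hyps] using insert by (intro poly_over_arith(3)[OF k(2)]) auto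
  qed
  have "poly_over k p"
    unfolding p_def using *[of k] fin poly_over_monom[OF k(2) subringD(1)[OF k(2)], of 0]
    by (intro poly_over_arith(1)[OF k(2)]) (auto simp: monom_0 one_pCons)
  moreover have "degree p > 0"
  proof (rule ccontr)
    assume "\<not> ?thesis"
    then obtain c where c: "p = [:c:]" by (metis degree_eq_zeroE gr0I)
    have "poly p 0 = 1"
      using fin subringD[OF k(2)] by (auto simp: p_def poly_prod)
    then have "c = 1" using c by simp
    then have p1: "(\<Prod>a\<in>k. [:- a, 1:]) = 0" using c by (simp add: p_def one_pCons)
    then show False using fin by simp
  qed
  ultimately obtain z where "z \<in> k" "poly p z = 0" using k(3) by blast
  then show False using fin by (simp add: p_def poly_prod) (metis prod_zero right_minus_eq add_0 zero_neq_one)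
qed

section \<open>Complete integral curves\<close>

locale curve =
  fixes k :: "'a::field set" and C :: "'a set set"
  assumes k_closed: "alg_closed_subfield k"
    and C_curve: "complete_integral_curve k C"
begin

abbreviation "K \<equiv> function_field C"

definition affine :: "'a set \<Rightarrow> bool" where
  "affine A \<longleftrightarrow> finite_type k A \<and> spec A \<subseteq> C"

lemmas k_subfield = alg_closed_subfieldD(1)[OF k_closed]
lemmas k_subring = alg_closed_subfieldD(2)[OF k_closed]
lemmas k_ring = subringD[OF k_subring]

lemma finite_typeD: "finite_type k A \<Longrightarrow> is_subring A" "finite_type k A \<Longrightarrow> k \<subseteq> A"
  unfolding finite_type_def by (metis alg_gen_subring) (metis alg_gen_base)

lemma chart_exists:
  assumes "x \<in> C"
  obtains A where "affine A" "x \<in> spec A"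
proof -
  obtain \<A> where A: "\<forall>A\<in>\<A>. finite_type k A" "C = (\<Union>A\<in>\<A>. spec A)"
    using C_curve by (auto simp: complete_integral_curve_def integral_scheme_def)
  then obtain A where "A \<in> \<A>" "x \<in> spec A" using assms by blast
  moreover from this have "affine A" using A unfolding affine_def by blast
  ultimately show ?thesis using that by blast
qed

lemma finite_charts:
  obtains \<A> where "finite \<A>" "\<And>A. A \<in> \<A> \<Longrightarrow> affine A" "C = (\<Union>A\<in>\<A>. spec A)"
proof -
  obtain \<A> where "finite \<A>" "\<forall>A\<in>\<A>. finite_type k A" "C = (\<Union>A\<in>\<A>. spec A)"
    using C_curve by (auto simp: complete_integral_curve_def integral_scheme_def)
  moreover from this have "affine A" if "A \<in> \<A>" for A using that unfolding affine_def by blast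
  ultimately show ?thesis using that[of \<A>] by blast
qed

lemma affineD:
  assumes "affine A"
  shows "finite_type k A" "is_subring A" "k \<subseteq> A" "spec A \<subseteq> C" "x \<in> spec A \<Longrightarrow> x \<in> C"
  using assms finite_typeD by (auto simp: affine_def)

lemma C_nonempty: "C \<noteq> {}"
  using C_curve by (auto simp: complete_integral_curve_def one_dimensional_def)

lemma point:
  assumes "x \<in> C"
  shows "local_ring x" "is_subring x" "k \<subseteq> x" "x \<subseteq> K" "frac x = K"
proof -
  obtain A where A: "affine A" "x \<in> spec A" using chart_exists assms by blast
  show "local_ring x" using specD[OF affineD(2)[OF A(1)] A(2)] by simp
  then show "is_subring x" by (rule local_ring_subring)
  show "k \<subseteq> x" using specD[OF affineD(2)[OF A(1)] A(2)] affineD(3)[OF A(1)] by auto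
  show "x \<subseteq> K" using assms by (auto simp: function_field_def)
  show "frac x = K" using C_curve assms by (simp add: complete_integral_curve_def integral_scheme_def)
qed

lemmas point_ring = subringD[OF point(2)]
lemmas point_max = is_submodD[OF local_ring_max[OF point(1)]]

lemma K_subfield: "is_subfield K"
proof -
  obtain x where x: "x \<in> C" using C_nonempty by auto
  show ?thesis using frac_subfield[OF point(2)[OF x]] point(5)[OF x] by simp
qed

lemmas K_subring = subfield_subring[OF K_subfield]
lemmas K_ring = subringD[OF K_subring]

lemma k_K: "k \<subseteq> K"
  using C_nonempty point by fastforce

lemma affine_frac:
  assumes "affine A"
  shows "frac A = K" "A \<subseteq> K" "K \<in> spec A"
proof -
  have "frac A \<in> C" using frac_in_spec affineD[OF assms] by blast
  then show 1: "frac A = K" using point(5) frac_self[OF frac_subfield[OF affineD(2)[OF assms]]] by metis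
  then show "A \<subseteq> K" using frac_incl affineD(2)[OF assms] by blast
  show "K \<in> spec A" using frac_in_spec[OF affineD(2)[OF assms]] 1 by simp
qed

lemma K_point: "K \<in> C"
proof -
  obtain x where "x \<in> C" using C_nonempty by blast
  then obtain A where "affine A" "x \<in> spec A" by (rule chart_exists)
  then show ?thesis using affine_frac(3) affineD(5) by blast
qed

lemma max_K: "max_ideal K = {0}"
  by (rule subfield_max_ideal[OF K_subfield])

lemma center_unique:
  assumes "valuation_ring K V" "x \<in> C" "y \<in> C" "dominates V x" "dominates V y"
  shows "x = y"
  using C_curve assms unfolding complete_integral_curve_def integral_scheme_def by blast

lemma center_exists:
  assumes "valuation_ring K V" "k \<subseteq> V"
  obtains x where "x \<in> C" "dominates V x"
  using C_curve assms unfolding complete_integral_curve_def complete_scheme_def by blast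

lemma val_local: "valuation_ring K V \<Longrightarrow> local_ring V"
  using valuation_local K_subfield by blast

lemma center_chart:
  assumes "valuation_ring K V" "affine A" "A \<subseteq> V"
  shows "loc A V \<in> C" "loc A V \<in> spec A" "dominates V (loc A V)"
  using loc_props[OF val_local[OF assms(1)] affineD(2)[OF assms(2)] assms(3)] affineD(5)[OF assms(2)] by auto

lemma spec_point:
  assumes "affine A" "x \<in> spec A"
  shows "x \<in> C" "A \<subseteq> x" "loc A x = x" "u \<in> x \<Longrightarrow> \<exists>a\<in>A. \<exists>s\<in>A. s \<notin> max_ideal x \<and> u = a / s"
proof -
  show "x \<in> C" "A \<subseteq> x" and l: "loc A x = x"
    using specD[OF affineD(2)[OF assms(1)] assms(2)] affineD(5)[OF assms] by auto
  show "u \<in> x \<Longrightarrow> \<exists>a\<in>A. \<exists>s\<in>A. s \<notin> max_ideal x \<and> u = a / s" using loc_iff[of u A x] l by simp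
qed

lemma no_long_chain:
  assumes "x \<in> C" "y \<in> C" "x \<subset> y"
  shows "y = K"
proof (rule ccontr)
  assume "y \<noteq> K"
  then have "y \<subset> K" using point(4)[OF assms(2)] by auto
  then show False using C_curve assms K_point
    unfolding complete_integral_curve_def one_dimensional_def by blast
qed

lemma K_neq_k: "K \<noteq> k"
proof
  assume "K = k"
  obtain x y where "x \<in> C" "y \<in> C" "x \<subset> y"
    using C_curve by (auto simp: complete_integral_curve_def one_dimensional_def)
  then show False using point(3)[of x] point(4)[of y] \<open>K = k\<close> by auto
qed

lemma alg_gen_K: "A \<subseteq> K \<Longrightarrow> S \<subseteq> K \<Longrightarrow> alg_gen A S \<subseteq> K"
  by (rule alg_gen_least[OF K_subring])

lemma k_transcendental:
  assumes "y \<in> K" "y \<notin> k" "poly_over k p" "p \<noteq> 0"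
  shows "poly p y \<noteq> 0"
  using alg_closed_root[OF k_closed assms(3,4)] assms(2) by blast

text \<open>A valuation ring \<open>V\<close> with a residue field that is transcendental over \<open>k\<close>, witnessed by \<open>z\<close>, is not
  centered at a closed point.  For the ring \<open>k[z] + m\<close>, with \<open>m\<close> the maximal ideal of \<open>V\<close>, has the
  proper ideal generated by \<open>z\<close> and \<open>m\<close>, and the center of a valuation ring above this ideal is a point
  strictly below the center of \<open>V\<close>.\<close>

lemma chain_from_valuation:
  assumes V: "valuation_ring K V" and A: "affine A" "A \<subseteq> V" and z: "z \<in> A" "z \<notin> k"
    and unit: "\<And>p. poly_over k p \<Longrightarrow> p \<noteq> 0 \<Longrightarrow> inverse (poly p z) \<in> V"
  shows "V = K"
proof -
  note Vl = val_local[OF V] note Vm = is_submodD[OF local_ring_max[OF Vl]] note Vr = subringD[OF valuationD(1)[OF V]]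
  let ?R = "alg_gen k {z}"
  have kV: "k \<subseteq> V" using A affineD(3) by blast
  have zV: "z \<in> V" "z \<in> K" using z A affine_frac(2)[OF A(1)] by auto
  have R: "is_subring ?R" "?R \<subseteq> V" "k \<subseteq> ?R" "z \<in> ?R"
    using alg_gen_subring[of k "{z}"] alg_gen_least[OF valuationD(1)[OF V] kV, of "{z}"] zV alg_gen_base[of k "{z}"]
      alg_gen_gens[of "{z}" k] by auto
  define D where "D = {u + m |u m. u \<in> ?R \<and> m \<in> max_ideal V}"
  have D: "is_subring D"
    unfolding is_subring_def
  proof (intro conjI ballI)
    show "1 \<in> D" unfolding D_def using subringD(1)[OF R(1)] Vm(1) by force
    fix a b assume "a \<in> D" "b \<in> D"
    then obtain u m v n where *: "u \<in> ?R" "v \<in> ?R" "m \<in> max_ideal V" "n \<in> max_ideal V" "a = u + m" "b = v + n"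
      by (auto simp: D_def)
    have "a - b = (u - v) + (m - n)" using * by simp
    moreover have "u - v \<in> ?R" "m - n \<in> max_ideal V"
      using * subringD(3)[OF R(1)] is_submod_diff(2)[OF valuationD(1)[OF V] local_ring_max[OF Vl]] by auto
    ultimately show "a - b \<in> D" unfolding D_def by blast
    have "a * b = u * v + (u * n + b * m)" using * by (simp add: algebra_simps)
    moreover have "u * v \<in> ?R" using * subringD(4)[OF R(1)] by auto
    moreover have "b \<in> V" using * R(2) Vr(6) max_ideal_subset by (metis subsetD)
    then have "u * n + b * m \<in> max_ideal V" using * R(2) Vm by auto
    ultimately show "a * b \<in> D" unfolding D_def by blast
  qed
  have RD: "?R \<subseteq> D" "max_ideal V \<subseteq> D"
    unfolding D_def using Vm(1) subringD(2)[OF R(1)] by force+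
  have DV: "D \<subseteq> V" unfolding D_def using R(2) Vr(6) max_ideal_subset by fastforce
  define I where "I = {z * u + m |u m. u \<in> ?R \<and> m \<in> max_ideal V}"
  have "1 \<notin> submod_gen D (insert z (max_ideal V))"
  proof
    have "is_submod D I"
      unfolding is_submod_def
    proof (intro conjI ballI)
      show "0 \<in> I" unfolding I_def using subringD(2)[OF R(1)] Vm(1) by force
      fix a b assume "a \<in> I" "b \<in> I"
      then obtain u m v n where *: "u \<in> ?R" "v \<in> ?R" "m \<in> max_ideal V" "n \<in> max_ideal V" "a = z * u + m" "b = z * v + n"
        by (auto simp: I_def)
      have "a + b = z * (u + v) + (m + n)" using * by (simp add: algebra_simps)
      moreover have "u + v \<in> ?R" "m + n \<in> max_ideal V"
        using * subringD(6)[OF R(1)] Vm(2) by auto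
      ultimately show "a + b \<in> I" unfolding I_def by blast
    next
      fix a b assume "a \<in> D" "b \<in> I"
      then obtain u m v n where *: "u \<in> ?R" "v \<in> ?R" "m \<in> max_ideal V" "n \<in> max_ideal V" "a = u + m" "b = z * v + n"
        by (auto simp: I_def D_def)
      have "a * b = z * (u * v) + (a * n + (z * v) * m)" using * by (simp add: algebra_simps)
      moreover have "u * v \<in> ?R" using * subringD(4)[OF R(1)] by auto
      moreover have "a * n + (z * v) * m \<in> max_ideal V"
        using * R(2) DV \<open>a \<in> D\<close> zV Vr(4) by (intro Vm(2,3)) auto
      ultimately show "a * b \<in> I" unfolding I_def by blast
    qed
    moreover have "insert z (max_ideal V) \<subseteq> I"
      unfolding I_def using subringD(1,2)[OF R(1)] Vm(1) by force
    moreover assume "1 \<in> submod_gen D (insert z (max_ideal V))"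
    ultimately have "1 \<in> I" using submod_gen_least by blast
    then obtain u m where um: "u \<in> ?R" "m \<in> max_ideal V" "1 = z * u + m" by (auto simp: I_def)
    then obtain p where p: "poly_over k p" "u = poly p z" by (auto simp: alg_gen_single[OF k_subring])
    define q where "q = 1 - pCons 0 p"
    have "poly_over k q"
      unfolding q_def using p poly_over_monom[OF k_subring k_ring(1), of 0]
      by (intro poly_over_arith k_subring) (auto simp: poly_over_pCons k_ring monom_0 one_pCons)
    moreover have "coeff q 0 = 1" by (simp add: q_def)
    then have "q \<noteq> 0" by auto
    ultimately have "inverse (poly q z) \<in> V" "poly q z \<noteq> 0" using unit k_transcendental[OF zV(2) z(2)] by auto
    moreover have "poly q z = m" using um p by (simp add: q_def algebra_simps)
    ultimately show False using um by (auto simp: max_ideal_iff)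
  qed
  moreover have "D \<subseteq> K" "insert z (max_ideal V) \<subseteq> D" using DV valuationD(2)[OF V] RD R(4) by auto
  ultimately obtain W where W: "valuation_ring K W" "D \<subseteq> W" "insert z (max_ideal V) \<subseteq> max_ideal W"
    using chevalley[OF K_subfield D, of "insert z (max_ideal V)"] by metis
  have WV: "W \<subseteq> V"
  proof
    fix u assume u: "u \<in> W"
    show "u \<in> V"
    proof (rule ccontr)
      assume n: "u \<notin> V"
      have "u \<in> K" using u valuationD(2)[OF W(1)] by auto
      then have "inverse u \<in> max_ideal W" using valuation_max[OF K_subfield V] n W(3) by auto
      then have "u * inverse u \<in> max_ideal W" using is_submodD(3)[OF local_ring_max[OF val_local[OF W(1)]] u] by blast
      moreover have "u \<noteq> 0" using n Vr by auto
      ultimately show False using one_notin_max[OF valuationD(1)[OF W(1)]] by simp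
    qed
  qed
  have "k \<subseteq> W" using R(3) RD W(2) by auto
  then obtain x where x: "x \<in> C" "dominates W x" using center_exists W(1) by blast
  obtain B where B: "affine B" "x \<in> spec B" using chart_exists x(1) by blast
  note Bx = spec_point[OF B]
  have BW: "B \<subseteq> W" using Bx(2) dominatesD(1)[OF x(2)] by auto
  define y where "y = loc A V"
  note y = center_chart[OF V A, folded y_def]
  have "loc B V = y"
    using center_unique[OF V _ y(1) _ y(3)] center_chart[OF V B(1)] BW WV by auto
  moreover have "x = loc B W" using loc_dominates[OF x(2) Bx(2)] Bx(3) by simp
  moreover have "loc B W \<subseteq> loc B V"
  proof
    fix u assume "u \<in> loc B W"
    then obtain a s where "a \<in> B" "s \<in> B" "s \<notin> max_ideal W" "u = a / s" by (rule locE)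
    then show "u \<in> loc B V" using W(3) by (auto simp: loc_iff)
  qed
  ultimately have xy: "x \<subseteq> y" by metis
  have zm: "z \<in> max_ideal W" using W(3) by auto
  have z0: "z \<noteq> 0" using z(2) k_ring by auto
  then have "inverse z \<notin> x" using zm dominatesD(1)[OF x(2)] by (auto simp: max_ideal_iff)
  moreover have "inverse z \<in> y"
  proof -
    have "inverse (poly [:0, 1:] z) \<in> V" by (rule unit) (auto simp: poly_over_pCons poly_over_0 k_ring)
    then have "z \<notin> max_ideal V" using z0 by (intro unitI) auto
    then show ?thesis unfolding y_def loc_iff
      using z(1) subringD(1)[OF affineD(2)[OF A(1)]] by (intro bexI[of _ 1] bexI[of _ z]) (auto simp: divide_inverse)
  qed
  ultimately have "y = K" using no_long_chain[OF x(1) y(1)] xy by blast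
  then show ?thesis using dominatesD(1)[OF y(3)] valuationD(2)[OF V] by auto
qed

lemma frac_alg_gen_closed:
  assumes L: "is_subfield L" "L \<subseteq> K" and "k \<subseteq> closure_in K L" "S \<subseteq> closure_in K L"
  shows "frac (alg_gen k S) \<subseteq> closure_in K L"
  using assms closure_field_subfield[OF K_subfield L]
  by (intro frac_least alg_gen_least) (auto simp: is_subfield_def)

text \<open>Here \<open>h\<close> is a common denominator of the coefficients of an equation of \<open>s\<close>, which is thus integral over
  \<open>D[1/h]\<close>.\<close>

lemma algebraic_denominator:
  assumes D: "is_subring D" "D \<subseteq> K" and s: "s \<in> closure_in K (frac D)"
  shows "\<exists>h\<in>D. h \<noteq> 0 \<and> (\<forall>V. valuation_ring K V \<longrightarrow> D \<subseteq> V \<longrightarrow> inverse h \<in> V \<longrightarrow> s \<in> V)"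
proof -
  have FK: "frac D \<subseteq> K" using frac_least K_subfield D by blast
  obtain q where q: "poly_over (frac D) q" "s = poly q (inverse s)"
    using closure_in_polyE[OF K_subfield subfield_subring[OF frac_subfield[OF D(1)]] FK s] by blast
  obtain h where h: "h \<in> D" "h \<noteq> 0" "\<forall>u\<in>coeff q ` {..degree q}. h * u \<in> D"
    using common_denominator[OF D(1), of "coeff q ` {..degree q}"] q(1) by (auto simp: poly_over_def)
  have "s \<in> V" if V: "valuation_ring K V" "D \<subseteq> V" "inverse h \<in> V" for V
  proof (rule ccontr)
    assume n: "s \<notin> V"
    note Vr = subringD[OF valuationD(1)[OF V(1)]]
    have "s \<in> K" using s closure_in_subset by blast
    then have i: "inverse s \<in> V" using valuationD(3)[OF V(1)] n by blast
    have "coeff q i \<in> V" for i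
    proof (cases "i \<le> degree q")
      case True
      then have "h * coeff q i \<in> V" using h V(2) by auto
      then have "inverse h * (h * coeff q i) \<in> V" using Vr(4) V(3) by blast
      then show ?thesis using h(2) by (simp flip: mult.assoc)
    qed (use Vr in \<open>simp add: coeff_eq_0\<close>)
    then have "poly q (inverse s) \<in> V" using poly_over_eval[OF valuationD(1)[OF V(1)] _ i] by (simp add: poly_over_def)
    then show False using n q(2) by simp
  qed
  then show ?thesis using h by blast
qed

text \<open>If \<open>y\<close> is transcendental over \<open>L\<close>, finitely many elements that are algebraic over \<open>L(y)\<close> have no
  pole at the place \<open>y = c\<close> for all but finitely many \<open>c\<close>: their denominators divide a polynomial
  \<open>H\<close> in \<open>y\<close>, and \<open>c\<close> is chosen in the infinite set \<open>k\<close> with \<open>H c \<noteq> 0\<close>.\<close>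

lemma nontrivial_valuation:
  assumes L: "is_subfield L" "L \<subseteq> K" "k \<subseteq> L" and yK: "y \<in> K" and yL: "y \<notin> closure_in K L"
    and S: "finite S" "S \<subseteq> closure_in K (frac (alg_gen L {y}))"
  obtains V where "valuation_ring K V" "V \<noteq> K" "L \<subseteq> V" "S \<subseteq> V"
proof -
  define D where "D = alg_gen L {y}"
  have D: "is_subring D" "L \<subseteq> D" "y \<in> D" "D \<subseteq> K"
    using alg_gen_subring[of L "{y}"] alg_gen_base[of L "{y}"] alg_gen_gens[of "{y}" L]
      alg_gen_K[of L "{y}"] L yK by (auto simp: D_def)
  have Dp: "\<exists>H. poly_over L H \<and> h = poly H y" if "h \<in> D" for h
    using that by (auto simp: D_def alg_gen_single[OF subfield_subring[OF L(1)]])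
  obtain h where h: "\<And>s. s \<in> S \<Longrightarrow> h s \<in> D \<and> h s \<noteq> 0 \<and>
      (\<forall>V. valuation_ring K V \<longrightarrow> D \<subseteq> V \<longrightarrow> inverse (h s) \<in> V \<longrightarrow> s \<in> V)"
    using algebraic_denominator[OF D(1,4)] S(2) by (metis D_def subsetD)
  define g where "g = prod h S"
  have g: "g \<in> D" unfolding g_def using h by (intro subring_prod[OF D(1)]) auto
  moreover have "g \<noteq> 0" unfolding g_def using h S(1) by (auto simp: prod_zero_iff)
  ultimately have g: "g \<in> D" "g \<noteq> 0" by auto
  obtain H where H: "poly_over L H" "g = poly H y" using Dp g by blast
  have "H \<noteq> 0" using g H by auto
  then have "\<not> k \<subseteq> {c. poly H c = 0}"
    using alg_closed_infinite[OF k_closed] poly_roots_finite finite_subset by blast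
  then obtain c where c: "c \<in> k" "poly H c \<noteq> 0" by auto
  have cL: "c \<in> L" using c L by auto
  have "1 \<notin> submod_gen D {y - c}"
  proof
    assume "1 \<in> submod_gen D {y - c}"
    then obtain a where a: "a \<in> D" "1 = a * (y - c)"
      by (auto simp: submod_gen_insert[OF D(1)] submod_gen_empty elim!: adjoinE)
    then obtain p where p: "poly_over L p" "a = poly p y" using Dp by blast
    define q where "q = p * [:- c, 1:] - 1"
    have "poly_over L q"
      unfolding q_def using p cL subringD[OF subfield_subring[OF L(1)]]
      by (intro poly_over_arith subfield_subring[OF L(1)]) (auto simp: poly_over_pCons poly_over_0 one_pCons)
    moreover have "poly q c = -1" by (simp add: q_def)
    then have "q \<noteq> 0" by auto
    moreover have "poly q y = 0" using a p by (simp add: q_def algebra_simps)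
    ultimately show False using closure_field_iff[OF K_subfield L(1,2) yK] yL by blast
  qed
  then obtain V where V: "valuation_ring K V" "D \<subseteq> V" "{y - c} \<subseteq> max_ideal V"
    using chevalley[OF K_subfield D(1,4)] D subringD(3)[OF D(1), of y c] cL by blast
  note Vr = subringD[OF valuationD(1)[OF V(1)]]
  have Lunit: "inverse u \<in> V" if "u \<in> L" for u using that subfield_inverse[OF L(1)] D V by blast
  have "g \<notin> max_ideal V"
  proof
    assume gm: "g \<in> max_ideal V"
    define q where "q = synthetic_div H c"
    have Hq: "H = [:-c, 1:] * q + [:poly H c:]" using synthetic_div_correct'[of c H] by (simp add: q_def)
    have "poly_over V q"
      unfolding q_def using H(1) D V cL by (intro poly_over_synthetic_div valuationD(1)[OF V(1)]) (auto elim!: poly_over_mono)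
    then have "poly q y \<in> V" using poly_over_eval[OF valuationD(1)[OF V(1)]] D V by auto
    then have "poly q y * (y - c) \<in> max_ideal V"
      using is_submodD(3)[OF local_ring_max[OF val_local[OF V(1)]]] V by auto
    moreover have "poly H c = g - poly q y * (y - c)"
      unfolding H(2) by (subst Hq) (simp add: algebra_simps)
    ultimately have "poly H c \<in> max_ideal V"
      using is_submod_diff(2)[OF valuationD(1)[OF V(1)] local_ring_max[OF val_local[OF V(1)]] gm] by simp
    moreover have "poly H c \<in> L" using poly_over_eval[OF subfield_subring[OF L(1)] H(1) cL] .
    ultimately show False using Lunit c(2) by (auto simp: max_ideal_iff)
  qed
  then have gi: "inverse g \<in> V" using unitD(2) g V by blast
  have "s \<in> V" if s: "s \<in> S" for s
  proof -
    have "g = h s * prod h (S - {s})" unfolding g_def using S(1) s by (simp add: prod.remove)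
    then have "inverse (h s) = inverse g * prod h (S - {s})" using g(2) by (simp add: field_simps)
    moreover have "prod h (S - {s}) \<in> V" using h V(2) by (intro subring_prod valuationD(1)[OF V(1)]) auto
    ultimately have "inverse (h s) \<in> V" using gi Vr by auto
    then show ?thesis using h s V by blast
  qed
  then have "S \<subseteq> V" by blast
  moreover have "V \<noteq> K"
  proof
    assume "V = K"
    then have "y - c = 0" using V(3) max_K by auto
    then show False using yL cL closure_in_incl[OF L(2)] by auto
  qed
  moreover have "L \<subseteq> V" using D V by auto
  ultimately show ?thesis using that V(1) by blast
qed

text \<open>A minimal set \<open>T\<close> of generators of a chart over which the function field is algebraic cannot have
  two elements \<open>y\<close> and \<open>z\<close>: a place \<open>y = c\<close> over a field \<open>L\<close> that contains \<open>z\<close> would be centered at a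
  closed point, with a transcendental residue field.\<close>

lemma transcendence_degree_one:
  obtains y where "y \<in> K" "y \<notin> k" "K \<subseteq> closure_in K (frac (alg_gen k {y}))"
proof -
  obtain A where A: "affine A" using C_nonempty chart_exists by blast
  obtain S where S: "finite S" "A = alg_gen k S" using affineD(1)[OF A] by (auto simp: finite_type_def)
  have SA: "S \<subseteq> A" "S \<subseteq> K" using S(2) alg_gen_gens affine_frac(2)[OF A] by auto
  define P where "P = (\<lambda>T. T \<subseteq> S \<and> K \<subseteq> closure_in K (frac (alg_gen k T)))"
  have sub: "is_subfield (frac (alg_gen k T))" "frac (alg_gen k T) \<subseteq> K" "k \<subseteq> frac (alg_gen k T)"
    "T \<subseteq> frac (alg_gen k T)" if "T \<subseteq> S" for T
  proof -
    show "is_subfield (frac (alg_gen k T))" using frac_subfield[OF alg_gen_subring] .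
    show "frac (alg_gen k T) \<subseteq> K" using that SA by (intro frac_least K_subfield alg_gen_K k_K) auto
    show "k \<subseteq> frac (alg_gen k T)" "T \<subseteq> frac (alg_gen k T)"
      using frac_incl[OF alg_gen_subring[of k T]] alg_gen_base[of k T] alg_gen_gens[of T k] by auto
  qed
  have "K \<subseteq> closure_in K (frac (alg_gen k S))"
    using affine_frac(1)[OF A] S closure_in_incl[of K K] by auto
  then have PS: "P S" by (simp add: P_def)
  obtain T where T: "P T" and minT: "\<And>T'. P T' \<Longrightarrow> card T \<le> card T'"
    using ex_has_least_nat[of P S card] PS by auto
  have TS: "T \<subseteq> S" "K \<subseteq> closure_in K (frac (alg_gen k T))" using T by (auto simp: P_def)
  have finT: "finite T" using TS S finite_subset by blast
  have drop: "\<not> P (T - {t})" if "t \<in> T" for t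
    using minT[of "T - {t}"] that finT card_Diff1_less[of T t] by auto
  have "T \<noteq> {}"
  proof
    assume "T = {}"
    then have "K \<subseteq> closure_in K k" using TS(2) by (simp add: alg_gen_empty[OF k_subring] frac_self[OF k_subfield])
    then show False using closure_alg_closed[OF K_subfield k_closed k_K] K_neq_k k_K by auto
  qed
  then obtain y where y: "y \<in> T" by auto
  define L where "L = frac (alg_gen k (T - {y}))"
  have L: "is_subfield L" "L \<subseteq> K" "k \<subseteq> L" "T - {y} \<subseteq> L"
    using sub[of "T - {y}"] TS(1) by (auto simp: L_def)
  have yL: "y \<notin> closure_in K L"
  proof
    assume "y \<in> closure_in K L"
    then have "frac (alg_gen k T) \<subseteq> closure_in K L"
      using L closure_in_incl[OF L(2)] by (intro frac_alg_gen_closed) auto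
    then have "K \<subseteq> closure_in K L" using TS(2) closure_in_idem by blast
    then have "P (T - {y})" using TS by (auto simp: P_def L_def)
    then show False using drop[OF y] by simp
  qed
  have yK: "y \<in> K" "y \<notin> k" using y TS SA yL closure_in_incl[OF L(2)] L(3) by auto
  show ?thesis
  proof (cases "T = {y}")
    case True
    then show ?thesis using that[of y] yK TS by auto
  next
    case False
    then obtain z where z: "z \<in> T" "z \<noteq> y" using y by auto
    have zL: "z \<in> L" using z L(4) by auto
    have zk: "z \<notin> k"
    proof
      assume "z \<in> k"
      then have "alg_gen k T \<subseteq> alg_gen k (T - {z})"
        using alg_gen_base[of k "T - {z}"] alg_gen_gens[of "T - {z}" k] by (intro alg_gen_least alg_gen_subring) auto
      then have "frac (alg_gen k T) \<subseteq> frac (alg_gen k (T - {z}))" by (rule frac_mono)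
      then have "closure_in K (frac (alg_gen k T)) \<subseteq> closure_in K (frac (alg_gen k (T - {z})))"
        using TS(1) by (intro closure_in_idem order_trans[OF _ closure_in_incl[OF sub(2)]]) auto
      then have "P (T - {z})"
        using TS order_trans[OF TS(2)] by (auto simp: P_def)
      then show False using drop[OF z(1)] by simp
    qed
    let ?D = "alg_gen L {y}"
    have D: "L \<subseteq> ?D" "y \<in> ?D" "?D \<subseteq> K"
      using alg_gen_base[of L "{y}"] alg_gen_gens[of "{y}" L] alg_gen_K[of L "{y}"] L yK by auto
    have "frac (alg_gen k T) \<subseteq> frac ?D"
      using D L by (intro frac_mono alg_gen_least alg_gen_subring) auto
    then have "closure_in K (frac (alg_gen k T)) \<subseteq> closure_in K (frac ?D)"
      by (intro closure_in_idem order_trans[OF _ closure_in_incl[OF frac_least[OF K_subfield D(3)]]])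
    then have KD: "K \<subseteq> closure_in K (frac ?D)" by (rule order_trans[OF TS(2)])
    obtain V where V: "valuation_ring K V" "V \<noteq> K" "L \<subseteq> V" "S \<subseteq> V"
      using nontrivial_valuation[OF L(1-3) yK(1) yL S(1)] KD SA(2) by blast
    have "A \<subseteq> V" unfolding S(2) using V L(3) by (intro alg_gen_least valuationD(1)[OF V(1)]) auto
    moreover have "inverse (poly p z) \<in> V" if "poly_over k p" "p \<noteq> 0" for p
      using zL V(3) subfield_inverse[OF L(1)] poly_over_eval'[OF subfield_subring[OF L(1)] L(3) that(1)] by blast
    ultimately have "V = K" using chain_from_valuation[OF V(1) A _ _ zk] z TS(1) SA by blast
    then show ?thesis using V(2) by simp
  qed
qed

text \<open>The consequence of one-dimensionality from which finiteness statements follow: modulo a nonzero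
  function \<open>b\<close>, every function \<open>a\<close> satisfies a polynomial equation over \<open>k\<close>.\<close>

theorem dependence:
  assumes a: "a \<in> K" and b: "b \<in> K" "b \<noteq> 0"
  shows "\<exists>p u. poly_over k p \<and> p \<noteq> 0 \<and> u \<in> alg_gen k {a, b} \<and> poly p a = b * u"
proof (cases "b \<in> k")
  case True
  let ?R = "alg_gen k {a, b}"
  have "inverse b \<in> ?R" using True subfield_inverse[OF k_subfield] alg_gen_base by blast
  moreover have "poly_over k 1" by (simp add: one_pCons poly_over_pCons poly_over_0 k_ring)
  ultimately show ?thesis using b by (intro exI[of _ 1] exI[of _ "inverse b"]) auto
next
  case False
  obtain y where y: "y \<in> K" "y \<notin> k" "K \<subseteq> closure_in K (frac (alg_gen k {y}))"
    by (rule transcendence_degree_one)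
  have "alg_dependent k y b"
    using closure_imp_alg_dependent[OF K_subfield k_subring k_K y(1)] y(3) b by blast
  then have "y \<in> closure_in K (frac (alg_gen k {b}))"
    using alg_dependent_imp_closure[OF K_subfield k_closed k_K b(1) False y(1)] alg_dependent_sym by blast
  moreover have "k \<subseteq> frac (alg_gen k {b})" "frac (alg_gen k {b}) \<subseteq> K"
    using frac_incl[OF alg_gen_subring[of k "{b}"]] alg_gen_base[of k "{b}"]
      frac_least[OF K_subfield alg_gen_K[OF k_K, of "{b}"]] b by auto
  ultimately have "frac (alg_gen k {y}) \<subseteq> closure_in K (frac (alg_gen k {b}))"
    using closure_in_incl[of "frac (alg_gen k {b})" K]
    by (intro frac_alg_gen_closed frac_subfield[OF alg_gen_subring]) auto
  then have "a \<in> closure_in K (frac (alg_gen k {b}))" using y(3) a closure_in_idem by blast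
  then have "alg_dependent k b a" by (rule closure_imp_alg_dependent[OF K_subfield k_subring k_K b(1)])
  then show ?thesis using alg_dependent_reduced[OF k_subring _ b(2)] by blast
qed

end

section \<open>Closed points and the normalization\<close>

context curve
begin

lemma closed_point_nonzero:
  assumes "x \<in> C" "x \<noteq> K"
  obtains b where "b \<in> max_ideal x" "b \<noteq> 0"
proof -
  have "\<not> max_ideal x \<subseteq> {0}"
  proof
    assume m: "max_ideal x \<subseteq> {0}"
    have "K \<subseteq> x"
      unfolding point(5)[OF assms(1), symmetric]
    proof
      fix u assume "u \<in> frac x"
      then obtain a s where as: "a \<in> x" "s \<in> x" "s \<noteq> 0" "u = a / s" by (auto simp: frac_def)
      then have "inverse s \<in> x" using m by (auto simp: max_ideal_iff)
      then show "u \<in> x" using as point_ring(4)[OF assms(1)] by (simp add: divide_inverse)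
    qed
    then show False using assms point(4) by blast
  qed
  then show ?thesis using that by auto
qed

lemma k_max: "x \<in> C \<Longrightarrow> c \<in> k \<Longrightarrow> c \<in> max_ideal x \<Longrightarrow> c = 0"
  using subfield_inverse[OF k_subfield, of c] point(3)[of x] by (auto simp: max_ideal_iff)

lemma residue_field:
  assumes x: "x \<in> C" "x \<noteq> K" "a \<in> x"
  shows "\<exists>c\<in>k. a - c \<in> max_ideal x"
proof -
  obtain b where b: "b \<in> max_ideal x" "b \<noteq> 0" using closed_point_nonzero x by blast
  have bx: "b \<in> x" using b max_ideal_subset by auto
  obtain p u where p: "poly_over k p" "p \<noteq> 0" "u \<in> alg_gen k {a, b}" "poly p a = b * u"
    using dependence[of a b] b(2) bx x point(4)[OF x(1)] by blast
  have "alg_gen k {a, b} \<subseteq> x" using point[OF x(1)] x bx by (intro alg_gen_least) auto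
  then have "u * b \<in> max_ideal x" using p(3) point_max(3)[OF x(1) _ b(1)] by blast
  then show ?thesis
    using alg_closed_residue[OF k_closed point(1,3)[OF x(1)] x(3) p(1,2)] p(4) by (simp add: mult.commute)
qed

lemma residue_unique:
  assumes "x \<in> C" "c \<in> k" "d \<in> k" "a - c \<in> max_ideal x" "a - d \<in> max_ideal x"
  shows "c = d"
proof -
  have "(a - d) - (a - c) \<in> max_ideal x"
    by (rule is_submod_diff(2)[OF point(2)[OF assms(1)] local_ring_max[OF point(1)[OF assms(1)]] assms(5,4)])
  then have "c - d \<in> max_ideal x" by simp
  then show ?thesis using k_max[OF assms(1), of "c - d"] k_ring(3)[OF assms(2,3)] by simp
qed

text \<open>In the equation of \<open>a\<close> modulo \<open>b\<close>, the polynomial in \<open>a\<close> is a power of \<open>a\<close> times a unit.  This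
  replaces the Artinian property of the quotients of the local ring.\<close>

lemma power_divisible:
  assumes x: "x \<in> C" and b: "b \<in> x" "b \<noteq> 0" and a: "a \<in> max_ideal x"
  shows "\<exists>n. \<exists>u\<in>x. a ^ n = b * u"
proof -
  have ax: "a \<in> x" using a max_ideal_subset by auto
  obtain p u where p: "poly_over k p" "p \<noteq> 0" "u \<in> alg_gen k {a, b}" "poly p a = b * u"
    using dependence[of a b] b ax point(4)[OF x] by blast
  have "alg_gen k {a, b} \<subseteq> x" using point[OF x] ax b by (intro alg_gen_least) auto
  then have "u \<in> x" using p by auto
  have "\<exists>n. \<exists>u\<in>x. a ^ n = b * u" if "poly_over k q" "q \<noteq> 0" "v \<in> x" "a ^ j * poly q a = b * v" for q v j
    using that
  proof (induction q arbitrary: v j)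
    case (pCons c q)
    have q: "poly_over k q" "c \<in> k" using pCons.prems k_ring by (auto simp: poly_over_pCons)
    have qx: "poly q a \<in> x" using poly_over_eval'[OF point(2,3)[OF x] q(1) ax] .
    show ?case
    proof (cases "c = 0")
      case True
      have "a ^ Suc j * poly q a = b * v" using pCons.prems True by (simp add: ac_simps)
      then show ?thesis using pCons.IH[OF q(1) _ pCons.prems(3), of "Suc j"] pCons.hyps True by auto
    next
      case False
      let ?w = "poly (pCons c q) a"
      have w: "?w \<in> x" using poly_over_eval'[OF point(2,3)[OF x] pCons.prems(1) ax] .
      have "?w \<notin> max_ideal x"
      proof
        assume "?w \<in> max_ideal x"
        moreover have "poly q a * a \<in> max_ideal x" using point_max(3)[OF x qx a] .
        ultimately have "?w - poly q a * a \<in> max_ideal x"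
          using is_submod_diff(2)[OF point(2)[OF x] local_ring_max[OF point(1)[OF x]]] by blast
        then show False using k_max[OF x q(2)] False by (simp add: mult.commute)
      qed
      then have i: "?w \<noteq> 0" "inverse ?w \<in> x" using unitD w by auto
      then have "a ^ j = b * (v * inverse ?w)" using pCons.prems(4) by (simp add: field_simps)
      then show ?thesis using point_ring(4)[OF x pCons.prems(3) i(2)] by blast
    qed
  qed simp
  from this[of p u 0] show ?thesis using p \<open>u \<in> x\<close> by simp
qed

text \<open>A zero of \<open>b\<close> in a chart is determined by the values in \<open>k\<close> of the generators of the coordinate
  ring, and these values are roots of the equations of the generators modulo \<open>b\<close>.\<close>

lemma finite_zeros:
  assumes A: "affine A" and b: "b \<in> A" "b \<noteq> 0"
  shows "finite {x \<in> spec A. b \<in> max_ideal x}"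
proof -
  let ?X = "{x \<in> spec A. b \<in> max_ideal x}"
  obtain S where S: "finite S" "A = alg_gen k S" using affineD(1)[OF A] by (auto simp: finite_type_def)
  have SA: "S \<subseteq> A" using S alg_gen_gens by auto
  have AK: "A \<subseteq> K" using affine_frac(2)[OF A] .
  have "\<forall>s\<in>S. \<exists>p u. poly_over k p \<and> p \<noteq> 0 \<and> u \<in> alg_gen k {s, b} \<and> poly p s = b * u"
    using dependence b SA AK by blast
  then obtain p u where p: "\<And>s. s \<in> S \<Longrightarrow> poly_over k (p s) \<and> p s \<noteq> 0 \<and> u s \<in> alg_gen k {s, b} \<and> poly (p s) s = b * u s"
    by metis
  have X: "x \<in> C" "x \<noteq> K" "A \<subseteq> x" "loc A x = x" if "x \<in> ?X" for x
    using that spec_point[OF A] b max_K by auto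
  have "\<forall>x\<in>?X. \<forall>s\<in>S. \<exists>c\<in>k. s - c \<in> max_ideal x"
    using residue_field X SA by blast
  then obtain r where r: "\<And>x s. x \<in> ?X \<Longrightarrow> s \<in> S \<Longrightarrow> r x s \<in> k \<and> s - r x s \<in> max_ideal x"
    by metis
  define \<rho> where "\<rho> = (\<lambda>x. restrict (r x) S)"
  have "\<rho> x \<in> (\<Pi>\<^sub>E s\<in>S. {c. poly (p s) c = 0})" if x: "x \<in> ?X" for x
  proof -
    have "poly (p s) (r x s) = 0" if s: "s \<in> S" for s
    proof -
      note xC = X(1)[OF x] note xs = is_submod_diff(2)[OF point(2)[OF xC] local_ring_max[OF point(1)[OF xC]]]
      have sx: "s \<in> x" "b \<in> x" using s SA X(3)[OF x] b by auto
      have "alg_gen k {s, b} \<subseteq> x" using point[OF xC] sx by (intro alg_gen_least) auto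
      then have "u s * b \<in> max_ideal x" using p[OF s] x point_max(3)[OF xC] by blast
      then have 1: "poly (p s) s \<in> max_ideal x" using p[OF s] by (simp add: mult.commute)
      define q where "q = synthetic_div (p s) (r x s)"
      have q: "p s = [:- r x s, 1:] * q + [:poly (p s) (r x s):]"
        using synthetic_div_correct'[of "r x s" "p s"] by (simp add: q_def)
      have "poly_over k q" unfolding q_def using p[OF s] r[OF x s] by (intro poly_over_synthetic_div k_subring) auto
      then have "poly q s \<in> x" using poly_over_eval'[OF point(2,3)[OF xC]] sx by blast
      then have "poly q s * (s - r x s) \<in> max_ideal x" using point_max(3)[OF xC] r[OF x s] by blast
      then have "poly (p s) s - poly q s * (s - r x s) \<in> max_ideal x" using xs 1 by blast
      moreover have "poly (p s) s = (s - r x s) * poly q s + poly (p s) (r x s)"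
        by (subst q) (simp add: left_diff_distrib)
      ultimately have "poly (p s) (r x s) \<in> max_ideal x" by (simp add: algebra_simps)
      then show ?thesis using k_max[OF xC] poly_over_eval[OF k_subring] p[OF s] r[OF x s] by blast
    qed
    then show ?thesis by (auto simp: \<rho>_def)
  qed
  moreover have "finite (\<Pi>\<^sub>E s\<in>S. {c. poly (p s) c = 0})"
    using S p poly_roots_finite by (intro finite_PiE) auto
  ultimately have "finite (\<rho> ` ?X)" by (meson finite_subset image_subsetI)
  moreover have "inj_on \<rho> ?X"
  proof (rule inj_onI)
    fix x y assume x: "x \<in> ?X" and y: "y \<in> ?X" and eq: "\<rho> x = \<rho> y"
    note xC = X(1)[OF x] and yC = X(1)[OF y]
    define B where "B = {a. \<exists>c\<in>k. a - c \<in> max_ideal x \<and> a - c \<in> max_ideal y}"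
    have "is_subring B"
      unfolding is_subring_def
    proof (intro conjI ballI)
      show "1 \<in> B" unfolding B_def using k_ring(1) point_max(1)[OF xC] point_max(1)[OF yC] by force
      fix a a' assume "a \<in> B" "a' \<in> B"
      then obtain c c' where c: "c \<in> k" "c' \<in> k" "a - c \<in> max_ideal x" "a - c \<in> max_ideal y"
        "a' - c' \<in> max_ideal x" "a' - c' \<in> max_ideal y" by (auto simp: B_def)
      have *: "(a - a') - (c - c') \<in> max_ideal z \<and> a * a' - c * c' \<in> max_ideal z"
        if z: "z \<in> C" "a - c \<in> max_ideal z" "a' - c' \<in> max_ideal z" for z
      proof
        have "(a - c) - (a' - c') \<in> max_ideal z"
          using is_submod_diff(2)[OF point(2) local_ring_max[OF point(1)]] z by blast
        then show "(a - a') - (c - c') \<in> max_ideal z" by (simp add: algebra_simps)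
        have "c \<in> z" "c' \<in> z" using c point(3)[OF z(1)] by auto
        moreover have "a - c \<in> z" using z max_ideal_subset by auto
        then have "(a - c) + c \<in> z" using point_ring(6)[OF z(1)] \<open>c \<in> z\<close> by blast
        ultimately have "a * (a' - c') + c' * (a - c) \<in> max_ideal z"
          using point_max(2,3)[OF z(1)] z by simp
        then show "a * a' - c * c' \<in> max_ideal z" by (simp add: algebra_simps)
      qed
      show "a - a' \<in> B" "a * a' \<in> B"
        using *[OF xC] *[OF yC] c k_ring(3,4)[OF c(1,2)] by (auto simp: B_def)
    qed
    moreover have "k \<subseteq> B" unfolding B_def using point_max(1)[OF xC] point_max(1)[OF yC] by force
    moreover have "S \<subseteq> B"
    proof
      fix s assume s: "s \<in> S"
      have "r x s = r y s" using eq s by (metis \<rho>_def restrict_apply')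
      then show "s \<in> B" unfolding B_def using r[OF x s] r[OF y s] by auto
    qed
    ultimately have AB: "A \<subseteq> B" unfolding S(2) by (rule alg_gen_least)
    have "max_ideal x \<inter> A = max_ideal y \<inter> A"
    proof -
      have "a \<in> max_ideal z'" if a: "a \<in> B" "a \<in> max_ideal z" and z: "z = x \<and> z' = y \<or> z = y \<and> z' = x" for a z z'
      proof -
        have zC: "z \<in> C" using z xC yC by auto
        obtain c where c: "c \<in> k" "a - c \<in> max_ideal z" "a - c \<in> max_ideal z'" using a(1) z by (auto simp: B_def)
        have "c = 0" using residue_unique[OF zC c(1) k_ring(2) c(2)] a by simp
        then show ?thesis using c by simp
      qed
      then show ?thesis using AB by blast
    qed
    then have "loc A x = loc A y" by (rule loc_cong)
    then show "x = y" using X(4)[OF x] X(4)[OF y] by simp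
  qed
  ultimately show ?thesis by (rule finite_imageD)
qed

lemma finite_poles:
  assumes u: "u \<in> K"
  shows "finite {x \<in> C. u \<notin> x}"
proof -
  obtain \<A> where \<A>: "finite \<A>" "\<And>A. A \<in> \<A> \<Longrightarrow> affine A" "C = (\<Union>A\<in>\<A>. spec A)"
    by (rule finite_charts) blast
  have "finite {x \<in> spec A. u \<notin> x}" if "A \<in> \<A>" for A
  proof -
    have A: "affine A" using \<A> that by blast
    obtain a s where as: "a \<in> A" "s \<in> A" "s \<noteq> 0" "u = a / s"
      using u affine_frac(1)[OF A] unfolding frac_def by blast
    have "{x \<in> spec A. u \<notin> x} \<subseteq> {x \<in> spec A. s \<in> max_ideal x}"
    proof safe
      fix x assume x: "x \<in> spec A" "u \<notin> x"
      show "s \<in> max_ideal x"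
      proof (rule ccontr)
        assume "s \<notin> max_ideal x"
        moreover have "a \<in> x" "s \<in> x" using as spec_point(2)[OF A x(1)] by auto
        ultimately have "a * inverse s \<in> x" using unitD(2) point_ring(4)[OF spec_point(1)[OF A x(1)]] by blast
        then show False using x as by (simp add: divide_inverse)
      qed
    qed
    then show ?thesis using finite_zeros[OF A as(2,3)] finite_subset by blast
  qed
  moreover have "{x \<in> C. u \<notin> x} = (\<Union>A\<in>\<A>. {x \<in> spec A. u \<notin> x})" using \<A>(3) by auto
  ultimately show ?thesis using \<A>(1) by simp
qed

lemma closed_point_subset: "x \<in> C \<Longrightarrow> y \<in> C \<Longrightarrow> y \<noteq> K \<Longrightarrow> x \<subseteq> y \<Longrightarrow> x = y"
  using no_long_chain by blast

text \<open>A root \<open>u\<close> of a polynomial \<open>a + X q\<close> over an integrally closed local ring, with a unit among the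
  coefficients, lies in the ring or has its inverse there: \<open>b = a / u = - q u\<close> is integral, and if neither
  \<open>a\<close> nor \<open>b\<close> is a unit, then \<open>q + b\<close> is such a polynomial of smaller degree.\<close>

lemma integrally_closed_dichotomy:
  assumes R: "local_ring R" "R \<subseteq> K" "closure_in K R \<subseteq> R" and u: "u \<in> K"
    and "poly_over R p" "poly p u = 0" "\<exists>i. coeff p i \<notin> max_ideal R"
  shows "u \<in> R \<or> inverse u \<in> R"
  using assms(5-7)
proof (induction "degree p" arbitrary: p rule: less_induct)
  case less
  note Rs = local_ring_subring[OF R(1)] note Rr = subringD[OF Rs]
  show ?case
  proof (cases "u = 0")
    case False
    obtain a q where p: "p = pCons a q" by (cases p)
    have q: "a \<in> R" "poly_over R q" using less.prems(1) Rr by (auto simp: p poly_over_pCons)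
    have eq: "a + u * poly q u = 0" using less.prems(2) by (simp add: p)
    define b where "b = a / u"
    have b: "b = - poly q u" using eq False by (simp add: b_def field_simps eq_neg_iff_add_eq_0)
    have bR: "b \<in> R"
    proof -
      have "b \<in> K" using q u R K_subfield unfolding b_def by (intro subfield_divide) auto
      moreover have "b \<in> V" if V: "valuation_ring K V" "R \<subseteq> V" for V
      proof (cases "u \<in> V")
        case True
        then show ?thesis
          using poly_over_eval'[OF valuationD(1)[OF V(1)] V(2) q(2)] subringD(5)[OF valuationD(1)[OF V(1)]] by (simp add: b)
      next
        case False
        then have "inverse u \<in> V" using valuationD(3)[OF V(1) u] by blast
        then show ?thesis using q V subringD(4)[OF valuationD(1)[OF V(1)], of a "inverse u"] by (auto simp: b_def divide_inverse)
      qed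
      ultimately show ?thesis using R(3) by (auto simp: closure_in_def)
    qed
    show ?thesis
    proof (cases "b \<in> max_ideal R")
      case False
      then have "inverse b \<in> R" using unitD(2) bR by blast
      moreover have "u = a * inverse b" using unitD(1)[OF bR False] \<open>u \<noteq> 0\<close> by (simp add: b_def field_simps)
      ultimately show ?thesis using q Rr by auto
    next
      case bm: True
      show ?thesis
      proof (cases "a \<in> max_ideal R")
        case False
        then have "inverse a \<in> R" "a \<noteq> 0" using unitD q(1) by auto
        then have "b * inverse a \<in> R" using bR Rr(4) by blast
        moreover have "b * inverse a = inverse u" using \<open>a \<noteq> 0\<close> by (simp add: b_def field_simps)
        ultimately show ?thesis by simp
      next
        case am: True
        define q' where "q' = q + [:b:]"
        have q0: "q \<noteq> 0"
        proof
          assume "q = 0"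
          then have "coeff p i \<in> max_ideal R" for i
            using am is_submodD(1)[OF local_ring_max[OF R(1)]] by (simp add: p coeff_pCons split: nat.splits)
          then show False using less.prems(3) by blast
        qed
        have "poly_over R q'"
          unfolding q'_def using q bR Rr by (intro poly_over_arith Rs) (auto simp: poly_over_pCons poly_over_0)
        moreover have "poly q' u = 0" by (simp add: q'_def b)
        moreover have "degree q' < degree p"
          using q0 degree_add_le[of q "degree q" "[:b:]"] by (simp add: p q'_def)
        moreover have "\<exists>i. coeff q' i \<notin> max_ideal R"
        proof -
          obtain i where i: "coeff p i \<notin> max_ideal R" using less.prems(3) by blast
          then obtain j where j: "i = Suc j" using am by (cases i) (auto simp: p)
          have "coeff q' j \<notin> max_ideal R"
          proof
            assume c: "coeff q' j \<in> max_ideal R"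
            have "coeff q' j - coeff [:b:] j \<in> max_ideal R"
              using bm is_submodD(1)[OF local_ring_max[OF R(1)]]
              by (intro is_submod_diff(2)[OF Rs local_ring_max[OF R(1)] c]) (auto simp: coeff_pCons split: nat.splits)
            then show False using i by (simp add: q'_def p j)
          qed
          then show ?thesis by blast
        qed
        ultimately show ?thesis using less.hyps by blast
      qed
    qed
  qed (use Rr in simp)
qed

text \<open>The equation of \<open>u\<close> modulo an element \<open>b\<close> of the maximal ideal has coefficients in \<open>k\<close> up to
  multiples of \<open>b\<close>, so it has a unit among its coefficients.\<close>

lemma integrally_closed_valuation:
  assumes R: "local_ring R" "k \<subseteq> R" "R \<subseteq> K" "closure_in K R \<subseteq> R" "frac R = K"
  shows "valuation_ring K R"
proof -
  note Rs = local_ring_subring[OF R(1)] note Rr = subringD[OF Rs]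
  have "u \<in> R \<or> inverse u \<in> R" if u: "u \<in> K" for u
  proof (cases "\<exists>b\<in>max_ideal R. b \<noteq> 0")
    case False
    obtain a s where as: "a \<in> R" "s \<in> R" "s \<noteq> 0" "u = a / s" using R(5) u unfolding frac_def by blast
    then have "inverse s \<in> R" using False unitD(2) by blast
    then show ?thesis using as Rr by (auto simp: divide_inverse)
  next
    case True
    then obtain b where b: "b \<in> max_ideal R" "b \<noteq> 0" by blast
    have bR: "b \<in> R" using b max_ideal_subset by auto
    obtain p v where p: "poly_over k p" "p \<noteq> 0" "v \<in> alg_gen k {u, b}" "poly p u = b * v"
      using dependence[of u b] b bR R(3) u by blast
    have "alg_gen k {u, b} = alg_gen (alg_gen k {b}) {u}" by (simp add: alg_gen_Un insert_commute)
    also have "\<dots> \<subseteq> alg_gen R {u}" using R bR by (intro alg_gen_mono alg_gen_least Rs) auto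
    finally obtain q where q: "poly_over R q" "v = poly q u" using p(3) by (auto simp: alg_gen_single[OF Rs])
    define f where "f = p - smult b q"
    have "poly_over R f" unfolding f_def using q p R bR
      by (intro poly_over_arith poly_over_smult Rs) (auto elim: poly_over_mono)
    moreover have "poly f u = 0" using p q by (simp add: f_def)
    moreover have "coeff f (degree p) \<notin> max_ideal R"
    proof
      assume "coeff f (degree p) \<in> max_ideal R"
      moreover have "coeff q (degree p) * b \<in> max_ideal R"
        using is_submodD(3)[OF local_ring_max[OF R(1)] _ b(1)] q(1) by (simp add: poly_over_def)
      ultimately have "coeff f (degree p) + coeff q (degree p) * b \<in> max_ideal R"
        using is_submodD(2)[OF local_ring_max[OF R(1)]] by blast
      then have "lead_coeff p \<in> max_ideal R" by (simp add: f_def mult.commute)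
      moreover have "inverse (lead_coeff p) \<in> R"
        using p(1) R(2) subfield_inverse[OF k_subfield] by (auto simp: poly_over_def)
      ultimately show False using p(2) by (simp add: max_ideal_iff)
    qed
    ultimately show ?thesis using integrally_closed_dichotomy[OF R(1,3,4) u] by blast
  qed
  then show ?thesis using R Rs by (auto simp: valuation_ring_def)
qed

lemma valuation_dominated:
  assumes "valuation_ring K V" "valuation_ring K W" "dominates V W"
  shows "V = W"
proof -
  have "u \<in> W" if u: "u \<in> V" for u
  proof (rule ccontr)
    assume n: "u \<notin> W"
    have "u \<in> K" using u valuationD(2)[OF assms(1)] by auto
    then have "inverse u \<in> max_ideal W" using valuation_max[OF K_subfield assms(2)] n by blast
    then have "inverse u \<in> max_ideal V" using dominatesD(2)[OF assms(3)] by auto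
    moreover have "u \<noteq> 0" using n subringD[OF valuationD(1)[OF assms(2)]] by auto
    ultimately show False using u by (simp add: max_ideal_iff)
  qed
  then show ?thesis using dominatesD(1)[OF assms(3)] by auto
qed

text \<open>Localization preserves integral closedness.\<close>

lemma spec_closure_valuation:
  assumes A: "affine A" and y: "y \<in> spec (closure_in K A)"
  shows "valuation_ring K y"
proof -
  let ?B = "closure_in K A"
  have B: "is_subring ?B" "A \<subseteq> ?B" "?B \<subseteq> K"
    using closure_in_subring[OF K_subfield, of A] closure_in_incl[OF affine_frac(2)[OF A]] closure_in_subset[of K A] by auto
  note Y = specD[OF B(1) y]
  note Yr = subringD[OF local_ring_subring[OF Y(1)]]
  have fB: "frac ?B = K"
    using frac_mono[OF B(2)] affine_frac(1)[OF A] frac_least[OF K_subfield B(3)] by auto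
  have fy: "frac y = K" using frac_loc[OF Y(1) B(1) Y(2)] Y(3) fB by simp
  have yK: "y \<subseteq> K" using frac_incl[OF local_ring_subring[OF Y(1)]] fy by simp
  have "closure_in K y \<subseteq> y"
  proof
    fix x assume x: "x \<in> closure_in K y"
    have xK: "x \<in> K" using x closure_in_subset by auto
    obtain p where p: "poly_over y p" "x = poly p (inverse x)"
      using closure_in_polyE[OF K_subfield local_ring_subring[OF Y(1)] yK x] by blast
    have "\<exists>s\<in>?B. s \<notin> max_ideal y \<and> (\<forall>i\<le>n. s * coeff p i \<in> ?B)" for n
    proof (induction n)
      case 0
      have "coeff p 0 \<in> loc ?B y" using p(1) Y(3) by (simp add: poly_over_def)
      then obtain a s where as: "a \<in> ?B" "s \<in> ?B" "s \<notin> max_ideal y" "coeff p 0 = a / s" by (rule locE)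
      have "s \<noteq> 0" using unitD(1) as Y(2) by blast
      then show ?case using as by (intro bexI[of _ s]) auto
    next
      case (Suc n)
      then obtain t where t: "t \<in> ?B" "t \<notin> max_ideal y" "\<forall>i\<le>n. t * coeff p i \<in> ?B" by blast
      have "coeff p (Suc n) \<in> loc ?B y" using p(1) Y(3) by (simp add: poly_over_def)
      then obtain a s where as: "a \<in> ?B" "s \<in> ?B" "s \<notin> max_ideal y" "coeff p (Suc n) = a / s" by (rule locE)
      have "s \<noteq> 0" using unitD(1) as Y(2) by blast
      have "t * s \<notin> max_ideal y" using local_ring_prime[OF Y(1)] t as Y(2) by blast
      moreover have "t * s * coeff p i \<in> ?B" if "i \<le> Suc n" for i
      proof (cases "i = Suc n")
        case True
        then show ?thesis using as t \<open>s \<noteq> 0\<close> subringD(4)[OF B(1)] by simp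
      next
        case False
        then have "s * (t * coeff p i) \<in> ?B" using t that by (intro subringD(4)[OF B(1) as(2)]) auto
        then show ?thesis by (simp add: ac_simps)
      qed
      ultimately show ?case using subringD(4)[OF B(1)] t as by blast
    qed
    then obtain s where s: "s \<in> ?B" "s \<notin> max_ideal y" "\<forall>i\<le>degree p. s * coeff p i \<in> ?B" by blast
    have "s * x \<in> V" if V: "valuation_ring K V" "A \<subseteq> V" for V
    proof -
      have BV: "?B \<subseteq> V" using V closure_inD by blast
      note Vs = valuationD(1)[OF V(1)]
      show ?thesis
      proof (cases "x \<in> V")
        case True
        then show ?thesis using subringD(4)[OF Vs] s BV by auto
      next
        case False
        then have i: "inverse x \<in> V" using valuationD(3)[OF V(1) xK] by blast
        have "s * x = s * poly p (inverse x)" using p(2) by simp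
        also have "\<dots> = (\<Sum>i\<le>degree p. (s * coeff p i) * inverse x ^ i)"
          unfolding poly_altdef sum_distrib_left by (simp only: mult.assoc)
        also have "\<dots> \<in> V"
        proof (rule subring_sum[OF Vs])
          fix j assume "j \<in> {..degree p}"
          then have "s * coeff p j \<in> V" using s(3) BV by auto
          then show "s * coeff p j * inverse x ^ j \<in> V"
            by (rule subringD(4)[OF Vs _ subringD(7)[OF Vs i]])
        qed
        finally show ?thesis .
      qed
    qed
    moreover have "s * x \<in> K" using s(1) B(3) xK K_ring by auto
    ultimately have "s * x \<in> y" using Y(2) by (auto simp: closure_in_def)
    moreover have "inverse s \<in> y" "s \<noteq> 0" using unitD s Y(2) by blast+
    ultimately have "inverse s * (s * x) \<in> y" using Yr(4) by blast
    then show "x \<in> y" using \<open>s \<noteq> 0\<close> by (simp flip: mult.assoc)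
  qed
  moreover have "k \<subseteq> y" using affineD(3)[OF A] B(2) Y(2) by blast
  ultimately show ?thesis using integrally_closed_valuation[OF Y(1) _ yK _ fy] by blast
qed

text \<open>Conversely, the local ring of an integrally closed chart at the center of a valuation ring \<open>V\<close> is itself a
  valuation ring, and so it is equal to \<open>V\<close>.\<close>

lemma normalization_eq: "normalization k C = {V. valuation_ring K V \<and> k \<subseteq> V}"
proof -
  have cl: "{a \<in> frac A. integral_over A a} = closure_in K A" if "affine A" for A
    using closure_in_integral[OF K_subfield affineD(2)[OF that] affine_frac(2)[OF that]]
      affine_frac(1)[OF that] closure_in_subset by blast
  have eq: "normalization k C = (\<Union>A\<in>{A. affine A}. spec (closure_in K A))"
    using cl unfolding normalization_def affine_def by auto
  show ?thesis
  proof (intro equalityI subsetI)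
    fix V assume "V \<in> normalization k C"
    then obtain A where A: "affine A" "V \<in> spec (closure_in K A)" using eq by blast
    have "k \<subseteq> V" using specD(2)[OF closure_in_subring[OF K_subfield] A(2)]
        closure_in_incl[OF affine_frac(2)[OF A(1)]] affineD(3)[OF A(1)] by blast
    then show "V \<in> {V. valuation_ring K V \<and> k \<subseteq> V}" using spec_closure_valuation[OF A] by blast
  next
    fix V assume "V \<in> {V. valuation_ring K V \<and> k \<subseteq> V}"
    then have V: "valuation_ring K V" "k \<subseteq> V" by auto
    obtain x where x: "x \<in> C" "dominates V x" using center_exists[OF V] by blast
    obtain A where A: "affine A" "x \<in> spec A" using chart_exists[OF x(1)] by blast
    have "A \<subseteq> V" using spec_point(2)[OF A] dominatesD(1)[OF x(2)] by blast
    then have "closure_in K A \<subseteq> V" using V closure_inD by blast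
    note L = loc_props[OF val_local[OF V(1)] closure_in_subring[OF K_subfield] this]
    have "V = loc (closure_in K A) V"
      using valuation_dominated[OF V(1) spec_closure_valuation[OF A(1) L(5)] L(4)] .
    then show "V \<in> normalization k C" using L(5) A(1) eq by auto
  qed
qed

section \<open>The Zariski topology\<close>

text \<open>The ring \<open>A[1/f]\<close>, whose spectrum is the basic open set where \<open>f\<close> does not vanish.\<close>

definition inverted :: "'a set \<Rightarrow> 'a \<Rightarrow> 'a set" where
  "inverted A f = alg_gen A {inverse f}"

lemma inverted_eq:
  assumes A: "is_subring A" "f \<in> A" "f \<noteq> 0"
  shows "inverted A f = {a / f ^ n |a n. a \<in> A}"
proof
  let ?R = "{a / f ^ n |a n. a \<in> A}"
  note Ar = subringD[OF A(1)]
  have I: "a / f ^ n \<in> ?R" if "a \<in> A" for a n using that by blast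
  have "is_subring ?R"
    unfolding is_subring_def
  proof (intro conjI ballI)
    show "1 \<in> ?R" using I[OF Ar(1), of 0] by simp
    fix u v assume "u \<in> ?R" "v \<in> ?R"
    then obtain a n b m where *: "a \<in> A" "b \<in> A" "u = a / f ^ n" "v = b / f ^ m" by blast
    have 1: "u - v = (a * f ^ m - b * f ^ n) / f ^ (n + m)"
      unfolding *(3,4) using A(3) by (simp add: field_simps power_add)
    show "u - v \<in> ?R" unfolding 1 using *(1,2) A(2) Ar by (intro I) auto
    have 2: "u * v = (a * b) / f ^ (n + m)" using * by (simp add: power_add)
    show "u * v \<in> ?R" unfolding 2 using *(1,2) Ar by (intro I) auto
  qed
  moreover have "A \<subseteq> ?R" using I[of _ 0] by auto
  moreover have "inverse f \<in> ?R" using I[OF Ar(1), of 1] by (simp add: divide_inverse)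
  ultimately show "inverted A f \<subseteq> ?R" unfolding inverted_def by (intro alg_gen_least) auto
  show "?R \<subseteq> inverted A f"
  proof clarify
    fix a n assume "a \<in> A"
    then have "a * inverse f ^ n \<in> inverted A f"
      unfolding inverted_def using alg_gen_base[of A "{inverse f}"] alg_gen_gens[of "{inverse f}" A]
      by (intro subringD(4,7)[OF alg_gen_subring]) auto
    then show "a / f ^ n \<in> inverted A f" by (simp add: divide_inverse power_inverse)
  qed
qed

lemma finite_type_inverted: "finite_type k A \<Longrightarrow> finite_type k (inverted A f)"
  unfolding finite_type_def inverted_def
  by (metis alg_gen_Un finite.emptyI finite.insertI finite_UnI)

lemma inverted_ring: "is_subring (inverted A f)" "A \<subseteq> inverted A f" "inverse f \<in> inverted A f"
  unfolding inverted_def using alg_gen_subring[of A "{inverse f}"] alg_gen_base[of A "{inverse f}"]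
    alg_gen_gens[of "{inverse f}" A] by auto

lemma spec_inverted:
  assumes A: "is_subring A" "f \<in> A" "f \<noteq> 0"
  shows "spec (inverted A f) = {x \<in> spec A. f \<notin> max_ideal x}"
proof (intro equalityI subsetI)
  let ?B = "inverted A f"
  note B = inverted_ring[where A = A and f = f]
  fix x assume "x \<in> spec ?B"
  note X = specD[OF B(1) this]
  have f: "f \<notin> max_ideal x" using X(2) B(3) A(3) by (intro unitI) auto
  have Ax: "A \<subseteq> x" using X B by auto
  note L = loc_props[OF X(1) A(1) Ax]
  have "inverse f \<in> loc A x" using f A subringD(1)[OF A(1)] unfolding loc_iff
    by (intro bexI[of _ 1] bexI[of _ f]) (auto simp: divide_inverse)
  then have "?B \<subseteq> loc A x" unfolding inverted_def
    using L(2) by (intro alg_gen_least local_ring_subring[OF L(1)]) auto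
  moreover have "A \<subseteq> loc ?B x" using loc_props(2)[OF X(1) B(1) X(2)] B(2) by auto
  ultimately have "loc A x = x" using loc_eq[OF X(1) A(1) Ax B(1) X(2)] X(3) by simp
  then show "x \<in> {x \<in> spec A. f \<notin> max_ideal x}" using L(5) f by simp
next
  let ?B = "inverted A f"
  note B = inverted_ring[where A = A and f = f]
  fix x assume x: "x \<in> {x \<in> spec A. f \<notin> max_ideal x}"
  then have X: "local_ring x" "A \<subseteq> x" "loc A x = x" using specD[OF A(1)] by auto
  have "inverse f \<in> x" using x X(2) A(2) unitD(2) by blast
  then have Bx: "?B \<subseteq> x" unfolding inverted_def using X by (intro alg_gen_least local_ring_subring) auto
  note L = loc_props[OF X(1) B(1) Bx]
  have "x \<subseteq> loc ?B x"
  proof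
    fix u assume "u \<in> x"
    then have "u \<in> loc A x" using X(3) by simp
    then obtain a s where "a \<in> A" "s \<in> A" "s \<notin> max_ideal x" "u = a / s" by (rule locE)
    then show "u \<in> loc ?B x" using B(2) by (auto simp: loc_iff)
  qed
  then have "loc ?B x = x" using L(3) by auto
  then show "x \<in> spec ?B" using L(5) by simp
qed

text \<open>The valuative criterion as a property of a set of local rings.  It is inherited by subsets, and it is
  what the topology of the curve, of the Gorenstein locus and of the canonical model depends on.\<close>

definition separated :: "'a set set \<Rightarrow> bool" where
  "separated X \<longleftrightarrow> (\<forall>x\<in>X. local_ring x \<and> x \<subseteq> K) \<and>
     (\<forall>V. valuation_ring K V \<longrightarrow> (\<forall>x\<in>X. \<forall>y\<in>X. dominates V x \<and> dominates V y \<longrightarrow> x = y))"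

lemma separatedD: "separated X \<Longrightarrow> x \<in> X \<Longrightarrow> local_ring x" "separated X \<Longrightarrow> x \<in> X \<Longrightarrow> x \<subseteq> K"
  by (auto simp: separated_def)

lemma separated_C: "separated C"
  unfolding separated_def
proof (intro conjI ballI allI impI)
  show "x \<in> C \<Longrightarrow> local_ring x" "x \<in> C \<Longrightarrow> x \<subseteq> K" for x using point(1,4) by auto
  show "x = y" if "valuation_ring K V" "x \<in> C" "y \<in> C" "dominates V x \<and> dominates V y" for V x y
    using center_unique[OF that(1-3)] that(4) by blast
qed

lemma separated_subset: "separated X \<Longrightarrow> Y \<subseteq> X \<Longrightarrow> separated Y"
  unfolding separated_def by blast

lemma separated_dominates:
  assumes X: "separated X" and "x \<in> X" "y \<in> X" "z \<subseteq> K" "local_ring z" "dominates z x" "dominates z y"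
  shows "x = y"
proof -
  obtain V where V: "valuation_ring K V" "dominates V z"
    using dominating_valuation[OF K_subfield assms(5,4)] by blast
  have "dominates V x" "dominates V y" using dominates_trans[OF V(2)] assms(6,7) by auto
  then show ?thesis using X V(1) assms(2,3) by (auto simp: separated_def)
qed

text \<open>Intersections of affine open sets are covered by common basic open sets: \<open>f\<close> is a common denominator,
  outside the maximal ideal of \<open>x\<close>, of the generators of \<open>B\<close>.  Separatedness identifies the points.\<close>

lemma basic_open:
  assumes X: "separated X" and A: "finite_type k A" "spec A \<subseteq> X" and B: "finite_type k B" "spec B \<subseteq> X"
    and x: "x \<in> spec A" "x \<in> spec B"
  shows "\<exists>f\<in>A. f \<noteq> 0 \<and> f \<notin> max_ideal x \<and> spec (inverted A f) \<subseteq> spec A \<inter> spec B"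
proof -
  note As = finite_typeD(1)[OF A(1)] and Bs = finite_typeD(1)[OF B(1)]
  note xA = specD[OF As x(1)] and xB = specD[OF Bs x(2)]
  obtain T where T: "finite T" "B = alg_gen k T" using B(1) by (auto simp: finite_type_def)
  have TB: "T \<subseteq> x" using T xB(2) alg_gen_gens by auto
  have "\<exists>f\<in>A. f \<notin> max_ideal x \<and> (\<forall>t\<in>T. f * t \<in> A)"
    using T(1) TB
  proof (induction T)
    case empty
    then show ?case using subringD(1)[OF As] one_notin_max[OF local_ring_subring[OF xA(1)]] by blast
  next
    case (insert t T)
    then obtain f where f: "f \<in> A" "f \<notin> max_ideal x" "\<forall>t\<in>T. f * t \<in> A" by auto
    have "t \<in> loc A x" using insert.prems xA(3) by simp
    then obtain a s where as: "a \<in> A" "s \<in> A" "s \<notin> max_ideal x" "t = a / s" by (rule locE)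
    have "s \<noteq> 0" using unitD(1) as xA(2) by blast
    have "f * s \<notin> max_ideal x" using local_ring_prime[OF xA(1)] f as xA(2) by blast
    moreover have "f * s * t \<in> A" using f as \<open>s \<noteq> 0\<close> subringD(4)[OF As] by simp
    moreover have "f * s * t' \<in> A" if "t' \<in> T" for t'
      using f(3) that subringD(4)[OF As as(2), of "f * t'"] by (metis mult.assoc mult.commute)
    ultimately show ?case using subringD(4)[OF As f(1) as(2)] by blast
  qed
  then obtain f where f: "f \<in> A" "f \<notin> max_ideal x" "\<forall>t\<in>T. f * t \<in> A" by blast
  have f0: "f \<noteq> 0" using unitD(1) f xA(2) by blast
  note Af = inverted_ring[where A = A and f = f]
  have "T \<subseteq> inverted A f"
  proof
    fix t assume "t \<in> T"
    then have "f * t * inverse f \<in> inverted A f" using f(3) Af(2) by (intro subringD(4)[OF Af(1) _ Af(3)]) auto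
    moreover have "f * t * inverse f = t" using f0 by simp
    ultimately show "t \<in> inverted A f" by metis
  qed
  then have BA: "B \<subseteq> inverted A f"
    unfolding T(2) using Af(2) finite_typeD(2)[OF A(1)] by (intro alg_gen_least Af(1)) auto
  have "y \<in> spec B" if y: "y \<in> spec (inverted A f)" for y
  proof -
    have yX: "y \<in> X" using y spec_inverted[OF As f(1) f0] A(2) by auto
    note Y = specD[OF Af(1) y]
    have By: "B \<subseteq> y" using BA Y(2) by auto
    note L = loc_props[OF Y(1) Bs By]
    have "y = loc B y"
      using separated_dominates[OF X yX _ separatedD(2)[OF X yX] Y(1) dominates_refl L(4)] L(5) B(2) by blast
    then show ?thesis using L(5) by simp
  qed
  then show ?thesis using f f0 spec_inverted[OF As f(1) f0] by blast
qed

text \<open>The affine open sets thus form a basis of the topology that they generate.\<close>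

lemma open_iff:
  assumes X: "separated X"
  shows "openin (zariski k X) U \<longleftrightarrow> (\<forall>x\<in>U. \<exists>A. finite_type k A \<and> spec A \<subseteq> X \<and> spec A \<subseteq> U \<and> x \<in> spec A)"
proof
  assume "openin (zariski k X) U"
  then have "generate_topology_on (affine_opens k X) U"
    by (simp add: zariski_def openin_topology_generated_by_iff)
  then show "\<forall>x\<in>U. \<exists>A. finite_type k A \<and> spec A \<subseteq> X \<and> spec A \<subseteq> U \<and> x \<in> spec A"
  proof induction
    case (Int U V)
    show ?case
    proof
      fix x assume x: "x \<in> U \<inter> V"
      obtain A where A: "finite_type k A" "spec A \<subseteq> X" "spec A \<subseteq> U" "x \<in> spec A" using Int.IH(1) x by blast
      obtain B where B: "finite_type k B" "spec B \<subseteq> X" "spec B \<subseteq> V" "x \<in> spec B" using Int.IH(2) x by blast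
      obtain f where f: "f \<in> A" "f \<noteq> 0" "f \<notin> max_ideal x" "spec (inverted A f) \<subseteq> spec A \<inter> spec B"
        using basic_open[OF X A(1,2) B(1,2) A(4) B(4)] by blast
      have "x \<in> spec (inverted A f)" using spec_inverted[OF finite_typeD(1)[OF A(1)] f(1,2)] A(4) f(3) by blast
      then show "\<exists>A. finite_type k A \<and> spec A \<subseteq> X \<and> spec A \<subseteq> U \<inter> V \<and> x \<in> spec A"
        using f A B finite_type_inverted[OF A(1)] by (intro exI[of _ "inverted A f"]) auto
    qed
  next
    case (UN \<K>)
    then show ?case by (meson Union_upper UnionE order_trans)
  qed (auto simp: affine_opens_def)
next
  assume *: "\<forall>x\<in>U. \<exists>A. finite_type k A \<and> spec A \<subseteq> X \<and> spec A \<subseteq> U \<and> x \<in> spec A"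
  have "openin (zariski k X) (\<Union>{spec A |A. finite_type k A \<and> spec A \<subseteq> X \<and> spec A \<subseteq> U})"
    unfolding zariski_def openin_topology_generated_by_iff
    by (rule generate_topology_on.UN, rule generate_topology_on.Basis) (auto simp: affine_opens_def)
  moreover have "\<Union>{spec A |A. finite_type k A \<and> spec A \<subseteq> X \<and> spec A \<subseteq> U} = U"
  proof (intro equalityI subsetI)
    fix x assume "x \<in> U"
    then obtain A where "finite_type k A" "spec A \<subseteq> X" "spec A \<subseteq> U" "x \<in> spec A" using * by blast
    then show "x \<in> \<Union>{spec A |A. finite_type k A \<and> spec A \<subseteq> X \<and> spec A \<subseteq> U}"
      by (intro UnionI[of "spec A"]) auto
  qed auto
  ultimately show "openin (zariski k X) U" by simp
qed

lemma affine_open: "affine A \<Longrightarrow> openin (zariski k C) (spec A)"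
  unfolding open_iff[OF separated_C] affine_def by blast

lemma affine_inverted:
  assumes "affine A" "f \<in> A" "f \<noteq> 0"
  shows "affine (inverted A f)"
  using assms finite_type_inverted spec_inverted[OF affineD(2)[OF assms(1)] assms(2,3)] by (auto simp: affine_def)

lemma affine_nonempty_open: "affine A \<Longrightarrow> spec A \<in> nonempty_opens k C"
  using affine_open affine_frac(3) by (auto simp: nonempty_opens_def)

lemma nonempty_openD:
  assumes "U \<in> nonempty_opens k C"
  shows "x \<in> U \<Longrightarrow> \<exists>A. affine A \<and> spec A \<subseteq> U \<and> x \<in> spec A" "K \<in> U" "U \<subseteq> C"
proof -
  show 1: "x \<in> U \<Longrightarrow> \<exists>A. affine A \<and> spec A \<subseteq> U \<and> x \<in> spec A" for x
    using assms open_iff[OF separated_C, of U] unfolding nonempty_opens_def affine_def by blast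
  obtain x where "x \<in> U" using assms by (auto simp: nonempty_opens_def)
  then obtain A where "affine A" "spec A \<subseteq> U" using 1 by blast
  then show "K \<in> U" using affine_frac(3) by blast
  show "U \<subseteq> C" using 1 affineD(4) by blast
qed

lemma nonempty_open_Int:
  assumes "U \<in> nonempty_opens k C" "V \<in> nonempty_opens k C"
  shows "U \<inter> V \<in> nonempty_opens k C"
  using assms nonempty_openD(2)[OF assms(1)] nonempty_openD(2)[OF assms(2)]
  unfolding nonempty_opens_def by (auto intro: openin_Int)

lemma C_nonempty_open: "C \<in> nonempty_opens k C"
  unfolding nonempty_opens_def using C_nonempty open_iff[OF separated_C, of C] chart_exists
  by (auto simp: affine_def) (metis affine_def chart_exists)

text \<open>The place \<open>y = c\<close> of \<open>k(y)\<close>, for almost all \<open>c\<close>, is below a place of the function field with center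
  on the given chart.\<close>

lemma affine_closed_point:
  assumes A: "affine A"
  obtains x where "x \<in> spec A" "x \<noteq> K"
proof -
  obtain y where y: "y \<in> K" "y \<notin> k" "K \<subseteq> closure_in K (frac (alg_gen k {y}))"
    by (rule transcendence_degree_one)
  obtain S where S: "finite S" "A = alg_gen k S" using affineD(1)[OF A] by (auto simp: finite_type_def)
  have SA: "S \<subseteq> K" using S(2) alg_gen_gens affine_frac(2)[OF A] by blast
  obtain V where V: "valuation_ring K V" "V \<noteq> K" "k \<subseteq> V" "S \<subseteq> V"
    using nontrivial_valuation[OF k_subfield k_K order_refl y(1) _ S(1)] y SA
      closure_alg_closed[OF K_subfield k_closed k_K] by blast
  have "A \<subseteq> V" unfolding S(2) using V by (intro alg_gen_least valuationD(1)[OF V(1)]) auto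
  note c = center_chart[OF V(1) A this]
  have "loc A V \<noteq> K" using dominatesD(1)[OF c(3)] V(2) valuationD(2)[OF V(1)] by blast
  then show ?thesis using that c by blast
qed

end

section \<open>Coherent fractional sheaves\<close>

lemma carrier_ring_of [simp]: "carrier (ring_of A) = A" "monoid.mult (ring_of A) = (*)" "monoid.one (ring_of A) = 1"
  "ring.zero (ring_of A) = 0" "ring.add (ring_of A) = (+)"
  by (simp_all add: ring_of_def)

lemma sect_fractional [simp]:
  "carrier (sect (fractional_sheaf G) U) = sections G U"
  "ring.add (sect (fractional_sheaf G) U) = (+)" "ring.zero (sect (fractional_sheaf G) U) = 0"
  "module.smult (sect (fractional_sheaf G) U) = (*)" "restr (fractional_sheaf G) U V s = s"
  by (simp_all add: fractional_sheaf_def)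

lemma ring_of_cring:
  assumes "is_subring A"
  shows "cring (ring_of A)"
proof (rule cringI)
  show "abelian_group (ring_of A)"
    using subringD[OF assms] by (intro abelian_groupI) (auto intro: bexI[of _ "- _"])
  show "comm_monoid (ring_of A)"
    using subringD[OF assms] by (intro comm_monoidI) auto
qed (auto simp: algebra_simps)

lemma fractional_module:
  assumes "is_subring A" "is_submod A (sections G U)"
  shows "Module.module (ring_of A) (sect (fractional_sheaf G) U)"
proof (rule moduleI)
  show "cring (ring_of A)" by (rule ring_of_cring[OF assms(1)])
  show "abelian_group (sect (fractional_sheaf G) U)"
    using is_submodD[OF assms(2)] is_submod_diff(1)[OF assms]
    by (intro abelian_groupI) (auto intro: bexI[of _ "- _"])
qed (use is_submodD[OF assms(2)] in \<open>auto simp: algebra_simps\<close>)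

lemma fractional_minus:
  assumes "is_subring A" "is_submod A (sections G U)" "x \<in> sections G U" "y \<in> sections G U"
  shows "\<ominus>\<^bsub>sect (fractional_sheaf G) U\<^esub> y = - y"
    "x \<ominus>\<^bsub>sect (fractional_sheaf G) U\<^esub> y = x - y"
proof -
  interpret m: Module.module "ring_of A" "sect (fractional_sheaf G) U"
    by (rule fractional_module[OF assms(1,2)])
  show "\<ominus>\<^bsub>sect (fractional_sheaf G) U\<^esub> y = - y"
    using assms is_submod_diff(1)[OF assms(1,2)] by (intro m.minus_equality) auto
  then show "x \<ominus>\<^bsub>sect (fractional_sheaf G) U\<^esub> y = x - y"
    by (simp add: a_minus_def)
qed

lemma sectionsD: "s \<in> sections G U \<Longrightarrow> x \<in> U \<Longrightarrow> s \<in> G x"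
  by (auto simp: sections_def)

lemma sectionsI: "(\<And>x. x \<in> U \<Longrightarrow> s \<in> G x) \<Longrightarrow> s \<in> sections G U"
  by (auto simp: sections_def)

lemma sections_antimono: "V \<subseteq> U \<Longrightarrow> sections G U \<subseteq> sections G V"
  by (auto simp: sections_def)

lemma sections_submod:
  assumes "\<And>x. x \<in> U \<Longrightarrow> is_submod A (G x)"
  shows "is_submod A (sections G U)"
  unfolding is_submod_def
  by (intro conjI ballI sectionsI) (auto intro: is_submodD[OF assms] sectionsD)

context curve
begin

lemma opens_subring: "U \<in> nonempty_opens k C \<Longrightarrow> is_subring (\<Inter>U)"
  using nonempty_openD(3) point(2) by (intro subring_Inter) blast

lemma opens_k: "U \<in> nonempty_opens k C \<Longrightarrow> k \<subseteq> \<Inter>U"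
  using nonempty_openD(3) point(3) by blast

text \<open>A proper ideal is contained in the maximal ideal of some point of the spectrum, here the center of a
  valuation ring.\<close>

lemma local_global:
  assumes A: "is_subring A" "A \<subseteq> K" and I: "is_submod A I" "I \<subseteq> A"
    and s: "\<And>x. x \<in> spec A \<Longrightarrow> \<exists>s\<in>I. s \<notin> max_ideal x"
  shows "1 \<in> I"
proof (rule ccontr)
  assume "1 \<notin> I"
  then have "1 \<notin> submod_gen A I" using submod_gen_self[OF I(1)] by simp
  then obtain V where V: "valuation_ring K V" "A \<subseteq> V" "I \<subseteq> max_ideal V"
    using chevalley[OF K_subfield A I(2)] by metis
  note L = loc_props[OF val_local[OF V(1)] A(1) V(2)]
  obtain s where "s \<in> I" "s \<notin> max_ideal (loc A V)" using s[OF L(5)] by blast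
  then show False using V(3) I(2) L(2) dominates_max_iff[OF L(4), of s] by blast
qed

lemma sections_structure:
  assumes A: "affine A"
  shows "sections (\<lambda>x. x) (spec A) = A"
proof
  note Ar = subringD[OF affineD(2)[OF A]]
  show "A \<subseteq> sections (\<lambda>x. x) (spec A)" using spec_point(2)[OF A] by (auto intro: sectionsI)
  show "sections (\<lambda>x. x) (spec A) \<subseteq> A"
  proof
    fix u assume u: "u \<in> sections (\<lambda>x. x) (spec A)"
    define I where "I = {a \<in> A. a * u \<in> A}"
    have I: "is_submod A I" "I \<subseteq> A"
      using Ar unfolding is_submod_def I_def by (auto simp: distrib_right mult.assoc)
    have "1 \<in> I"
    proof (rule local_global[OF affineD(2)[OF A] affine_frac(2)[OF A] I])
      fix x assume x: "x \<in> spec A"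
      obtain a s where as: "a \<in> A" "s \<in> A" "s \<notin> max_ideal x" "u = a / s"
        using spec_point(4)[OF A x] sectionsD[OF u x] by blast
      have "s \<noteq> 0" using as unitD(1) spec_point(2)[OF A x] by blast
      then show "\<exists>s\<in>I. s \<notin> max_ideal x" using as by (intro bexI[of _ s]) (auto simp: I_def)
    qed
    then show "u \<in> A" by (simp add: I_def)
  qed
qed

text \<open>Coherence of a subsheaf of the constant sheaf \<open>K\<close>, in terms of its stalks: sections over an affine
  open set form a finitely generated module, and the stalks are its localizations.  In this form
  a sheaf can be changed at a single point.\<close>

definition coh :: "('a set \<Rightarrow> 'a set) \<Rightarrow> bool" where
  "coh G \<longleftrightarrow> (\<forall>x\<in>C. is_submod x (G x) \<and> G x \<subseteq> K) \<and>
     (\<forall>A. affine A \<longrightarrow> fin_gen A (sections G (spec A)) \<and>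
        (\<forall>x\<in>spec A. \<forall>e\<in>G x. \<exists>s\<in>A. s \<notin> max_ideal x \<and> s * e \<in> sections G (spec A)))"

lemma cohD:
  assumes "coh G"
  shows "x \<in> C \<Longrightarrow> is_submod x (G x)" "x \<in> C \<Longrightarrow> G x \<subseteq> K" "affine A \<Longrightarrow> fin_gen A (sections G (spec A))"
    "affine A \<Longrightarrow> x \<in> spec A \<Longrightarrow> e \<in> G x \<Longrightarrow> \<exists>s\<in>A. s \<notin> max_ideal x \<and> s * e \<in> sections G (spec A)"
  using assms unfolding coh_def by blast+

lemma coh_sections_submod:
  assumes "coh G" "U \<subseteq> C"
  shows "is_submod (\<Inter>U) (sections G U)"
proof -
  have "is_submod (\<Inter>U) (G x)" if "x \<in> U" for x
    using is_submod_mono[OF cohD(1)[OF assms(1)], of x "\<Inter>U"] assms(2) that by blast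
  then show ?thesis by (rule sections_submod)
qed

lemma affine_Inter:
  assumes "affine A"
  shows "\<Inter>(spec A) = A"
  using sections_structure[OF assms] by (simp add: sections_def)

lemma coh_affine_submod:
  assumes "coh G" "affine A"
  shows "is_submod A (sections G (spec A))"
  using coh_sections_submod[OF assms(1) affineD(4)[OF assms(2)]] affine_Inter[OF assms(2)] by simp

lemma coh_localize:
  assumes G: "coh G" and A: "affine A" and f: "f \<in> A" "f \<noteq> 0"
    and t: "t \<in> sections G (spec (inverted A f))"
  shows "\<exists>n. f ^ n * t \<in> sections G (spec A)"
proof -
  let ?B = "inverted A f" and ?M = "sections G (spec A)"
  note B = affine_inverted[OF A f] and M = is_submodD[OF coh_affine_submod[OF G A]]
  note Ar = subringD[OF affineD(2)[OF A]]
  define I where "I = {b \<in> ?B. \<exists>n. f ^ n * (b * t) \<in> ?M}"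
  have up: "f ^ (n + m) * y \<in> ?M" if "f ^ n * y \<in> ?M" for n m y
  proof -
    have "f ^ m * (f ^ n * y) \<in> ?M" using M(3) Ar(7)[OF f(1)] that by blast
    then show ?thesis by (simp add: power_add ac_simps)
  qed
  have "is_submod ?B I"
    unfolding is_submod_def
  proof (intro conjI ballI)
    show "0 \<in> I" using M(1) subringD(2)[OF inverted_ring(1)] by (auto simp: I_def)
    fix a b assume "a \<in> I" "b \<in> I"
    then obtain n m where *: "a \<in> ?B" "b \<in> ?B" "f ^ n * (a * t) \<in> ?M" "f ^ m * (b * t) \<in> ?M"
      by (auto simp: I_def)
    have "f ^ (n + m) * (a * t) + f ^ (m + n) * (b * t) \<in> ?M" using up * by (intro M(2)) auto
    then have "f ^ (n + m) * ((a + b) * t) \<in> ?M" by (simp add: algebra_simps)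
    then show "a + b \<in> I" using * subringD(6)[OF inverted_ring(1)] by (auto simp: I_def)
  next
    fix a b assume a: "a \<in> ?B" and "b \<in> I"
    then obtain n where *: "b \<in> ?B" "f ^ n * (b * t) \<in> ?M" by (auto simp: I_def)
    obtain c m where c: "c \<in> A" "a = c / f ^ m"
      using a inverted_eq[OF affineD(2)[OF A] f] by blast
    have "c * (f ^ n * (b * t)) \<in> ?M" using M(3) c(1) *(2) by blast
    moreover have "f ^ (n + m) * ((a * b) * t) = c * (f ^ n * (b * t))" using c f(2) by (simp add: power_add)
    ultimately have "f ^ (n + m) * ((a * b) * t) \<in> ?M" by metis
    then show "a * b \<in> I" using a * subringD(4)[OF inverted_ring(1)] by (auto simp: I_def)
  qed
  moreover have "I \<subseteq> ?B" by (auto simp: I_def)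
  moreover have "\<exists>s\<in>I. s \<notin> max_ideal x" if x: "x \<in> spec ?B" for x
  proof -
    have xA: "x \<in> spec A" using x spec_inverted[OF affineD(2)[OF A] f] by blast
    obtain s where s: "s \<in> A" "s \<notin> max_ideal x" "s * t \<in> ?M"
      using cohD(4)[OF G A xA sectionsD[OF t x]] by blast
    then show ?thesis using inverted_ring(2)[of A f] by (intro bexI[of _ s]) (auto simp: I_def intro!: exI[of _ 0])
  qed
  ultimately have "1 \<in> I" using local_global[OF inverted_ring(1) affine_frac(2)[OF B]] by blast
  then show ?thesis by (auto simp: I_def)
qed

lemma coh_sheaf:
  assumes G: "coh G"
  shows "sheaf_of_modules k C (fractional_sheaf G)"
proof -
  have mod: "Module.module (ring_of (\<Inter>U)) (sect (fractional_sheaf G) U)" if U: "U \<in> nonempty_opens k C" for U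
    by (rule fractional_module[OF opens_subring[OF U] coh_sections_submod[OF G nonempty_openD(3)[OF U]]])
  have res: "restrict (\<lambda>s. s) (sections G U) \<in>
      linear_maps (\<Inter>U) (sect (fractional_sheaf G) U) (sect (fractional_sheaf G) V)"
    if U: "U \<in> nonempty_opens k C" and V: "V \<subseteq> U" for U V
    using sections_antimono[OF V, of G]
      is_submodD[OF coh_sections_submod[OF G nonempty_openD(3)[OF U]]]
    by (auto simp: linear_maps_def)
  have glue: "\<exists>!s. s \<in> sections G U \<and> (\<forall>V\<in>\<V>. s = f V)"
    if U: "U \<in> nonempty_opens k C" and V: "\<V> \<subseteq> nonempty_opens k C" "\<Union>\<V> = U"
    and f: "\<forall>V\<in>\<V>. f V \<in> sections G V" "\<forall>V\<in>\<V>. \<forall>W\<in>\<V>. f V = f W" for U \<V> f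
  proof -
    obtain V0 where V0: "V0 \<in> \<V>" using nonempty_openD(2)[OF U] V by blast
    have "f V0 \<in> sections G U"
    proof (rule sectionsI)
      fix x assume "x \<in> U"
      then obtain V where "V \<in> \<V>" "x \<in> V" using V by blast
      moreover have "f V0 = f V" using f(2) V0 \<open>V \<in> \<V>\<close> by blast
      ultimately show "f V0 \<in> G x" using f(1) sectionsD by metis
    qed
    moreover have "\<forall>V\<in>\<V>. f V0 = f V" using f(2) V0 by blast
    ultimately have "f V0 \<in> sections G U \<and> (\<forall>V\<in>\<V>. f V0 = f V)" by (rule conjI)
    moreover have "s = f V0" if "s \<in> sections G U \<and> (\<forall>V\<in>\<V>. s = f V)" for s
      using that V0 by blast
    ultimately show ?thesis by (rule ex1I)
  qed
  show ?thesis
    unfolding sheaf_of_modules_def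
  proof (intro conjI, goal_cases)
    case 1
    show ?case by (intro ballI mod)
  next
    case 2
    show ?case unfolding sect_fractional by (intro ballI impI res)
  next
    case 5
    show ?case unfolding sect_fractional by (intro ballI allI impI, elim conjE) (rule glue)
  qed auto
qed

lemma coh_coherent:
  assumes G: "coh G"
  shows "coherent k C (fractional_sheaf G)"
  unfolding coherent_def
proof (intro conjI allI impI ballI)
  show "sheaf_of_modules k C (fractional_sheaf G)" by (rule coh_sheaf[OF G])
next
  fix A assume "finite_type k A \<and> spec A \<subseteq> C"
  then have A: "affine A" by (simp add: affine_def)
  obtain S where S: "finite S" "sections G (spec A) = submod_gen A S" using cohD(3)[OF G A] by (auto simp: fin_gen_def)
  show "\<exists>S. finite S \<and> S \<subseteq> carrier (sect (fractional_sheaf G) (spec A)) \<and>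
      (\<forall>N. submodule N (ring_of A) (sect (fractional_sheaf G) (spec A)) \<and> S \<subseteq> N \<longrightarrow>
        N = carrier (sect (fractional_sheaf G) (spec A)))"
  proof (intro exI[of _ S] conjI allI impI S(1))
    show "S \<subseteq> carrier (sect (fractional_sheaf G) (spec A))" using S(2) submod_gen_gens[of S A] by simp
    fix N assume N: "submodule N (ring_of A) (sect (fractional_sheaf G) (spec A)) \<and> S \<subseteq> N"
    interpret m: Module.module "ring_of A" "sect (fractional_sheaf G) (spec A)"
      by (rule fractional_module[OF affineD(2)[OF A] coh_affine_submod[OF G A]])
    have "is_submod A N"
      unfolding is_submod_def
    proof (intro conjI ballI)
      obtain u where "u \<in> N" using m.submoduleE(2)[OF conjunct1[OF N]] by blast
      then show "0 \<in> N" using m.submoduleE(4)[OF conjunct1[OF N], of 0 u] subringD(2)[OF affineD(2)[OF A]] by simp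
    qed (use m.submoduleE(4,5)[OF conjunct1[OF N]] in auto)
    then show "N = carrier (sect (fractional_sheaf G) (spec A))"
      using submod_gen_least[of A N S] N S(2) m.submoduleE(1)[OF conjunct1[OF N]] by auto
  qed
next
  fix A f assume "finite_type k A \<and> spec A \<subseteq> C" and f: "f \<in> A - {0}"
  then have A: "affine A" by (simp add: affine_def)
  have *: "{a / f ^ n |a n. a \<in> A} = inverted A f" using inverted_eq[OF affineD(2)[OF A]] f by auto
  have "\<exists>n. \<exists>s\<in>sections G (spec A). s = f ^ n * t" if "t \<in> sections G (spec (inverted A f))" for t
    using coh_localize[OF G A _ _ that] f by blast
  then show "let U = spec A; D = spec {a / f ^ n |a n. a \<in> A} in
      (\<forall>s\<in>carrier (sect (fractional_sheaf G) U). restr (fractional_sheaf G) U D s = \<zero>\<^bsub>sect (fractional_sheaf G) D\<^esub> \<longrightarrow>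
        (\<exists>n. f ^ n \<odot>\<^bsub>sect (fractional_sheaf G) U\<^esub> s = \<zero>\<^bsub>sect (fractional_sheaf G) U\<^esub>)) \<and>
      (\<forall>t\<in>carrier (sect (fractional_sheaf G) D). \<exists>n. \<exists>s\<in>carrier (sect (fractional_sheaf G) U).
        restr (fractional_sheaf G) U D s = f ^ n \<odot>\<^bsub>sect (fractional_sheaf G) D\<^esub> t)"
    unfolding Let_def * sect_fractional by auto
qed

lemma neighbourhood:
  assumes U: "U \<in> nonempty_opens k C" and x: "x \<in> U" and a: "a \<in> x"
  shows "\<exists>B. affine B \<and> spec B \<subseteq> U \<and> x \<in> spec B \<and> a \<in> B"
proof -
  obtain A where A: "affine A" "spec A \<subseteq> U" "x \<in> spec A" using nonempty_openD(1)[OF U x] by blast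
  obtain b s where bs: "b \<in> A" "s \<in> A" "s \<notin> max_ideal x" "a = b / s" using spec_point(4)[OF A(1,3) a] by blast
  have s0: "s \<noteq> 0" using bs unitD(1) spec_point(2)[OF A(1,3)] by blast
  have "a \<in> inverted A s" using bs inverted_ring[where A = A and f = s] subringD(4)[OF inverted_ring(1)[of A s]]
    by (auto simp: divide_inverse)
  then show ?thesis
    using affine_inverted[OF A(1) bs(2) s0] spec_inverted[OF affineD(2)[OF A(1)] bs(2) s0] A bs(3)
    by (intro exI[of _ "inverted A s"]) auto
qed

lemma coherent_module:
  "coherent k C F \<Longrightarrow> U \<in> nonempty_opens k C \<Longrightarrow> Module.module (ring_of (\<Inter>U)) (sect F U)"
  unfolding coherent_def sheaf_of_modules_def by (drule conjunct1, drule conjunct1, erule (1) bspec)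

text \<open>Conversely, a stalk is the union of the sections over affine neighbourhoods, each of which contains
  a basic open subset of a given affine neighbourhood.\<close>

lemma coherent_fractional_coh:
  assumes "coherent_fractional k C \<omega>"
  shows "coh \<omega>"
proof -
  have co: "coherent k C (fractional_sheaf \<omega>)" and
    st: "\<And>x. x \<in> C \<Longrightarrow> \<omega> x \<subseteq> K \<and> \<omega> x = \<Union>{sections \<omega> U |U. U \<in> nonempty_opens k C \<and> x \<in> U}"
    using assms unfolding coherent_fractional_def by blast+
  have sm: "Module.module (ring_of (\<Inter>U)) (sect (fractional_sheaf \<omega>) U)" if "U \<in> nonempty_opens k C" for U
    by (rule coherent_module[OF co that])
  have sub: "is_submod (\<Inter>U) (sections \<omega> U)" if U: "U \<in> nonempty_opens k C" for U
  proof -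
    interpret m: Module.module "ring_of (\<Inter>U)" "sect (fractional_sheaf \<omega>) U" by (rule sm[OF U])
    show ?thesis
      unfolding is_submod_def using m.zero_closed m.a_closed m.smult_closed by auto
  qed
  have stE: "\<exists>B. affine B \<and> spec B \<subseteq> U \<and> x \<in> spec B \<and> a \<in> B \<and> e \<in> sections \<omega> (spec B)"
    if U: "U \<in> nonempty_opens k C" "x \<in> U" and a: "a \<in> x" and e: "e \<in> \<omega> x" for U x a e
  proof -
    have xC: "x \<in> C" using U nonempty_openD(3) by blast
    then obtain V where V: "V \<in> nonempty_opens k C" "x \<in> V" "e \<in> sections \<omega> V" using e st[OF xC] by blast
    obtain B where B: "affine B" "spec B \<subseteq> U \<inter> V" "x \<in> spec B" "a \<in> B"
      using neighbourhood[OF nonempty_open_Int[OF U(1) V(1)] _ a] U(2) V(2) by blast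
    then show ?thesis using sections_antimono[of "spec B" V \<omega>] V(3) by blast
  qed
  have stI: "sections \<omega> (spec B) \<subseteq> \<omega> x" if "x \<in> spec B" for x B
    using that by (auto simp: sections_def)
  have affsub: "is_submod A (sections \<omega> (spec A))" if "affine A" for A
    using sub[OF affine_nonempty_open[OF that]] affine_Inter[OF that] by simp
  show ?thesis
    unfolding coh_def
  proof (intro conjI ballI allI impI)
    fix x assume x: "x \<in> C"
    show "\<omega> x \<subseteq> K" using st[OF x] by blast
    show "is_submod x (\<omega> x)"
      unfolding is_submod_def
    proof (intro conjI ballI)
      obtain B where B: "affine B" "x \<in> spec B" using chart_exists[OF x] by blast
      show "0 \<in> \<omega> x" using is_submodD(1)[OF affsub[OF B(1)]] stI[OF B(2)] by blast
      fix e e' assume e: "e \<in> \<omega> x" "e' \<in> \<omega> x"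
      obtain U where U: "affine U" "x \<in> spec U" "e \<in> sections \<omega> (spec U)"
        using stE[OF C_nonempty_open x point_ring(1)[OF x] e(1)] by blast
      obtain V where V: "affine V" "spec V \<subseteq> spec U" "x \<in> spec V" "e' \<in> sections \<omega> (spec V)"
        using stE[OF affine_nonempty_open[OF U(1)] U(2) point_ring(1)[OF x] e(2)] by blast
      then show "e + e' \<in> \<omega> x"
        using is_submodD(2)[OF affsub[OF V(1)]] sections_antimono[OF V(2), of \<omega>] U(3) stI[OF V(3)] by blast
    next
      fix a e assume a: "a \<in> x" and e: "e \<in> \<omega> x"
      obtain V where V: "affine V" "x \<in> spec V" "a \<in> V" "e \<in> sections \<omega> (spec V)"
        using stE[OF C_nonempty_open x a e] by blast
      then show "a * e \<in> \<omega> x" using is_submodD(3)[OF affsub[OF V(1)]] stI[OF V(2)] by blast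
    qed
  next
    fix A assume A: "affine A"
    obtain S where S: "finite S" "S \<subseteq> sections \<omega> (spec A)"
      "\<And>N. submodule N (ring_of A) (sect (fractional_sheaf \<omega>) (spec A)) \<Longrightarrow> S \<subseteq> N \<Longrightarrow> N = sections \<omega> (spec A)"
    proof -
      have "\<exists>S. finite S \<and> S \<subseteq> carrier (sect (fractional_sheaf \<omega>) (spec A)) \<and>
          (\<forall>N. submodule N (ring_of A) (sect (fractional_sheaf \<omega>) (spec A)) \<and> S \<subseteq> N \<longrightarrow>
            N = carrier (sect (fractional_sheaf \<omega>) (spec A)))"
        by (rule conjunct1[OF mp[OF spec[OF conjunct2[OF co[unfolded coherent_def]]]]])
          (use A in \<open>simp add: affine_def\<close>)
      then show ?thesis using that unfolding sect_fractional by metis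
    qed
    interpret m: Module.module "ring_of A" "sect (fractional_sheaf \<omega>) (spec A)"
      using sm[OF affine_nonempty_open[OF A]] affine_Inter[OF A] by simp
    have N: "submod_gen A S \<subseteq> sections \<omega> (spec A)" by (rule submod_gen_least[OF affsub[OF A] S(2)])
    have "submodule (submod_gen A S) (ring_of A) (sect (fractional_sheaf \<omega>) (spec A))"
    proof (rule m.submoduleI)
      fix a assume a: "a \<in> submod_gen A S"
      have "\<ominus>\<^bsub>sect (fractional_sheaf \<omega>) (spec A)\<^esub> a = - a"
        using fractional_minus(1)[OF affineD(2)[OF A] affsub[OF A]] a N by blast
      then show "\<ominus>\<^bsub>sect (fractional_sheaf \<omega>) (spec A)\<^esub> a \<in> submod_gen A S"
        using is_submod_diff(1)[OF affineD(2)[OF A] submod_gen_submod a] by simp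
    qed (use N is_submodD[OF submod_gen_submod[of A S]] in auto)
    then have "submod_gen A S = sections \<omega> (spec A)" using S(3) submod_gen_gens by blast
    then show "fin_gen A (sections \<omega> (spec A))" using S(1) unfolding fin_gen_def by metis
  next
    fix A x e assume A: "affine A" and x: "x \<in> spec A" and e: "e \<in> \<omega> x"
    have xC: "x \<in> C" using spec_point(1)[OF A x] .
    obtain B where B: "affine B" "x \<in> spec B" "e \<in> sections \<omega> (spec B)"
      using stE[OF C_nonempty_open xC point_ring(1)[OF xC] e] by blast
    obtain f where f: "f \<in> A" "f \<noteq> 0" "f \<notin> max_ideal x" "spec (inverted A f) \<subseteq> spec A \<inter> spec B"
      using basic_open[OF separated_C affineD(1,4)[OF A] affineD(1,4)[OF B(1)] x B(2)] by blast
    have "e \<in> sections \<omega> (spec (inverted A f))" using B(3) f(4) by (auto simp: sections_def)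
    moreover have "\<forall>t\<in>sections \<omega> (spec (inverted A f)). \<exists>n. \<exists>s\<in>sections \<omega> (spec A). s = f ^ n * t"
    proof -
      have "f \<in> A - {0}" using f by auto
      note bspec[OF conjunct2[OF mp[OF spec[OF conjunct2[OF co[unfolded coherent_def]], of A]]] this]
      then show ?thesis
        using A unfolding Let_def sect_fractional affine_def inverted_eq[OF affineD(2)[OF A] f(1,2)] by simp
    qed
    ultimately obtain n where "f ^ n * e \<in> sections \<omega> (spec A)" by blast
    moreover have "f ^ n \<notin> max_ideal x"
      using local_ring_power_prime[OF point(1)[OF xC]] f(1,3) spec_point(2)[OF A x] by blast
    moreover have "f ^ n \<in> A" using subringD(7)[OF affineD(2)[OF A] f(1)] .
    ultimately show "\<exists>s\<in>A. s \<notin> max_ideal x \<and> s * e \<in> sections \<omega> (spec A)" by blast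
  qed
qed

subsection \<open>Changing a coherent sheaf at one point\<close>

lemma separate_points:
  assumes A: "affine A" and x: "x \<in> spec A" and Q: "Q \<in> spec A" "Q \<noteq> K" and ne: "x \<noteq> Q"
  shows "\<exists>a\<in>A. a \<in> max_ideal Q \<and> a \<notin> max_ideal x"
proof (rule ccontr)
  assume n: "\<not> ?thesis"
  have "x \<subseteq> Q"
  proof
    fix u assume "u \<in> x"
    then obtain a s where "a \<in> A" "s \<in> A" "s \<notin> max_ideal x" "u = a / s" using spec_point(4)[OF A x] by blast
    then have "u \<in> loc A Q" using n by (auto simp: loc_iff)
    then show "u \<in> Q" using spec_point(3)[OF A Q(1)] by simp
  qed
  then show False using closed_point_subset[OF spec_point(1)[OF A x] spec_point(1)[OF A Q(1)] Q(2)] ne by blast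
qed

text \<open>Some \<open>s e\<close> is a section, and \<open>s\<close> is congruent to a nonzero constant.\<close>

lemma approximate_section:
  assumes G: "coh G" and A: "affine A" and Q: "Q \<in> spec A" "Q \<noteq> K" and e: "e \<in> G Q"
    and N: "is_submod Q N" "\<And>a u. a \<in> max_ideal Q \<Longrightarrow> u \<in> G Q \<Longrightarrow> a * u \<in> N"
  shows "\<exists>b\<in>sections G (spec A). b - e \<in> N"
proof -
  have QC: "Q \<in> C" using spec_point(1)[OF A Q(1)] .
  obtain s where s: "s \<in> A" "s \<notin> max_ideal Q" "s * e \<in> sections G (spec A)"
    using cohD(4)[OF G A Q(1) e] by blast
  have sQ: "s \<in> Q" using s spec_point(2)[OF A Q(1)] by blast
  obtain c where c: "c \<in> k" "s - c \<in> max_ideal Q" using residue_field[OF QC Q(2) sQ] by blast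
  have c0: "c \<noteq> 0" using c s by auto
  have ci: "inverse c \<in> k" using subfield_inverse[OF k_subfield c(1)] .
  have "inverse c * (s * e) \<in> sections G (spec A)"
    using is_submodD(3)[OF coh_affine_submod[OF G A] _ s(3)] ci affineD(3)[OF A] by blast
  moreover have "inverse c * (s * e) - e = inverse c * ((s - c) * e)" using c0 by (simp add: field_simps)
  moreover have "inverse c * ((s - c) * e) \<in> N"
    using is_submodD(3)[OF N(1)] ci point(3)[OF QC] N(2)[OF c(2) e] by blast
  ultimately show ?thesis by metis
qed

text \<open>On a chart, the sections whose value in the stalk at \<open>Q\<close> lies in \<open>N\<close> have colength at most one in all
  sections, so they are finitely generated.\<close>

lemma coh_shrink:
  assumes G: "coh G" and Q: "Q \<in> C" "Q \<noteq> K"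
    and N: "is_submod Q N" "N \<subseteq> G Q" "\<And>a u. a \<in> max_ideal Q \<Longrightarrow> u \<in> G Q \<Longrightarrow> a * u \<in> N"
    and e: "e \<in> G Q" "\<And>u. u \<in> G Q \<Longrightarrow> \<exists>c\<in>k. u - c * e \<in> N"
  shows "coh (G(Q := N))"
  unfolding coh_def
proof (intro conjI ballI allI impI)
  let ?F = "G(Q := N)"
  fix x assume "x \<in> C"
  then show "is_submod x (?F x)" "?F x \<subseteq> K" using cohD(1,2)[OF G] N by auto
next
  let ?F = "G(Q := N)"
  have sec: "sections ?F (spec A) = (if Q \<in> spec A then sections G (spec A) \<inter> N else sections G (spec A))" for A
    using N(2) unfolding sections_def by auto
  fix A assume A: "affine A"
  show "fin_gen A (sections ?F (spec A))"
  proof (cases "Q \<in> spec A")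
    case False
    then show ?thesis using cohD(3)[OF G A] sec by simp
  next
    case True
    obtain b where b: "b \<in> sections G (spec A)" "b - e \<in> N"
      using approximate_section[OF G A True Q(2) e(1) N(1,3)] by blast
    obtain T where T: "finite T" "A = alg_gen k T" using affineD(1)[OF A] by (auto simp: finite_type_def)
    have NA: "is_submod A N" using is_submod_mono[OF N(1) spec_point(2)[OF A True]] .
    note M = coh_affine_submod[OF G A]
    have "fin_gen A (sections G (spec A) \<inter> N)"
    proof (rule fin_gen_colength_one[OF k_subfield T cohD(3)[OF G A] is_submod_Int[OF M NA] _ b(1)])
      fix x assume x: "x \<in> sections G (spec A)"
      then obtain c where c: "c \<in> k" "x - c * e \<in> N" using e(2) sectionsD[OF x True] by blast
      have cA: "c \<in> A" using c affineD(3)[OF A] by blast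
      have eq: "x - c * b = (x - c * e) - c * (b - e)" by (simp add: algebra_simps)
      have "x - c * b \<in> N"
        unfolding eq using is_submod_diff(2)[OF affineD(2)[OF A] NA c(2)] is_submodD(3)[OF NA cA b(2)] by blast
      moreover have "x - c * b \<in> sections G (spec A)"
        using is_submod_diff(2)[OF affineD(2)[OF A] M x] is_submodD(3)[OF M cA b(1)] by blast
      ultimately have "x - c * b \<in> sections G (spec A) \<inter> N" by simp
      then show "\<exists>c\<in>k. x - c * b \<in> sections G (spec A) \<inter> N" using c(1) by blast
    qed auto
    then show ?thesis using sec True by simp
  qed
  fix x e' assume x: "x \<in> spec A" and e': "e' \<in> ?F x"
  have "e' \<in> G x" using e' N(2) by (auto split: if_splits)
  then obtain s where s: "s \<in> A" "s \<notin> max_ideal x" "s * e' \<in> sections G (spec A)"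
    using cohD(4)[OF G A x] by blast
  show "\<exists>s\<in>A. s \<notin> max_ideal x \<and> s * e' \<in> sections ?F (spec A)"
  proof (cases "Q \<in> spec A")
    case False
    then show ?thesis using s sec by auto
  next
    case True
    show ?thesis
    proof (cases "x = Q")
      case True
      then have "s * e' \<in> N" using e' is_submodD(3)[OF N(1)] s(1) spec_point(2)[OF A x] by auto
      then show ?thesis using s sec by auto
    next
      case False
      then obtain a where a: "a \<in> A" "a \<in> max_ideal Q" "a \<notin> max_ideal x"
        using separate_points[OF A x True Q(2)] by blast
      have "a * s \<in> A" using subringD(4)[OF affineD(2)[OF A]] a s by blast
      moreover have "a * s \<notin> max_ideal x"
        using local_ring_prime[OF point(1)[OF spec_point(1)[OF A x]]] a s spec_point(2)[OF A x] by blast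
      moreover have "a * s * e' \<in> sections G (spec A)"
        using is_submodD(3)[OF coh_affine_submod[OF G A] a(1) s(3)] by (simp add: mult.assoc)
      moreover have "a * s * e' \<in> N" using N(3)[OF a(2) sectionsD[OF s(3) True]] by (simp add: mult.assoc)
      ultimately show ?thesis using sec True by auto
    qed
  qed
qed

lemma coh_structure: "coh (\<lambda>x. x)"
  unfolding coh_def
proof (intro conjI ballI allI impI)
  show "x \<in> C \<Longrightarrow> is_submod x x" "x \<in> C \<Longrightarrow> x \<subseteq> K" for x
    using is_submod_self[OF point(2)] point(4) by auto
  fix A assume A: "affine A"
  have "A = submod_gen A {1}"
    using submod_gen_least[OF is_submod_self[OF affineD(2)[OF A]], of "{1}"] subringD(1)[OF affineD(2)[OF A]]
      is_submodD(3)[OF submod_gen_submod[of A "{1}"], of _ 1] submod_gen_gens[of "{1}" A] by auto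
  then show "fin_gen A (sections (\<lambda>x. x) (spec A))" unfolding sections_structure[OF A] fin_gen_def by blast
  fix x e assume x: "x \<in> spec A" "e \<in> x"
  then obtain a s where as: "a \<in> A" "s \<in> A" "s \<notin> max_ideal x" "e = a / s" using spec_point(4)[OF A x(1)] by blast
  have "s \<noteq> 0" using as unitD(1) spec_point(2)[OF A x(1)] by blast
  then show "\<exists>s\<in>A. s \<notin> max_ideal x \<and> s * e \<in> sections (\<lambda>x. x) (spec A)"
    unfolding sections_structure[OF A] using as by (intro bexI[of _ s]) auto
qed

lemma pole_order:
  assumes x: "x \<in> C" and h: "h \<in> K" and a: "a \<in> max_ideal x"
  shows "\<exists>n. a ^ n * h \<in> x"
proof -
  obtain b d where bd: "b \<in> x" "d \<in> x" "d \<noteq> 0" "h = b / d" using point(5)[OF x] h unfolding frac_def by blast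
  obtain n u where "u \<in> x" "a ^ n = d * u" using power_divisible[OF x bd(2,3) a] by blast
  then have "a ^ n * h = u * b" "u * b \<in> x" using bd point_ring(4)[OF x] by auto
  then show ?thesis by metis
qed

text \<open>The finitely many other poles of \<open>h\<close> on a chart are cancelled by a function with value other than
  zero at \<open>Q\<close>.\<close>

lemma clear_poles:
  assumes A: "affine A" and Q: "Q \<in> spec A" and h: "h \<in> K"
  shows "\<exists>s\<in>A. s \<notin> max_ideal Q \<and> (\<forall>x\<in>spec A. x \<noteq> Q \<longrightarrow> s * h \<in> x)"
proof -
  note Ar = subringD[OF affineD(2)[OF A]]
  have ind: "\<exists>s\<in>A. s \<notin> max_ideal Q \<and> (\<forall>x\<in>F. s * h \<in> x)" if "finite F" "F \<subseteq> spec A - {Q, K}" for F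
    using that
  proof (induction F rule: finite_induct)
    case empty
    then show ?case using Ar(1) one_notin_max[OF point(2)[OF spec_point(1)[OF A Q]]] by blast
  next
    case (insert x F)
    then obtain s where s: "s \<in> A" "s \<notin> max_ideal Q" "\<forall>x\<in>F. s * h \<in> x" by auto
    have x: "x \<in> spec A" "x \<noteq> K" "Q \<noteq> x" using insert.prems by auto
    obtain a where a: "a \<in> A" "a \<in> max_ideal x" "a \<notin> max_ideal Q"
      using separate_points[OF A Q x] by blast
    obtain n where n: "a ^ n * h \<in> x" using pole_order[OF spec_point(1)[OF A x(1)] h a(2)] by blast
    have an: "a ^ n \<in> A" using Ar(7) a by blast
    have "a ^ n \<notin> max_ideal Q"
      using local_ring_power_prime[OF point(1)[OF spec_point(1)[OF A Q]]] a spec_point(2)[OF A Q] by blast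
    then have "s * a ^ n \<notin> max_ideal Q"
      using local_ring_prime[OF point(1)[OF spec_point(1)[OF A Q]]] s an spec_point(2)[OF A Q] by blast
    moreover have "s * a ^ n * h \<in> x"
      using point_ring(4)[OF spec_point(1)[OF A x(1)] _ n, of s] s(1) spec_point(2)[OF A x(1)] by (auto simp: mult.assoc)
    moreover have "s * a ^ n * h \<in> y" if "y \<in> F" for y
    proof -
      have y: "y \<in> spec A" using insert.prems that by auto
      have "a ^ n * (s * h) \<in> y"
        using point_ring(4)[OF spec_point(1)[OF A y]] s(3) that an spec_point(2)[OF A y] by blast
      then show ?thesis by (simp add: ac_simps)
    qed
    ultimately show ?case using Ar(4)[OF s(1) an] by blast
  qed
  have "finite {x \<in> spec A. x \<noteq> Q \<and> h \<notin> x}"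
    by (rule finite_subset[OF _ finite_poles[OF h]]) (use affineD(4)[OF A] in auto)
  moreover have "{x \<in> spec A. x \<noteq> Q \<and> h \<notin> x} \<subseteq> spec A - {Q, K}" using h by auto
  ultimately obtain s where s: "s \<in> A" "s \<notin> max_ideal Q" "\<forall>x\<in>{x \<in> spec A. x \<noteq> Q \<and> h \<notin> x}. s * h \<in> x"
    using ind by meson
  have "s * h \<in> x" if x: "x \<in> spec A" "x \<noteq> Q" for x
  proof (cases "h \<in> x")
    case True
    then show ?thesis
      using s(1) spec_point(2)[OF A x(1)] point_ring(4)[OF spec_point(1)[OF A x(1)], of s h] by blast
  qed (use s(3) x in auto)
  then show ?thesis using s(1,2) by auto
qed

text \<open>The structure sheaf may be enlarged at a closed point \<open>Q\<close> by an element \<open>h\<close> of the socle of \<open>K / Q\<close>.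
  On a chart, the sections are generated by \<open>1\<close> and \<open>s h\<close>, where \<open>s\<close> cancels the other poles of \<open>h\<close>.\<close>

lemma coh_enlarge:
  assumes Q: "Q \<in> C" "Q \<noteq> K" and h: "h \<in> K" "\<And>a. a \<in> max_ideal Q \<Longrightarrow> a * h \<in> Q"
  shows "coh ((\<lambda>x. x)(Q := adjoin k Q h))"
proof -
  let ?M = "adjoin k Q h" and ?G = "(\<lambda>x. x)(Q := adjoin k Q h)"
  note Qr = point_ring[OF Q(1)]
  have M: "is_submod Q ?M"
    unfolding is_submod_def
  proof (intro conjI ballI)
    show "0 \<in> ?M" using adjoinI[OF Qr(2) k_ring(2), of h] by simp
    fix u v assume "u \<in> ?M" "v \<in> ?M"
    then obtain a c b d where *: "a \<in> Q" "c \<in> k" "u = a + c * h" "b \<in> Q" "d \<in> k" "v = b + d * h"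
      by (elim adjoinE)
    have eq: "u + v = (a + b) + (c + d) * h" using * by (simp add: algebra_simps)
    show "u + v \<in> ?M" unfolding eq using * Qr k_ring by (intro adjoinI) auto
  next
    fix u v assume u: "u \<in> Q" and "v \<in> ?M"
    then obtain b d where *: "b \<in> Q" "d \<in> k" "v = b + d * h" by (elim adjoinE)
    obtain c where c: "c \<in> k" "u - c \<in> max_ideal Q" using residue_field[OF Q u] by blast
    have eq: "u * v = (u * b + d * ((u - c) * h)) + (c * d) * h" using * by (simp add: algebra_simps)
    have "d \<in> Q" using * point(3)[OF Q(1)] by blast
    then show "u * v \<in> ?M" unfolding eq using * c u Qr k_ring h(2)[OF c(2)] by (intro adjoinI) auto
  qed
  have QM: "Q \<subseteq> ?M" "h \<in> ?M"
    using adjoinI[OF _ k_ring(2), of _ Q h] adjoinI[OF Qr(2) k_ring(1), of h] by auto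
  have MK: "?M \<subseteq> K"
  proof
    fix u assume "u \<in> ?M"
    then obtain b d where *: "b \<in> Q" "d \<in> k" "u = b + d * h" by (elim adjoinE)
    then have "b \<in> K" "d \<in> K" using point(4)[OF Q(1)] k_K by auto
    then show "u \<in> K" using * K_ring(4,6) h(1) by blast
  qed
  have xG: "x \<subseteq> ?G x" for x using QM by auto
  have sec: "s * h \<in> sections ?G (spec A)"
    if A: "affine A" "Q \<in> spec A" "s \<in> A" "\<forall>x\<in>spec A. x \<noteq> Q \<longrightarrow> s * h \<in> x" for s A
  proof (rule sectionsI)
    fix x assume "x \<in> spec A"
    then show "s * h \<in> ?G x" using that is_submodD(3)[OF M _ QM(2)] spec_point(2)[OF A(1,2)] by auto
  qed
  show ?thesis
    unfolding coh_def
  proof (intro conjI ballI allI impI)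
    fix x assume "x \<in> C"
    then show "is_submod x (?G x)" "?G x \<subseteq> K" using M MK is_submod_self[OF point(2)] point(4) by auto
  next
    fix A assume A: "affine A"
    note As = affineD(2)[OF A] note Ar = subringD[OF As]
    have Asec: "A \<subseteq> sections ?G (spec A)"
    proof
      fix a assume "a \<in> A"
      then show "a \<in> sections ?G (spec A)" using xG spec_point(2)[OF A] by (intro sectionsI) blast
    qed
    have submod: "is_submod A (sections ?G (spec A))"
    proof -
      have "is_submod A (?G x)" if "x \<in> spec A" for x
        using is_submod_mono[OF M spec_point(2)[OF A]] is_submod_superring[OF point(2)] spec_point[OF A that] that by auto
      then show ?thesis by (rule sections_submod)
    qed
    show "fin_gen A (sections ?G (spec A))"
    proof (cases "Q \<in> spec A")
      case False
      then have "sections ?G (spec A) = sections (\<lambda>x. x) (spec A)" by (auto simp: sections_def)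
      then show ?thesis using cohD(3)[OF coh_structure A] by simp
    next
      case True
      obtain s where s: "s \<in> A" "s \<notin> max_ideal Q" "\<forall>x\<in>spec A. x \<noteq> Q \<longrightarrow> s * h \<in> x"
        using clear_poles[OF A True h(1)] by blast
      have sQ: "s \<in> Q" using s spec_point(2)[OF A True] by blast
      obtain c where c: "c \<in> k" "s - c \<in> max_ideal Q" using residue_field[OF Q sQ] by blast
      have c0: "c \<noteq> 0" using c s by auto
      have ci: "inverse c \<in> k" using subfield_inverse[OF k_subfield c(1)] .
      have "sections ?G (spec A) = submod_gen A {1, s * h}"
      proof
        show "submod_gen A {1, s * h} \<subseteq> sections ?G (spec A)"
          using submod Asec Ar(1) sec[OF A True s(1,3)] by (intro submod_gen_least) auto
        show "sections ?G (spec A) \<subseteq> submod_gen A {1, s * h}"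
        proof
          fix g assume g: "g \<in> sections ?G (spec A)"
          have "g \<in> ?M" using sectionsD[OF g True] by simp
          then obtain q d where q: "q \<in> Q" "d \<in> k" "g = q + d * h" by (elim adjoinE)
          define b where "b = d * inverse c"
          have bk: "b \<in> k" using q ci k_ring by (auto simp: b_def)
          then have bA: "b \<in> A" using affineD(3)[OF A] by blast
          have "g - b * (s * h) \<in> sections (\<lambda>x. x) (spec A)"
          proof (rule sectionsI)
            fix x assume x: "x \<in> spec A"
            note xr = point_ring[OF spec_point(1)[OF A x]]
            show "g - b * (s * h) \<in> x"
            proof (cases "x = Q")
              case True
              have "g - b * (s * h) = q - b * ((s - c) * h)" using q c0 by (simp add: b_def algebra_simps)
              moreover have "b \<in> Q" using bk point(3)[OF Q(1)] by blast
              ultimately show ?thesis using Qr q(1) h(2)[OF c(2)] True by auto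
            next
              case False
              have "g \<in> x" using sectionsD[OF g x] False by simp
              moreover have "b \<in> x" using bA spec_point(2)[OF A x] by blast
              ultimately show ?thesis using s(3) x False xr by auto
            qed
          qed
          then have "g - b * (s * h) \<in> A" using sections_structure[OF A] by simp
          moreover have "1 \<in> submod_gen A {1, s * h}" "s * h \<in> submod_gen A {1, s * h}"
            using submod_gen_gens[of "{1, s * h}" A] by blast+
          ultimately have "(g - b * (s * h)) * 1 + b * (s * h) \<in> submod_gen A {1, s * h}"
            by (rule is_submodD(2)[OF submod_gen_submod is_submodD(3)[OF submod_gen_submod]
                  is_submodD(3)[OF submod_gen_submod bA]])
          then show "g \<in> submod_gen A {1, s * h}" by simp
        qed
      qed
      then show ?thesis unfolding fin_gen_def by (intro exI[of _ "{1, s * h}"]) simp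
    qed
    fix x e assume x: "x \<in> spec A" and e: "e \<in> ?G x"
    have ploc: "\<exists>s\<in>A. s \<notin> max_ideal x \<and> s * u \<in> sections ?G (spec A)" if "u \<in> x" for u
      using cohD(4)[OF coh_structure A x that] Asec unfolding sections_structure[OF A] by blast
    show "\<exists>s\<in>A. s \<notin> max_ideal x \<and> s * e \<in> sections ?G (spec A)"
    proof (cases "x = Q")
      case False
      then show ?thesis using e ploc by simp
    next
      case True
      then have "e \<in> ?M" using e by simp
      then obtain q d where q: "q \<in> Q" "d \<in> k" "e = q + d * h" by (elim adjoinE)
      have QA: "Q \<in> spec A" using x True by simp
      obtain s where s: "s \<in> A" "s \<notin> max_ideal Q" "\<forall>x\<in>spec A. x \<noteq> Q \<longrightarrow> s * h \<in> x"
        using clear_poles[OF A QA h(1)] by blast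
      obtain t where t: "t \<in> A" "t \<notin> max_ideal Q" "t * q \<in> sections ?G (spec A)"
        using ploc[of q] q True by blast
      have dA: "d \<in> A" using q affineD(3)[OF A] by blast
      have "s * (t * q) + (t * d) * (s * h) \<in> sections ?G (spec A)"
        using is_submodD(3)[OF submod s(1) t(3)] is_submodD(3)[OF submod Ar(4)[OF t(1) dA] sec[OF A QA s(1,3)]]
        by (rule is_submodD(2)[OF submod])
      then have "(s * t) * e \<in> sections ?G (spec A)" using q by (simp add: algebra_simps)
      moreover have "s * t \<notin> max_ideal Q"
        using local_ring_prime[OF point(1)[OF Q(1)]] s t spec_point(2)[OF A QA] by blast
      ultimately show ?thesis using Ar(4)[OF s(1) t(1)] True by blast
    qed
  qed
qed

end

section \<open>Linear forms, Cech cohomology and duality\<close>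

text \<open>Cochains are functions with values in the field, so linear algebra over the subfield \<open>k\<close> is carried
  out with subspaces of a space of functions.\<close>

definition fun_subspace :: "'a::field set \<Rightarrow> ('i \<Rightarrow> 'a) set \<Rightarrow> bool" where
  "fun_subspace k M \<longleftrightarrow> (\<lambda>_. 0) \<in> M \<and> (\<forall>x\<in>M. \<forall>y\<in>M. (\<lambda>i. x i + y i) \<in> M) \<and>
     (\<forall>a\<in>k. \<forall>x\<in>M. (\<lambda>i. a * x i) \<in> M)"

lemma fun_subspaceD:
  assumes "fun_subspace k M"
  shows "(\<lambda>_. 0) \<in> M" "x \<in> M \<Longrightarrow> y \<in> M \<Longrightarrow> (\<lambda>i. x i + y i) \<in> M" "a \<in> k \<Longrightarrow> x \<in> M \<Longrightarrow> (\<lambda>i. a * x i) \<in> M"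
  using assms by (auto simp: fun_subspace_def)

text \<open>A subspace that contains \<open>B\<close> and is maximal among those that avoid \<open>c\<close> is a complement of the line
  \<open>k c\<close>, hence the kernel of a linear form with value \<open>1\<close> at \<open>c\<close>.\<close>

lemma separating_linear_form:
  assumes k: "is_subfield k" and Z: "fun_subspace k Z" and B: "fun_subspace k B" "B \<subseteq> Z"
    and c: "c \<in> Z" "c \<notin> B"
  shows "\<exists>l. (\<forall>z\<in>Z. l z \<in> k) \<and> (\<forall>x\<in>Z. \<forall>y\<in>Z. l (\<lambda>i. x i + y i) = l x + l y) \<and>
    (\<forall>a\<in>k. \<forall>x\<in>Z. l (\<lambda>i. a * x i) = a * l x) \<and> (\<forall>b\<in>B. l b = 0) \<and> l c = 1"
proof -
  note kr = subringD[OF subfield_subring[OF k]] and Zs = fun_subspaceD[OF Z]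
  define \<M> where "\<M> = {M. fun_subspace k M \<and> B \<subseteq> M \<and> M \<subseteq> Z \<and> c \<notin> M}"
  have "\<exists>M\<in>\<M>. \<forall>X\<in>\<M>. M \<subseteq> X \<longrightarrow> X = M"
  proof (rule subset_Zorn_nonempty)
    show "\<M> \<noteq> {}" using B c by (auto simp: \<M>_def)
    fix \<C> assume C: "\<C> \<noteq> {}" "subset.chain \<M> \<C>"
    then have CM: "\<C> \<subseteq> \<M>" and ch: "\<And>B C. B \<in> \<C> \<Longrightarrow> C \<in> \<C> \<Longrightarrow> B \<subseteq> C \<or> C \<subseteq> B"
      by (auto simp: subset_chain_def)
    have "fun_subspace k (\<Union>\<C>)"
      unfolding fun_subspace_def
    proof (intro conjI ballI)
      obtain M where "M \<in> \<C>" using C(1) by blast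
      then show "(\<lambda>_. 0) \<in> \<Union>\<C>" using CM fun_subspaceD(1)[of k M] by (auto simp: \<M>_def)
      fix x y assume "x \<in> \<Union>\<C>" "y \<in> \<Union>\<C>"
      then obtain M N where "M \<in> \<C>" "N \<in> \<C>" "x \<in> M" "y \<in> N" by auto
      then obtain D where D: "D \<in> \<C>" "x \<in> D" "y \<in> D" using ch[of M N] by blast
      then show "(\<lambda>i. x i + y i) \<in> \<Union>\<C>" using CM fun_subspaceD(2)[of k D x y] by (auto simp: \<M>_def)
    next
      fix a x assume "a \<in> k" "x \<in> \<Union>\<C>"
      then obtain M where "M \<in> \<C>" "x \<in> M" by auto
      then show "(\<lambda>i. a * x i) \<in> \<Union>\<C>" using CM fun_subspaceD(3)[of k M a x] \<open>a \<in> k\<close> by (auto simp: \<M>_def)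
    qed
    then show "\<Union>\<C> \<in> \<M>" using C CM by (auto simp: \<M>_def)
  qed
  then obtain M where "M \<in> \<M>" and maxM: "\<And>X. X \<in> \<M> \<Longrightarrow> M \<subseteq> X \<Longrightarrow> X = M"
    by blast
  then have M: "fun_subspace k M" "B \<subseteq> M" "M \<subseteq> Z" "c \<notin> M" by (simp_all add: \<M>_def)
  note Ms = fun_subspaceD[OF M(1)]
  have uniq: "a = b" if "a \<in> k" "b \<in> k" "(\<lambda>i. z i + - a * c i) \<in> M" "(\<lambda>i. z i + - b * c i) \<in> M" for a b z
  proof (rule ccontr)
    assume "a \<noteq> b"
    have "(\<lambda>i. (- 1) * (z i + - a * c i)) \<in> M" using Ms(3)[OF _ that(3), of "-1"] kr by auto
    from Ms(2)[OF that(4) this] have "(\<lambda>i. (a - b) * c i) \<in> M" by (simp add: algebra_simps)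
    from Ms(3)[OF subfield_inverse[OF k kr(3)[OF that(1,2)]] this]
    have "(\<lambda>i. inverse (a - b) * ((a - b) * c i)) \<in> M" .
    then show False using M(4) \<open>a \<noteq> b\<close> by (simp flip: mult.assoc)
  qed
  have ex: "\<exists>a\<in>k. (\<lambda>i. z i + - a * c i) \<in> M" if z: "z \<in> Z" for z
  proof (cases "z \<in> M")
    case True
    then show ?thesis using kr by (intro bexI[of _ 0]) auto
  next
    case False
    define X where "X = {\<lambda>i. m i + a * z i |m a. m \<in> M \<and> a \<in> k}"
    have XI: "(\<lambda>i. m i + a * z i) \<in> X" if "m \<in> M" "a \<in> k" for m a using that by (auto simp: X_def)
    have "fun_subspace k X"
      unfolding fun_subspace_def
    proof (intro conjI ballI)
      show "(\<lambda>_. 0) \<in> X" using XI[OF Ms(1) kr(2)] by simp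
      fix x y assume "x \<in> X" "y \<in> X"
      then obtain m a n b where *: "m \<in> M" "a \<in> k" "n \<in> M" "b \<in> k" "x = (\<lambda>i. m i + a * z i)" "y = (\<lambda>i. n i + b * z i)"
        by (auto simp: X_def)
      have "(\<lambda>i. (m i + n i) + (a + b) * z i) \<in> X" using XI[OF Ms(2)[OF *(1,3)] kr(6)[OF *(2,4)]] .
      then show "(\<lambda>i. x i + y i) \<in> X" using * by (simp add: algebra_simps)
    next
      fix b x assume b: "b \<in> k" and "x \<in> X"
      then obtain m a where *: "m \<in> M" "a \<in> k" "x = (\<lambda>i. m i + a * z i)" by (auto simp: X_def)
      have "(\<lambda>i. b * m i + (b * a) * z i) \<in> X" using XI[OF Ms(3)[OF b *(1)] kr(4)[OF b *(2)]] .
      then show "(\<lambda>i. b * x i) \<in> X" using * by (simp add: algebra_simps)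
    qed
    moreover have "X \<subseteq> Z" using M(3) z Zs(2,3) by (auto simp: X_def)
    moreover have MX: "M \<subseteq> X"
    proof
      fix m assume "m \<in> M"
      then show "m \<in> X" using XI[OF _ kr(2), of m] by simp
    qed
    moreover have "z \<in> X" using XI[OF Ms(1) kr(1)] by simp
    then have "X \<noteq> M" using False by auto
    ultimately have "c \<in> X" using maxM[of X] M(2) unfolding \<M>_def by blast
    then obtain m a where ma: "m \<in> M" "a \<in> k" "c = (\<lambda>i. m i + a * z i)" by (auto simp: X_def)
    have a0: "a \<noteq> 0" using ma M(4) by auto
    have ai: "inverse a \<in> k" using ma subfield_inverse[OF k] by blast
    have "(\<lambda>i. - inverse a * m i) \<in> M" by (rule Ms(3)[OF kr(5)[OF ai] ma(1)])
    moreover have "z i + - inverse a * c i = - inverse a * m i" for i using ma a0 by (simp add: field_simps)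
    ultimately show ?thesis using ai by (intro bexI[of _ "inverse a"]) auto
  qed
  define l where "l = (\<lambda>z. SOME a. a \<in> k \<and> (\<lambda>i. z i + - a * c i) \<in> M)"
  have l: "l z \<in> k" "(\<lambda>i. z i + - l z * c i) \<in> M" if "z \<in> Z" for z
    using someI_ex[of "\<lambda>a. a \<in> k \<and> (\<lambda>i. z i + - a * c i) \<in> M"] ex[OF that] by (auto simp: l_def)
  have leq: "l z = a" if "z \<in> Z" "a \<in> k" "(\<lambda>i. z i + - a * c i) \<in> M" for z a
    using uniq l that by blast
  show ?thesis
  proof (intro exI[of _ l] conjI ballI)
    show "l z \<in> k" if "z \<in> Z" for z using l that by blast
    show "l (\<lambda>i. x i + y i) = l x + l y" if xy: "x \<in> Z" "y \<in> Z" for x y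
    proof (rule leq)
      show "(\<lambda>i. x i + y i) \<in> Z" "l x + l y \<in> k" using xy Zs l kr by auto
      show "(\<lambda>i. x i + y i + - (l x + l y) * c i) \<in> M"
        using Ms(2)[OF l(2)[OF xy(1)] l(2)[OF xy(2)]] by (simp add: algebra_simps)
    qed
    show "l (\<lambda>i. a * x i) = a * l x" if ax: "a \<in> k" "x \<in> Z" for a x
    proof (rule leq)
      show "(\<lambda>i. a * x i) \<in> Z" "a * l x \<in> k" using ax Zs l kr by auto
      show "(\<lambda>i. a * x i + - (a * l x) * c i) \<in> M"
        using Ms(3)[OF ax(1) l(2)[OF ax(2)]] by (simp add: algebra_simps)
    qed
    show "l b = 0" if "b \<in> B" for b using that B M(2) kr by (intro leq) auto
    show "l c = 1" using c kr Ms(1) by (intro leq) auto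
  qed
qed

context curve
begin

abbreviation "pairs \<equiv> affine_opens k C \<times> affine_opens k C"

lemma affine_opens_iff: "U \<in> affine_opens k C \<longleftrightarrow> (\<exists>A. affine A \<and> U = spec A)"
  by (auto simp: affine_opens_def affine_def)

lemma affine_opens_open: "U \<in> affine_opens k C \<Longrightarrow> U \<in> nonempty_opens k C"
  using affine_nonempty_open by (auto simp: affine_opens_iff)

lemma affine_opens_subset: "U \<in> affine_opens k C \<Longrightarrow> U \<subseteq> C"
  using nonempty_openD(3)[OF affine_opens_open] .

lemma affine_opens_cover: "\<Union>(affine_opens k C) = C"
proof
  show "\<Union>(affine_opens k C) \<subseteq> C" using affine_opens_subset by blast
  show "C \<subseteq> \<Union>(affine_opens k C)"
  proof
    fix x assume "x \<in> C"
    then obtain A where "affine A" "x \<in> spec A" by (rule chart_exists)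
    then have "spec A \<in> affine_opens k C" using affine_opens_iff by blast
    then show "x \<in> \<Union>(affine_opens k C)" using \<open>x \<in> spec A\<close> by (rule UnionI)
  qed
qed

lemma pair_submod:
  assumes "coh G" "U \<in> nonempty_opens k C" "V \<in> nonempty_opens k C"
  shows "is_subring (\<Inter>(U \<inter> V))" "is_submod (\<Inter>(U \<inter> V)) (sections G (U \<inter> V))" "is_submod k (sections G (U \<inter> V))"
proof -
  have UV: "U \<inter> V \<in> nonempty_opens k C" by (rule nonempty_open_Int[OF assms(2,3)])
  show "is_subring (\<Inter>(U \<inter> V))" by (rule opens_subring[OF UV])
  show 1: "is_submod (\<Inter>(U \<inter> V)) (sections G (U \<inter> V))"
    by (rule coh_sections_submod[OF assms(1) nonempty_openD(3)[OF UV]])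
  show "is_submod k (sections G (U \<inter> V))" by (rule is_submod_mono[OF 1 opens_k[OF UV]])
qed

lemma cochain_iff:
  "c \<in> cech_cochains1 k C (fractional_sheaf G) \<longleftrightarrow> c \<in> extensional pairs \<and>
    (\<forall>U\<in>affine_opens k C. \<forall>V\<in>affine_opens k C. c (U, V) \<in> sections G (U \<inter> V))"
  by (auto simp: cech_cochains1_def PiE_iff)

lemma cocycle_iff:
  "c \<in> cech_cocycles1 k C (fractional_sheaf G) \<longleftrightarrow> c \<in> cech_cochains1 k C (fractional_sheaf G) \<and>
    (\<forall>U\<in>affine_opens k C. \<forall>V\<in>affine_opens k C. \<forall>W\<in>affine_opens k C. c (U, W) = c (U, V) + c (V, W))"
  by (simp add: cech_cocycles1_def Let_def)

lemma cocycleD: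
  assumes "c \<in> cech_cocycles1 k C (fractional_sheaf G)"
  shows "c \<in> extensional pairs"
    "U \<in> affine_opens k C \<Longrightarrow> V \<in> affine_opens k C \<Longrightarrow> c (U, V) \<in> sections G (U \<inter> V)"
    "U \<in> affine_opens k C \<Longrightarrow> V \<in> affine_opens k C \<Longrightarrow> W \<in> affine_opens k C \<Longrightarrow> c (U, W) = c (U, V) + c (V, W)"
  using assms unfolding cocycle_iff cochain_iff by blast+

lemma coboundary_iff:
  assumes "coh G"
  shows "c \<in> cech_coboundaries1 k C (fractional_sheaf G) \<longleftrightarrow> c \<in> cech_cochains1 k C (fractional_sheaf G) \<and>
    (\<exists>b. (\<forall>U\<in>affine_opens k C. b U \<in> sections G U) \<and>
      (\<forall>U\<in>affine_opens k C. \<forall>V\<in>affine_opens k C. c (U, V) = b V - b U))"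
proof -
  have eq: "b V \<ominus>\<^bsub>sect (fractional_sheaf G) (U \<inter> V)\<^esub> b U = b V - b U"
    if "\<forall>U\<in>affine_opens k C. b U \<in> sections G U" "U \<in> affine_opens k C" "V \<in> affine_opens k C" for b U V
    using that pair_submod[OF assms affine_opens_open[OF that(2)] affine_opens_open[OF that(3)]]
      sections_antimono[of "U \<inter> V" U G] sections_antimono[of "U \<inter> V" V G]
    by (intro fractional_minus(2)) auto
  show ?thesis
  proof
    assume "c \<in> cech_coboundaries1 k C (fractional_sheaf G)"
    then obtain b where "c \<in> cech_cochains1 k C (fractional_sheaf G)"
      "\<forall>U\<in>affine_opens k C. b U \<in> sections G U" "\<forall>U\<in>affine_opens k C. \<forall>V\<in>affine_opens k C.
         c (U, V) = b V \<ominus>\<^bsub>sect (fractional_sheaf G) (U \<inter> V)\<^esub> b U"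
      unfolding cech_coboundaries1_def by (auto simp: Pi_iff)
    then show "c \<in> cech_cochains1 k C (fractional_sheaf G) \<and>
      (\<exists>b. (\<forall>U\<in>affine_opens k C. b U \<in> sections G U) \<and>
        (\<forall>U\<in>affine_opens k C. \<forall>V\<in>affine_opens k C. c (U, V) = b V - b U))"
      using eq[of b] by (intro conjI exI[of _ b]) simp_all
  next
    assume "c \<in> cech_cochains1 k C (fractional_sheaf G) \<and>
      (\<exists>b. (\<forall>U\<in>affine_opens k C. b U \<in> sections G U) \<and>
        (\<forall>U\<in>affine_opens k C. \<forall>V\<in>affine_opens k C. c (U, V) = b V - b U))"
    then obtain b where b: "c \<in> cech_cochains1 k C (fractional_sheaf G)"
      "\<forall>U\<in>affine_opens k C. b U \<in> sections G U"
      "\<forall>U\<in>affine_opens k C. \<forall>V\<in>affine_opens k C. c (U, V) = b V - b U" by blast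
    then show "c \<in> cech_coboundaries1 k C (fractional_sheaf G)"
      unfolding cech_coboundaries1_def mem_Collect_eq using eq[of b]
      by (intro conjI bexI[of _ b]) simp_all
  qed
qed

definition cochain_scale :: "'a \<Rightarrow> ('a set set \<times> 'a set set \<Rightarrow> 'a) \<Rightarrow> 'a set set \<times> 'a set set \<Rightarrow> 'a" where
  "cochain_scale w c = (\<lambda>(U, V)\<in>pairs. w * c (U, V))"

lemma cochain_scale_apply:
  "U \<in> affine_opens k C \<Longrightarrow> V \<in> affine_opens k C \<Longrightarrow> cochain_scale w c (U, V) = w * c (U, V)"
  by (simp add: cochain_scale_def)

lemma cochain_scale_ext: "cochain_scale w c \<in> extensional pairs"
  by (simp add: cochain_scale_def)

lemma scale_sections:
  assumes "\<And>x u. x \<in> C \<Longrightarrow> u \<in> G x \<Longrightarrow> w * u \<in> H x" "U \<subseteq> C" "s \<in> sections G U"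
  shows "w * s \<in> sections H U"
  using assms by (auto simp: sections_def)

lemma scale_cocycle:
  assumes "\<And>x u. x \<in> C \<Longrightarrow> u \<in> G x \<Longrightarrow> w * u \<in> H x" "c \<in> cech_cocycles1 k C (fractional_sheaf G)"
  shows "cochain_scale w c \<in> cech_cocycles1 k C (fractional_sheaf H)"
  unfolding cocycle_iff cochain_iff
proof (intro conjI ballI)
  show "cochain_scale w c \<in> extensional pairs" by (rule cochain_scale_ext)
  fix U V assume UV: "U \<in> affine_opens k C" "V \<in> affine_opens k C"
  have "U \<inter> V \<subseteq> C" using affine_opens_subset[OF UV(1)] by auto
  then show "cochain_scale w c (U, V) \<in> sections H (U \<inter> V)"
    unfolding cochain_scale_apply[OF UV]
    by (intro scale_sections[where G = G, OF assms(1)] cocycleD(2)[OF assms(2) UV])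
  show "cochain_scale w c (U, W) = cochain_scale w c (U, V) + cochain_scale w c (V, W)"
    if "W \<in> affine_opens k C" for W
    unfolding cochain_scale_apply[OF UV] cochain_scale_apply[OF UV(1) that] cochain_scale_apply[OF UV(2) that]
      cocycleD(3)[OF assms(2) UV that] by (rule distrib_left)
qed

lemma scale_coboundary:
  assumes "coh G" "coh H" "\<And>x u. x \<in> C \<Longrightarrow> u \<in> G x \<Longrightarrow> w * u \<in> H x"
    "c \<in> cech_coboundaries1 k C (fractional_sheaf G)"
  shows "cochain_scale w c \<in> cech_coboundaries1 k C (fractional_sheaf H)"
proof -
  obtain b where b: "\<forall>U\<in>affine_opens k C. b U \<in> sections G U"
    "\<forall>U\<in>affine_opens k C. \<forall>V\<in>affine_opens k C. c (U, V) = b V - b U"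
    and c: "c \<in> cech_cochains1 k C (fractional_sheaf G)"
    using assms(4) unfolding coboundary_iff[OF assms(1)] by blast
  show ?thesis
    unfolding coboundary_iff[OF assms(2)]
  proof (intro conjI exI[of _ "\<lambda>U. w * b U"] ballI)
    show "w * b U \<in> sections H U" if U: "U \<in> affine_opens k C" for U
    proof -
      have "U \<subseteq> C" using affine_opens_subset[OF U] .
      then show ?thesis using b(1) U by (intro scale_sections[where G = G, OF assms(3)]) auto
    qed
    show "cochain_scale w c (U, V) = w * b V - w * b U" if "U \<in> affine_opens k C" "V \<in> affine_opens k C" for U V
      using b(2) that by (simp add: cochain_scale_apply right_diff_distrib)
    show "cochain_scale w c \<in> cech_cochains1 k C (fractional_sheaf H)"
      unfolding cochain_iff
    proof (intro conjI ballI cochain_scale_ext)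
      fix U V assume UV: "U \<in> affine_opens k C" "V \<in> affine_opens k C"
      have "U \<inter> V \<subseteq> C" using affine_opens_subset[OF UV(1)] by auto
      then show "cochain_scale w c (U, V) \<in> sections H (U \<inter> V)"
        using c UV unfolding cochain_scale_apply[OF UV]
        by (intro scale_sections[where G = G, OF assms(3)]) (auto simp: cochain_iff)
    qed
  qed
qed

lemma scale_hom:
  assumes F: "coh F" "\<And>x u. x \<in> C \<Longrightarrow> u \<in> F x \<Longrightarrow> w * u \<in> G x"
  shows "(\<lambda>U\<in>nonempty_opens k C. \<lambda>s\<in>sections F U. w * s) \<in> sheaf_homs k C (fractional_sheaf F) (fractional_sheaf G)"
proof -
  have lin: "(\<lambda>s\<in>sections F U. w * s) \<in> linear_maps (\<Inter>U) (sect (fractional_sheaf F) U) (sect (fractional_sheaf G) U)"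
    if U: "U \<in> nonempty_opens k C" for U
    using is_submodD[OF coh_sections_submod[OF F(1) nonempty_openD(3)[OF U]]]
      scale_sections[OF F(2) nonempty_openD(3)[OF U]]
    by (auto simp: linear_maps_def algebra_simps)
  show ?thesis
    unfolding sheaf_homs_def
  proof (intro CollectI conjI ballI impI)
    fix U V s assume UV: "U \<in> nonempty_opens k C" "V \<in> nonempty_opens k C" "V \<subseteq> U"
      and "s \<in> carrier (sect (fractional_sheaf F) U)"
    then have s: "s \<in> sections F U" "s \<in> sections F V" using sections_antimono[OF UV(3), of F] by auto
    then show "restr (fractional_sheaf G) U V ((\<lambda>U\<in>nonempty_opens k C. \<lambda>s\<in>sections F U. w * s) U s) =
        (\<lambda>U\<in>nonempty_opens k C. \<lambda>s\<in>sections F U. w * s) V (restr (fractional_sheaf F) U V s)"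
      using UV by simp
  qed (use lin in auto)
qed

text \<open>Any two sections are proportional over the coordinate ring of a smaller open set, so the quotient
  \<open>w = \<phi> s / s\<close> is the same for all sections \<open>s\<close>.\<close>

lemma hom_is_scaling:
  assumes F: "coh F" and G: "coh G" and \<phi>: "\<phi> \<in> sheaf_homs k C (fractional_sheaf F) (fractional_sheaf G)"
  obtains w where "w \<in> K" "\<And>x u. x \<in> C \<Longrightarrow> u \<in> F x \<Longrightarrow> w * u \<in> G x"
    "\<And>U s. U \<in> nonempty_opens k C \<Longrightarrow> s \<in> sections F U \<Longrightarrow> \<phi> U s = w * s"
proof -
  note conclude = that
  have lin: "\<phi> U \<in> linear_maps (\<Inter>U) (sect (fractional_sheaf F) U) (sect (fractional_sheaf G) U)"
    if "U \<in> nonempty_opens k C" for U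
    using \<phi> that by (auto simp: sheaf_homs_def PiE_iff)
  have res: "\<phi> U s = \<phi> V s" if "U \<in> nonempty_opens k C" "V \<in> nonempty_opens k C" "V \<subseteq> U" "s \<in> sections F U" for U V s
    using \<phi> that unfolding sheaf_homs_def sect_fractional by blast
  have smul: "\<phi> U (a * s) = a * \<phi> U s" if "U \<in> nonempty_opens k C" "a \<in> \<Inter>U" "s \<in> sections F U" for U a s
    using lin[OF that(1)] that(2,3) by (simp add: linear_maps_def)
  have into: "\<phi> U s \<in> sections G U" if "U \<in> nonempty_opens k C" "s \<in> sections F U" for U s
    using lin[OF that(1)] that(2) by (auto simp: linear_maps_def)
  have secK: "sections H U \<subseteq> K" if "coh H" "U \<in> nonempty_opens k C" for H U
    using cohD(2)[OF that(1) K_point] nonempty_openD(2)[OF that(2)] by (auto simp: sections_def)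
  obtain A where A: "affine A" using C_nonempty chart_exists by blast
  have ratio: "\<phi> U s * s' = \<phi> U' s' * s"
    if U: "U \<in> nonempty_opens k C" "s \<in> sections F U" and U': "U' \<in> nonempty_opens k C" "s' \<in> sections F U'" "s' \<noteq> 0"
    for U U' s s'
  proof -
    define V where "V = U \<inter> U' \<inter> spec A"
    have V: "V \<in> nonempty_opens k C" "V \<subseteq> U" "V \<subseteq> U'" "V \<subseteq> spec A"
      unfolding V_def using U(1) U'(1) affine_nonempty_open[OF A] nonempty_open_Int by auto
    have AV: "A \<subseteq> \<Inter>V" using affine_Inter[OF A] V(4) by blast
    have "s / s' \<in> frac A"
      using secK[OF F U(1)] secK[OF F U'(1)] U(2) U'(2) subfield_divide[OF K_subfield] affine_frac(1)[OF A] by blast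
    then obtain a b where ab: "a \<in> A" "b \<in> A" "b \<noteq> 0" "s / s' = a / b" unfolding frac_def by blast
    have eq: "b * s = a * s'" using ab(3,4) U'(3) by (simp add: field_simps)
    have sV: "s \<in> sections F V" "s' \<in> sections F V" using sections_antimono V U(2) U'(2) by blast+
    have "b * \<phi> U s = \<phi> V (b * s)" using smul[OF V(1) _ sV(1), of b] res[OF U(1) V(1,2) U(2)] ab AV by auto
    also have "\<dots> = a * \<phi> U' s'" unfolding eq using smul[OF V(1) _ sV(2), of a] res[OF U'(1) V(1,3) U'(2)] ab AV by auto
    finally have "b * (\<phi> U s * s') = \<phi> U' s' * (a * s')" by (simp add: ac_simps)
    also have "\<dots> = b * (\<phi> U' s' * s)" by (simp add: eq[symmetric] ac_simps)
    finally show ?thesis using ab(3) by simp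
  qed
  have main: thesis if w: "w \<in> K" "\<And>U s. U \<in> nonempty_opens k C \<Longrightarrow> s \<in> sections F U \<Longrightarrow> \<phi> U s = w * s" for w
  proof (rule conclude[OF w(1) _ w(2)])
    fix x u assume x: "x \<in> C" and u: "u \<in> F x"
    obtain B where B: "affine B" "x \<in> spec B" using chart_exists[OF x] by blast
    obtain s where s: "s \<in> B" "s \<notin> max_ideal x" "s * u \<in> sections F (spec B)" using cohD(4)[OF F B u] by blast
    have "w * (s * u) \<in> sections G (spec B)"
      using into[OF affine_nonempty_open[OF B(1)] s(3)] w(2)[OF affine_nonempty_open[OF B(1)] s(3)] by simp
    then have 1: "w * (s * u) \<in> G x" using B(2) by (rule sectionsD)
    have "s \<in> x" using s spec_point(2)[OF B] by blast
    then have i: "inverse s \<in> x" "s \<noteq> 0" using s unitD by auto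
    have "inverse s * (w * (s * u)) \<in> G x" using is_submodD(3)[OF cohD(1)[OF G x] i(1) 1] .
    moreover have "inverse s * (w * (s * u)) = w * u" using i by simp
    ultimately show "w * u \<in> G x" by metis
  qed auto
  show ?thesis
  proof (cases "\<exists>U\<in>nonempty_opens k C. \<exists>s\<in>sections F U. s \<noteq> 0")
    case True
    then obtain U0 s0 where U0: "U0 \<in> nonempty_opens k C" "s0 \<in> sections F U0" "s0 \<noteq> 0" by blast
    show ?thesis
    proof (rule main[of "\<phi> U0 s0 / s0"])
      show "\<phi> U0 s0 / s0 \<in> K"
        using secK[OF F U0(1)] secK[OF G U0(1)] into[OF U0(1,2)] U0(2) subfield_divide[OF K_subfield] by blast
      show "\<phi> U s = \<phi> U0 s0 / s0 * s" if "U \<in> nonempty_opens k C" "s \<in> sections F U" for U s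
        using ratio[OF that U0] U0(3) by (simp add: field_simps)
    qed
  next
    case False
    show ?thesis
    proof (rule main[of 0])
      show "0 \<in> K" by (rule K_ring(2))
      show "\<phi> U s = 0 * s" if U: "U \<in> nonempty_opens k C" "s \<in> sections F U" for U s
      proof -
        have "s = 0" using False U by blast
        moreover have "0 \<in> \<Inter>U" using subringD(2)[OF opens_subring[OF U(1)]] .
        ultimately show ?thesis using smul[OF U(1), of 0 s] U(2) by simp
      qed
    qed
  qed
qed

text \<open>Cochains are undefined outside \<open>pairs\<close>, so that their pointwise sum is not a cochain; extended by
  zero they form a subspace.\<close>

definition zero_extension :: "('a set set \<times> 'a set set \<Rightarrow> 'a) \<Rightarrow> 'a set set \<times> 'a set set \<Rightarrow> 'a" where
  "zero_extension c = (\<lambda>p. if p \<in> pairs then c p else 0)"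

lemma zero_extension_restrict: "c \<in> extensional pairs \<Longrightarrow> restrict (zero_extension c) pairs = c"
  by (auto simp: zero_extension_def extensional_def restrict_def)

lemma zero_extension_inj: "c \<in> extensional pairs \<Longrightarrow> d \<in> extensional pairs \<Longrightarrow> zero_extension c = zero_extension d \<Longrightarrow> c = d"
  using zero_extension_restrict by metis

abbreviation cochain_add ::
  "('a set set \<times> 'a set set \<Rightarrow> 'a) \<Rightarrow> ('a set set \<times> 'a set set \<Rightarrow> 'a) \<Rightarrow> 'a set set \<times> 'a set set \<Rightarrow> 'a" where
  "cochain_add c d \<equiv> (\<lambda>(U, V)\<in>pairs. c (U, V) + d (U, V))"

lemma cochain_add_cocycle:
  assumes "coh G" "c \<in> cech_cocycles1 k C (fractional_sheaf G)" "d \<in> cech_cocycles1 k C (fractional_sheaf G)"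
  shows "cochain_add c d \<in> cech_cocycles1 k C (fractional_sheaf G)"
  unfolding cocycle_iff cochain_iff
proof (intro conjI ballI)
  fix U V assume UV: "U \<in> affine_opens k C" "V \<in> affine_opens k C"
  show "cochain_add c d (U, V) \<in> sections G (U \<inter> V)"
    using is_submodD(2)[OF pair_submod(2)[OF assms(1) affine_opens_open[OF UV(1)] affine_opens_open[OF UV(2)]]
        cocycleD(2)[OF assms(2) UV] cocycleD(2)[OF assms(3) UV]] UV by simp
  show "cochain_add c d (U, W) = cochain_add c d (U, V) + cochain_add c d (V, W)" if "W \<in> affine_opens k C" for W
    using UV that cocycleD(3)[OF assms(2) UV that] cocycleD(3)[OF assms(3) UV that] by simp
qed simp

lemma cochain_add_coboundary:
  assumes "coh G" "c \<in> cech_coboundaries1 k C (fractional_sheaf G)" "d \<in> cech_coboundaries1 k C (fractional_sheaf G)"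
  shows "cochain_add c d \<in> cech_coboundaries1 k C (fractional_sheaf G)"
proof -
  obtain b where b: "\<forall>U\<in>affine_opens k C. b U \<in> sections G U"
    "\<forall>U\<in>affine_opens k C. \<forall>V\<in>affine_opens k C. c (U, V) = b V - b U"
    using assms(2) unfolding coboundary_iff[OF assms(1)] by blast
  obtain b' where b': "\<forall>U\<in>affine_opens k C. b' U \<in> sections G U"
    "\<forall>U\<in>affine_opens k C. \<forall>V\<in>affine_opens k C. d (U, V) = b' V - b' U"
    using assms(3) unfolding coboundary_iff[OF assms(1)] by blast
  have "b U + b' U \<in> sections G U" if U: "U \<in> affine_opens k C" for U
    using is_submodD(2)[OF coh_sections_submod[OF assms(1) nonempty_openD(3)[OF affine_opens_open[OF U]]]] b(1) b'(1) U by blast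
  moreover have "cochain_add c d \<in> cech_cochains1 k C (fractional_sheaf G)"
    using assms(2,3) is_submodD(2)[OF pair_submod(2)[OF assms(1) affine_opens_open affine_opens_open]]
    unfolding coboundary_iff[OF assms(1)] by (auto simp: cochain_iff)
  ultimately show ?thesis
    unfolding coboundary_iff[OF assms(1)] using b(2) b'(2)
    by (intro conjI exI[of _ "\<lambda>U. b U + b' U"]) auto
qed

lemma coboundary_cocycle:
  assumes "coh G" "c \<in> cech_coboundaries1 k C (fractional_sheaf G)"
  shows "c \<in> cech_cocycles1 k C (fractional_sheaf G)"
proof -
  obtain b where "\<forall>U\<in>affine_opens k C. \<forall>V\<in>affine_opens k C. c (U, V) = b V - b U"
    "c \<in> cech_cochains1 k C (fractional_sheaf G)"
    using assms(2) unfolding coboundary_iff[OF assms(1)] by blast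
  then show ?thesis by (simp add: cocycle_iff)
qed

lemma k_scale: "coh G \<Longrightarrow> a \<in> k \<Longrightarrow> x \<in> C \<Longrightarrow> u \<in> G x \<Longrightarrow> a * u \<in> G x"
  using is_submodD(3)[OF cohD(1)] point(3) by blast

lemma zero_coboundary: "coh G \<Longrightarrow> restrict (\<lambda>_. 0) pairs \<in> cech_coboundaries1 k C (fractional_sheaf G)"
  unfolding coboundary_iff
  by (intro conjI exI[of _ "\<lambda>_. 0"])
    (auto simp: cochain_iff is_submodD(1)[OF pair_submod(2)[OF _ affine_opens_open affine_opens_open]]
      is_submodD(1)[OF coh_sections_submod[OF _ nonempty_openD(3)[OF affine_opens_open]]])

lemma extension_subspace:
  assumes G: "coh G" and ext: "Z \<subseteq> extensional pairs" and zero: "restrict (\<lambda>_. 0) pairs \<in> Z"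
    and add: "\<And>c d. c \<in> Z \<Longrightarrow> d \<in> Z \<Longrightarrow> cochain_add c d \<in> Z"
    and scale: "\<And>a c. a \<in> k \<Longrightarrow> c \<in> Z \<Longrightarrow> cochain_scale a c \<in> Z"
  shows "fun_subspace k (zero_extension ` Z)"
  unfolding fun_subspace_def
proof (intro conjI ballI)
  have "(\<lambda>_. 0) = zero_extension (restrict (\<lambda>_. 0) pairs)" by (auto simp: zero_extension_def)
  then show "(\<lambda>_. 0) \<in> zero_extension ` Z" using zero by blast
  fix x y assume "x \<in> zero_extension ` Z" "y \<in> zero_extension ` Z"
  then obtain c d where cd: "c \<in> Z" "d \<in> Z" "x = zero_extension c" "y = zero_extension d" by blast
  have "(\<lambda>i. x i + y i) = zero_extension (cochain_add c d)" by (auto simp: zero_extension_def cd)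
  then show "(\<lambda>i. x i + y i) \<in> zero_extension ` Z" using add[OF cd(1,2)] by blast
next
  fix a x assume a: "a \<in> k" and "x \<in> zero_extension ` Z"
  then obtain c where c: "c \<in> Z" "x = zero_extension c" by blast
  have "(\<lambda>i. a * x i) = zero_extension (cochain_scale a c)" by (auto simp: zero_extension_def cochain_scale_def c)
  then show "(\<lambda>i. a * x i) \<in> zero_extension ` Z" using scale[OF a c(1)] by blast
qed

lemma H1_dualD:
  assumes "t \<in> H1_dual k C (fractional_sheaf G)"
  shows "c \<in> cech_cocycles1 k C (fractional_sheaf G) \<Longrightarrow> t c \<in> k"
    "c \<in> cech_cocycles1 k C (fractional_sheaf G) \<Longrightarrow> d \<in> cech_cocycles1 k C (fractional_sheaf G) \<Longrightarrow>
      t (cochain_add c d) = t c + t d"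
    "a \<in> k \<Longrightarrow> c \<in> cech_cocycles1 k C (fractional_sheaf G) \<Longrightarrow> t (cochain_scale a c) = a * t c"
    "c \<in> cech_coboundaries1 k C (fractional_sheaf G) \<Longrightarrow> t c = 0"
  using assms unfolding H1_dual_def sect_fractional cochain_scale_def by (auto simp: PiE_iff)

lemma H1_dualI:
  assumes "t \<in> extensional (cech_cocycles1 k C (fractional_sheaf G))"
    "\<And>c. c \<in> cech_cocycles1 k C (fractional_sheaf G) \<Longrightarrow> t c \<in> k"
    "\<And>c d. c \<in> cech_cocycles1 k C (fractional_sheaf G) \<Longrightarrow> d \<in> cech_cocycles1 k C (fractional_sheaf G) \<Longrightarrow>
      t (cochain_add c d) = t c + t d"
    "\<And>a c. a \<in> k \<Longrightarrow> c \<in> cech_cocycles1 k C (fractional_sheaf G) \<Longrightarrow> t (cochain_scale a c) = a * t c"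
    "\<And>c. c \<in> cech_coboundaries1 k C (fractional_sheaf G) \<Longrightarrow> t c = 0"
  shows "t \<in> H1_dual k C (fractional_sheaf G)"
  using assms unfolding H1_dual_def sect_fractional cochain_scale_def by (simp add: PiE_iff)

lemma detecting_form:
  assumes G: "coh G" and c: "c \<in> cech_cocycles1 k C (fractional_sheaf G)" "c \<notin> cech_coboundaries1 k C (fractional_sheaf G)"
  shows "\<exists>l\<in>H1_dual k C (fractional_sheaf G). l c = 1"
proof -
  let ?Z = "cech_cocycles1 k C (fractional_sheaf G)" and ?B = "cech_coboundaries1 k C (fractional_sheaf G)"
  have ext: "?Z \<subseteq> extensional pairs" using cocycleD(1) by blast
  have BZ: "?B \<subseteq> ?Z" using coboundary_cocycle[OF G] by blast
  note zB = zero_coboundary[OF G]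
  have sZ: "fun_subspace k (zero_extension ` ?Z)"
    using zB BZ cochain_add_cocycle[OF G] scale_cocycle[OF k_scale[OF G]] by (intro extension_subspace[OF G ext]) auto
  have sB: "fun_subspace k (zero_extension ` ?B)"
    using zB BZ ext cochain_add_coboundary[OF G] scale_coboundary[OF G G k_scale[OF G]] by (intro extension_subspace[OF G]) auto
  have nB: "zero_extension c \<notin> zero_extension ` ?B"
  proof
    assume "zero_extension c \<in> zero_extension ` ?B"
    then obtain d where d: "d \<in> ?B" "zero_extension c = zero_extension d" by blast
    then have "c = d" using zero_extension_inj c(1) BZ ext by blast
    then show False using d c(2) by simp
  qed
  obtain l where l: "\<forall>z\<in>zero_extension ` ?Z. l z \<in> k"
    "\<forall>x\<in>zero_extension ` ?Z. \<forall>y\<in>zero_extension ` ?Z. l (\<lambda>i. x i + y i) = l x + l y"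
    "\<forall>a\<in>k. \<forall>x\<in>zero_extension ` ?Z. l (\<lambda>i. a * x i) = a * l x" "\<forall>b\<in>zero_extension ` ?B. l b = 0" "l (zero_extension c) = 1"
    using separating_linear_form[OF k_subfield sZ sB image_mono[OF BZ] imageI[OF c(1)] nB]
    by (elim exE conjE) (rule that)
  have e1: "zero_extension (cochain_add c d) = (\<lambda>i. zero_extension c i + zero_extension d i)" for c d
    by (auto simp: zero_extension_def)
  have e2: "zero_extension (cochain_scale a c) = (\<lambda>i. a * zero_extension c i)" for a c
    by (auto simp: zero_extension_def cochain_scale_def)
  have "restrict (l \<circ> zero_extension) ?Z \<in> H1_dual k C (fractional_sheaf G)"
  proof (rule H1_dualI)
    fix c d assume "c \<in> ?Z" "d \<in> ?Z"
    then show "restrict (l \<circ> zero_extension) ?Z (cochain_add c d) =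
        restrict (l \<circ> zero_extension) ?Z c + restrict (l \<circ> zero_extension) ?Z d"
      using cochain_add_cocycle[OF G] l(2) by (simp add: e1)
  next
    fix a c assume "a \<in> k" "c \<in> ?Z"
    then show "restrict (l \<circ> zero_extension) ?Z (cochain_scale a c) = a * restrict (l \<circ> zero_extension) ?Z c"
      using scale_cocycle[OF k_scale[OF G]] l(3) by (simp add: e2)
  qed (use l BZ in auto)
  then show ?thesis using l(5) c(1) by (intro bexI[of _ "restrict (l \<circ> zero_extension) ?Z"]) auto
qed

end

locale dualized_curve = curve +
  fixes \<omega> :: "'a set \<Rightarrow> 'a set"
  assumes dualizing: "dualizing_sheaf k C \<omega>"
begin

lemma coh_omega: "coh \<omega>"
  using dualizing coherent_fractional_coh by (simp add: dualizing_sheaf_def)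

lemma duality:
  obtains t where "t \<in> H1_dual k C (fractional_sheaf \<omega>)"
    "\<And>F. coh F \<Longrightarrow> bij_betw
          (\<lambda>\<phi>. \<lambda>c\<in>cech_cocycles1 k C (fractional_sheaf F). t (\<lambda>(U, V)\<in>pairs. \<phi> (U \<inter> V) (c (U, V))))
          (sheaf_homs k C (fractional_sheaf F) (fractional_sheaf \<omega>)) (H1_dual k C (fractional_sheaf F))"
  using dualizing coh_coherent unfolding dualizing_sheaf_def by blast

lemma hom_cochain:
  assumes w: "\<And>U s. U \<in> nonempty_opens k C \<Longrightarrow> s \<in> sections F U \<Longrightarrow> \<phi> U s = w * s"
    and c: "c \<in> cech_cocycles1 k C (fractional_sheaf F)"
  shows "(\<lambda>(U, V)\<in>pairs. \<phi> (U \<inter> V) (c (U, V))) = cochain_scale w c"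
proof
  fix p
  show "(\<lambda>(U, V)\<in>pairs. \<phi> (U \<inter> V) (c (U, V))) p = cochain_scale w c p"
  proof (cases "p \<in> pairs")
    case True
    then obtain U V where p: "p = (U, V)" "U \<in> affine_opens k C" "V \<in> affine_opens k C" by auto
    have "c (U, V) \<in> sections F (U \<inter> V)" using cocycleD(2)[OF c p(2,3)] .
    then have "\<phi> (U \<inter> V) (c (U, V)) = w * c (U, V)"
      using w nonempty_open_Int affine_opens_open p by blast
    then show ?thesis using p by (simp add: cochain_scale_apply)
  qed (auto simp: cochain_scale_def)
qed

text \<open>The source of all functions constructed below.
  If no global section of \<open>G\<close> leaves the submodule \<open>N\<close> of colength one of the stalk of \<open>G\<close> at
  \<open>Q\<close>, then the boundary of a local section outside \<open>N\<close> is a nonzero class in the first cohomology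
  of the subsheaf \<open>F\<close> defined by \<open>N\<close>, and it dies in that of \<open>G\<close>.  A linear form that detects it is
  given by a rational function that maps \<open>F\<close> into \<open>\<omega>\<close>, but not \<open>G\<close>.\<close>

theorem multiplier_exists:
  assumes G: "coh G" and Q: "Q \<in> C" "Q \<noteq> K"
    and N: "is_submod Q N" "N \<subseteq> G Q" "\<And>a u. a \<in> max_ideal Q \<Longrightarrow> u \<in> G Q \<Longrightarrow> a * u \<in> N"
    and e: "e \<in> G Q" "e \<notin> N" "\<And>u. u \<in> G Q \<Longrightarrow> \<exists>c\<in>k. u - c * e \<in> N"
    and H0: "\<And>h. h \<in> sections G C \<Longrightarrow> h \<in> N"
  obtains w where "w \<in> K" "\<And>x u. x \<in> C \<Longrightarrow> u \<in> (G(Q := N)) x \<Longrightarrow> w * u \<in> \<omega> x" "\<exists>u\<in>G Q. w * u \<notin> \<omega> Q"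
proof -
  let ?F = "G(Q := N)"
  have F: "coh ?F" using coh_shrink[OF G Q N e(1,3)] .
  have "\<exists>b. b \<in> sections G U \<and> (Q \<in> U \<longrightarrow> b - e \<in> N)" if U: "U \<in> affine_opens k C" for U
  proof -
    obtain A where A: "affine A" "U = spec A" using U affine_opens_iff by blast
    show ?thesis
    proof (cases "Q \<in> U")
      case True
      then show ?thesis using approximate_section[OF G A(1) _ Q(2) e(1) N(1,3)] A(2) by blast
    next
      case False
      then show ?thesis using is_submodD(1)[OF coh_affine_submod[OF G A(1)]] A(2) by blast
    qed
  qed
  then obtain b where b: "\<And>U. U \<in> affine_opens k C \<Longrightarrow> b U \<in> sections G U"
    "\<And>U. U \<in> affine_opens k C \<Longrightarrow> Q \<in> U \<Longrightarrow> b U - e \<in> N" by metis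
  \<comment> \<open>The image of the class of \<open>e\<close> under the connecting map of the quotient of \<open>G\<close> by \<open>F\<close>.\<close>
  define c where "c = (\<lambda>(U, V)\<in>pairs. b V - b U)"
  have c_apply: "c (U, V) = b V - b U" if "U \<in> affine_opens k C" "V \<in> affine_opens k C" for U V
    using that by (simp add: c_def)
  have bG: "b V - b U \<in> sections G (U \<inter> V)" if UV: "U \<in> affine_opens k C" "V \<in> affine_opens k C" for U V
  proof -
    note P = pair_submod[OF G affine_opens_open[OF UV(1)] affine_opens_open[OF UV(2)]]
    show ?thesis
      using b(1)[OF UV(1)] b(1)[OF UV(2)] sections_antimono[of "U \<inter> V" U G] sections_antimono[of "U \<inter> V" V G]
      by (intro is_submod_diff(2)[OF P(1,2)]) auto
  qed
  have "b V - b U \<in> sections ?F (U \<inter> V)" if UV: "U \<in> affine_opens k C" "V \<in> affine_opens k C" for U V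
  proof (rule sectionsI)
    fix x assume x: "x \<in> U \<inter> V"
    show "b V - b U \<in> ?F x"
    proof (cases "x = Q")
      case True
      have "(b V - e) - (b U - e) \<in> N"
        using is_submod_diff(2)[OF point(2)[OF Q(1)] N(1) b(2)[OF UV(2)] b(2)[OF UV(1)]] x True by simp
      then show ?thesis using True by simp
    qed (use sectionsD[OF bG[OF UV] x] in simp)
  qed
  then have cF: "c \<in> cech_cocycles1 k C (fractional_sheaf ?F)"
    unfolding cocycle_iff cochain_iff by (auto simp: c_apply) (simp add: c_def)
  have "c \<notin> cech_coboundaries1 k C (fractional_sheaf ?F)"
  proof
    assume "c \<in> cech_coboundaries1 k C (fractional_sheaf ?F)"
    then obtain b' where b': "\<And>U. U \<in> affine_opens k C \<Longrightarrow> b' U \<in> sections ?F U"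
      "\<And>U V. U \<in> affine_opens k C \<Longrightarrow> V \<in> affine_opens k C \<Longrightarrow> c (U, V) = b' V - b' U"
      unfolding coboundary_iff[OF F] by blast
    obtain A where A: "affine A" "Q \<in> spec A" using chart_exists[OF Q(1)] by blast
    let ?U = "spec A"
    have U: "?U \<in> affine_opens k C" using A affine_opens_iff by blast
    define h where "h = b ?U - b' ?U"
    have hV: "h = b V - b' V" if "V \<in> affine_opens k C" for V
      using b'(2)[OF U that] c_apply[OF U that] by (simp add: h_def algebra_simps)
    have "h \<in> sections G C"
    proof (rule sectionsI)
      fix x assume x: "x \<in> C"
      then obtain V where V: "V \<in> affine_opens k C" "x \<in> V" using affine_opens_cover by blast
      have "b' V \<in> G x" using sectionsD[OF b'(1)[OF V(1)] V(2)] N(2) by (auto split: if_splits)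
      then show "h \<in> G x" unfolding hV[OF V(1)]
        using is_submod_diff(2)[OF point(2)[OF x] cohD(1)[OF G x] sectionsD[OF b(1)[OF V(1)] V(2)]] by blast
    qed
    then have "h \<in> N" by (rule H0)
    moreover have "b' ?U \<in> N" using sectionsD[OF b'(1)[OF U] A(2)] by simp
    ultimately have "h + b' ?U \<in> N" using is_submodD(2)[OF N(1)] by blast
    then have "b ?U \<in> N" by (simp add: h_def)
    then have "b ?U - (b ?U - e) \<in> N"
      by (rule is_submod_diff(2)[OF point(2)[OF Q(1)] N(1) _ b(2)[OF U A(2)]])
    then show False using e(2) by simp
  qed
  then obtain l where l: "l \<in> H1_dual k C (fractional_sheaf ?F)" "l c = 1"
    using detecting_form[OF F cF] by blast
  obtain t where t: "t \<in> H1_dual k C (fractional_sheaf \<omega>)" and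
    bij: "\<And>F. coh F \<Longrightarrow> bij_betw
          (\<lambda>\<phi>. \<lambda>c\<in>cech_cocycles1 k C (fractional_sheaf F). t (\<lambda>(U, V)\<in>pairs. \<phi> (U \<inter> V) (c (U, V))))
          (sheaf_homs k C (fractional_sheaf F) (fractional_sheaf \<omega>)) (H1_dual k C (fractional_sheaf F))"
    by (rule duality) blast
  obtain \<phi> where \<phi>: "\<phi> \<in> sheaf_homs k C (fractional_sheaf ?F) (fractional_sheaf \<omega>)"
    "l = (\<lambda>c\<in>cech_cocycles1 k C (fractional_sheaf ?F). t (\<lambda>(U, V)\<in>pairs. \<phi> (U \<inter> V) (c (U, V))))"
    using bij_betw_imp_surj_on[OF bij[OF F]] l(1) by blast
  obtain w where w: "w \<in> K" "\<And>x u. x \<in> C \<Longrightarrow> u \<in> ?F x \<Longrightarrow> w * u \<in> \<omega> x"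
    "\<And>U s. U \<in> nonempty_opens k C \<Longrightarrow> s \<in> sections ?F U \<Longrightarrow> \<phi> U s = w * s"
    using hom_is_scaling[OF F coh_omega \<phi>(1)] by blast
  have lc: "l c = t (cochain_scale w c)"
    using \<phi>(2) cF hom_cochain[where \<phi> = \<phi> and F = ?F and w = w, OF w(3) cF] by simp
  have "\<exists>u\<in>G Q. w * u \<notin> \<omega> Q"
  proof (rule ccontr)
    assume n: "\<not> ?thesis"
    have wG: "w * u \<in> \<omega> x" if "x \<in> C" "u \<in> G x" for x u
      using w(2)[OF that(1), of u] n that by (cases "x = Q") auto
    have "c \<in> cech_coboundaries1 k C (fractional_sheaf G)"
      unfolding coboundary_iff[OF G]
    proof (intro conjI exI[of _ b])
      show "c \<in> cech_cochains1 k C (fractional_sheaf G)"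
        unfolding cochain_iff using bG by (auto simp: c_apply) (simp add: c_def)
    qed (use b c_apply in auto)
    then have "cochain_scale w c \<in> cech_coboundaries1 k C (fractional_sheaf \<omega>)"
      using scale_coboundary[OF G coh_omega wG] by blast
    then show False using H1_dualD(4)[OF t] lc l(2) by simp
  qed
  then show ?thesis using that w by blast
qed

end

section \<open>Global sections of the dualizing sheaf\<close>

text \<open>Among finitely many elements, one of largest absolute value with respect to a valuation.\<close>

lemma max_ratio:
  assumes L: "is_subfield L" and V: "valuation_ring L V" and S: "finite S" "S \<subseteq> L" "\<exists>s\<in>S. s \<noteq> 0"
  shows "\<exists>g\<in>S. g \<noteq> 0 \<and> (\<forall>s\<in>S. s / g \<in> V)"
  using S
proof (induction S rule: finite_induct)
  case (insert a S)
  note Vr = subringD[OF valuationD(1)[OF V]]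
  show ?case
  proof (cases "\<exists>s\<in>S. s \<noteq> 0")
    case False
    then have "a \<noteq> 0" using insert.prems by auto
    moreover have "s / a \<in> V" if "s \<in> insert a S" for s using that False \<open>a \<noteq> 0\<close> Vr(1,2) by auto
    ultimately show ?thesis by blast
  next
    case True
    then obtain g where g: "g \<in> S" "g \<noteq> 0" "\<forall>s\<in>S. s / g \<in> V" using insert by auto
    show ?thesis
    proof (cases "a / g \<in> V")
      case True
      then show ?thesis using g by blast
    next
      case False
      then have a0: "a \<noteq> 0" using Vr(2) by auto
      have "a / g \<in> L" using insert.prems g(1) by (intro subfield_divide[OF L]) auto
      then have "inverse (a / g) \<in> V" using valuationD(3)[OF V _ False] by blast
      then have ga: "g / a \<in> V" by simp
      have "s / a \<in> V" if "s \<in> insert a S" for s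
      proof (cases "s = a")
        case False
        then have "(s / g) * (g / a) \<in> V" using g(3) ga Vr(4) that by blast
        then show ?thesis using g(2) by simp
      qed (use a0 Vr in simp)
      then show ?thesis using a0 by blast
    qed
  qed
qed auto

text \<open>A multiplier of a finitely generated module is integral.  With valuations: multiplication by \<open>w\<close>
  does not increase the largest absolute value of an element of the module.\<close>

lemma stable_in_valuation:
  assumes L: "is_subfield L" and V: "valuation_ring L V" and A: "is_subring A" "A \<subseteq> V"
    and M: "fin_gen A M" "M \<subseteq> L" "M \<noteq> {0}" and w: "\<And>u. u \<in> M \<Longrightarrow> w * u \<in> M"
  shows "w \<in> V"
proof -
  obtain S where S: "finite S" "M = submod_gen A S" using M(1) by (auto simp: fin_gen_def)
  have SM: "S \<subseteq> M" using S(2) submod_gen_gens[of S A] by simp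
  note Vr = subringD[OF valuationD(1)[OF V]]
  have "\<exists>s\<in>S. s \<noteq> 0"
  proof (rule ccontr)
    assume "\<not> ?thesis"
    then have "S \<subseteq> {0}" by auto
    then have "M \<subseteq> {0}" unfolding S(2) by (intro submod_gen_least) (auto simp: is_submod_def)
    then show False using M(3) is_submodD(1)[OF fin_gen_submod[OF M(1)]] by auto
  qed
  then obtain g where g: "g \<in> S" "g \<noteq> 0" "\<forall>s\<in>S. s / g \<in> V"
    using max_ratio[OF L V S(1)] SM M(2) by blast
  have "is_submod A {u. u / g \<in> V}"
    unfolding is_submod_def using A(2) Vr by (auto simp: add_divide_distrib) (metis Vr(4) subsetD times_divide_eq_right)
  then have "M \<subseteq> {u. u / g \<in> V}" unfolding S(2) using g(3) by (intro submod_gen_least) auto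
  then have "w * g / g \<in> V" using w[of g] g(1) SM by blast
  then show ?thesis using g(2) by simp
qed

context curve
begin

lemma stable_constant:
  assumes "fin_gen k M" "M \<subseteq> K" "M \<noteq> {0}" "w \<in> K" "\<And>u. u \<in> M \<Longrightarrow> w * u \<in> M"
  shows "w \<in> k"
proof -
  have "w \<in> V" if "valuation_ring K V" "k \<subseteq> V" for V
    using stable_in_valuation[OF K_subfield that(1) k_subring that(2) assms(1-3,5)] by blast
  then have "w \<in> closure_in K k" using assms(4) by (auto simp: closure_in_def)
  then show ?thesis using closure_alg_closed[OF K_subfield k_closed k_K] by simp
qed

lemma stalk_fin_gen:
  assumes G: "coh G" and x: "x \<in> C"
  shows "fin_gen x (G x)"
proof -
  obtain A where A: "affine A" "x \<in> spec A" using chart_exists[OF x] by blast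
  obtain S where S: "finite S" "sections G (spec A) = submod_gen A S" using cohD(3)[OF G A(1)] by (auto simp: fin_gen_def)
  have "S \<subseteq> sections G (spec A)" using S(2) submod_gen_gens[of S A] by simp
  then have SG: "S \<subseteq> G x" using sectionsD[OF _ A(2)] by blast
  have "G x = submod_gen x S"
  proof
    show "submod_gen x S \<subseteq> G x" by (rule submod_gen_least[OF cohD(1)[OF G x] SG])
    show "G x \<subseteq> submod_gen x S"
    proof
      fix e assume "e \<in> G x"
      then obtain s where s: "s \<in> A" "s \<notin> max_ideal x" "s * e \<in> sections G (spec A)" using cohD(4)[OF G A] by blast
      have 1: "s * e \<in> submod_gen x S"
        using s(3) S(2) submod_gen_mono[OF spec_point(2)[OF A], of S S] by blast
      have i: "inverse s \<in> x" "s \<noteq> 0" using s spec_point(2)[OF A] unitD by blast+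
      have "inverse s * (s * e) \<in> submod_gen x S" using is_submodD(3)[OF submod_gen_submod i(1) 1] .
      then show "e \<in> submod_gen x S" using i(2) by (simp flip: mult.assoc)
    qed
  qed
  then show ?thesis using S(1) unfolding fin_gen_def by blast
qed

lemma max_ideal_fin_gen:
  assumes Q: "Q \<in> C" "Q \<noteq> K"
  shows "fin_gen Q (max_ideal Q)"
proof -
  have "coh ((\<lambda>x. x)(Q := max_ideal Q))"
  proof (rule coh_shrink[OF coh_structure Q])
    show "is_submod Q (max_ideal Q)" by (rule local_ring_max[OF point(1)[OF Q(1)]])
    show "max_ideal Q \<subseteq> Q" by (rule max_ideal_subset)
    show "a * u \<in> max_ideal Q" if "a \<in> max_ideal Q" "u \<in> Q" for a u
      using point_max(3)[OF Q(1) that(2,1)] by (simp add: mult.commute)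
    show "1 \<in> Q" by (rule point_ring(1)[OF Q(1)])
    show "\<exists>c\<in>k. u - c * 1 \<in> max_ideal Q" if "u \<in> Q" for u using residue_field[OF Q that] by simp
  qed
  from stalk_fin_gen[OF this Q(1)] show ?thesis by simp
qed

lemma point_maximal_submodule:
  assumes x: "x \<in> C" "x \<noteq> K" and M: "fin_gen x M" and J: "is_submod x J" "J \<subseteq> M" "J \<noteq> M"
  obtains N e where "is_submod x N" "J \<subseteq> N" "N \<subseteq> M" "e \<in> M" "e \<notin> N"
    "\<And>u. u \<in> M \<Longrightarrow> \<exists>c\<in>k. u - c * e \<in> N" "\<And>a u. a \<in> max_ideal x \<Longrightarrow> u \<in> M \<Longrightarrow> a * u \<in> N"
proof -
  obtain S where S: "finite S" "M = submod_gen x S" using M by (auto simp: fin_gen_def)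
  have M': "M = submod_gen x (J \<union> S)"
  proof
    show "M \<subseteq> submod_gen x (J \<union> S)" unfolding S(2) by (rule submod_gen_mono) auto
    show "submod_gen x (J \<union> S) \<subseteq> M"
      using J(2) S(2) submod_gen_gens[of S x] by (intro submod_gen_least fin_gen_submod[OF M]) auto
  qed
  have "\<exists>N e. is_submod x N \<and> J \<subseteq> N \<and> N \<subseteq> M \<and> e \<in> M \<and> e \<notin> N \<and> (\<forall>u\<in>M. \<exists>c\<in>k. u - c * e \<in> N) \<and>
    (\<forall>a\<in>max_ideal x. \<forall>u\<in>M. a * u \<in> N)"
    using residue_field[OF x] local_ring_one_minus(3)[OF point(1)[OF x(1)]]
    by (intro maximal_submodule[OF point(2)[OF x(1)] local_ring_max[OF point(1)[OF x(1)]] max_ideal_subset _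
        one_notin_max[OF point(2)[OF x(1)]] k_subring point(3)[OF x(1)] _ S(1) J(1,2) M' J(3)]) auto
  then show ?thesis using that by blast
qed

end

context dualized_curve
begin

abbreviation "H \<equiv> global_sections C \<omega>"

lemma H_iff: "h \<in> H \<longleftrightarrow> (\<forall>x\<in>C. h \<in> \<omega> x)"
  by (auto simp: global_sections_def sections_def)

lemma H_K: "H \<subseteq> K"
  using cohD(2)[OF coh_omega K_point] K_point by (auto simp: H_iff)

lemma H_submod: "is_submod k H"
  unfolding is_submod_def
  using is_submodD[OF cohD(1)[OF coh_omega]] k_scale[OF coh_omega] by (auto simp: H_iff)

lemma H_scale: "h \<in> H \<Longrightarrow> x \<in> C \<Longrightarrow> u \<in> x \<Longrightarrow> h * u \<in> \<omega> x"
  using is_submodD(3)[OF cohD(1)[OF coh_omega], of x u h] by (simp add: H_iff mult.commute)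

text \<open>Duality for the structure sheaf: a homomorphism from \<open>O\<close> to \<open>\<omega>\<close> is given by the image of \<open>1\<close>, so global
  sections of \<open>\<omega>\<close> are the linear forms on \<open>H\<^sup>1(O)\<close>.  Here \<open>\<tau> h\<close> is the form of the section \<open>h\<close>, on cocycles.\<close>

lemma structure_duality:
  obtains \<tau> where
    "\<And>h c. h \<in> H \<Longrightarrow> c \<in> cech_coboundaries1 k C structure_sheaf \<Longrightarrow> \<tau> h c = 0"
    "\<And>h c d. h \<in> H \<Longrightarrow> c \<in> cech_cocycles1 k C structure_sheaf \<Longrightarrow> d \<in> cech_cocycles1 k C structure_sheaf \<Longrightarrow>
      \<tau> h (cochain_add c d) = \<tau> h c + \<tau> h d"
    "\<And>h a c. h \<in> H \<Longrightarrow> a \<in> k \<Longrightarrow> c \<in> cech_cocycles1 k C structure_sheaf \<Longrightarrow> \<tau> h (cochain_scale a c) = a * \<tau> h c"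
    "\<And>h h' c. h \<in> H \<Longrightarrow> h' \<in> H \<Longrightarrow> c \<in> cech_cocycles1 k C structure_sheaf \<Longrightarrow> \<tau> (h + h') c = \<tau> h c + \<tau> h' c"
    "\<And>h a c. h \<in> H \<Longrightarrow> a \<in> k \<Longrightarrow> c \<in> cech_cocycles1 k C structure_sheaf \<Longrightarrow> \<tau> (a * h) c = a * \<tau> h c"
    "\<And>h c. h \<in> H \<Longrightarrow> c \<in> cech_cocycles1 k C structure_sheaf \<Longrightarrow> \<tau> h c \<in> k"
    "\<And>h h'. h \<in> H \<Longrightarrow> h' \<in> H \<Longrightarrow> (\<And>c. c \<in> cech_cocycles1 k C structure_sheaf \<Longrightarrow> \<tau> h c = \<tau> h' c) \<Longrightarrow> h = h'"
    "\<And>l. l \<in> H1_dual k C structure_sheaf \<Longrightarrow> \<exists>h\<in>H. \<forall>c\<in>cech_cocycles1 k C structure_sheaf. \<tau> h c = l c"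
proof -
  let ?O = "\<lambda>x::'a set. x"
  obtain t where t: "t \<in> H1_dual k C (fractional_sheaf \<omega>)" and
    bij: "\<And>F. coh F \<Longrightarrow> bij_betw
          (\<lambda>\<phi>. \<lambda>c\<in>cech_cocycles1 k C (fractional_sheaf F). t (\<lambda>(U, V)\<in>pairs. \<phi> (U \<inter> V) (c (U, V))))
          (sheaf_homs k C (fractional_sheaf F) (fractional_sheaf \<omega>)) (H1_dual k C (fractional_sheaf F))"
    by (rule duality) blast
  note O = structure_sheaf_def
  define \<tau> where "\<tau> = (\<lambda>h c. t (cochain_scale h c))"
  have sc: "cochain_scale h c \<in> cech_cocycles1 k C (fractional_sheaf \<omega>)"
    if "h \<in> H" "c \<in> cech_cocycles1 k C structure_sheaf" for h c
    by (rule scale_cocycle[where G = ?O]) (use H_scale that in \<open>auto simp: O\<close>)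
  define \<phi> where "\<phi> = (\<lambda>h. \<lambda>U\<in>nonempty_opens k C. \<lambda>s\<in>sections ?O U. h * s)"
  have \<phi>: "\<phi> h \<in> sheaf_homs k C structure_sheaf (fractional_sheaf \<omega>)" if "h \<in> H" for h
    unfolding \<phi>_def O using H_scale[OF that] by (intro scale_hom coh_structure)
  have one: "1 \<in> sections ?O C" using point_ring(1) by (auto intro: sectionsI)
  have form: "(\<lambda>c\<in>cech_cocycles1 k C structure_sheaf. t (\<lambda>(U, V)\<in>pairs. \<phi> h (U \<inter> V) (c (U, V)))) =
      (\<lambda>c\<in>cech_cocycles1 k C structure_sheaf. \<tau> h c)" if "h \<in> H" for h
  proof (rule restrict_ext)
    fix c assume c: "c \<in> cech_cocycles1 k C structure_sheaf"
    have "(\<lambda>(U, V)\<in>pairs. \<phi> h (U \<inter> V) (c (U, V))) = cochain_scale h c"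
      by (rule hom_cochain[where F = ?O]) (use c in \<open>auto simp: \<phi>_def O\<close>)
    then show "t (\<lambda>(U, V)\<in>pairs. \<phi> h (U \<inter> V) (c (U, V))) = \<tau> h c" by (simp add: \<tau>_def)
  qed
  note bijO = bij[OF coh_structure, folded structure_sheaf_def]
  show ?thesis
  proof (rule that[of \<tau>])
    show "\<tau> h c = 0" if "h \<in> H" "c \<in> cech_coboundaries1 k C structure_sheaf" for h c
      unfolding \<tau>_def using scale_coboundary[OF coh_structure coh_omega H_scale[OF that(1)]] that(2)
      by (intro H1_dualD(4)[OF t]) (auto simp: O)
    show "\<tau> h (cochain_add c d) = \<tau> h c + \<tau> h d"
      if "h \<in> H" "c \<in> cech_cocycles1 k C structure_sheaf" "d \<in> cech_cocycles1 k C structure_sheaf" for h c d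
    proof -
      have "cochain_scale h (cochain_add c d) = cochain_add (cochain_scale h c) (cochain_scale h d)"
        by (auto simp: cochain_scale_def distrib_left)
      then show ?thesis unfolding \<tau>_def using H1_dualD(2)[OF t sc[OF that(1,2)] sc[OF that(1,3)]] by simp
    qed
    show "\<tau> h (cochain_scale a c) = a * \<tau> h c"
      if "h \<in> H" "a \<in> k" "c \<in> cech_cocycles1 k C structure_sheaf" for h a c
    proof -
      have "cochain_scale h (cochain_scale a c) = cochain_scale a (cochain_scale h c)"
        by (auto simp: cochain_scale_def)
      then show ?thesis unfolding \<tau>_def using H1_dualD(3)[OF t that(2) sc[OF that(1,3)]] by simp
    qed
    show "\<tau> (h + h') c = \<tau> h c + \<tau> h' c"
      if "h \<in> H" "h' \<in> H" "c \<in> cech_cocycles1 k C structure_sheaf" for h h' c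
    proof -
      have "cochain_scale (h + h') c = cochain_add (cochain_scale h c) (cochain_scale h' c)"
        by (auto simp: cochain_scale_def distrib_right)
      then show ?thesis unfolding \<tau>_def using H1_dualD(2)[OF t sc[OF that(1,3)] sc[OF that(2,3)]] by simp
    qed
    show "\<tau> (a * h) c = a * \<tau> h c"
      if "h \<in> H" "a \<in> k" "c \<in> cech_cocycles1 k C structure_sheaf" for h a c
    proof -
      have "cochain_scale (a * h) c = cochain_scale a (cochain_scale h c)"
        by (auto simp: cochain_scale_def)
      then show ?thesis unfolding \<tau>_def using H1_dualD(3)[OF t that(2) sc[OF that(1,3)]] by simp
    qed
    show "\<tau> h c \<in> k" if "h \<in> H" "c \<in> cech_cocycles1 k C structure_sheaf" for h c
      unfolding \<tau>_def by (rule H1_dualD(1)[OF t sc[OF that]])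
    show "h = h'" if h: "h \<in> H" "h' \<in> H" and eq: "\<And>c. c \<in> cech_cocycles1 k C structure_sheaf \<Longrightarrow> \<tau> h c = \<tau> h' c" for h h'
    proof -
      have "(\<lambda>c\<in>cech_cocycles1 k C structure_sheaf. \<tau> h c) = (\<lambda>c\<in>cech_cocycles1 k C structure_sheaf. \<tau> h' c)"
        using eq by (rule restrict_ext)
      then have "\<phi> h = \<phi> h'"
        using inj_onD[OF bij_betw_imp_inj_on[OF bijO] _ \<phi>[OF h(1)] \<phi>[OF h(2)]] form h by simp
      then have "\<phi> h C 1 = \<phi> h' C 1" by simp
      then show ?thesis using C_nonempty_open one by (simp add: \<phi>_def)
    qed
    show "\<exists>h\<in>H. \<forall>c\<in>cech_cocycles1 k C structure_sheaf. \<tau> h c = l c" if l: "l \<in> H1_dual k C structure_sheaf" for l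
    proof -
      obtain \<psi> where \<psi>: "\<psi> \<in> sheaf_homs k C structure_sheaf (fractional_sheaf \<omega>)"
        "l = (\<lambda>c\<in>cech_cocycles1 k C structure_sheaf. t (\<lambda>(U, V)\<in>pairs. \<psi> (U \<inter> V) (c (U, V))))"
        using bij_betw_imp_surj_on[OF bijO] l by blast
      obtain w where w: "w \<in> K" "\<And>x u. x \<in> C \<Longrightarrow> u \<in> x \<Longrightarrow> w * u \<in> \<omega> x"
        "\<And>U s. U \<in> nonempty_opens k C \<Longrightarrow> s \<in> sections ?O U \<Longrightarrow> \<psi> U s = w * s"
        using hom_is_scaling[OF coh_structure coh_omega \<psi>(1)[unfolded O]] by blast
      have "w * 1 \<in> \<omega> x" if "x \<in> C" for x using w(2)[OF that point_ring(1)[OF that]] .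
      then have "w \<in> H" by (simp add: H_iff)
      moreover have "\<tau> w c = l c" if c: "c \<in> cech_cocycles1 k C structure_sheaf" for c
      proof -
        have "(\<lambda>(U, V)\<in>pairs. \<psi> (U \<inter> V) (c (U, V))) = cochain_scale w c"
          by (rule hom_cochain[where F = ?O]) (use w(3) c in \<open>auto simp: O\<close>)
        then show ?thesis using \<psi>(2) c by (simp add: \<tau>_def)
      qed
      ultimately show ?thesis by blast
    qed
  qed
qed

end

locale canonical_curve = dualized_curve +
  fixes g :: nat
  assumes genus: "has_arithmetic_genus k C g" and g2: "g \<ge> 2"
begin

text \<open>The dual basis of a basis \<open>S\<close> of \<open>H\<^sup>1(O)\<close> spans the space of global sections of \<open>\<omega>\<close>, and it has at
  least two elements.  The coordinates of a cocycle \<open>z\<close> are \<open>R z\<close>.\<close>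

lemma H_dual_basis:
  "fin_gen k H" "\<exists>h1\<in>H. \<exists>h2\<in>H. h1 \<noteq> 0 \<and> (\<forall>c\<in>k. h2 \<noteq> c * h1)"
proof -
  let ?Z = "cech_cocycles1 k C structure_sheaf" and ?B = "cech_coboundaries1 k C structure_sheaf"
  note O = structure_sheaf_def
  obtain S where S: "S \<subseteq> ?Z" "finite S" "card S = g" and
    rep0: "\<forall>z\<in>?Z. \<exists>!r. r \<in> S \<rightarrow>\<^sub>E k \<and> (\<lambda>p\<in>pairs. z p - (\<Sum>s\<in>S. r s * s p)) \<in> ?B"
    using genus unfolding has_arithmetic_genus_def by (elim exE conjE) (rule that)
  note rep = bspec[OF rep0]
  define R where "R = (\<lambda>z. THE r. r \<in> S \<rightarrow>\<^sub>E k \<and> (\<lambda>p\<in>pairs. z p - (\<Sum>s\<in>S. r s * s p)) \<in> ?B)"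
  have R: "R z \<in> S \<rightarrow>\<^sub>E k" "(\<lambda>p\<in>pairs. z p - (\<Sum>s\<in>S. R z s * s p)) \<in> ?B" if "z \<in> ?Z" for z
    using theI'[OF rep[OF that]] by (auto simp: R_def)
  have Ru: "R z = r" if "z \<in> ?Z" "r \<in> S \<rightarrow>\<^sub>E k" "(\<lambda>p\<in>pairs. z p - (\<Sum>s\<in>S. r s * s p)) \<in> ?B" for z r
    using rep[OF that(1)] R[OF that(1)] that(2,3) by blast
  have Rk: "R z s \<in> k" if "z \<in> ?Z" "s \<in> S" for z s using R(1)[OF that(1)] that(2) by auto
  have Zadd: "cochain_add c d \<in> ?Z" if "c \<in> ?Z" "d \<in> ?Z" for c d
    using cochain_add_cocycle[OF coh_structure] that by (simp add: O)
  have Zsc: "cochain_scale a c \<in> ?Z" if "a \<in> k" "c \<in> ?Z" for a c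
    using scale_cocycle[OF k_scale[OF coh_structure]] that by (simp add: O)
  have Badd: "cochain_add c d \<in> ?B" if "c \<in> ?B" "d \<in> ?B" for c d
    using cochain_add_coboundary[OF coh_structure] that by (simp add: O)
  have Bsc: "cochain_scale a c \<in> ?B" if "a \<in> k" "c \<in> ?B" for a c
    using scale_coboundary[OF coh_structure coh_structure k_scale[OF coh_structure]] that by (simp add: O)
  have BZ: "?B \<subseteq> ?Z" using coboundary_cocycle[OF coh_structure] by (auto simp: O)
  have B0: "restrict (\<lambda>_. 0) pairs \<in> ?B" using zero_coboundary[OF coh_structure] by (simp add: O)
  have Zext: "z \<in> extensional pairs" if "z \<in> ?Z" for z using cocycleD(1)[OF that[unfolded O]] .
  have coord: "restrict (\<lambda>z. R z s) ?Z \<in> H1_dual k C structure_sheaf" if s: "s \<in> S" for s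
    unfolding O
  proof (rule H1_dualI, unfold structure_sheaf_def[symmetric])
    fix c d assume cd: "c \<in> ?Z" "d \<in> ?Z"
    have "R (cochain_add c d) = (\<lambda>s\<in>S. R c s + R d s)"
    proof (rule Ru[OF Zadd[OF cd]])
      show "(\<lambda>s\<in>S. R c s + R d s) \<in> S \<rightarrow>\<^sub>E k" using Rk cd k_ring by auto
      have eq: "(\<lambda>p\<in>pairs. cochain_add c d p - (\<Sum>s\<in>S. (\<lambda>s\<in>S. R c s + R d s) s * s p)) =
          cochain_add (\<lambda>p\<in>pairs. c p - (\<Sum>s\<in>S. R c s * s p)) (\<lambda>p\<in>pairs. d p - (\<Sum>s\<in>S. R d s * s p))"
        by (auto simp: distrib_right sum.distrib)
      show "(\<lambda>p\<in>pairs. cochain_add c d p - (\<Sum>s\<in>S. (\<lambda>s\<in>S. R c s + R d s) s * s p)) \<in> ?B"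
        unfolding eq by (rule Badd[OF R(2)[OF cd(1)] R(2)[OF cd(2)]])
    qed
    then show "restrict (\<lambda>z. R z s) ?Z (cochain_add c d) = restrict (\<lambda>z. R z s) ?Z c + restrict (\<lambda>z. R z s) ?Z d"
      using Zadd[OF cd] cd s by simp
  next
    fix a c assume ac: "a \<in> k" "c \<in> ?Z"
    have "R (cochain_scale a c) = (\<lambda>s\<in>S. a * R c s)"
    proof (rule Ru[OF Zsc[OF ac]])
      show "(\<lambda>s\<in>S. a * R c s) \<in> S \<rightarrow>\<^sub>E k" using Rk ac k_ring by auto
      have eq: "(\<lambda>p\<in>pairs. cochain_scale a c p - (\<Sum>s\<in>S. (\<lambda>s\<in>S. a * R c s) s * s p)) =
          cochain_scale a (\<lambda>p\<in>pairs. c p - (\<Sum>s\<in>S. R c s * s p))"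
        by (auto simp: cochain_scale_def right_diff_distrib sum_distrib_left mult.assoc)
      show "(\<lambda>p\<in>pairs. cochain_scale a c p - (\<Sum>s\<in>S. (\<lambda>s\<in>S. a * R c s) s * s p)) \<in> ?B"
        unfolding eq by (rule Bsc[OF ac(1) R(2)[OF ac(2)]])
    qed
    then show "restrict (\<lambda>z. R z s) ?Z (cochain_scale a c) = a * restrict (\<lambda>z. R z s) ?Z c"
      using Zsc[OF ac] ac s by simp
  next
    fix c assume c: "c \<in> ?B"
    have "R c = (\<lambda>s\<in>S. 0)"
    proof (rule Ru)
      show "c \<in> ?Z" using c BZ by auto
      show "(\<lambda>s\<in>S. 0) \<in> S \<rightarrow>\<^sub>E k" using k_ring by auto
      have "(\<lambda>p\<in>pairs. c p - (\<Sum>s\<in>S. (\<lambda>s\<in>S. 0) s * s p)) = restrict c pairs" by simp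
      also have "\<dots> = c" using Zext[of c] c BZ by (auto simp: extensional_restrict)
      finally show "(\<lambda>p\<in>pairs. c p - (\<Sum>s\<in>S. (\<lambda>s\<in>S. 0) s * s p)) \<in> ?B" using c by simp
    qed
    then show "restrict (\<lambda>z. R z s) ?Z c = 0" using c BZ s by auto
  qed (use Rk s in auto)
  have Rs: "R s s' = (if s = s' then 1 else 0)" if ss: "s \<in> S" "s' \<in> S" for s s'
  proof -
    have "R s = (\<lambda>s'\<in>S. if s = s' then 1 else 0)"
    proof (rule Ru)
      show "s \<in> ?Z" using ss S by auto
      show "(\<lambda>s'\<in>S. if s = s' then 1 else 0) \<in> S \<rightarrow>\<^sub>E k" using k_ring by auto
      have "(\<lambda>p\<in>pairs. s p - (\<Sum>s'\<in>S. (\<lambda>s'\<in>S. if s = s' then 1 else 0) s' * s' p)) = restrict (\<lambda>_. 0) pairs"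
        using ss S(2) by (auto simp: if_distrib[of "\<lambda>x. x * _"] sum.delta cong: if_cong)
      then show "(\<lambda>p\<in>pairs. s p - (\<Sum>s'\<in>S. (\<lambda>s'\<in>S. if s = s' then 1 else 0) s' * s' p)) \<in> ?B" using B0 by simp
    qed
    then show ?thesis using ss by simp
  qed
  obtain \<tau> where
    \<tau>0: "\<And>h c. h \<in> H \<Longrightarrow> c \<in> ?B \<Longrightarrow> \<tau> h c = 0" and
    \<tau>1: "\<And>h c d. h \<in> H \<Longrightarrow> c \<in> ?Z \<Longrightarrow> d \<in> ?Z \<Longrightarrow> \<tau> h (cochain_add c d) = \<tau> h c + \<tau> h d" and
    \<tau>2: "\<And>h a c. h \<in> H \<Longrightarrow> a \<in> k \<Longrightarrow> c \<in> ?Z \<Longrightarrow> \<tau> h (cochain_scale a c) = a * \<tau> h c" and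
    \<tau>3: "\<And>h h' c. h \<in> H \<Longrightarrow> h' \<in> H \<Longrightarrow> c \<in> ?Z \<Longrightarrow> \<tau> (h + h') c = \<tau> h c + \<tau> h' c" and
    \<tau>4: "\<And>h a c. h \<in> H \<Longrightarrow> a \<in> k \<Longrightarrow> c \<in> ?Z \<Longrightarrow> \<tau> (a * h) c = a * \<tau> h c" and
    \<tau>5: "\<And>h c. h \<in> H \<Longrightarrow> c \<in> ?Z \<Longrightarrow> \<tau> h c \<in> k" and
    \<tau>6: "\<And>h h'. h \<in> H \<Longrightarrow> h' \<in> H \<Longrightarrow> (\<And>c. c \<in> ?Z \<Longrightarrow> \<tau> h c = \<tau> h' c) \<Longrightarrow> h = h'" and
    \<tau>7: "\<And>l. l \<in> H1_dual k C structure_sheaf \<Longrightarrow> \<exists>h\<in>H. \<forall>c\<in>?Z. \<tau> h c = l c"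
    by (rule structure_duality) blast
  have "\<exists>h\<in>H. \<forall>c\<in>?Z. \<tau> h c = R c s" if "s \<in> S" for s
    using \<tau>7[OF coord[OF that]] by auto
  then obtain w where w: "\<And>s. s \<in> S \<Longrightarrow> w s \<in> H" "\<And>s c. s \<in> S \<Longrightarrow> c \<in> ?Z \<Longrightarrow> \<tau> (w s) c = R c s" by metis
  note Hs = is_submodD[OF H_submod]
  have \<tau>z: "\<tau> 0 c = 0" if "c \<in> ?Z" for c using \<tau>4[OF Hs(1) k_ring(2) that] by simp
  have lin: "(\<Sum>s\<in>T. a s * w s) \<in> H \<and> \<tau> (\<Sum>s\<in>T. a s * w s) c = (\<Sum>s\<in>T. a s * R c s)"
    if "T \<subseteq> S" "c \<in> ?Z" "\<And>s. s \<in> S \<Longrightarrow> a s \<in> k" for T a c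
    using finite_subset[OF that(1) S(2)] that(1)
  proof (induction T rule: finite_induct)
    case empty
    then show ?case using Hs(1) \<tau>z[OF that(2)] by simp
  next
    case (insert s T)
    have s: "s \<in> S" using insert.prems by simp
    have aw: "a s * w s \<in> H" using Hs(3) w(1) that(3) s by blast
    show ?case
      using insert \<tau>3[OF aw _ that(2)] \<tau>4[OF w(1)[OF s] that(3)[OF s] that(2)] w(2)[OF s that(2)] Hs(2)[OF aw]
      by simp
  qed
  have expand: "(\<lambda>p\<in>pairs. z p - (\<Sum>s\<in>T. R z s * s p)) \<in> ?Z \<and>
      \<tau> h (\<lambda>p\<in>pairs. z p - (\<Sum>s\<in>T. R z s * s p)) = \<tau> h z - (\<Sum>s\<in>T. R z s * \<tau> h s)"
    if "T \<subseteq> S" "z \<in> ?Z" "h \<in> H" for T z h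
    using finite_subset[OF that(1) S(2)] that(1)
  proof (induction T rule: finite_induct)
    case empty
    have "(\<lambda>p\<in>pairs. z p - (\<Sum>s\<in>{}. R z s * s p)) = z" using Zext[OF that(2)] by (simp add: extensional_restrict)
    then show ?case using that(2) by simp
  next
    case (insert s T)
    have s: "s \<in> S" "s \<in> ?Z" using insert.prems S by auto
    let ?c = "\<lambda>p\<in>pairs. z p - (\<Sum>s\<in>T. R z s * s p)"
    have "T \<subseteq> S" using insert.prems by simp
    note c = conjunct1[OF insert.IH[OF this]] conjunct2[OF insert.IH[OF this]]
    have r: "- R z s \<in> k" using Rk[OF that(2) s(1)] k_ring by auto
    have eq: "(\<lambda>p\<in>pairs. z p - (\<Sum>s\<in>insert s T. R z s * s p)) = cochain_add ?c (cochain_scale (- R z s) s)"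
      using insert.hyps by (auto simp: cochain_scale_def algebra_simps)
    have "\<tau> h ?c + - R z s * \<tau> h s = \<tau> h z - (\<Sum>s\<in>insert s T. R z s * \<tau> h s)"
      unfolding c(2) using insert.hyps by simp
    then show ?case
      unfolding eq \<tau>1[OF that(3) c(1) Zsc[OF r s(2)]] \<tau>2[OF that(3) r s(2)]
      by (intro conjI Zadd[OF c(1) Zsc[OF r s(2)]])
  qed
  have "h = (\<Sum>s\<in>S. \<tau> h s * w s)" if h: "h \<in> H" for h
  proof (rule \<tau>6[OF h])
    have hk: "\<tau> h s \<in> k" if "s \<in> S" for s using \<tau>5[OF h] S(1) that by blast
    note lin' = lin[where a = "\<tau> h", OF order_refl _ hk]
    obtain z0 where "z0 \<in> ?Z" using B0 BZ by blast
    then show "(\<Sum>s\<in>S. \<tau> h s * w s) \<in> H" using lin' by blast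
    fix z assume z: "z \<in> ?Z"
    have "\<tau> h z = (\<Sum>s\<in>S. R z s * \<tau> h s)"
      using expand[OF order_refl z h] \<tau>0[OF h R(2)[OF z]] by simp
    then show "\<tau> h z = \<tau> (\<Sum>s\<in>S. \<tau> h s * w s) z" using lin'[OF z] by (simp add: mult.commute)
  qed
  then have "H \<subseteq> submod_gen k (w ` S)"
  proof -
    assume *: "\<And>h. h \<in> H \<Longrightarrow> h = (\<Sum>s\<in>S. \<tau> h s * w s)"
    show ?thesis
    proof
      fix h assume h: "h \<in> H"
      have "(\<Sum>s\<in>S. \<tau> h s * w s) \<in> submod_gen k (w ` S)"
        using \<tau>5[OF h] S(1) submod_gen_gens[of "w ` S" k]
        by (intro is_submod_sum[OF submod_gen_submod] is_submodD(3)[OF submod_gen_submod]) auto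
      then show "h \<in> submod_gen k (w ` S)" using *[OF h] by simp
    qed
  qed
  moreover have "submod_gen k (w ` S) \<subseteq> H" using w(1) by (intro submod_gen_least H_submod) auto
  ultimately show "fin_gen k H" unfolding fin_gen_def using S(2) by (intro exI[of _ "w ` S"]) auto
  obtain s1 s2 where s12: "s1 \<in> S" "s2 \<in> S" "s1 \<noteq> s2"
    using S(2,3) g2 by (metis card_le_Suc0_iff_eq not_less_eq_eq numeral_2_eq_2)
  have sZ: "s1 \<in> ?Z" "s2 \<in> ?Z" using s12 S(1) by auto
  have "w s1 \<noteq> 0"
    using w(2)[OF s12(1) sZ(1)] Rs[OF s12(1,1)] \<tau>z[OF sZ(1)] by auto
  moreover have "w s2 \<noteq> c * w s1" if "c \<in> k" for c
  proof
    assume "w s2 = c * w s1"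
    then have "\<tau> (w s2) s2 = c * \<tau> (w s1) s2" using \<tau>4[OF w(1)[OF s12(1)] that sZ(2)] by simp
    then show False using w(2) sZ s12 Rs by simp
  qed
  ultimately show "\<exists>h1\<in>H. \<exists>h2\<in>H. h1 \<noteq> 0 \<and> (\<forall>c\<in>k. h2 \<noteq> c * h1)" using w(1) s12 by blast
qed

lemma H_nonzero: "H \<noteq> {0}"
  using H_dual_basis(2) by auto

lemma stable_H: "w \<in> K \<Longrightarrow> (\<And>h. h \<in> H \<Longrightarrow> w * h \<in> H) \<Longrightarrow> w \<in> k"
  using stable_constant[OF H_dual_basis(1) H_K H_nonzero] by blast

lemma generic_stalk: "submod_gen K H = K" "\<omega> K = K"
proof -
  obtain h where h: "h \<in> H" "h \<noteq> 0" using H_dual_basis(2) by blast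
  have sup: "K \<subseteq> M" if "is_submod K M" "h \<in> M" for M
  proof
    fix u assume "u \<in> K"
    then have "(u / h) * h \<in> M" using is_submodD(3)[OF that(1) _ that(2)] subfield_divide[OF K_subfield] h H_K by blast
    then show "u \<in> M" using h by simp
  qed
  have "h \<in> submod_gen K H" by (rule subsetD[OF submod_gen_gens h(1)])
  then show "submod_gen K H = K"
    by (intro equalityI sup submod_gen_submod submod_gen_least[OF is_submod_self[OF K_subring] H_K])
  have "h \<in> \<omega> K" using h K_point by (simp add: H_iff)
  then show "\<omega> K = K" by (intro equalityI sup cohD(1,2)[OF coh_omega K_point])
qed

text \<open>If the global sections lay in a proper submodule of the stalk at \<open>Q\<close>, then the multiplier for
  a maximal one would preserve the finite-dimensional space \<open>H\<close>, and so be a constant.\<close>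

theorem H_generates:
  assumes Q: "Q \<in> C"
  shows "submod_gen Q H = \<omega> Q"
proof (cases "Q = K")
  case True
  then show ?thesis using generic_stalk by simp
next
  case False
  show ?thesis
  proof (rule ccontr)
    assume ne: "submod_gen Q H \<noteq> \<omega> Q"
    have HQ: "submod_gen Q H \<subseteq> \<omega> Q"
      using Q by (intro submod_gen_least cohD(1)[OF coh_omega Q]) (auto simp: H_iff)
    obtain N e where N: "is_submod Q N" "submod_gen Q H \<subseteq> N" "N \<subseteq> \<omega> Q" "e \<in> \<omega> Q" "e \<notin> N"
      "\<And>u. u \<in> \<omega> Q \<Longrightarrow> \<exists>c\<in>k. u - c * e \<in> N" "\<And>a u. a \<in> max_ideal Q \<Longrightarrow> u \<in> \<omega> Q \<Longrightarrow> a * u \<in> N"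
      using point_maximal_submodule[OF Q False stalk_fin_gen[OF coh_omega Q] submod_gen_submod HQ ne] by metis
    have HN: "h \<in> N" if "h \<in> H" for h using that N(2) submod_gen_gens[of H Q] by blast
    obtain w where w: "w \<in> K" "\<And>x u. x \<in> C \<Longrightarrow> u \<in> (\<omega>(Q := N)) x \<Longrightarrow> w * u \<in> \<omega> x" "\<exists>u\<in>\<omega> Q. w * u \<notin> \<omega> Q"
      using multiplier_exists[OF coh_omega Q False N(1,3,7,4,5,6)] HN unfolding global_sections_def by metis
    have "w * h \<in> H" if h: "h \<in> H" for h
      unfolding H_iff
    proof
      fix x assume x: "x \<in> C"
      have "h \<in> (\<omega>(Q := N)) x" using h HN x by (simp add: H_iff)
      then show "w * h \<in> \<omega> x" using w(2) x by blast
    qed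
    then have "w \<in> k" using stable_H w(1) by blast
    then show False using w(3) k_scale[OF coh_omega _ Q] by blast
  qed
qed

text \<open>A multiplier of the stalk of \<open>\<omega>\<close> at \<open>Q\<close> lies in the local ring.  Otherwise a multiple \<open>h'\<close> of it is
  in the socle of \<open>K / Q\<close>, and the structure sheaf can be enlarged at \<open>Q\<close> to \<open>Q + k h'\<close>.  A global section
  of the enlarged sheaf preserves \<open>H\<close> and so is constant; hence some homomorphism from the structure sheaf
  to \<open>\<omega>\<close>, multiplication by \<open>w \<in> H\<close>, does not extend to the enlarged sheaf.  But \<open>h' w\<close> is in the
  stalk of \<open>\<omega>\<close>.\<close>

theorem multiplier_in_stalk:
  assumes Q: "Q \<in> C" and h: "h \<in> K" "\<And>u. u \<in> \<omega> Q \<Longrightarrow> h * u \<in> \<omega> Q"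
  shows "h \<in> Q"
proof (rule ccontr)
  assume hQ: "h \<notin> Q"
  then have QK: "Q \<noteq> K" using h by auto
  note Qr = point_ring[OF Q]
  \<comment> \<open>Multiplication by powers of the generators \<open>F\<close> of the maximal ideal leads into the socle.\<close>
  have soc: "\<exists>h'\<in>K. h' \<notin> Q \<and> (\<forall>u\<in>\<omega> Q. h' * u \<in> \<omega> Q) \<and> (\<forall>a\<in>F. a * h' \<in> Q)"
    if "finite F" "F \<subseteq> max_ideal Q" for F
    using that
  proof (induction F rule: finite_induct)
    case empty
    then show ?case using h hQ by auto
  next
    case (insert a F)
    then obtain h' where h': "h' \<in> K" "h' \<notin> Q" "\<forall>u\<in>\<omega> Q. h' * u \<in> \<omega> Q" "\<forall>a\<in>F. a * h' \<in> Q" by auto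
    have a: "a \<in> max_ideal Q" "a \<in> Q" using insert.prems max_ideal_subset by auto
    define n where "n = (LEAST n. a ^ n * h' \<in> Q)"
    have n: "a ^ n * h' \<in> Q" using LeastI_ex[OF pole_order[OF Q h'(1) a(1)]] by (simp add: n_def)
    have "n \<noteq> 0" using n h'(2) by (metis mult_1 power_0)
    then obtain m where m: "n = Suc m" by (cases n) auto
    have "a ^ m * h' \<notin> Q" using not_less_Least[of m "\<lambda>n. a ^ n * h' \<in> Q"] m by (simp add: n_def)
    moreover have am: "a ^ m \<in> Q" using Qr(7) a by blast
    then have "a ^ m * h' \<in> K" using h' point(4)[OF Q] K_ring by blast
    moreover have "a ^ m * h' * u \<in> \<omega> Q" if "u \<in> \<omega> Q" for u
      using is_submodD(3)[OF cohD(1)[OF coh_omega Q] am, of "h' * u"] h'(3) that by (simp add: mult.assoc)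
    moreover have "b * (a ^ m * h') \<in> Q" if "b \<in> F" for b
      using Qr(4)[OF am, of "b * h'"] h'(4) that by (simp add: ac_simps)
    moreover have "a * (a ^ m * h') \<in> Q" using n m by (simp add: ac_simps)
    ultimately show ?case by (intro bexI[of _ "a ^ m * h'"]) auto
  qed
  obtain F where F: "finite F" "max_ideal Q = submod_gen Q F"
    using max_ideal_fin_gen[OF Q QK] by (auto simp: fin_gen_def)
  have "F \<subseteq> max_ideal Q" using F(2) submod_gen_gens[of F Q] by simp
  then obtain h' where h': "h' \<in> K" "h' \<notin> Q" "\<forall>u\<in>\<omega> Q. h' * u \<in> \<omega> Q" "\<forall>a\<in>F. a * h' \<in> Q"
    using soc F(1) by blast
  have "is_submod Q {a. a * h' \<in> Q}" unfolding is_submod_def using Qr by (auto simp: distrib_right mult.assoc)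
  then have "max_ideal Q \<subseteq> {a. a * h' \<in> Q}" unfolding F(2) using h'(4) by (intro submod_gen_least) auto
  then have mh: "a * h' \<in> Q" if "a \<in> max_ideal Q" for a using that by auto
  let ?M = "adjoin k Q h'" and ?G = "(\<lambda>x. x)(Q := adjoin k Q h')"
  have G: "coh ?G" by (rule coh_enlarge[OF Q QK h'(1) mh])
  have M\<omega>: "v * u \<in> \<omega> Q" if v: "v \<in> ?M" and u: "u \<in> \<omega> Q" for v u
  proof -
    obtain q c where qc: "q \<in> Q" "c \<in> k" "v = q + c * h'" using v by (elim adjoinE)
    have "q * u \<in> \<omega> Q" using is_submodD(3)[OF cohD(1)[OF coh_omega Q] qc(1) u] .
    moreover have "c * (h' * u) \<in> \<omega> Q" using k_scale[OF coh_omega qc(2) Q] h'(3) u by blast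
    ultimately have "q * u + c * (h' * u) \<in> \<omega> Q" using is_submodD(2)[OF cohD(1)[OF coh_omega Q]] by blast
    then show ?thesis using qc by (simp add: algebra_simps)
  qed
  have QM: "Q \<subseteq> ?M" "h' \<in> ?M"
    using adjoinI[OF _ k_ring(2), of _ Q h'] adjoinI[OF Qr(2) k_ring(1), of h'] by auto
  have H0: "y \<in> Q" if y: "y \<in> sections ?G C" for y
  proof -
    have "y * u \<in> \<omega> x" if x: "x \<in> C" "u \<in> \<omega> x" for x u
      using sectionsD[OF y x(1)] M\<omega> is_submodD(3)[OF cohD(1)[OF coh_omega x(1)] _ x(2)] x(2) by (cases "x = Q") auto
    then have "y * h \<in> H" if "h \<in> H" for h using that by (auto simp: H_iff)
    moreover have "y \<in> K" using sectionsD[OF y K_point] QK by simp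
    ultimately have "y \<in> k" by (intro stable_H)
    then show ?thesis using point(3)[OF Q] by blast
  qed
  obtain w where w: "w \<in> K" "\<And>x u. x \<in> C \<Longrightarrow> u \<in> (?G(Q := Q)) x \<Longrightarrow> w * u \<in> \<omega> x" "\<exists>u\<in>?G Q. w * u \<notin> \<omega> Q"
  proof (rule multiplier_exists[OF G Q QK is_submod_self[OF point(2)[OF Q]], of h'])
    show "Q \<subseteq> ?G Q" "h' \<in> ?G Q" using QM by auto
    show "a * u \<in> Q" if "a \<in> max_ideal Q" and u: "u \<in> ?G Q" for a u
    proof -
      obtain q c where qc: "q \<in> Q" "c \<in> k" "u = q + c * h'" using u by (auto elim: adjoinE)
      have "a * u = a * q + c * (a * h')" using qc by (simp add: algebra_simps)
      moreover have "a \<in> Q" "c \<in> Q" using that(1) max_ideal_subset qc point(3)[OF Q] by auto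
      ultimately show ?thesis using Qr(4,6) qc(1) mh[OF that(1)] by simp
    qed
    show "h' \<notin> Q" by (rule h'(2))
    show "\<exists>c\<in>k. u - c * h' \<in> Q" if "u \<in> ?G Q" for u
    proof -
      have "u \<in> ?M" using that by simp
      then show ?thesis
      proof (rule adjoinE)
        fix q c assume "q \<in> Q" "c \<in> k" "u = q + c * h'"
        then show ?thesis by (intro bexI[of _ c]) auto
      qed
    qed
  qed (use H0 in auto)
  have "w \<in> \<omega> Q" using w(2)[OF Q, of 1] Qr by simp
  then show False using w(3) M\<omega> by (auto simp: mult.commute)
qed

end

section \<open>Functions of degree two\<close>

context curve
begin

lemma alg_gen_k_poly: "u \<in> alg_gen k {f} \<longleftrightarrow> (\<exists>p. poly_over k p \<and> u = poly p f)"
  by (auto simp: alg_gen_single[OF k_subring])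

lemma poly_shift_unit:
  assumes "poly_over k p" "p \<noteq> 0"
  shows "\<exists>i q. poly_over k q \<and> coeff q 0 \<noteq> 0 \<and> (\<forall>s. poly p s = s ^ i * poly q s)"
  using assms
proof (induction p)
  case (pCons a p)
  show ?case
  proof (cases "a = 0")
    case False
    then show ?thesis using pCons.prems by (intro exI[of _ 0] exI[of _ "pCons a p"]) auto
  next
    case True
    then have "p \<noteq> 0" "poly_over k p" using pCons.prems k_ring(2) by (auto simp: poly_over_pCons)
    then obtain i q where q: "poly_over k q" "coeff q 0 \<noteq> 0" "\<forall>s. poly p s = s ^ i * poly q s" using pCons.IH by blast
    then show ?thesis using True by (intro exI[of _ "Suc i"] exI[of _ q]) auto
  qed
qed simp

lemma poly_mod_max:
  assumes P: "P \<in> C" and s: "s \<in> max_ideal P" and q: "poly_over k q"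
  shows "poly q s \<in> max_ideal P \<longleftrightarrow> coeff q 0 = 0"
proof -
  obtain a r where qr: "q = pCons a r" by (cases q)
  have ar: "a \<in> k" "poly_over k r" using q k_ring(2) by (auto simp: qr poly_over_pCons)
  have sP: "s \<in> P" using s max_ideal_subset by auto
  have m: "poly r s * s \<in> max_ideal P"
    by (rule point_max(3)[OF P poly_over_eval'[OF point(2,3)[OF P] ar(2) sP] s])
  show ?thesis
  proof
    assume "poly q s \<in> max_ideal P"
    then have "poly q s - poly r s * s \<in> max_ideal P"
      using is_submod_diff(2)[OF point(2)[OF P] local_ring_max[OF point(1)[OF P]]] m by blast
    then show "coeff q 0 = 0" using k_max[OF P ar(1)] by (simp add: qr mult.commute)
  next
    assume "coeff q 0 = 0"
    then show "poly q s \<in> max_ideal P" using m by (simp add: qr mult.commute)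
  qed
qed

text \<open>If the function field is \<open>k(s)\<close>, then a closed point at which \<open>s\<close> vanishes has the local ring of
  the line at the origin: each function is a power of \<open>s\<close> times a quotient of polynomials in \<open>s\<close> with
  constant terms other than zero.\<close>

lemma rational_uniformizer:
  assumes K: "frac (alg_gen k {s}) = K" and P: "P \<in> C" "P \<noteq> K" "s \<in> max_ideal P" "s \<noteq> 0"
  shows "P = loc (alg_gen k {s}) P" "\<forall>u\<in>max_ideal P. \<exists>v\<in>P. u = s * v"
proof -
  let ?D = "alg_gen k {s}" and ?R = "loc (alg_gen k {s}) P"
  have sP: "s \<in> P" using P(3) max_ideal_subset by auto
  have DP: "?D \<subseteq> P" using point[OF P(1)] sP by (intro alg_gen_least) auto
  note R = loc_props[OF point(1)[OF P(1)] alg_gen_subring DP]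
  note Rr = subringD[OF local_ring_subring[OF R(1)]]
  have sR: "s \<in> ?R" using R(2) alg_gen_gens[of "{s}" k] by auto
  have dec: "\<exists>e i j. u * s ^ j = s ^ i * e \<and> e \<in> ?R \<and> inverse e \<in> ?R \<and> e \<noteq> 0" if u: "u \<in> K" "u \<noteq> 0" for u
  proof -
    obtain a b where ab: "a \<in> ?D" "b \<in> ?D" "b \<noteq> 0" "u = a / b" using u(1) K unfolding frac_def by blast
    then obtain p q where pq: "poly_over k p" "a = poly p s" "poly_over k q" "b = poly q s"
      unfolding alg_gen_k_poly by blast
    have "p \<noteq> 0" "q \<noteq> 0" using pq ab u(2) by auto
    then obtain i p' j q' where p': "poly_over k p'" "coeff p' 0 \<noteq> 0" "a = s ^ i * poly p' s"
      and q': "poly_over k q'" "coeff q' 0 \<noteq> 0" "b = s ^ j * poly q' s"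
      using poly_shift_unit[OF pq(1)] poly_shift_unit[OF pq(3)] pq(2,4) by metis
    have D: "poly p' s \<in> ?D" "poly q' s \<in> ?D" using p' q' alg_gen_k_poly by blast+
    have u': "poly p' s \<notin> max_ideal P" "poly q' s \<notin> max_ideal P"
      using poly_mod_max[OF P(1,3)] p' q' by auto
    then have nz: "poly p' s \<noteq> 0" "poly q' s \<noteq> 0" using D DP unitD(1) by blast+
    let ?e = "poly p' s / poly q' s"
    have "?e \<in> ?R" "poly q' s / poly p' s \<in> ?R" using D u' unfolding loc_iff by blast+
    moreover have "u * s ^ j = s ^ i * ?e" using ab(4) p'(3) q'(3) nz P(4) by (simp add: field_simps)
    ultimately show ?thesis using nz by (intro exI[of _ ?e] exI[of _ i] exI[of _ j]) auto
  qed
  have main: "u \<in> ?R \<and> (u \<in> max_ideal P \<longrightarrow> (\<exists>v\<in>P. u = s * v))" if u: "u \<in> P" "u \<noteq> 0" for u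
  proof -
    obtain e i j where e: "u * s ^ j = s ^ i * e" "e \<in> ?R" "inverse e \<in> ?R" "e \<noteq> 0"
      using dec[of u] u point(4)[OF P(1)] by blast
    show ?thesis
    proof (cases "j \<le> i")
      case True
      have eq: "u = s ^ (i - j) * e"
      proof -
        have "s ^ i = s ^ j * s ^ (i - j)" using True by (simp flip: power_add)
        then have "s ^ j * u = s ^ j * (s ^ (i - j) * e)" using e(1) by (simp add: ac_simps)
        then show ?thesis using P(4) by simp
      qed
      have "u \<in> ?R" unfolding eq using Rr sR e by auto
      moreover have "\<exists>v\<in>P. u = s * v" if um: "u \<in> max_ideal P"
      proof (cases "i - j")
        case 0
        then have "u = e" using eq by simp
        then have "inverse u \<in> P" using e R(3) by auto
        then show ?thesis using um u by (simp add: max_ideal_iff)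
      next
        case (Suc n)
        then have "u = s * (s ^ n * e)" using eq by simp
        moreover have "s ^ n * e \<in> P" by (rule subsetD[OF R(3) Rr(4)[OF Rr(7)[OF sR] e(2)]])
        ultimately show ?thesis by blast
      qed
      ultimately show ?thesis by blast
    next
      case False
      then obtain n where n: "j = i + Suc n" using less_imp_Suc_add[of i j] by auto
      have "s ^ i * (u * (s * s ^ n)) = s ^ i * e" using e(1) n by (simp add: power_add ac_simps)
      then have "u * (s * s ^ n) = e" using P(4) by simp
      then have "s * (u * s ^ n * inverse e) = 1" using e(4) by (simp add: field_simps)
      moreover have "u * s ^ n * inverse e \<in> P"
        by (intro point_ring(4,7)[OF P(1)] u(1) sP subsetD[OF R(3) e(3)])
      ultimately have "inverse s \<in> P" by (metis inverse_unique)
      then show ?thesis using P by (simp add: max_ideal_iff)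
    qed
  qed
  then show "P = ?R" using R(3) Rr(2) by blast
  show "\<forall>u\<in>max_ideal P. \<exists>v\<in>P. u = s * v"
    using main max_ideal_subset point_ring(2)[OF P(1)] by (metis mult_zero_right subsetD)
qed

lemma global_constant:
  assumes "x \<in> K" "\<And>y. y \<in> C \<Longrightarrow> x \<in> y"
  shows "x \<in> k"
proof -
  have "x \<in> V" if V: "valuation_ring K V" "k \<subseteq> V" for V
  proof -
    obtain y where "y \<in> C" "dominates V y" using center_exists[OF V] by blast
    then show ?thesis using assms(2) dominatesD(1) by blast
  qed
  then have "x \<in> closure_in K k" using assms(1) by (auto simp: closure_in_def)
  then show ?thesis using closure_alg_closed[OF K_subfield k_closed k_K] by simp
qed

lemma line_center:
  assumes x: "x \<in> C" and f: "f \<noteq> 0" "f \<in> x \<or> inverse f \<in> x"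
  shows "center (projective_line k f) x \<in> projective_line k f" "dominates x (center (projective_line k f) x)"
proof -
  let ?X = "projective_line k f"
  let ?A = "alg_gen k {f}" and ?B = "alg_gen k {inverse f}"
  have sub: "alg_gen k {u} \<subseteq> x" if "u \<in> x" for u using point[OF x] that by (intro alg_gen_least) auto
  have inv: "alg_gen k {u} \<subseteq> loc (alg_gen k {inverse u}) x" if u: "u \<in> x" "inverse u \<in> x" "u \<noteq> 0" for u
  proof (rule alg_gen_least)
    note L = loc_props[OF point(1)[OF x] alg_gen_subring sub[OF u(2)]]
    show "is_subring (loc (alg_gen k {inverse u}) x)" by (rule local_ring_subring[OF L(1)])
    show "k \<subseteq> loc (alg_gen k {inverse u}) x" using L(2) alg_gen_base[of k "{inverse u}"] by auto
    have "inverse u \<notin> max_ideal x" using u by (intro unitI) auto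
    moreover have "inverse u \<in> alg_gen k {inverse u}" using alg_gen_gens[of "{inverse u}" k] by simp
    moreover have "u = 1 / inverse u" by (simp add: divide_inverse)
    ultimately have "u \<in> loc (alg_gen k {inverse u}) x"
      unfolding loc_iff using subringD(1)[OF alg_gen_subring, of k "{inverse u}"] by blast
    then show "{u} \<subseteq> loc (alg_gen k {inverse u}) x" by simp
  qed
  have both: "loc ?A x = loc ?B x" if "f \<in> x" "inverse f \<in> x"
    using inv[OF that f(1)] inv[of "inverse f"] that f(1)
    by (intro loc_eq point(1)[OF x] alg_gen_subring sub) auto
  have cand: "y = loc ?A x \<and> f \<in> x \<or> y = loc ?B x \<and> inverse f \<in> x" if y: "y \<in> ?X" "dominates x y" for y
  proof -
    have "y = loc (alg_gen k {u}) x \<and> u \<in> x" if "y \<in> spec (alg_gen k {u})" for u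
      using specD[OF alg_gen_subring that] loc_dominates[OF y(2)] dominatesD(1)[OF y(2)] alg_gen_gens[of "{u}" k] by auto
    then show ?thesis using y(1) unfolding projective_line_def by blast
  qed
  have ex: "\<exists>y\<in>?X. dominates x y"
    using f(2) loc_props(4,5)[OF point(1)[OF x] alg_gen_subring sub] unfolding projective_line_def by blast
  have "\<exists>!y. y \<in> ?X \<and> dominates x y" using ex cand both by metis
  then have "center ?X x \<in> ?X \<and> dominates x (center ?X x)" unfolding center_def by (rule theI')
  then show "center ?X x \<in> ?X" "dominates x (center ?X x)" by auto
qed

lemma spec_subset_frac:
  assumes "is_subring A"
  shows "\<Union>(spec A) = frac A"
proof
  show "frac A \<subseteq> \<Union>(spec A)" using frac_in_spec[OF assms] by blast
  show "\<Union>(spec A) \<subseteq> frac A"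
  proof
    fix u assume "u \<in> \<Union>(spec A)"
    then obtain y where y: "y \<in> spec A" "u \<in> y" by blast
    note Y = specD[OF assms y(1)]
    have "y \<subseteq> frac y" by (rule frac_incl[OF local_ring_subring[OF Y(1)]])
    then show "u \<in> frac A" using frac_loc[OF Y(1) assms Y(2)] Y(3) y(2) by auto
  qed
qed

lemma frac_inverse: "frac (alg_gen k {inverse f}) \<subseteq> frac (alg_gen k {f})"
proof (rule frac_least[OF frac_subfield[OF alg_gen_subring]], rule alg_gen_least)
  note F = frac_subfield[OF alg_gen_subring[of k "{f}"]] and I = frac_incl[OF alg_gen_subring[of k "{f}"]]
  show "is_subring (frac (alg_gen k {f}))" by (rule subfield_subring[OF F])
  show "k \<subseteq> frac (alg_gen k {f})" using I alg_gen_base[of k "{f}"] by auto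
  show "{inverse f} \<subseteq> frac (alg_gen k {f})" using I alg_gen_gens[of "{f}" k] subfield_inverse[OF F] by auto
qed

lemma function_field_line: "function_field (projective_line k f) = frac (alg_gen k {f})"
  using frac_inverse[of f] unfolding function_field_def projective_line_def
  by (simp add: spec_subset_frac[OF alg_gen_subring] Un_absorb2)

text \<open>Condition \<open>dims\<close> says that the pole divisor of \<open>f\<close>, cut out by \<open>s = 1/f\<close> on the set \<open>T\<close> of the poles, has
  degree at most two.  Let \<open>L n\<close> be the space of functions with at most an \<open>n\<close>-fold pole along it, and
  compare leading coefficients, that is, values of \<open>s ^ n x\<close> modulo \<open>s\<close>.  If they all are constant, then
  all functions without other poles are polynomials in \<open>f\<close>.  Otherwise let \<open>e\<close> be a function of least
  order with a nonconstant leading coefficient; together with \<open>1\<close> it accounts for all of them, and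
  the functions without other poles are generated by \<open>1\<close> and \<open>e\<close> over \<open>k[f]\<close>.\<close>

lemma pole_filtration:
  assumes f: "f \<in> K" "f \<notin> k" and T: "T = {x \<in> C. f \<notin> x}"
    and pole: "\<And>x. x \<in> T \<Longrightarrow> inverse f \<in> max_ideal x"
    and dims: "\<And>a b. (\<And>x. x \<in> T \<Longrightarrow> a \<in> x \<and> b \<in> x) \<Longrightarrow> \<exists>c1\<in>k. \<exists>c2\<in>k. \<exists>c3\<in>k. (c1 \<noteq> 0 \<or> c2 \<noteq> 0 \<or> c3 \<noteq> 0) \<and>
      (\<forall>x\<in>T. \<exists>u\<in>x. c1 + c2 * a + c3 * b = inverse f * u)"
  shows "\<exists>e\<in>K. \<forall>n x. x \<in> K \<and> (\<forall>y\<in>C - T. x \<in> y) \<and> (\<forall>y\<in>T. inverse f ^ n * x \<in> y) \<longrightarrow>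
    (\<exists>d\<in>alg_gen k {f}. \<exists>d'\<in>alg_gen k {f}. x = d + d' * e)"
proof -
  define s where "s = inverse f"
  let ?D = "alg_gen k {f}"
  note Dr = subringD[OF alg_gen_subring[of k "{f}"]]
  have kD: "k \<subseteq> ?D" and fD: "f \<in> ?D" using alg_gen_base[of k "{f}"] alg_gen_gens[of "{f}" k] by auto
  have f0: "f \<noteq> 0" using f(2) k_ring(2) by auto
  have sf: "s * f = 1" "f * s = 1" using f0 by (auto simp: s_def)
  define L where "L = (\<lambda>n. {x \<in> K. (\<forall>y\<in>C - T. x \<in> y) \<and> (\<forall>y\<in>T. s ^ n * x \<in> y)})"
  have TC: "y \<in> C" if "y \<in> T" for y using that T by auto
  have fy: "f \<in> y" if "y \<in> C - T" for y using that T by auto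
  have sT: "s \<in> max_ideal y" "s \<in> y" if "y \<in> T" for y using pole[OF that] max_ideal_subset by (auto simp: s_def)
  have ky: "c \<in> y" if "c \<in> k" "y \<in> C" for c y using point(3) that by blast
  have L0: "L 0 \<subseteq> k" using global_constant TC unfolding L_def by auto
  have T0: "T \<noteq> {}"
  proof
    assume "T = {}"
    then have "f \<in> k" using global_constant[OF f(1)] T by blast
    then show False using f(2) by simp
  qed
  have step: "x - c * f ^ Suc n - c' * (f ^ (Suc n - m) * e) \<in> L n"
    if x: "x \<in> L (Suc n)" and c: "c \<in> k" "c' \<in> k" and e: "e \<in> L m" "m \<le> Suc n"
      and u: "\<forall>y\<in>T. \<exists>u\<in>y. s ^ Suc n * x - c - c' * (s ^ m * e) = s * u" for x c c' e m n
  proof -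
    let ?x = "x - c * f ^ Suc n - c' * (f ^ (Suc n - m) * e)"
    have xe: "x \<in> K" "e \<in> K" using x e by (auto simp: L_def)
    have comb: "?x \<in> R" if "is_subring R" "x \<in> R" "e \<in> R" "c \<in> R" "c' \<in> R" "f \<in> R" for R
      by (intro subringD(3,4,7)[OF that(1)] that)
    have "?x \<in> K" using xe c f(1) k_K by (intro comb K_subring) auto
    moreover have "?x \<in> y" if y: "y \<in> C - T" for y
    proof -
      have "x \<in> y" "e \<in> y" "c \<in> y" "c' \<in> y" "f \<in> y" "y \<in> C" using x e y fy[OF y] ky c by (auto simp: L_def)
      then show ?thesis by (intro comb point(2))
    qed
    moreover have "s ^ n * ?x \<in> y" if y: "y \<in> T" for y
    proof -
      obtain u where u: "u \<in> y" "s ^ Suc n * x - c - c' * (s ^ m * e) = s * u" using u y by blast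
      have p: "s ^ Suc n * f ^ Suc n = 1" using sf by (metis power_mult_distrib power_one)
      have q: "s ^ Suc n * f ^ (Suc n - m) = s ^ m"
      proof -
        have "s ^ Suc n = s ^ m * s ^ (Suc n - m)" using e(2) by (metis le_add_diff_inverse power_add)
        then have "s ^ Suc n * f ^ (Suc n - m) = s ^ m * (s * f) ^ (Suc n - m)" by (simp add: power_mult_distrib mult.assoc)
        then show ?thesis using sf by simp
      qed
      have "s * (s ^ n * ?x) = s ^ Suc n * x - c * (s ^ Suc n * f ^ Suc n) - c' * ((s ^ Suc n * f ^ (Suc n - m)) * e)"
        by (simp add: algebra_simps)
      also have "\<dots> = s * u" using u(2) unfolding p q by simp
      finally have "s ^ n * ?x = u" using sf by (metis mult_cancel_left mult_zero_left zero_neq_one)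
      then show ?thesis using u by simp
    qed
    ultimately show ?thesis by (simp add: L_def)
  qed
  define scalar where "scalar = (\<lambda>n x. \<exists>c\<in>k. \<forall>y\<in>T. \<exists>u\<in>y. s ^ n * x - c = s * u)"
  have low: "L n \<subseteq> ?D" if "\<And>m. m \<le> n \<Longrightarrow> \<forall>x\<in>L m. scalar m x" for n
    using that
  proof (induction n)
    case (Suc n)
    show ?case
    proof
      fix x assume x: "x \<in> L (Suc n)"
      then obtain c where c: "c \<in> k" "\<forall>y\<in>T. \<exists>u\<in>y. s ^ Suc n * x - c = s * u" using Suc.prems[of "Suc n"] by (auto simp: scalar_def)
      have "x - c * f ^ Suc n - 0 * (f ^ (Suc n - Suc n) * x) \<in> L n"
        using c by (intro step[OF x c(1) k_ring(2) x order_refl]) auto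
      then have "x - c * f ^ Suc n \<in> ?D" using Suc by auto
      then have "(x - c * f ^ Suc n) + c * f ^ Suc n \<in> ?D"
        by (intro Dr(6) Dr(4)[OF subsetD[OF kD c(1)] Dr(7)[OF fD]])
      then show "x \<in> ?D" by simp
    qed
  qed (use L0 kD in auto)
  show ?thesis
  proof (cases "\<forall>n. \<forall>x\<in>L n. scalar n x")
    case True
    then have "L n \<subseteq> ?D" for n using low by blast
    have "\<exists>d\<in>?D. \<exists>d'\<in>?D. x = d + d' * 0"
      if "x \<in> K \<and> (\<forall>y\<in>C - T. x \<in> y) \<and> (\<forall>y\<in>T. inverse f ^ n * x \<in> y)" for n x
    proof -
      have "x \<in> L n" using that by (simp add: L_def s_def)
      then have "x \<in> ?D" using \<open>\<And>n. L n \<subseteq> ?D\<close> by blast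
      then show ?thesis by (intro bexI[of _ x] bexI[of _ 0] Dr(2)) simp_all
    qed
    then show ?thesis using K_ring(2) by blast
  next
    case False
    define m where "m = (LEAST m. \<exists>x\<in>L m. \<not> scalar m x)"
    obtain e where e: "e \<in> L m" "\<not> scalar m e"
      using LeastI_ex[of "\<lambda>m. \<exists>x\<in>L m. \<not> scalar m x"] False unfolding m_def by blast
    have less: "scalar n x" if "n < m" "x \<in> L n" for n x
      using not_less_Least[of n "\<lambda>m. \<exists>x\<in>L m. \<not> scalar m x"] that unfolding m_def by blast
    have "m \<noteq> 0"
    proof
      assume "m = 0"
      then have "e \<in> k" using e L0 by auto
      then have "scalar m e" unfolding scalar_def \<open>m = 0\<close> using point_ring(2)[OF TC]
        by (intro bexI[of _ e] ballI bexI[of _ 0]) auto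
      then show False using e by simp
    qed
    have "x \<in> {d + d' * e |d d'. d \<in> ?D \<and> d' \<in> ?D}" if "x \<in> L n" for n x
      using that
    proof (induction n arbitrary: x)
      case 0
      then show ?case using L0 kD Dr(2) by (intro CollectI exI[of _ x] exI[of _ 0]) auto
    next
      case (Suc n)
      show ?case
      proof (cases "Suc n < m")
        case True
        then have "x \<in> ?D" using low[of "Suc n"] less Suc.prems by auto
        then show ?thesis using Dr(2) by (intro CollectI exI[of _ x] exI[of _ 0]) auto
      next
        case False
        have "\<exists>c1\<in>k. \<exists>c2\<in>k. \<exists>c3\<in>k. (c1 \<noteq> 0 \<or> c2 \<noteq> 0 \<or> c3 \<noteq> 0) \<and>
            (\<forall>y\<in>T. \<exists>u\<in>y. c1 + c2 * (s ^ m * e) + c3 * (s ^ Suc n * x) = inverse f * u)"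
          using e(1) Suc.prems by (intro dims) (auto simp: L_def)
        then obtain c1 c2 c3 where c: "c1 \<in> k" "c2 \<in> k" "c3 \<in> k" "c1 \<noteq> 0 \<or> c2 \<noteq> 0 \<or> c3 \<noteq> 0"
          "\<forall>y\<in>T. \<exists>u\<in>y. c1 + c2 * (s ^ m * e) + c3 * (s ^ Suc n * x) = s * u" unfolding s_def by blast
        have c3: "c3 \<noteq> 0"
        proof
          assume 3: "c3 = 0"
          show False
          proof (cases "c2 = 0")
            case True
            obtain y where y: "y \<in> T" using T0 by blast
            then obtain u where "u \<in> y" "c1 = s * u" using c(5) True 3 by auto
            then have "c1 \<in> max_ideal y" using point_max(3)[OF TC[OF y], of u s] sT[OF y] by (simp add: mult.commute)
            then show False using k_max[OF TC[OF y] c(1)] c(4) True 3 by simp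
          next
            case False
            have i: "inverse c2 \<in> k" using subfield_inverse[OF k_subfield c(2)] .
            have "scalar m e"
              unfolding scalar_def
            proof (rule bexI[of _ "- (inverse c2 * c1)"], rule ballI)
              show "- (inverse c2 * c1) \<in> k" using i c k_ring by auto
              fix y assume y: "y \<in> T"
              then obtain u where u: "u \<in> y" "c1 + c2 * (s ^ m * e) = s * u" using c(5) 3 by auto
              have "s ^ m * e - - (inverse c2 * c1) = inverse c2 * (c1 + c2 * (s ^ m * e))"
                using False by (simp add: field_simps)
              also have "\<dots> = s * (inverse c2 * u)" unfolding u(2) by simp
              finally show "\<exists>u\<in>y. s ^ m * e - - (inverse c2 * c1) = s * u"
                using point_ring(4)[OF TC[OF y] ky[OF i TC[OF y]] u(1)] by blast
            qed
            then show False using e(2) by simp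
          qed
        qed
        define b1 b2 where "b1 = - (inverse c3 * c1)" and "b2 = - (inverse c3 * c2)"
        have i: "inverse c3 \<in> k" using subfield_inverse[OF k_subfield c(3)] .
        have b: "b1 \<in> k" "b2 \<in> k" using i c k_ring by (auto simp: b1_def b2_def)
        have "\<exists>u\<in>y. s ^ Suc n * x - b1 - b2 * (s ^ m * e) = s * u" if y: "y \<in> T" for y
        proof -
          obtain u where u: "u \<in> y" "c1 + c2 * (s ^ m * e) + c3 * (s ^ Suc n * x) = s * u" using c(5) y by blast
          have "s ^ Suc n * x - b1 - b2 * (s ^ m * e) = inverse c3 * (c1 + c2 * (s ^ m * e) + c3 * (s ^ Suc n * x))"
            using c3 by (simp add: b1_def b2_def field_simps)
          also have "\<dots> = s * (inverse c3 * u)" unfolding u(2) by simp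
          finally show ?thesis using point_ring(4)[OF TC[OF y] ky[OF i TC[OF y]] u(1)] by blast
        qed
        then have "x - b1 * f ^ Suc n - b2 * (f ^ (Suc n - m) * e) \<in> L n"
          using False by (intro step[OF Suc.prems b e(1)]) auto
        then obtain d d' where d: "d \<in> ?D" "d' \<in> ?D" "x - b1 * f ^ Suc n - b2 * (f ^ (Suc n - m) * e) = d + d' * e"
          using Suc.IH by blast
        have "x = (d + b1 * f ^ Suc n) + (d' + b2 * f ^ (Suc n - m)) * e"
          using d(3) by (simp add: algebra_simps)
        moreover have "d + b1 * f ^ Suc n \<in> ?D" "d' + b2 * f ^ (Suc n - m) \<in> ?D"
          by (intro Dr(6)[OF d(1)] Dr(6)[OF d(2)] Dr(4)[OF subsetD[OF kD b(1)] Dr(7)[OF fD]]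
              Dr(4)[OF subsetD[OF kD b(2)] Dr(7)[OF fD]])+
        ultimately show ?thesis by blast
      qed
    qed
    note span = this
    show ?thesis
    proof (rule bexI[of _ e])
      show "e \<in> K" using e(1) by (simp add: L_def)
      have "\<exists>d\<in>?D. \<exists>d'\<in>?D. x = d + d' * e"
        if "x \<in> K \<and> (\<forall>y\<in>C - T. x \<in> y) \<and> (\<forall>y\<in>T. inverse f ^ n * x \<in> y)" for n x
      proof -
        have "x \<in> L n" using that by (simp add: L_def s_def)
        from span[OF this] show ?thesis by blast
      qed
      then show "\<forall>n x. x \<in> K \<and> (\<forall>y\<in>C - T. x \<in> y) \<and> (\<forall>y\<in>T. inverse f ^ n * x \<in> y) \<longrightarrow>
          (\<exists>d\<in>?D. \<exists>d'\<in>?D. x = d + d' * e)" by (intro allI impI)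
    qed
  qed
qed

text \<open>A function with a pole divisor of degree at most two, but not one, is a map of degree two to the line.
  The function field is spanned by \<open>1\<close> and \<open>e\<close> over \<open>k(f)\<close>, because each function is a quotient of
  one without poles outside \<open>T\<close> by a polynomial in \<open>f\<close>.  It is not \<open>k(f)\<close> itself, as then the pole divisor
  would be a single reduced point.\<close>

theorem hyperellipticI:
  assumes f: "f \<in> K" "f \<notin> k" and T: "T = {x \<in> C. f \<notin> x}"
    and pole: "\<And>x. x \<in> T \<Longrightarrow> inverse f \<in> max_ideal x"
    and dims: "\<And>a b. (\<And>x. x \<in> T \<Longrightarrow> a \<in> x \<and> b \<in> x) \<Longrightarrow> \<exists>c1\<in>k. \<exists>c2\<in>k. \<exists>c3\<in>k. (c1 \<noteq> 0 \<or> c2 \<noteq> 0 \<or> c3 \<noteq> 0) \<and>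
      (\<forall>x\<in>T. \<exists>u\<in>x. c1 + c2 * a + c3 * b = inverse f * u)"
    and deg: "\<And>P. T = {P} \<Longrightarrow> \<exists>u\<in>max_ideal P. \<forall>v\<in>P. u \<noteq> inverse f * v"
  shows "hyperelliptic k C"
proof -
  let ?D = "alg_gen k {f}"
  define L where "L = frac ?D"
  note Dr = subringD[OF alg_gen_subring[of k "{f}"]]
  have kD: "k \<subseteq> ?D" and fD: "f \<in> ?D" using alg_gen_base[of k "{f}"] alg_gen_gens[of "{f}" k] by auto
  have f0: "f \<noteq> 0" using f(2) k_ring(2) by auto
  have TC: "y \<in> C" if "y \<in> T" for y using that T by auto
  have TK: "y \<noteq> K" if "y \<in> T" for y using that T f(1) by auto
  have L: "is_subfield L" "?D \<subseteq> L" "L \<subseteq> K"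
    using frac_subfield[OF alg_gen_subring] frac_incl[OF alg_gen_subring[of k "{f}"]]
      frac_least[OF K_subfield alg_gen_K[OF k_K, of "{f}"]] f by (auto simp: L_def)
  note Lr = subringD[OF subfield_subring[OF L(1)]]
  have T0: "T \<noteq> {}"
  proof
    assume "T = {}"
    then have "f \<in> k" using global_constant[OF f(1)] T by blast
    then show False using f(2) by simp
  qed
  have LK: "L \<noteq> K"
  proof
    assume "L = K"
    then have s: "frac (alg_gen k {inverse f}) = K"
      using frac_inverse[of f] frac_inverse[of "inverse f"] by (auto simp: L_def)
    have i0: "inverse f \<noteq> 0" using f0 by simp
    have one: "P = loc (alg_gen k {inverse f}) P" "\<forall>u\<in>max_ideal P. \<exists>v\<in>P. u = inverse f * v" if "P \<in> T" for P
      using rational_uniformizer[OF s TC[OF that] TK[OF that] pole[OF that] i0] by blast+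
    obtain P where P: "P \<in> T" using T0 by blast
    have "Q = P" if Q: "Q \<in> T" for Q
    proof -
      have "max_ideal Q \<inter> alg_gen k {inverse f} = max_ideal P \<inter> alg_gen k {inverse f}"
        using poly_mod_max[OF TC[OF P] pole[OF P]] poly_mod_max[OF TC[OF Q] pole[OF Q]]
        by (auto simp: alg_gen_k_poly)
      then show ?thesis using one(1)[OF P] one(1)[OF Q] loc_cong by metis
    qed
    then have "T = {P}" using P by blast
    then show False using deg one(2)[OF P] by blast
  qed
  obtain e where e: "e \<in> K" "\<And>n x. x \<in> K \<and> (\<forall>y\<in>C - T. x \<in> y) \<and> (\<forall>y\<in>T. inverse f ^ n * x \<in> y) \<Longrightarrow>
    \<exists>d\<in>?D. \<exists>d'\<in>?D. x = d + d' * e"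
    using pole_filtration[OF f T pole dims] by blast
  have span: "\<exists>c\<in>L. \<exists>c'\<in>L. x = c + c' * e" if x: "x \<in> K" for x
  proof -
    define F where "F = {y \<in> C. x \<notin> y} - T"
    have F: "finite F" using finite_poles[OF x] by (simp add: F_def)
    have "\<exists>d\<in>?D. d \<noteq> 0 \<and> d * x \<in> y" if y: "y \<in> F" for y
    proof -
      have yC: "y \<in> C" "f \<in> y" "y \<noteq> K" using y T x by (auto simp: F_def)
      obtain c where c: "c \<in> k" "f - c \<in> max_ideal y" using residue_field[OF yC(1,3,2)] by blast
      obtain n where n: "(f - c) ^ n * x \<in> y" using pole_order[OF yC(1) x c(2)] by blast
      have "f - c \<noteq> 0" using f(2) c(1) by auto
      moreover have "f - c \<in> ?D" using fD c kD Dr(3) by blast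
      ultimately show ?thesis using n Dr(7) by (intro bexI[of _ "(f - c) ^ n"]) auto
    qed
    then obtain h where h: "\<And>y. y \<in> F \<Longrightarrow> h y \<in> ?D \<and> h y \<noteq> 0 \<and> h y * x \<in> y" by metis
    define d where "d = prod h F"
    have d: "d \<in> ?D" "d \<noteq> 0"
      unfolding d_def using h F by (auto intro!: subring_prod[OF alg_gen_subring] simp: prod_zero_iff)
    have dx: "d * x \<in> y" if y: "y \<in> C - T" for y
    proof -
      have Dy: "?D \<subseteq> y" using point[of y] y T by (intro alg_gen_least) auto
      have yC: "y \<in> C" using y by simp
      show ?thesis
      proof (cases "x \<in> y")
        case True
        then show ?thesis using d Dy point_ring(4)[OF yC] by blast
      next
        case False
        then have yF: "y \<in> F" using y by (auto simp: F_def)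
        have "prod h (F - {y}) \<in> ?D" using h by (intro subring_prod[OF alg_gen_subring]) auto
        then have "prod h (F - {y}) * (h y * x) \<in> y" using h[OF yF] Dy point_ring(4)[OF yC] by blast
        then show ?thesis unfolding d_def prod.remove[OF F yF] by (simp add: ac_simps)
      qed
    qed
    have dxK: "d * x \<in> K" using d L x K_ring(4) by blast
    have fT: "finite T" using finite_poles[OF f(1)] T by simp
    have "\<exists>n. \<forall>y\<in>S. inverse f ^ n * (d * x) \<in> y" if "finite S" "S \<subseteq> T" for S
      using that
    proof (induction S rule: finite_induct)
      case (insert y S)
      then obtain n where n: "\<forall>y\<in>S. inverse f ^ n * (d * x) \<in> y" by auto
      have yT: "y \<in> T" using insert.prems by simp
      obtain m where m: "inverse f ^ m * (d * x) \<in> y" using pole_order[OF TC[OF yT] dxK pole[OF yT]] by blast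
      have up: "inverse f ^ (i + j) * (d * x) \<in> z" if "inverse f ^ i * (d * x) \<in> z" "z \<in> T" for i j z
      proof -
        have "inverse f \<in> z" using pole[OF that(2)] max_ideal_subset by auto
        then have "inverse f ^ j * (inverse f ^ i * (d * x)) \<in> z"
          by (intro point_ring(4)[OF TC[OF that(2)] _ that(1)] point_ring(7)[OF TC[OF that(2)]])
        then show ?thesis by (simp add: power_add ac_simps)
      qed
      have "\<forall>z\<in>insert y S. inverse f ^ (n + m) * (d * x) \<in> z"
        using up[of n _ m] up[OF m yT, of n] n insert.prems by (auto simp: add.commute)
      then show ?case by blast
    qed simp
    then obtain n where "\<forall>y\<in>T. inverse f ^ n * (d * x) \<in> y" using fT by blast
    then obtain a b where ab: "a \<in> ?D" "b \<in> ?D" "d * x = a + b * e" using e(2)[of "d * x" n] dx dxK by blast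
    have "x = a / d + (b / d) * e" using ab(3) d(2) by (simp add: field_simps)
    moreover have "a / d \<in> L" "b / d \<in> L" using ab d L by (auto intro!: subfield_divide)
    ultimately show ?thesis by blast
  qed
  have eL: "e \<notin> L"
  proof
    assume "e \<in> L"
    then have "K \<subseteq> L" using span Lr(4,6) by blast
    then show False using LK L(3) by blast
  qed
  have ext: "extension_degree L K 2"
    unfolding extension_degree_def
  proof (intro exI[of _ "{1, e}"] conjI ballI)
    have e1: "e \<noteq> 1" using eL Lr(1) by auto
    then show "card {1, e} = 2" by simp
    show "{1, e} \<subseteq> K" using e(1) K_ring by simp
    have sum: "(\<Sum>s\<in>{1, e}. c s * s) = c 1 + c e * e" for c using e1 by simp
    fix x assume "x \<in> K"
    then obtain c c' where c: "c \<in> L" "c' \<in> L" "x = c + c' * e" using span by blast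
    show "\<exists>!c. c \<in> {1, e} \<rightarrow>\<^sub>E L \<and> x = (\<Sum>s\<in>{1, e}. c s * s)"
      unfolding sum
    proof (rule ex1I[of _ "\<lambda>s\<in>{1, e}. if s = 1 then c else c'"])
      show "(\<lambda>s\<in>{1, e}. if s = 1 then c else c') \<in> {1, e} \<rightarrow>\<^sub>E L \<and>
          x = (\<lambda>s\<in>{1, e}. if s = 1 then c else c') 1 + (\<lambda>s\<in>{1, e}. if s = 1 then c else c') e * e"
      proof
        show "(\<lambda>s\<in>{1, e}. if s = 1 then c else c') \<in> {1, e} \<rightarrow>\<^sub>E L" using c(1,2) by simp
        show "x = (\<lambda>s\<in>{1, e}. if s = 1 then c else c') 1 + (\<lambda>s\<in>{1, e}. if s = 1 then c else c') e * e"
          using c(3) e1 by simp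
      qed
      fix b assume b: "b \<in> {1, e} \<rightarrow>\<^sub>E L \<and> x = b 1 + b e * e"
      then have bL: "b 1 \<in> L" "b e \<in> L" by auto
      have eq: "(b e - c') * e = c - b 1" using b c(3) by (simp add: algebra_simps)
      have "b e = c'"
      proof (rule ccontr)
        assume "b e \<noteq> c'"
        then have "e = (c - b 1) / (b e - c')" using eq by (simp add: field_simps)
        moreover have "(c - b 1) / (b e - c') \<in> L" using bL c Lr by (intro subfield_divide L(1)) auto
        ultimately show False using eL by simp
      qed
      then have "b 1 = c" using eq by simp
      then show "b = (\<lambda>s\<in>{1, e}. if s = 1 then c else c')"
        using b \<open>b e = c'\<close> e1 by (auto simp: PiE_iff extensional_def)
    qed
  qed simp
  have "transcendental_over k f"
    unfolding transcendental_over_def using k_transcendental[OF f] by (auto simp: poly_over_def)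
  moreover have "f \<in> x \<or> inverse f \<in> x" if "x \<in> C" for x
    using that T pole max_ideal_subset by blast
  then have "is_morphism C (projective_line k f) (center (projective_line k f))"
    unfolding is_morphism_def using line_center[OF _ f0] by blast
  ultimately show ?thesis
    unfolding hyperelliptic_def using f(1) ext function_field_line by (auto simp: L_def)
qed

end

section \<open>The local rings of the canonical model\<close>

lemma mem_scale_set: "v \<noteq> 0 \<Longrightarrow> u \<in> scale_set v A \<longleftrightarrow> u / v \<in> A"
  unfolding scale_set_def by (force simp: field_simps)

lemma scale_set_submod: "is_submod A M \<Longrightarrow> is_submod A (scale_set v M)"
proof -
  assume M: "is_submod A M"
  have "v * x + v * y \<in> scale_set v M" if "x \<in> M" "y \<in> M" for x y
    unfolding scale_set_def distrib_left[symmetric] using is_submodD(2)[OF M that] by blast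
  moreover have "a * (v * x) \<in> scale_set v M" if "a \<in> A" "x \<in> M" for a x
    unfolding scale_set_def mult.left_commute[of a] using is_submodD(3)[OF M that] by blast
  moreover have "v * 0 \<in> scale_set v M" unfolding scale_set_def using is_submodD(1)[OF M] by blast
  ultimately show ?thesis unfolding is_submod_def by (auto simp: scale_set_def)
qed

context curve
begin

lemma chart_ring_facts:
  "is_subring (chart_ring k H v)" "k \<subseteq> chart_ring k H v" "u \<in> H \<Longrightarrow> u / v \<in> chart_ring k H v"
proof -
  show "is_subring (chart_ring k H v)" unfolding chart_ring_def by (rule alg_gen_subring)
  show "k \<subseteq> chart_ring k H v" unfolding chart_ring_def by (rule alg_gen_base)
  show "u \<in> H \<Longrightarrow> u / v \<in> chart_ring k H v"
    unfolding chart_ring_def by (rule subsetD[OF alg_gen_gens]) blast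
qed

lemma chart_ring_least:
  "is_subring B \<Longrightarrow> k \<subseteq> B \<Longrightarrow> (\<And>u. u \<in> H \<Longrightarrow> u / v \<in> B) \<Longrightarrow> chart_ring k H v \<subseteq> B"
  unfolding chart_ring_def by (rule alg_gen_least) auto

text \<open>The standard affine pieces of projective space are glued along the quotients \<open>v / v'\<close>.\<close>

lemma chart_loc_eq:
  assumes W: "local_ring W" and v: "v \<in> H" "v \<noteq> 0" "v' \<in> H" "v' \<noteq> 0"
    and c: "chart_ring k H v \<subseteq> W" "chart_ring k H v' \<subseteq> W"
  shows "loc (chart_ring k H v) W = loc (chart_ring k H v') W"
proof -
  have half: "chart_ring k H a \<subseteq> loc (chart_ring k H b) W"
    if ab: "a \<in> H" "a \<noteq> 0" "b \<in> H" "b \<noteq> 0" "chart_ring k H a \<subseteq> W" "chart_ring k H b \<subseteq> W" for a b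
  proof (rule chart_ring_least)
    note L = loc_props[OF W chart_ring_facts(1) ab(6)]
    show "is_subring (loc (chart_ring k H b) W)" by (rule local_ring_subring[OF L(1)])
    show "k \<subseteq> loc (chart_ring k H b) W" using L(2) chart_ring_facts(2) by blast
    fix u assume u: "u \<in> H"
    have "b / a \<in> W" using chart_ring_facts(3)[OF ab(3)] ab(5) by blast
    then have "a / b \<notin> max_ideal W" using ab by (intro unitI) auto
    moreover have "u / a = (u / b) / (a / b)" using ab by simp
    ultimately show "u / a \<in> loc (chart_ring k H b) W"
      unfolding loc_iff using chart_ring_facts(3)[OF u] chart_ring_facts(3)[OF ab(1)] by blast
  qed
  show ?thesis using half v c by (intro loc_eq[OF W chart_ring_facts(1) c(1) chart_ring_facts(1) c(2)]) auto
qed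

end

context canonical_curve
begin

lemma H_omega: "h \<in> H \<Longrightarrow> x \<in> C \<Longrightarrow> h \<in> \<omega> x"
  by (simp add: H_iff)

text \<open>As \<open>H\<close> generates the stalk, some section in \<open>H\<close> is not in the maximal ideal times the generator.\<close>

lemma principal_generator:
  assumes x: "x \<in> C" and w: "w \<noteq> 0" "\<omega> x = scale_set w x"
  obtains v where "v \<in> H" "v \<noteq> 0" "\<omega> x = scale_set v x"
proof -
  have "\<exists>v\<in>H. v / w \<notin> max_ideal x"
  proof (rule ccontr)
    assume "\<not> ?thesis"
    then have "H \<subseteq> scale_set w (max_ideal x)" using mem_scale_set[OF w(1)] by blast
    then have "\<omega> x \<subseteq> scale_set w (max_ideal x)"
      unfolding H_generates[OF x, symmetric]
      by (intro submod_gen_least scale_set_submod local_ring_max point(1)[OF x])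
    then have "w / w \<in> max_ideal x"
      using w point_ring(1)[OF x] mem_scale_set[OF w(1)] by (metis divide_self subsetD)
    then show False using w(1) one_notin_max[OF point(2)[OF x]] by simp
  qed
  then obtain v where v: "v \<in> H" "v / w \<notin> max_ideal x" by blast
  have vw: "v / w \<in> x" using H_omega[OF v(1) x] w mem_scale_set by blast
  then have i: "v / w \<noteq> 0" "inverse (v / w) \<in> x" using v(2) unitD by blast+
  then have v0: "v \<noteq> 0" by auto
  have "u / w \<in> x \<longleftrightarrow> u / v \<in> x" for u
  proof -
    have "u / v = (u / w) * inverse (v / w)" "u / w = (u / v) * (v / w)" using v0 w(1) by (simp_all add: field_simps)
    then show ?thesis using i(2) vw point_ring(4)[OF x] by metis
  qed
  then have "scale_set w x = scale_set v x" using mem_scale_set w(1) v0 by blast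
  then show ?thesis using that v(1) v0 w(2) by metis
qed

lemma gorenstein_point:
  assumes "x \<in> gorenstein_locus k C \<omega>"
  shows "x \<in> C" "\<exists>w. w \<noteq> 0 \<and> \<omega> x = scale_set w x"
proof -
  obtain U where U: "openin (zariski k C) U" "invertible_on k \<omega> U" "x \<in> U"
    using assms unfolding gorenstein_locus_def by blast
  then obtain A where A: "affine A" "x \<in> spec A"
    unfolding open_iff[OF separated_C] affine_def by blast
  then show "x \<in> C" using affineD(5) by blast
  show "\<exists>w. w \<noteq> 0 \<and> \<omega> x = scale_set w x"
    using U(2,3) unfolding invertible_on_def by blast
qed

lemma gorenstein_open: "openin (zariski k C) (gorenstein_locus k C \<omega>)"
  unfolding gorenstein_locus_def by (rule openin_Union) blast

end

text \<open>The local situation at a closed Gorenstein point \<open>P\<close>; a generator \<open>v\<close> of the stalk exists among the global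
  sections by \<open>principal_generator\<close>.\<close>

locale gorenstein_closed_point = canonical_curve +
  fixes P :: "'a set" and v :: 'a
  assumes P: "P \<in> C" "P \<noteq> K" and v: "v \<in> H" "v \<noteq> 0" and \<omega>P: "\<omega> P = scale_set v P"
    and nonhyperelliptic: "\<not> hyperelliptic k C"
begin

text \<open>The sections that vanish at \<open>P\<close>.\<close>

definition W :: "'a set" where
  "W = {h \<in> H. h / v \<in> max_ideal P}"

lemma omega_P_iff: "u \<in> \<omega> P \<longleftrightarrow> u / v \<in> P"
  unfolding \<omega>P by (rule mem_scale_set[OF v(2)])

lemma W_residue:
  assumes "h \<in> H"
  shows "\<exists>c\<in>k. h - c * v \<in> W"
proof -
  have "h / v \<in> P" using omega_P_iff H_omega[OF assms P(1)] by blast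
  then obtain c where c: "c \<in> k" "h / v - c \<in> max_ideal P" using residue_field[OF P] by blast
  have "(h - c * v) / v = h / v - c" using v(2) by (simp add: diff_divide_distrib)
  moreover have "h - c * v \<in> H"
    using is_submod_diff(2)[OF k_subring H_submod assms is_submodD(3)[OF H_submod c(1) v(1)]] .
  ultimately show ?thesis using c by (intro bexI[of _ c]) (auto simp: W_def)
qed

lemma W_submod: "is_submod k W"
proof -
  note m = point_max[OF P(1)]
  show ?thesis
    unfolding is_submod_def W_def
    using is_submodD[OF H_submod] m(1,2) m(3)[OF subsetD[OF point(3)[OF P(1)]]]
    by (auto simp: add_divide_distrib simp flip: times_divide_eq_right)
qed

lemma W_fin_gen: "fin_gen k W"
proof (rule fin_gen_colength_one[OF k_subfield finite.emptyI _ H_dual_basis(1) W_submod _ v(1)])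
  show "k = alg_gen k {}" using alg_gen_empty[OF k_subring] by simp
qed (use W_residue in \<open>auto simp: W_def\<close>)

lemma W_nonzero: "\<exists>h\<in>W. h \<noteq> 0"
proof -
  obtain h1 h2 where h: "h1 \<in> H" "h2 \<in> H" "h1 \<noteq> 0" "\<forall>c\<in>k. h2 \<noteq> c * h1" using H_dual_basis(2) by blast
  obtain c1 c2 where c: "c1 \<in> k" "c2 \<in> k" "h1 - c1 * v \<in> W" "h2 - c2 * v \<in> W" using W_residue h by metis
  show ?thesis
  proof (cases "c1 = 0")
    case True
    then show ?thesis using c(3) h(3) by auto
  next
    case False
    have "c1 * (h2 - c2 * v) - c2 * (h1 - c1 * v) \<in> W"
      using is_submod_diff(2)[OF k_subring W_submod is_submodD(3)[OF W_submod c(1,4)] is_submodD(3)[OF W_submod c(2,3)]] .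
    moreover have "c1 * (h2 - c2 * v) - c2 * (h1 - c1 * v) = c1 * h2 - c2 * h1" by (simp add: algebra_simps)
    moreover have "c1 * h2 - c2 * h1 \<noteq> 0"
    proof
      assume "c1 * h2 - c2 * h1 = 0"
      then have "h2 = (inverse c1 * c2) * h1" using False by (simp add: field_simps)
      moreover have "inverse c1 * c2 \<in> k" using subfield_inverse[OF k_subfield c(1)] c(2) k_ring(4) by blast
      ultimately show False using h(4) by blast
    qed
    ultimately show ?thesis by metis
  qed
qed

text \<open>As no nonconstant function preserves \<open>W\<close>, which has codimension one in \<open>H\<close>, one that maps \<open>W\<close> into \<open>H\<close>
  satisfies \<open>W + f W = H\<close>.\<close>

lemma pencil:
  assumes f: "f \<in> K" "f \<notin> k" and fW: "\<And>h. h \<in> W \<Longrightarrow> f * h \<in> H"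
  obtains w w' where "w \<in> W" "w' \<in> W" "v = w + f * w'"
proof -
  have "\<exists>w0\<in>W. f * w0 \<notin> W"
    using stable_constant[OF W_fin_gen _ _ f(1)] f(2) W_nonzero H_K by (force simp: W_def)
  then obtain w0 where w0: "w0 \<in> W" "f * w0 \<notin> W" by blast
  obtain c where c: "c \<in> k" "f * w0 - c * v \<in> W" using W_residue[OF fW[OF w0(1)]] by blast
  have c0: "c \<noteq> 0" using c w0(2) by auto
  have i: "inverse c \<in> k" using subfield_inverse[OF k_subfield c(1)] .
  have "v = - inverse c * (f * w0 - c * v) + f * (inverse c * w0)" using c0 by (simp add: field_simps)
  moreover have "- inverse c * (f * w0 - c * v) \<in> W" using is_submodD(3)[OF W_submod k_ring(5)[OF i] c(2)] .
  moreover have "inverse c * w0 \<in> W" using is_submodD(3)[OF W_submod i w0(1)] .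
  ultimately show ?thesis using that by blast
qed

lemma coh_at_P: "coh (\<omega>(P := scale_set v (max_ideal P)))"
proof (rule coh_shrink[OF coh_omega P])
  note m = point_max[OF P(1)]
  show "is_submod P (scale_set v (max_ideal P))" by (rule scale_set_submod[OF local_ring_max[OF point(1)[OF P(1)]]])
  show "scale_set v (max_ideal P) \<subseteq> \<omega> P" using max_ideal_subset mem_scale_set[OF v(2)] omega_P_iff by blast
  show "a * u \<in> scale_set v (max_ideal P)" if "a \<in> max_ideal P" "u \<in> \<omega> P" for a u
  proof -
    have "u / v \<in> P" using that(2) omega_P_iff by blast
    then have "(u / v) * a \<in> max_ideal P" by (rule m(3)[OF _ that(1)])
    then show ?thesis using mem_scale_set[OF v(2)] by (simp add: mult.commute)
  qed
  show "v \<in> \<omega> P" by (rule H_omega[OF v(1) P(1)])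
  show "\<exists>c\<in>k. u - c * v \<in> scale_set v (max_ideal P)" if "u \<in> \<omega> P" for u
  proof -
    have "u / v \<in> P" using that omega_P_iff by blast
    then obtain c where c: "c \<in> k" "u / v - c \<in> max_ideal P" using residue_field[OF P] by blast
    have "(u - c * v) / v = u / v - c" using v(2) by (simp add: diff_divide_distrib)
    then have "u - c * v \<in> scale_set v (max_ideal P)" using c(2) unfolding mem_scale_set[OF v(2)] by simp
    then show ?thesis using c(1) by blast
  qed
qed

lemma sections_at_P:
  assumes h: "h \<in> sections (\<omega>(P := scale_set v (max_ideal P))) C"
  shows "h \<in> W"
proof -
  have hx: "h \<in> (\<omega>(P := scale_set v (max_ideal P))) x" if "x \<in> C" for x using sectionsD[OF h that] .
  have 1: "h / v \<in> max_ideal P" using hx[OF P(1)] mem_scale_set[OF v(2)] by simp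
  then have "h \<in> \<omega> P" using omega_P_iff max_ideal_subset by blast
  then have "h \<in> \<omega> x" if "x \<in> C" for x using hx[OF that] by (cases "x = P") auto
  then show ?thesis using 1 by (simp add: W_def H_iff)
qed

text \<open>Sections separate tangent vectors at \<open>P\<close>.  Otherwise all \<open>h / v\<close> with \<open>h \<in> W\<close> lie in a submodule \<open>I\<close> of
  colength one in the maximal ideal, and there is a multiplier \<open>f\<close> of the sheaf \<open>\<omega>\<close> changed to \<open>v I\<close>
  at \<open>P\<close> into \<open>\<omega>\<close>.  It has no poles outside \<open>P\<close>, and \<open>f I\<close> is contained in the local ring; by
  \<open>v \<in> W + f W\<close>, the inverse of \<open>f\<close> is in \<open>I\<close>.  So \<open>I\<close> is the ideal of the poles of \<open>f\<close>, which is thus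
  a function of degree two.\<close>

theorem max_ideal_generated: "submod_gen P ((\<lambda>h. h / v) ` W) = max_ideal P"
proof (rule ccontr)
  let ?J = "submod_gen P ((\<lambda>h. h / v) ` W)"
  assume ne: "?J \<noteq> max_ideal P"
  note m = point_max[OF P(1)] note Pr = point_ring[OF P(1)]
  have "?J \<subseteq> max_ideal P"
    by (rule submod_gen_least[OF local_ring_max[OF point(1)[OF P(1)]]]) (auto simp: W_def)
  then obtain I e where I: "is_submod P I" "?J \<subseteq> I" "I \<subseteq> max_ideal P" "e \<in> max_ideal P" "e \<notin> I"
    "\<And>u. u \<in> max_ideal P \<Longrightarrow> \<exists>c\<in>k. u - c * e \<in> I" "\<And>a u. a \<in> max_ideal P \<Longrightarrow> u \<in> max_ideal P \<Longrightarrow> a * u \<in> I"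
    using point_maximal_submodule[OF P max_ideal_fin_gen[OF P] submod_gen_submod _ ne] by metis
  let ?G = "\<omega>(P := scale_set v (max_ideal P))" and ?N = "scale_set v I"
  have GP: "u \<in> ?G P \<longleftrightarrow> u / v \<in> max_ideal P" for u using mem_scale_set[OF v(2)] by simp
  note NP = mem_scale_set[OF v(2), of _ I]
  have WI: "h / v \<in> I" if "h \<in> W" for h using that I(2) submod_gen_gens[of "(\<lambda>h. h / v) ` W" P] by blast
  obtain f where f: "f \<in> K" "\<And>x u. x \<in> C \<Longrightarrow> u \<in> (?G(P := ?N)) x \<Longrightarrow> f * u \<in> \<omega> x" "\<exists>u\<in>?G P. f * u \<notin> \<omega> P"
  proof (rule multiplier_exists[OF coh_at_P P scale_set_submod[OF I(1), of v], of "v * e"])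
    show "?N \<subseteq> ?G P" using I(3) NP GP by blast
    show "a * u \<in> ?N" if "a \<in> max_ideal P" "u \<in> ?G P" for a u
      using I(7)[OF that(1), of "u / v"] that(2) GP NP by auto
    show "v * e \<in> ?G P" using GP I(4) v(2) by auto
    show "v * e \<notin> ?N" using NP I(5) v(2) by auto
    show "\<exists>c\<in>k. u - c * (v * e) \<in> ?N" if u: "u \<in> ?G P" for u
    proof -
      obtain c where c: "c \<in> k" "u / v - c * e \<in> I" using I(6) u GP by blast
      have "(u - c * (v * e)) / v = u / v - c * e" using v(2) by (simp add: diff_divide_distrib)
      then show ?thesis using c NP by (intro bexI[of _ c]) auto
    qed
    show "h \<in> ?N" if "h \<in> sections ?G C" for h using WI[OF sections_at_P[OF that]] NP by blast
  qed blast
  have fk: "f \<notin> k" using f(3) k_scale[OF coh_omega _ P(1)] GP omega_P_iff max_ideal_subset by blast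
  have F: "f * u \<in> \<omega> x" if "x \<in> C" "x \<noteq> P" "u \<in> \<omega> x" for x u using f(2)[OF that(1)] that by simp
  have FP: "f * u \<in> P" if u: "u \<in> I" for u
  proof -
    have "v * u \<in> ?N" using u NP v(2) by simp
    then have "f * (v * u) \<in> \<omega> P" using f(2)[OF P(1), of "v * u"] by simp
    then have "f * (v * u) / v \<in> P" using omega_P_iff by blast
    then show ?thesis using v(2) by simp
  qed
  have "f * h \<in> H" if h: "h \<in> W" for h
    unfolding H_iff
  proof
    fix x assume x: "x \<in> C"
    have "h \<in> (?G(P := ?N)) x" using h WI[OF h] NP x by (auto simp: W_def H_iff)
    then show "f * h \<in> \<omega> x" using f(2) x by blast
  qed
  then obtain w w' where w: "w \<in> W" "w' \<in> W" "v = w + f * w'" using pencil[OF f(1) fk] by blast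
  define a b where "a = w / v" and "b = w' / v"
  have ab: "a \<in> I" "b \<in> I" "f * b = 1 - a"
  proof -
    show "a \<in> I" "b \<in> I" using WI w by (auto simp: a_def b_def)
    have "v / v = w / v + f * w' / v" by (subst w(3)) (simp add: add_divide_distrib)
    then have "1 = a + f * b" using v(2) by (simp add: a_def b_def)
    then show "f * b = 1 - a" by (metis add_diff_cancel_left')
  qed
  note u = local_ring_one_minus[OF point(1)[OF P(1)] subsetD[OF I(3) ab(1)]]
  have u0: "1 - a \<noteq> 0" using unitD(1)[OF u(2,1)] .
  have f0: "f \<noteq> 0" using fk k_ring(2) by auto
  have "inverse f = inverse (1 - a) * b" using ab(3) u0 f0 by (simp add: field_simps)
  then have sI: "inverse f \<in> I" using is_submodD(3)[OF I(1) u(3) ab(2)] by simp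
  then have sm: "inverse f \<in> max_ideal P" using I(3) by blast
  have Is: "\<exists>z\<in>P. y = inverse f * z" if "y \<in> I" for y
    using FP[OF that] f0 by (intro bexI[of _ "f * y"]) auto
  define T where "T = {x \<in> C. f \<notin> x}"
  have fP: "f \<notin> P" using sm f0 by (auto simp: max_ideal_iff)
  have TP: "T = {P}"
    using fP P(1) multiplier_in_stalk[OF _ f(1)] F unfolding T_def by blast
  have "hyperelliptic k C"
  proof (rule hyperellipticI[OF f(1) fk T_def])
    show "inverse f \<in> max_ideal x" if "x \<in> T" for x using that TP sm by simp
    show "\<exists>u\<in>max_ideal Q. \<forall>z\<in>Q. u \<noteq> inverse f * z" if "T = {Q}" for Q
    proof -
      have "Q = P" using that TP by simp
      moreover have "e \<noteq> inverse f * z" if "z \<in> P" for z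
        using is_submodD(3)[OF I(1) that sI] I(5) by (auto simp: mult.commute)
      ultimately show ?thesis using I(4) by blast
    qed
    fix x y assume xy: "\<And>z. z \<in> T \<Longrightarrow> x \<in> z \<and> y \<in> z"
    have lin: "\<exists>c\<in>k. \<exists>d\<in>k. x - c - d * e \<in> I" if "x \<in> P" for x
      using residue_field[OF P that] I(6) by blast
    have "x \<in> P" "y \<in> P" using xy TP by auto
    then obtain c d c' d' where cd: "c \<in> k" "d \<in> k" "x - c - d * e \<in> I" "c' \<in> k" "d' \<in> k" "y - c' - d' * e \<in> I"
      using lin by metis
    have "\<exists>c1\<in>k. \<exists>c2\<in>k. \<exists>c3\<in>k. (c1 \<noteq> 0 \<or> c2 \<noteq> 0 \<or> c3 \<noteq> 0) \<and> c1 + c2 * x + c3 * y \<in> I"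
    proof (cases "d = 0 \<and> d' = 0")
      case True
      then have "- c + 1 * x + 0 * y \<in> I" using cd(3) by simp
      then show ?thesis using k_ring cd(1) zero_neq_one by metis
    next
      case False
      have "d' \<in> P" "d \<in> P" using cd point(3)[OF P(1)] by auto
      then have "d' * (x - c - d * e) - d * (y - c' - d' * e) \<in> I"
        using is_submod_diff(2)[OF point(2)[OF P(1)] I(1)] is_submodD(3)[OF I(1)] cd(3,6) by blast
      moreover have "d' * (x - c - d * e) - d * (y - c' - d' * e) = (d * c' - d' * c) + d' * x + (- d) * y"
        by (simp add: algebra_simps)
      ultimately have "(d * c' - d' * c) + d' * x + (- d) * y \<in> I" by simp
      moreover have "d * c' - d' * c \<in> k" "- d \<in> k" using cd k_ring by auto
      moreover have "d' \<noteq> 0 \<or> - d \<noteq> 0" using False by auto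
      ultimately show ?thesis using cd(5) by blast
    qed
    then show "\<exists>c1\<in>k. \<exists>c2\<in>k. \<exists>c3\<in>k. (c1 \<noteq> 0 \<or> c2 \<noteq> 0 \<or> c3 \<noteq> 0) \<and>
        (\<forall>z\<in>T. \<exists>u\<in>z. c1 + c2 * x + c3 * y = inverse f * u)"
      unfolding TP using Is by (metis singletonD)
  qed
  then show False using nonhyperelliptic by simp
qed

text \<open>Sections separate \<open>P\<close> from every other place \<open>V\<close>.  Otherwise the sections in \<open>W\<close> vanish at \<open>V\<close>, so they
  lie in a submodule \<open>N\<close> of colength one in the stalk of \<open>\<omega>\<close> at the center \<open>Q\<close>, and there is a multiplier
  \<open>f\<close> of the subsheaf defined by \<open>v m\<close> at \<open>P\<close>, with \<open>m\<close> the maximal ideal, and by \<open>N\<close> at \<open>Q\<close>.  By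
  \<open>v \<in> W + f W\<close> it has a pole at \<open>V\<close>, and its inverse generates both maximal ideals.  So the poles of \<open>f\<close>
  are two reduced points.\<close>

theorem center_is_P:
  assumes V: "valuation_ring K V" "k \<subseteq> V" "V \<noteq> K" and HV: "\<And>h. h \<in> H \<Longrightarrow> h / v \<in> V"
    and WV: "\<And>h. h \<in> W \<Longrightarrow> h / v \<in> max_ideal V" and Q: "Q \<in> C" "dominates V Q"
  shows "Q = P"
proof (rule ccontr)
  assume QP: "Q \<noteq> P"
  have QV: "Q \<subseteq> V" by (rule dominatesD(1)[OF Q(2)])
  have QK: "Q \<noteq> K" using QV V(3) valuationD(2)[OF V(1)] by blast
  note Vl = val_local[OF V(1)] note Vm = is_submodD[OF local_ring_max[OF Vl]] note Vr = subringD[OF local_ring_subring[OF Vl]]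
  note mP = point_max[OF P(1)] note Pr = point_ring[OF P(1)]
  note mQ = point_max[OF Q(1)] note Qr = point_ring[OF Q(1)]
  define J where "J = {u \<in> \<omega> Q. u / v \<in> max_ideal V}"
  have J: "is_submod Q J"
    unfolding is_submod_def J_def
    using is_submodD[OF cohD(1)[OF coh_omega Q(1)]] Vm(1,2) Vm(3)[OF subsetD[OF QV]]
    by (auto simp: add_divide_distrib simp flip: times_divide_eq_right)
  have v1: "v / v \<notin> max_ideal V" using v(2) one_notin_max[OF local_ring_subring[OF Vl]] by simp
  then have "v \<notin> J" unfolding J_def by blast
  then have "J \<noteq> \<omega> Q" using H_omega[OF v(1) Q(1)] by blast
  then obtain N e where N: "is_submod Q N" "J \<subseteq> N" "N \<subseteq> \<omega> Q" "e \<in> \<omega> Q" "e \<notin> N"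
    "\<And>u. u \<in> \<omega> Q \<Longrightarrow> \<exists>c\<in>k. u - c * e \<in> N" "\<And>a u. a \<in> max_ideal Q \<Longrightarrow> u \<in> \<omega> Q \<Longrightarrow> a * u \<in> N"
    using point_maximal_submodule[OF Q(1) QK stalk_fin_gen[OF coh_omega Q(1)] J] by (metis (no_types, lifting) J_def mem_Collect_eq subsetI)
  let ?G = "\<omega>(P := scale_set v (max_ideal P))"
  have GP: "u \<in> ?G P \<longleftrightarrow> u / v \<in> max_ideal P" for u using mem_scale_set[OF v(2)] by simp
  have GQ: "?G Q = \<omega> Q" using QP by simp
  have WJ: "h \<in> J" if "h \<in> W" for h using that WV[OF that] H_omega[OF _ Q(1)] by (auto simp: J_def W_def)
  obtain f where f: "f \<in> K" "\<And>x u. x \<in> C \<Longrightarrow> u \<in> (?G(Q := N)) x \<Longrightarrow> f * u \<in> \<omega> x" "\<exists>u\<in>\<omega> Q. f * u \<notin> \<omega> Q"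
  proof (rule multiplier_exists[OF coh_at_P Q(1) QK N(1), unfolded GQ, OF N(3,7,4,5,6)])
    show "h \<in> N" if "h \<in> sections ?G C" for h by (rule subsetD[OF N(2) WJ[OF sections_at_P[OF that]]])
  qed (assumption | rule that)+
  have fk: "f \<notin> k" using f(3) k_scale[OF coh_omega _ Q(1)] GQ by blast
  have f0: "f \<noteq> 0" using fk k_ring(2) by auto
  have F: "f * u \<in> \<omega> x" if "x \<in> C" "x \<noteq> P" "x \<noteq> Q" "u \<in> \<omega> x" for x u using f(2)[OF that(1)] that by simp
  have FP: "f * u \<in> P" if u: "u \<in> max_ideal P" for u
  proof -
    have "v * u \<in> ?G P" using u GP v(2) by simp
    then have "f * (v * u) \<in> \<omega> P" using f(2)[OF P(1), of "v * u"] QP by simp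
    then have "f * (v * u) / v \<in> P" using omega_P_iff by blast
    then show ?thesis using v(2) by simp
  qed
  have FQ: "f * a \<in> Q" if a: "a \<in> max_ideal Q" for a
  proof (rule multiplier_in_stalk[OF Q(1)])
    show "f * a \<in> K" using f(1) a max_ideal_subset point(4)[OF Q(1)] K_ring(4) by blast
    show "f * a * u \<in> \<omega> Q" if "u \<in> \<omega> Q" for u
      using f(2)[OF Q(1), of "a * u"] N(7)[OF a that] by (simp add: mult.assoc)
  qed
  have "f * h \<in> H" if h: "h \<in> W" for h
    unfolding H_iff
  proof
    fix x assume x: "x \<in> C"
    have "h \<in> (?G(Q := N)) x" using h WJ[OF h] N(2) GP x by (auto simp: W_def H_iff)
    then show "f * h \<in> \<omega> x" using f(2) x by blast
  qed
  then obtain w w' where w: "w \<in> W" "w' \<in> W" "v = w + f * w'" using pencil[OF f(1) fk] by blast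
  have eq: "f * (w' / v) = 1 - w / v"
  proof -
    have "v / v = w / v + f * w' / v" by (subst w(3)) (simp add: add_divide_distrib)
    then have "1 = w / v + f * (w' / v)" using v(2) by simp
    then show ?thesis by (metis add_diff_cancel_left')
  qed
  have fV: "f \<notin> V"
  proof
    assume "f \<in> V"
    then have "f * (w' / v) \<in> max_ideal V" using Vm(3) WV[OF w(2)] by blast
    then have "(1 - w / v) + w / v \<in> max_ideal V" unfolding eq using Vm(2) WV[OF w(1)] by blast
    then show False using one_notin_max[OF local_ring_subring[OF Vl]] by simp
  qed
  have sP: "inverse f \<in> max_ideal P"
  proof -
    have ab: "w / v \<in> max_ideal P" "w' / v \<in> max_ideal P" using w(1,2) by (auto simp: W_def)
    note u = local_ring_one_minus[OF point(1)[OF P(1)] ab(1)]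
    have "1 - w / v \<noteq> 0" using unitD(1)[OF u(2,1)] .
    then have "inverse f = inverse (1 - w / v) * (w' / v)" unfolding eq[symmetric] using f0 by (simp add: field_simps)
    then show ?thesis using mP(3)[OF u(3) ab(2)] by simp
  qed
  have sQ: "inverse f \<in> max_ideal Q"
  proof -
    have "\<exists>a\<in>max_ideal Q. f * a \<notin> max_ideal Q"
    proof (rule ccontr)
      assume n: "\<not> ?thesis"
      have "max_ideal Q \<noteq> {0}" using closed_point_nonzero[OF Q(1) QK] by blast
      moreover have "max_ideal Q \<subseteq> K" using max_ideal_subset point(4)[OF Q(1)] by blast
      ultimately have "f \<in> V"
        using stable_in_valuation[OF K_subfield V(1) point(2)[OF Q(1)] QV max_ideal_fin_gen[OF Q(1) QK], of f] n by blast
      then show False using fV by simp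
    qed
    then obtain a where a: "a \<in> max_ideal Q" "f * a \<notin> max_ideal Q" by blast
    have i: "f * a \<noteq> 0" "inverse (f * a) \<in> Q" using unitD[OF FQ[OF a(1)] a(2)] by auto
    have "inverse f = inverse (f * a) * a" using i(1) by simp
    then show ?thesis using mQ(3)[OF i(2) a(1)] by metis
  qed
  have div: "\<exists>z\<in>x. y = inverse f * z" if "y \<in> max_ideal x" "x = P \<or> x = Q" for x y
    using FP FQ that f0 by (intro bexI[of _ "f * y"]) auto
  define T where "T = {x \<in> C. f \<notin> x}"
  have "f \<notin> P" "f \<notin> Q" using sP sQ f0 by (auto simp: max_ideal_iff)
  then have T: "T = {P, Q}"
    using P(1) Q(1) multiplier_in_stalk[OF _ f(1)] F unfolding T_def by blast
  have "hyperelliptic k C"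
  proof (rule hyperellipticI[OF f(1) fk T_def])
    show "inverse f \<in> max_ideal x" if "x \<in> T" for x using that T sP sQ by auto
    show "\<exists>u\<in>max_ideal R. \<forall>z\<in>R. u \<noteq> inverse f * z" if "T = {R}" for R
      using that T QP by auto
    fix x y assume xy: "\<And>z. z \<in> T \<Longrightarrow> x \<in> z \<and> y \<in> z"
    have xyP: "x \<in> P" "y \<in> P" and xyQ: "x \<in> Q" "y \<in> Q" using xy T by auto
    obtain c d where cd: "c \<in> k" "d \<in> k" "x - c \<in> max_ideal P" "y - d \<in> max_ideal P"
      using residue_field[OF P xyP(1)] residue_field[OF P xyP(2)] by blast
    obtain c' d' where cd': "c' \<in> k" "d' \<in> k" "x - c' \<in> max_ideal Q" "y - d' \<in> max_ideal Q"
      using residue_field[OF Q(1) QK xyQ(1)] residue_field[OF Q(1) QK xyQ(2)] by blast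
    have "\<exists>c1\<in>k. \<exists>c2\<in>k. \<exists>c3\<in>k. (c1 \<noteq> 0 \<or> c2 \<noteq> 0 \<or> c3 \<noteq> 0) \<and>
        c1 + c2 * c + c3 * d = 0 \<and> c1 + c2 * c' + c3 * d' = 0"
    proof (cases "c = c' \<and> d = d'")
      case True
      then have "- c + 1 * c + 0 * d = 0 \<and> - c + 1 * c' + 0 * d' = 0" by simp
      moreover have "- c \<in> k" using cd k_ring(5) by blast
      ultimately show ?thesis using k_ring(1,2) zero_neq_one by metis
    next
      case False
      define c2 c3 where "c2 = d - d'" and "c3 = - (c - c')"
      have "- (c2 * c + c3 * d) + c2 * c + c3 * d = 0" "- (c2 * c + c3 * d) + c2 * c' + c3 * d' = 0"
        by (simp_all add: c2_def c3_def algebra_simps)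
      moreover have "c2 \<in> k" "c3 \<in> k" using cd cd' k_ring by (auto simp: c2_def c3_def)
      moreover have "- (c2 * c + c3 * d) \<in> k" using calculation(3,4) cd k_ring by auto
      moreover have "c2 \<noteq> 0 \<or> c3 \<noteq> 0" using False by (auto simp: c2_def c3_def)
      ultimately show ?thesis by blast
    qed
    then obtain c1 c2 c3 where c: "c1 \<in> k" "c2 \<in> k" "c3 \<in> k" "c1 \<noteq> 0 \<or> c2 \<noteq> 0 \<or> c3 \<noteq> 0"
      "c1 + c2 * c + c3 * d = 0" "c1 + c2 * c' + c3 * d' = 0" by blast
    have val: "c1 + c2 * x + c3 * y \<in> max_ideal z"
      if "z \<in> C" "x - a \<in> max_ideal z" "y - b \<in> max_ideal z" "c1 + c2 * a + c3 * b = 0" for z a b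
    proof -
      have "c2 \<in> z" "c3 \<in> z" using c point(3)[OF that(1)] by auto
      then have "c2 * (x - a) + c3 * (y - b) \<in> max_ideal z" using point_max(2,3)[OF that(1)] that(2,3) by blast
      moreover have "c2 * (x - a) + c3 * (y - b) = (c1 + c2 * x + c3 * y) - (c1 + c2 * a + c3 * b)"
        by (simp add: algebra_simps)
      ultimately show ?thesis using that(4) by simp
    qed
    have "\<forall>z\<in>T. \<exists>u\<in>z. c1 + c2 * x + c3 * y = inverse f * u"
      unfolding T using div[OF val[OF P(1) cd(3,4) c(5)]] div[OF val[OF Q(1) cd'(3,4) c(6)]] by blast
    then show "\<exists>c1\<in>k. \<exists>c2\<in>k. \<exists>c3\<in>k. (c1 \<noteq> 0 \<or> c2 \<noteq> 0 \<or> c3 \<noteq> 0) \<and>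
        (\<forall>z\<in>T. \<exists>u\<in>z. c1 + c2 * x + c3 * y = inverse f * u)"
      using c(1-4) by blast
  qed
  then show False using nonhyperelliptic by simp
qed

abbreviation "R \<equiv> chart_ring k H v"

lemma R_P: "R \<subseteq> P"
  using chart_ring_least[OF point(2,3)[OF P(1)]] H_omega[OF _ P(1)] omega_P_iff by blast

lemma z_props:
  "local_ring (loc R P)" "R \<subseteq> loc R P" "loc R P \<subseteq> P" "dominates P (loc R P)"
  using loc_props[OF point(1)[OF P(1)] chart_ring_facts(1) R_P] by auto

lemma W_max: "h \<in> W \<Longrightarrow> h / v \<in> max_ideal (loc R P)"
  using chart_ring_facts(3)[of h H v] z_props(2) dominates_max_iff[OF z_props(4), of "h / v"]
  by (auto simp: W_def)

text \<open>Here \<open>R\<close> is the coordinate ring of the chart of the canonical model where \<open>v\<close> does not vanish, and \<open>loc R P\<close>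
  its local ring at the image of \<open>P\<close>.\<close>

lemma dominating_is_over_P:
  assumes V: "valuation_ring K V" "dominates V (loc R P)"
  shows "dominates V P"
proof -
  have RV: "R \<subseteq> V" using z_props(2) dominatesD(1)[OF V(2)] by blast
  have kV: "k \<subseteq> V" using chart_ring_facts(2) RV by blast
  have WV: "h / v \<in> max_ideal V" if "h \<in> W" for h
    using W_max[OF that] dominatesD(2)[OF V(2)] by blast
  have "V \<noteq> K"
  proof
    assume "V = K"
    moreover obtain h where "h \<in> W" "h \<noteq> 0" using W_nonzero by blast
    ultimately show False using WV max_K v(2) by force
  qed
  moreover obtain Q where Q: "Q \<in> C" "dominates V Q" using center_exists[OF V(1) kV] by blast
  moreover have "h / v \<in> V" if "h \<in> H" for h using chart_ring_facts(3)[OF that] RV by blast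
  ultimately show ?thesis using center_is_P[OF V(1) kV _ _ WV Q] by blast
qed

text \<open>Elements \<open>x\<close> of \<open>P\<close> are integral over the local ring \<open>z\<close> of the canonical model, because every valuation
  ring that dominates \<open>z\<close> has center \<open>P\<close> and so contains \<open>x\<close>.  If \<open>x \<notin> z[1/x]\<close>, then \<open>1/x\<close> and the
  maximal ideal of \<open>z\<close> generate a proper ideal \<open>X\<close> of \<open>z[1/x]\<close>, and Chevalley's theorem yields a
  dominating valuation ring without \<open>x\<close>.\<close>

lemma P_integral:
  assumes x: "x \<in> P"
  shows "x \<in> alg_gen (loc R P) {inverse x}"
proof (rule ccontr)
  let ?z = "loc R P" and ?i = "inverse x"
  let ?B = "alg_gen ?z {?i}"
  assume n: "x \<notin> ?B"
  have zs: "is_subring ?z" by (rule local_ring_subring[OF z_props(1)])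
  note Br = subringD[OF alg_gen_subring[of ?z "{?i}"]] and zr = subringD[OF zs]
  note m = is_submodD[OF local_ring_max[OF z_props(1)]]
  have x0: "x \<noteq> 0" using n Br(2) by auto
  have zB: "?z \<subseteq> ?B" and iB: "?i \<in> ?B" using alg_gen_base[of ?z "{?i}"] alg_gen_gens[of "{?i}" ?z] by auto
  have dec: "\<exists>a\<in>?z. \<exists>b'\<in>?B. b = a + ?i * b'" if b: "b \<in> ?B" for b
  proof -
    obtain p where p: "poly_over ?z p" "b = poly p ?i" using b alg_gen_single[OF zs] by blast
    obtain a q where q: "p = pCons a q" by (cases p)
    have "a \<in> ?z" "poly_over ?z q" using p(1) zr(2) by (auto simp: q poly_over_pCons)
    then show ?thesis using p(2) alg_gen_single[OF zs, of ?i] by (intro bexI[of _ a] bexI[of _ "poly q ?i"]) (auto simp: q)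
  qed
  define X where "X = {a + ?i * b |a b. a \<in> max_ideal ?z \<and> b \<in> ?B}"
  have "is_submod ?B X"
    unfolding is_submod_def
  proof (intro conjI ballI)
    show "0 \<in> X" unfolding X_def using m(1) Br(2) by force
    fix u u' assume "u \<in> X" "u' \<in> X"
    then obtain a b a' b' where *: "a \<in> max_ideal ?z" "b \<in> ?B" "u = a + ?i * b" "a' \<in> max_ideal ?z" "b' \<in> ?B" "u' = a' + ?i * b'"
      unfolding X_def by blast
    have "u + u' = (a + a') + ?i * (b + b')" using * by (simp add: algebra_simps)
    then show "u + u' \<in> X" unfolding X_def using m(2)[OF *(1,4)] Br(6)[OF *(2,5)] by blast
  next
    fix c u assume c: "c \<in> ?B" and "u \<in> X"
    then obtain a b where *: "a \<in> max_ideal ?z" "b \<in> ?B" "u = a + ?i * b" unfolding X_def by blast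
    obtain d c' where d: "d \<in> ?z" "c' \<in> ?B" "c = d + ?i * c'" using dec[OF c] by blast
    have "c * u = d * a + ?i * (c' * a + c * b)" using * d by (simp add: algebra_simps)
    moreover have "a \<in> ?B" using *(1) max_ideal_subset zB by blast
    then have "c' * a + c * b \<in> ?B" by (intro Br(4,6) d(2) c *(2))
    ultimately show "c * u \<in> X" unfolding X_def using m(3)[OF d(1) *(1)] by blast
  qed
  moreover have "insert ?i (max_ideal ?z) \<subseteq> X"
  proof
    fix u assume u: "u \<in> insert ?i (max_ideal ?z)"
    show "u \<in> X"
    proof (cases "u = ?i")
      case True
      then have "u = 0 + ?i * 1" by simp
      then show ?thesis unfolding X_def using m(1) Br(1) by blast
    next
      case False
      then have "u = u + ?i * 0" "u \<in> max_ideal ?z" using u by auto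
      then show ?thesis unfolding X_def using Br(2) by blast
    qed
  qed
  ultimately have sX: "submod_gen ?B (insert ?i (max_ideal ?z)) \<subseteq> X" by (rule submod_gen_least)
  have "1 \<notin> submod_gen ?B (insert ?i (max_ideal ?z))"
  proof
    assume "1 \<in> submod_gen ?B (insert ?i (max_ideal ?z))"
    then obtain a b where ab: "a \<in> max_ideal ?z" "b \<in> ?B" "1 = a + ?i * b" using sX unfolding X_def by blast
    note u = local_ring_one_minus[OF z_props(1) ab(1)]
    have u0: "1 - a \<noteq> 0" using unitD(1)[OF u(2,1)] .
    have "x = inverse (1 - a) * b" using ab(3) x0 u0 by (simp add: field_simps)
    moreover have "inverse (1 - a) * b \<in> ?B" using Br(4) zB u(3) ab(2) by blast
    ultimately show False using n by simp
  qed
  moreover have "?B \<subseteq> K" using z_props(3) point(4)[OF P(1)] x subfield_inverse[OF K_subfield] by (intro alg_gen_K) auto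
  moreover have "insert ?i (max_ideal ?z) \<subseteq> ?B" using iB zB max_ideal_subset by blast
  ultimately obtain V where V: "valuation_ring K V" "?B \<subseteq> V" "insert ?i (max_ideal ?z) \<subseteq> max_ideal V"
    using chevalley[OF K_subfield alg_gen_subring, of ?z "{?i}" "insert ?i (max_ideal ?z)"] by metis
  have "dominates V ?z" using V zB by (intro dominatesI') auto
  then have "x \<in> V" using dominating_is_over_P[OF V(1)] dominatesD(1) x by blast
  moreover have "?i \<in> max_ideal V" using V(3) by auto
  ultimately show False using x0 by (auto simp: max_ideal_iff)
qed

end

text \<open>With an integral equation of degree \<open>d + 1\<close> for \<open>x\<close>, the powers of \<open>x\<close> up to \<open>d\<close> generate \<open>B[x]\<close> over \<open>B\<close>.\<close>

lemma integral_fin_gen: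
  assumes z: "is_subring z" and B: "is_subring B" "z \<subseteq> B" "fin_gen z B" and x: "x \<in> alg_gen B {inverse x}"
  shows "fin_gen z (alg_gen B {x})"
proof (cases "x = 0")
  case True
  then have "alg_gen B {x} = B"
    using alg_gen_least[OF B(1) order_refl, of "{x}"] alg_gen_base[of B "{x}"] subringD(2)[OF B(1)] by auto
  then show ?thesis using B(3) by simp
next
  case False
  obtain U where U: "finite U" "B = submod_gen z U" using B(3) by (auto simp: fin_gen_def)
  obtain p where p: "poly_over B p" "x = poly p (inverse x)" using x by (auto simp: alg_gen_single[OF B(1)])
  define d where "d = degree p"
  let ?A = "alg_gen B {x}"
  have A: "is_subring ?A" "B \<subseteq> ?A" "x \<in> ?A"
    using alg_gen_subring[of B "{x}"] alg_gen_base[of B "{x}"] alg_gen_gens[of "{x}" B] by auto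
  define S where "S = (\<lambda>(u, i). u * x ^ i) ` (U \<times> {..d})"
  define N where "N = submod_gen z S"
  note Nm = submod_gen_submod[of z S, folded N_def]
  have BxN: "b * x ^ i \<in> N" if "b \<in> B" "i \<le> d" for b i
  proof -
    have "is_submod z {b. b * x ^ i \<in> N}"
      unfolding is_submod_def using is_submodD[OF Nm] by (auto simp: distrib_right mult.assoc)
    moreover have "U \<subseteq> {b. b * x ^ i \<in> N}"
      using that(2) submod_gen_gens[of S z] by (auto simp: S_def N_def)
    ultimately have "B \<subseteq> {b. b * x ^ i \<in> N}" unfolding U(2) by (rule submod_gen_least)
    then show ?thesis using that(1) by blast
  qed
  have UB: "U \<subseteq> B" unfolding U(2) by (rule submod_gen_gens)
  have stable: "\<exists>T. is_submod z T \<and> S \<subseteq> T \<and> (\<forall>y\<in>T. a * y \<in> N)" if "\<And>s. s \<in> S \<Longrightarrow> a * s \<in> N" for a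
    using that is_submodD[OF Nm]
    by (intro exI[of _ "{y. a * y \<in> N}"]) (auto simp: is_submod_def distrib_left mult.left_commute)
  have closed: "a * y \<in> N" if "\<And>s. s \<in> S \<Longrightarrow> a * s \<in> N" "y \<in> N" for a y
    using stable[OF that(1)] submod_gen_least that(2) unfolding N_def by blast
  define E where "E = {a. \<forall>y\<in>N. a * y \<in> N}"
  have zE: "is_subring E"
  proof -
    have "(a - b) * y \<in> N" if "a \<in> E" "b \<in> E" "y \<in> N" for a b y
      using that is_submod_diff(2)[OF z Nm, of "a * y" "b * y"] by (auto simp: E_def left_diff_distrib)
    then show ?thesis by (auto simp: is_subring_def E_def mult.assoc)
  qed
  have "B \<subseteq> E"
  proof
    fix b assume b: "b \<in> B"
    have "b * s \<in> N" if "s \<in> S" for s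
    proof -
      obtain u i where ui: "u \<in> U" "i \<le> d" "s = u * x ^ i" using \<open>s \<in> S\<close> by (auto simp: S_def)
      then have "b * u \<in> B" using b UB subringD(4)[OF B(1)] by blast
      then show ?thesis using BxN[of "b * u" i] ui by (simp add: mult.assoc)
    qed
    then show "b \<in> E" using closed by (auto simp: E_def)
  qed
  moreover have "x \<in> E"
  proof -
    have "x * s \<in> N" if "s \<in> S" for s
    proof -
      obtain u i where ui: "u \<in> U" "i \<le> d" "s = u * x ^ i" using \<open>s \<in> S\<close> by (auto simp: S_def)
      show ?thesis
      proof (cases "i < d")
        case True
        then have "u * x ^ Suc i \<in> N" using ui UB by (intro BxN) auto
        then show ?thesis using ui by (simp add: ac_simps)
      next
        case False
        then have "i = d" using ui by simp
        have "x * s = u * (x ^ d * x)" using ui \<open>i = d\<close> by (simp add: ac_simps)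
        also have "x ^ d * x = x ^ d * poly p (inverse x)" using p(2) by simp
        also have "\<dots> = (\<Sum>j\<le>d. coeff p j * x ^ (d - j))"
          unfolding d_def by (rule power_mult_poly_inverse[OF \<open>x \<noteq> 0\<close> order_refl])
        also have "u * \<dots> = (\<Sum>j\<le>d. (u * coeff p j) * x ^ (d - j))"
          by (simp add: sum_distrib_left mult.assoc)
        also have "\<dots> \<in> N"
        proof (rule is_submod_sum[OF Nm])
          fix j assume "j \<in> {..d}"
          have "u * coeff p j \<in> B" using subringD(4)[OF B(1)] ui(1) UB p(1) by (auto simp: poly_over_def)
          then show "u * coeff p j * x ^ (d - j) \<in> N" by (intro BxN) auto
        qed
        finally show ?thesis .
      qed
    qed
    then show ?thesis using closed by (auto simp: E_def)
  qed
  ultimately have AE: "?A \<subseteq> E" by (intro alg_gen_least zE) auto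
  have "1 \<in> N" using BxN[OF subringD(1)[OF B(1)], of 0] by simp
  then have "?A \<subseteq> N" using AE unfolding E_def by (metis (mono_tags, lifting) mem_Collect_eq mult.right_neutral subsetD subsetI)
  moreover have "N \<subseteq> ?A"
    unfolding N_def
  proof (rule submod_gen_least)
    show "is_submod z ?A" using A B(2) by (intro is_submod_superring) auto
    show "S \<subseteq> ?A"
    proof
      fix s assume "s \<in> S"
      then obtain u i where "u \<in> U" "s = u * x ^ i" by (auto simp: S_def)
      then show "s \<in> ?A" using subringD(4)[OF A(1)] subringD(7)[OF A(1)] UB A(2,3) by blast
    qed
  qed
  ultimately show ?thesis unfolding fin_gen_def N_def S_def using U(1) by (intro exI[of _ S]) (auto simp: S_def)
qed

context gorenstein_closed_point
begin

text \<open>So \<open>P\<close> is a finite module over the local ring of the model, with the same residue field and with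
  its maximal ideal generated from below: the two rings are equal by Nakayama's lemma.\<close>

theorem local_ring_of_model: "loc R P = P"
proof -
  let ?z = "loc R P"
  have zs: "is_subring ?z" by (rule local_ring_subring[OF z_props(1)])
  have kz: "k \<subseteq> ?z" using chart_ring_facts(2) z_props(2) by blast
  obtain A where A: "affine A" "P \<in> spec A" using chart_exists[OF P(1)] by blast
  obtain S where S: "finite S" "A = alg_gen k S" using affineD(1)[OF A(1)] by (auto simp: finite_type_def)
  have AP: "A \<subseteq> P" by (rule spec_point(2)[OF A])
  have SP: "S \<subseteq> P" using AP S(2) alg_gen_gens[of S k] by blast
  have "fin_gen ?z (alg_gen ?z F)" if "finite F" "F \<subseteq> P" for F
    using that
  proof (induction F rule: finite_induct)
    case empty
    have "?z = submod_gen ?z {1}"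
      using submod_gen_insert[OF zs, of 1 "{}"] by (auto simp: submod_gen_empty adjoin_def)
    then show ?case unfolding alg_gen_empty[OF zs] fin_gen_def by blast
  next
    case (insert x F)
    have eq: "alg_gen ?z (insert x F) = alg_gen (alg_gen ?z F) {x}" by (simp add: alg_gen_Un)
    show ?case
      unfolding eq
    proof (rule integral_fin_gen[OF zs alg_gen_subring alg_gen_base])
      show "fin_gen ?z (alg_gen ?z F)" using insert by simp
      show "x \<in> alg_gen (alg_gen ?z F) {inverse x}"
        using P_integral[of x] insert.prems alg_gen_mono[OF alg_gen_base[of ?z F] order_refl, of "{inverse x}"] by blast
    qed
  qed
  then have fg: "fin_gen ?z (alg_gen ?z S)" using S(1) SP by blast
  have PS: "alg_gen ?z S = P"
  proof
    show "alg_gen ?z S \<subseteq> P" by (rule alg_gen_least[OF point(2)[OF P(1)] z_props(3) SP])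
    show "P \<subseteq> alg_gen ?z S"
    proof
      fix u assume "u \<in> P"
      then obtain a s where as: "a \<in> A" "s \<in> A" "s \<notin> max_ideal P" "u = a / s" using spec_point(4)[OF A] by blast
      have AS: "A \<subseteq> alg_gen ?z S" unfolding S(2) by (rule alg_gen_mono[OF kz order_refl])
      have "inverse s \<in> P" using as(2,3) AP unitD(2) by blast
      then have "inverse s \<in> alg_gen ?z {s}" using P_integral by fastforce
      moreover have "alg_gen ?z {s} \<subseteq> alg_gen ?z S"
        using as(2) AS by (intro alg_gen_least alg_gen_subring alg_gen_base) auto
      ultimately have "a * inverse s \<in> alg_gen ?z S" using as(1) AS subringD(4)[OF alg_gen_subring] by blast
      then show "u \<in> alg_gen ?z S" using as by (simp add: divide_inverse)
    qed
  qed
  show ?thesis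
  proof (rule ccontr)
    assume ne: "?z \<noteq> P"
    obtain U where U: "finite U" "P = submod_gen ?z U" using fg PS by (auto simp: fin_gen_def)
    have gen: "P = submod_gen ?z (?z \<union> U)"
    proof
      show "P \<subseteq> submod_gen ?z (?z \<union> U)" using U(2) submod_gen_mono[OF order_refl, of U "?z \<union> U" ?z] by auto
      show "submod_gen ?z (?z \<union> U) \<subseteq> P"
        using z_props(3) U(2) submod_gen_gens[of U ?z]
        by (intro submod_gen_least is_submod_superring point(2)[OF P(1)]) auto
    qed
    have res: "\<exists>c\<in>k. a - c \<in> max_ideal ?z" if a: "a \<in> ?z" for a
    proof -
      obtain c where c: "c \<in> k" "a - c \<in> max_ideal P" using residue_field[OF P] a z_props(3) by blast
      have "a - c \<in> ?z" using a c kz subringD(3)[OF zs] by blast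
      then show ?thesis using c dominates_max_iff[OF z_props(4)] by blast
    qed
    have "\<exists>N e. is_submod ?z N \<and> ?z \<subseteq> N \<and> N \<subseteq> P \<and> e \<in> P \<and> e \<notin> N \<and> (\<forall>u\<in>P. \<exists>c\<in>k. u - c * e \<in> N) \<and>
      (\<forall>a\<in>max_ideal ?z. \<forall>u\<in>P. a * u \<in> N)"
      using local_ring_one_minus(3)[OF z_props(1)] res
      by (intro maximal_submodule[OF zs local_ring_max[OF z_props(1)] max_ideal_subset _
          one_notin_max[OF zs] k_subring kz _ U(1) is_submod_self[OF zs] z_props(3) gen ne]) auto
    then obtain N e where N: "is_submod ?z N" "?z \<subseteq> N" "e \<in> P" "e \<notin> N" "\<And>a u. a \<in> max_ideal ?z \<Longrightarrow> u \<in> P \<Longrightarrow> a * u \<in> N"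
      by blast
    define Y where "Y = {y. \<forall>p\<in>P. p * y \<in> N}"
    have "is_submod P Y"
      unfolding is_submod_def Y_def using is_submodD[OF N(1)] point_ring(4)[OF P(1)]
      by (auto simp: distrib_left simp flip: mult.assoc)
    moreover have "(\<lambda>h. h / v) ` W \<subseteq> Y"
      using N(5)[OF W_max] by (auto simp: Y_def mult.commute)
    ultimately have mY: "max_ideal P \<subseteq> Y" using submod_gen_least max_ideal_generated by metis
    obtain c where c: "c \<in> k" "e - c \<in> max_ideal P" using residue_field[OF P N(3)] by blast
    have "1 * (e - c) \<in> N" using mY c(2) point_ring(1)[OF P(1)] unfolding Y_def by blast
    moreover have "c \<in> N" using c(1) kz N(2) by blast
    ultimately have "1 * (e - c) + c \<in> N" using is_submodD(2)[OF N(1)] by blast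
    then show False using N(4) by simp
  qed
qed

end

section \<open>The canonical map\<close>

context canonical_curve
begin

text \<open>On the normalization, \<open>\<omega>\<close> is generated at \<open>V\<close> by a section of largest absolute value.\<close>

lemma pullback_generator:
  assumes V: "valuation_ring K V" and x: "x \<in> C" "dominates V x"
  obtains v where "v \<in> H" "v \<noteq> 0" "submod_gen V (\<omega> x) = scale_set v V"
proof -
  obtain S where S: "finite S" "H = submod_gen k S" using H_dual_basis(1) by (auto simp: fin_gen_def)
  have SH: "S \<subseteq> H" unfolding S(2) by (rule submod_gen_gens)
  have kV: "k \<subseteq> V" using point(3)[OF x(1)] dominatesD(1)[OF x(2)] by blast
  note Vs = valuationD(1)[OF V]
  have "\<exists>s\<in>S. s \<noteq> 0"
  proof (rule ccontr)
    assume "\<not> ?thesis"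
    then have "S \<subseteq> {0}" by auto
    then have "H \<subseteq> {0}" unfolding S(2) by (intro submod_gen_least) (auto simp: is_submod_def)
    then show False using H_dual_basis(2) by blast
  qed
  then obtain v where v: "v \<in> S" "v \<noteq> 0" "\<forall>s\<in>S. s / v \<in> V"
    using max_ratio[OF K_subfield V S(1)] SH H_K by blast
  have Vv: "is_submod V (scale_set v V)" by (rule scale_set_submod[OF is_submod_self[OF Vs]])
  have "H \<subseteq> scale_set v V"
    unfolding S(2) using v(3) mem_scale_set[OF v(2)] by (intro submod_gen_least is_submod_mono[OF Vv kV]) auto
  then have "\<omega> x \<subseteq> scale_set v V"
    unfolding H_generates[OF x(1), symmetric]
    by (intro submod_gen_least is_submod_mono[OF Vv dominatesD(1)[OF x(2)]])
  then have "submod_gen V (\<omega> x) \<subseteq> scale_set v V" by (rule submod_gen_least[OF Vv])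
  moreover have "scale_set v V \<subseteq> submod_gen V (\<omega> x)"
  proof
    fix u assume "u \<in> scale_set v V"
    then have "u / v \<in> V" using mem_scale_set[OF v(2)] by blast
    moreover have "v \<in> submod_gen V (\<omega> x)" using H_omega[OF _ x(1)] SH v(1) subsetD[OF submod_gen_gens] by blast
    ultimately have "(u / v) * v \<in> submod_gen V (\<omega> x)" by (rule is_submodD(3)[OF submod_gen_submod])
    then show "u \<in> submod_gen V (\<omega> x)" using v(2) by simp
  qed
  ultimately show ?thesis using that v SH by blast
qed

lemma center_C:
  assumes "local_ring y" "y \<subseteq> K" "x \<in> C" "dominates y x"
  shows "center C y = x"
  unfolding center_def
  using assms separated_dominates[OF separated_C _ _ assms(2,1)] by (intro the_equality) blast+

lemma kappa_bar_eq:
  assumes V: "valuation_ring K V" and x: "x \<in> C" "dominates V x"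
    and v: "v \<in> H" "v \<noteq> 0" "submod_gen V (\<omega> x) = scale_set v V"
  shows "chart_ring k H v \<subseteq> V" "kappa_bar k C \<omega> V = loc (chart_ring k H v) V"
proof -
  note Vl = val_local[OF V]
  have kV: "k \<subseteq> V" using point(3)[OF x(1)] dominatesD(1)[OF x(2)] by blast
  have pb: "pullback_stalk C \<omega> V = submod_gen V (\<omega> x)"
    using center_C[OF Vl valuationD(2)[OF V] x] by (simp add: pullback_stalk_def)
  have chart: "chart_ring k H u \<subseteq> V" if u: "u \<noteq> 0" "submod_gen V (\<omega> x) = scale_set u V" for u
  proof (rule chart_ring_least[OF valuationD(1)[OF V] kV])
    fix h assume "h \<in> H"
    then have "h \<in> scale_set u V" using H_omega[OF _ x(1)] subsetD[OF submod_gen_gens] u(2) by blast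
    then show "h / u \<in> V" using mem_scale_set[OF u(1)] by blast
  qed
  show "chart_ring k H v \<subseteq> V" by (rule chart[OF v(2,3)])
  show "kappa_bar k C \<omega> V = loc (chart_ring k H v) V"
    unfolding kappa_bar_def projective_map_def pb loc_def[symmetric]
  proof (rule the_equality)
    show "\<exists>v'\<in>H. v' \<noteq> 0 \<and> submod_gen V (\<omega> x) = scale_set v' V \<and> loc (chart_ring k H v) V = loc (chart_ring k H v') V"
      using v by blast
    fix z assume "\<exists>v'\<in>H. v' \<noteq> 0 \<and> submod_gen V (\<omega> x) = scale_set v' V \<and> z = loc (chart_ring k H v') V"
    then obtain v' where v': "v' \<in> H" "v' \<noteq> 0" "submod_gen V (\<omega> x) = scale_set v' V" "z = loc (chart_ring k H v') V" by blast
    show "z = loc (chart_ring k H v) V"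
      unfolding v'(4) by (rule chart_loc_eq[OF Vl v'(1,2) v(1,2) chart[OF v'(2,3)] chart[OF v(2,3)]])
  qed
qed

lemma canonical_model_point:
  assumes "z \<in> canonical_model k C \<omega>"
  obtains V v where "valuation_ring K V" "v \<in> H" "v \<noteq> 0" "chart_ring k H v \<subseteq> V" "z = loc (chart_ring k H v) V"
proof -
  obtain V where V: "valuation_ring K V" "k \<subseteq> V" "z = kappa_bar k C \<omega> V"
    using assms unfolding canonical_model_def normalization_eq by blast
  obtain x where x: "x \<in> C" "dominates V x" using center_exists[OF V(1,2)] by blast
  obtain v where v: "v \<in> H" "v \<noteq> 0" "submod_gen V (\<omega> x) = scale_set v V" using pullback_generator[OF V(1) x] by blast
  show ?thesis using that V(1) v(1,2) kappa_bar_eq[OF V(1) x v] V(3) by blast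
qed

text \<open>Separatedness of projective space: a valuation ring that dominates two points of the model contains
  the coordinate rings of charts around both, and then the charts give the same local ring.\<close>

lemma separated_canonical_model: "separated (canonical_model k C \<omega>)"
  unfolding separated_def
proof (intro conjI ballI allI impI)
  fix z assume "z \<in> canonical_model k C \<omega>"
  then obtain V v where V: "valuation_ring K V" "v \<in> H" "v \<noteq> 0" "chart_ring k H v \<subseteq> V" "z = loc (chart_ring k H v) V"
    by (rule canonical_model_point)
  note L = loc_props[OF val_local[OF V(1)] chart_ring_facts(1) V(4)]
  show "local_ring z" using L(1) V(5) by simp
  show "z \<subseteq> K" using L(3) V(5) valuationD(2)[OF V(1)] by simp
next
  fix U z z' assume U: "valuation_ring K U" and z: "z \<in> canonical_model k C \<omega>" "z' \<in> canonical_model k C \<omega>"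
    and d: "dominates U z \<and> dominates U z'"
  have chart: "\<exists>v. v \<in> H \<and> v \<noteq> 0 \<and> chart_ring k H v \<subseteq> U \<and> z = loc (chart_ring k H v) U"
    if z: "z \<in> canonical_model k C \<omega>" "dominates U z" for z
  proof -
    obtain V v where V: "valuation_ring K V" "v \<in> H" "v \<noteq> 0" "chart_ring k H v \<subseteq> V" "z = loc (chart_ring k H v) V"
      using z(1) by (rule canonical_model_point)
    note L = loc_props[OF val_local[OF V(1)] chart_ring_facts(1) V(4), folded V(5)]
    have "loc (chart_ring k H v) U = z"
      by (metis loc_dominates[OF z(2) L(2)] loc_dominates[OF L(4,2)] V(5))
    then show ?thesis using V(2,3) L(2) dominatesD(1)[OF z(2)] by blast
  qed
  obtain v where v: "v \<in> H" "v \<noteq> 0" "chart_ring k H v \<subseteq> U" "z = loc (chart_ring k H v) U"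
    using chart[OF z(1) conjunct1[OF d]] by blast
  obtain v' where v': "v' \<in> H" "v' \<noteq> 0" "chart_ring k H v' \<subseteq> U" "z' = loc (chart_ring k H v') U"
    using chart[OF z(2) conjunct2[OF d]] by blast
  show "z = z'"
    unfolding v(4) v'(4) by (rule chart_loc_eq[OF val_local[OF U] v(1,2) v'(1,2) v(3) v'(3)])
qed

text \<open>The place \<open>V\<close> over a closed Gorenstein point \<open>P\<close> is mapped to the local ring \<open>loc R P = P\<close> of the model.
  For the generic point, which is mapped to the fraction field of \<open>R\<close>, a closed Gorenstein point \<open>Q\<close> shows
  that this field is \<open>K\<close>.\<close>

lemma gorenstein_subset_model:
  assumes nh: "\<not> hyperelliptic k C"
  shows "gorenstein_locus k C \<omega> \<subseteq> canonical_model k C \<omega>"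
proof
  fix P assume PG: "P \<in> gorenstein_locus k C \<omega>"
  have model: "loc (chart_ring k H v) V \<in> canonical_model k C \<omega>"
    if "valuation_ring K V" "x \<in> C" "dominates V x" "v \<in> H" "v \<noteq> 0" "submod_gen V (\<omega> x) = scale_set v V" for V x v
  proof -
    have "k \<subseteq> V" using point(3)[OF that(2)] dominatesD(1)[OF that(3)] by blast
    then have "V \<in> normalization k C" using that(1) normalization_eq by blast
    then show ?thesis unfolding canonical_model_def using kappa_bar_eq(2)[OF that, symmetric] by (rule image_eqI[rotated])
  qed
  have closed: "\<exists>v. v \<in> H \<and> v \<noteq> 0 \<and> \<omega> Q = scale_set v Q \<and> loc (chart_ring k H v) Q = Q \<and> chart_ring k H v \<subseteq> Q"
    if Q: "Q \<in> gorenstein_locus k C \<omega>" "Q \<noteq> K" for Q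
  proof -
    note g = gorenstein_point[OF Q(1)]
    obtain v where v': "v \<in> H" "v \<noteq> 0" "\<omega> Q = scale_set v Q" using g(2) principal_generator[OF g(1)] by metis
    interpret gorenstein_closed_point k C \<omega> g Q v
      by unfold_locales (use g(1) Q(2) v' nh in auto)
    show ?thesis using v' local_ring_of_model R_P by (intro exI[of _ v] conjI)
  qed
  show "P \<in> canonical_model k C \<omega>"
  proof (cases "P = K")
    case False
    note g = gorenstein_point[OF PG]
    obtain v where v: "v \<in> H" "v \<noteq> 0" "\<omega> P = scale_set v P" "loc (chart_ring k H v) P = P" "chart_ring k H v \<subseteq> P"
      using closed[OF PG False] by blast
    obtain V where V: "valuation_ring K V" "dominates V P"
      using dominating_valuation[OF K_subfield point(1,4)[OF g(1)]] by blast
    have PV: "P \<subseteq> V" by (rule dominatesD(1)[OF V(2)])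
    note Vs = valuationD(1)[OF V(1)]
    have "submod_gen V (\<omega> P) = scale_set v V"
    proof
      show "submod_gen V (\<omega> P) \<subseteq> scale_set v V"
        unfolding v(3) using PV by (intro submod_gen_least scale_set_submod is_submod_self[OF Vs]) (auto simp: scale_set_def)
      have vs: "v \<in> submod_gen V (\<omega> P)" by (rule subsetD[OF submod_gen_gens H_omega[OF v(1) g(1)]])
      show "scale_set v V \<subseteq> submod_gen V (\<omega> P)"
        using is_submodD(3)[OF submod_gen_submod _ vs] by (auto simp: scale_set_def mult.commute)
    qed
    then have "loc (chart_ring k H v) V \<in> canonical_model k C \<omega>" using model[OF V(1) g(1) V(2) v(1,2)] by blast
    moreover have "loc (chart_ring k H v) V = P" using loc_dominates[OF V(2) v(5)] v(4) by simp
    ultimately show ?thesis by simp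
  next
    case True
    obtain A where A: "affine A" "spec A \<subseteq> gorenstein_locus k C \<omega>"
      using gorenstein_open PG unfolding open_iff[OF separated_C] affine_def by blast
    obtain Q where Q: "Q \<in> spec A" "Q \<noteq> K" using affine_closed_point[OF A(1)] by blast
    have QG: "Q \<in> gorenstein_locus k C \<omega>" using A(2) Q(1) by blast
    obtain v where v: "v \<in> H" "v \<noteq> 0" "loc (chart_ring k H v) Q = Q" "chart_ring k H v \<subseteq> Q"
      using closed[OF QG Q(2)] by blast
    have QC: "Q \<in> C" using gorenstein_point(1)[OF QG] .
    have fr: "frac (chart_ring k H v) = K"
      using frac_loc[OF point(1)[OF QC] chart_ring_facts(1) v(4)] v(3) point(5)[OF QC] by simp
    have "submod_gen K (\<omega> K) = scale_set v K"
    proof -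
      have "scale_set v K = K"
      proof
        show "scale_set v K \<subseteq> K" using v(1) H_K K_ring(4) by (auto simp: scale_set_def)
        show "K \<subseteq> scale_set v K"
          using mem_scale_set[OF v(2)] subfield_divide[OF K_subfield] v(1) H_K by blast
      qed
      then show ?thesis using submod_gen_self[OF is_submod_self[OF K_subring]] generic_stalk(2) by simp
    qed
    then have "loc (chart_ring k H v) K \<in> canonical_model k C \<omega>"
      using model[OF valuation_subfield[OF K_subfield] K_point dominates_refl v(1,2)] by blast
    moreover have "loc (chart_ring k H v) K = K"
    proof -
      have "loc (chart_ring k H v) K = frac (chart_ring k H v)"
        unfolding set_eq_iff loc_iff max_K by (auto simp: frac_def)
      then show ?thesis using fr by simp
    qed
    ultimately show ?thesis using True by simp
  qed
qed

subsection \<open>The blowup is an isomorphism over the Gorenstein locus\<close>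

lemma module_power_facts:
  assumes A: "is_subring A" and M: "is_submod A M"
  shows "is_submod A (module_power A M n)"
    "a \<in> module_power A M m \<Longrightarrow> b \<in> module_power A M n \<Longrightarrow> a * b \<in> module_power A M (m + n)"
    "w \<in> M \<Longrightarrow> w ^ n \<in> module_power A M n"
proof -
  have sub: "is_submod A (module_power A M n)" for n
    by (cases n) (auto simp: is_submod_self[OF A] submod_gen_submod)
  show "is_submod A (module_power A M n)" by (rule sub)
  have gen: "x * y \<in> module_power A M (Suc n)" if "x \<in> M" "y \<in> module_power A M n" for x y n
    unfolding module_power.simps by (rule subsetD[OF submod_gen_gens]) (use that in blast)
  show "a \<in> module_power A M m \<Longrightarrow> b \<in> module_power A M n \<Longrightarrow> a * b \<in> module_power A M (m + n)"
  proof (induction m arbitrary: a)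
    case 0
    then show ?case using is_submodD(3)[OF sub[of n]] by simp
  next
    case (Suc m)
    have "is_submod A {a. a * b \<in> module_power A M (Suc m + n)}"
      unfolding is_submod_def using is_submodD[OF sub[of "Suc m + n"]] by (auto simp: distrib_right mult.assoc)
    moreover have "{x * y |x y. x \<in> M \<and> y \<in> module_power A M m} \<subseteq> {a. a * b \<in> module_power A M (Suc m + n)}"
      using Suc.IH[OF _ Suc.prems(2)] gen[of _ _ "m + n"] by (auto simp: mult.assoc simp del: module_power.simps)
    ultimately have "module_power A M (Suc m) \<subseteq> {a. a * b \<in> module_power A M (Suc m + n)}"
      unfolding module_power.simps(2)[of A M m] by (rule submod_gen_least)
    then show ?case using Suc.prems(1) by blast
  qed
  show "w \<in> M \<Longrightarrow> w ^ n \<in> module_power A M n"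
  proof (induction n)
    case 0
    then show ?case using subringD(1)[OF A] by simp
  next
    case (Suc n)
    then show ?case using gen[of w "w ^ n" n] by simp
  qed
qed

lemma homogeneous_localization_facts:
  assumes A: "is_subring A" and M: "is_submod A M" and w: "w \<in> M" "w \<noteq> 0"
  shows "is_subring (homogeneous_localization A M w)" "A \<subseteq> homogeneous_localization A M w"
    "u \<in> M \<Longrightarrow> u / w \<in> homogeneous_localization A M w"
proof -
  let ?B = "homogeneous_localization A M w"
  note mp = module_power_facts[OF A M]
  have I: "a / w ^ n \<in> ?B" if "a \<in> module_power A M n" for a n
    using that unfolding homogeneous_localization_def by blast
  show AB: "A \<subseteq> ?B" using I[of _ 0] by auto
  show "is_subring ?B"
    unfolding is_subring_def
  proof (intro conjI ballI)
    show "1 \<in> ?B" using AB subringD(1)[OF A] by blast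
    fix x y assume "x \<in> ?B" "y \<in> ?B"
    then obtain a m b n where *: "a \<in> module_power A M m" "b \<in> module_power A M n" "x = a / w ^ m" "y = b / w ^ n"
      unfolding homogeneous_localization_def by blast
    have 1: "x - y = (a * w ^ n - b * w ^ m) / w ^ (m + n)"
      unfolding *(3,4) using w(2) by (simp add: field_simps power_add)
    have "b * w ^ m \<in> module_power A M (m + n)" using mp(2)[OF *(2) mp(3)[OF w(1), of m]] by (simp add: add.commute)
    then show "x - y \<in> ?B" unfolding 1
      using mp(2)[OF *(1) mp(3)[OF w(1), of n]] by (intro I is_submod_diff(2)[OF A mp(1)])
    have 2: "x * y = (a * b) / w ^ (m + n)" using * by (simp add: power_add)
    show "x * y \<in> ?B" unfolding 2 by (rule I[OF mp(2)[OF *(1,2)]])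
  qed
  show "u / w \<in> ?B" if "u \<in> M"
  proof -
    have "u * 1 \<in> module_power A M (Suc 0)"
      unfolding module_power.simps by (rule subsetD[OF submod_gen_gens]) (use that subringD(1)[OF A] in blast)
    from I[OF this] show ?thesis by simp
  qed
qed

lemma homogeneous_localization_subset:
  assumes x: "is_subring x" "A \<subseteq> x" and w: "w \<noteq> 0" and M: "M \<subseteq> scale_set w x"
  shows "homogeneous_localization A M w \<subseteq> x"
proof -
  note xr = subringD[OF x(1)]
  have "module_power A M n \<subseteq> {a. a / w ^ n \<in> x}" for n
  proof (induction n)
    case 0
    then show ?case using x(2) by auto
  next
    case (Suc n)
    have "is_submod A {a. a / w ^ Suc n \<in> x}"
      unfolding is_submod_def using xr(2,4,6) x(2)
      by (auto simp: add_divide_distrib simp flip: times_divide_eq_right)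
    moreover have "a * b / w ^ Suc n \<in> x" if "a \<in> M" "b \<in> module_power A M n" for a b
    proof -
      have "a / w \<in> x" using that(1) M mem_scale_set[OF w] by blast
      moreover have "b / w ^ n \<in> x" using that(2) Suc by blast
      ultimately have "(a / w) * (b / w ^ n) \<in> x" by (rule xr(4))
      then show ?thesis by simp
    qed
    ultimately show ?case unfolding module_power.simps by (intro submod_gen_least) auto
  qed
  then show ?thesis unfolding homogeneous_localization_def by blast
qed

text \<open>Let \<open>y\<close> be a point of the blowup over a Gorenstein point \<open>x\<close>, in the chart of \<open>w\<close>, and \<open>v\<close> a generator of
  the stalk at \<open>x\<close>.  The quotient \<open>v / w\<close> belongs to the local ring \<open>y\<close>, so \<open>w\<close> is a generator as well,
  and the coordinate ring of the chart is contained in \<open>x\<close>.\<close>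

lemma blowup_point:
  assumes y: "y \<in> blowup k C \<omega>" and cy: "center C y \<in> gorenstein_locus k C \<omega>"
  shows "y = center C y"
proof -
  obtain A w where A: "affine A" and w: "w \<in> sections \<omega> (spec A)" "w \<noteq> 0"
    and yB: "y \<in> spec (homogeneous_localization A (sections \<omega> (spec A)) w)"
    using y unfolding blowup_def affine_def by blast
  let ?M = "sections \<omega> (spec A)"
  let ?B = "homogeneous_localization A ?M w"
  note As = affineD(2)[OF A] and M = coh_affine_submod[OF coh_omega A]
  note B = homogeneous_localization_facts[OF As M w]
  note Y = specD[OF B(1) yB] note Yr = subringD[OF local_ring_subring[OF Y(1)]]
  have Ay: "A \<subseteq> y" using B(2) Y(2) by blast
  have MK: "?M \<subseteq> K" using sectionsD[OF _ affine_frac(3)[OF A]] cohD(2)[OF coh_omega K_point] by blast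
  have "?M \<subseteq> scale_set w K"
    using MK w mem_scale_set[OF w(2)] subfield_divide[OF K_subfield] by blast
  then have BK: "?B \<subseteq> K" by (rule homogeneous_localization_subset[OF K_subring affine_frac(2)[OF A] w(2)])
  have yK: "y \<subseteq> K"
  proof
    fix u assume "u \<in> y"
    then have "u \<in> loc ?B y" using Y(3) by simp
    then obtain a s where "a \<in> ?B" "s \<in> ?B" "u = a / s" by (rule locE)
    then show "u \<in> K" using BK subfield_divide[OF K_subfield] by blast
  qed
  note L = loc_props[OF Y(1) As Ay]
  define x where "x = loc A y"
  have xA: "x \<in> spec A" and xC: "x \<in> C" and dx: "dominates y x" using L(4,5) affineD(5)[OF A] by (auto simp: x_def)
  have cx: "center C y = x" by (rule center_C[OF Y(1) yK xC dx])
  obtain v where v: "v \<noteq> 0" "\<omega> x = scale_set v x" using gorenstein_point(2) cy cx by metis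
  have mem: "u \<in> \<omega> x \<longleftrightarrow> u / v \<in> x" for u unfolding v(2) by (rule mem_scale_set[OF v(1)])
  have "v \<in> \<omega> x" using mem v(1) point_ring(1)[OF xC] by simp
  then obtain s where s: "s \<in> A" "s \<notin> max_ideal x" "s * v \<in> ?M" using cohD(4)[OF coh_omega A xA] by blast
  have sx: "s \<in> x" using s(1) spec_point(2)[OF A xA] by blast
  have wx: "w / v \<in> x" using mem sectionsD[OF w(1) xA] by blast
  \<comment> \<open>The section \<open>w\<close> generates the stalk, since \<open>v / w\<close> is in \<open>y\<close> up to a unit.\<close>
  have wu: "w / v \<notin> max_ideal x"
  proof
    assume "w / v \<in> max_ideal x"
    then have "w / v \<in> max_ideal y" using dominatesD(2)[OF dx] by blast
    moreover have "s * v / w \<in> y" using B(3)[OF s(3)] Y(2) by blast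
    ultimately have "(s * v / w) * (w / v) \<in> max_ideal y" using is_submodD(3)[OF local_ring_max[OF Y(1)]] by blast
    then have "s \<in> max_ideal y" using v(1) w(2) by simp
    then show False using s(2) sx dominates_max_iff[OF dx] by blast
  qed
  have vw: "v / w \<in> x" using unitD(2)[OF wx wu] by simp
  have "?M \<subseteq> scale_set w x"
  proof
    fix u assume "u \<in> ?M"
    then have "u / v \<in> x" using mem sectionsD[OF _ xA] by blast
    then have "(u / v) * (v / w) \<in> x" using point_ring(4)[OF xC] vw by blast
    then show "u \<in> scale_set w x" using v(1) mem_scale_set[OF w(2)] by simp
  qed
  then have Bx: "?B \<subseteq> x"
    by (rule homogeneous_localization_subset[OF point(2)[OF xC] spec_point(2)[OF A xA] w(2)])
  have "y \<subseteq> x"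
    using loc_least[OF point(2)[OF xC] dx Bx] Y(3) by simp
  then show ?thesis using dominatesD(1)[OF dx] cx by blast
qed

lemma gorenstein_in_blowup:
  assumes "x \<in> gorenstein_locus k C \<omega>"
  shows "x \<in> blowup k C \<omega>" "center C x = x"
proof -
  note g = gorenstein_point[OF assms]
  show "center C x = x" by (rule center_C[OF point(1,4)[OF g(1)] g(1) dominates_refl])
  obtain v where v: "v \<noteq> 0" "\<omega> x = scale_set v x" using g(2) by blast
  have mem: "u \<in> \<omega> x \<longleftrightarrow> u / v \<in> x" for u unfolding v(2) by (rule mem_scale_set[OF v(1)])
  obtain A where A: "affine A" "x \<in> spec A" using chart_exists[OF g(1)] by blast
  let ?M = "sections \<omega> (spec A)"
  note As = affineD(2)[OF A(1)] and M = coh_affine_submod[OF coh_omega A(1)]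
  have "v \<in> \<omega> x" using mem v(1) point_ring(1)[OF g(1)] by simp
  then obtain s where s: "s \<in> A" "s \<notin> max_ideal x" "s * v \<in> ?M" using cohD(4)[OF coh_omega A] by blast
  have sx: "s \<in> x" using s(1) spec_point(2)[OF A] by blast
  have si: "s \<noteq> 0" "inverse s \<in> x" using unitD[OF sx s(2)] by auto
  define w where "w = s * v"
  have w: "w \<in> ?M" "w \<noteq> 0" using s(3) si(1) v(1) by (auto simp: w_def)
  let ?B = "homogeneous_localization A ?M w"
  note B = homogeneous_localization_facts[OF As M w]
  have "?M \<subseteq> scale_set w x"
  proof
    fix u assume "u \<in> ?M"
    then have "u / v \<in> x" using mem sectionsD[OF _ A(2)] by blast
    then have "(u / v) * inverse s \<in> x" using point_ring(4)[OF g(1)] si(2) by blast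
    moreover have "(u / v) * inverse s = u / w" using v(1) si(1) by (simp add: w_def field_simps)
    ultimately show "u \<in> scale_set w x" using mem_scale_set[OF w(2)] by simp
  qed
  then have Bx: "?B \<subseteq> x"
    by (rule homogeneous_localization_subset[OF point(2)[OF g(1)] spec_point(2)[OF A] w(2)])
  note L = loc_props[OF point(1)[OF g(1)] B(1) Bx]
  have "x \<subseteq> loc ?B x"
  proof
    fix u assume "u \<in> x"
    then obtain a t where "a \<in> A" "t \<in> A" "t \<notin> max_ideal x" "u = a / t" using spec_point(4)[OF A] by blast
    then show "u \<in> loc ?B x" using B(2) by (auto simp: loc_iff)
  qed
  then have "loc ?B x = x" using L(3) by blast
  then have "x \<in> spec ?B" using L(5) by simp
  then show "x \<in> blowup k C \<omega>" unfolding blowup_def using A(1) w unfolding affine_def by blast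
qed

lemma kappa_identity:
  assumes nh: "\<not> hyperelliptic k C" and x: "x \<in> gorenstein_locus k C \<omega>"
  shows "kappa k C \<omega> x = x"
proof -
  let ?S = "{y \<in> blowup k C \<omega>. center C y \<in> gorenstein_locus k C \<omega>}"
  have "inj_on (center C) ?S"
  proof (rule inj_onI)
    fix y y' assume "y \<in> ?S" "y' \<in> ?S" "center C y = center C y'"
    then show "y = y'" using blowup_point[of y] blowup_point[of y'] by simp
  qed
  then have "the_inv_into ?S (center C) x = x"
    using gorenstein_in_blowup[OF x] x by (intro the_inv_into_f_eq) auto
  moreover have "center (canonical_model k C \<omega>) x = x"
    unfolding center_def
  proof (rule the_equality)
    note p = point[OF gorenstein_point(1)[OF x]]
    have xM: "x \<in> canonical_model k C \<omega>" using gorenstein_subset_model[OF nh] x by blast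
    then show "x \<in> canonical_model k C \<omega> \<and> dominates x x" using dominates_refl by blast
    show "y = x" if "y \<in> canonical_model k C \<omega> \<and> dominates x y" for y
      using separated_dominates[OF separated_canonical_model _ xM p(4,1) _ dominates_refl] that by blast
  qed
  ultimately show ?thesis by (simp add: kappa_def kappa_hat_def)
qed

text \<open>An affine neighbourhood of a point in the Gorenstein locus consists of points of the model, so it is
  open in both; thus the two topologies agree.\<close>

theorem kappa_open_embedding:
  assumes nh: "\<not> hyperelliptic k C"
  shows "open_embedding k (gorenstein_locus k C \<omega>) (canonical_model k C \<omega>) (kappa k C \<omega>)"
proof -
  let ?G = "gorenstein_locus k C \<omega>" and ?M = "canonical_model k C \<omega>"
  have GC: "?G \<subseteq> C" using gorenstein_point(1) by blast
  have GM: "?G \<subseteq> ?M" by (rule gorenstein_subset_model[OF nh])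
  note sG = separated_subset[OF separated_C GC] and sM = separated_canonical_model
  have cover: "\<exists>A. finite_type k A \<and> spec A \<subseteq> ?G \<and> x \<in> spec A" if "x \<in> ?G" for x
    using gorenstein_open that unfolding open_iff[OF separated_C] by blast
  have oG: "openin (zariski k ?G) ?G" unfolding open_iff[OF sG] using cover by blast
  have oM: "openin (zariski k ?M) ?G" unfolding open_iff[OF sM] using cover GM by blast
  have "topspace (zariski k ?G) \<subseteq> ?G"
    using openin_topspace[of "zariski k ?G"] unfolding open_iff[OF sG] by blast
  then have top: "topspace (zariski k ?G) = ?G" using openin_subset[OF oG] by blast
  have "openin (zariski k ?G) U \<longleftrightarrow> openin (subtopology (zariski k ?M) ?G) U" for U
  proof -
    have "openin (zariski k ?G) U \<longleftrightarrow> U \<subseteq> ?G \<and> openin (zariski k ?M) U"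
    proof
      assume U: "openin (zariski k ?G) U"
      then have "U \<subseteq> ?G" using openin_subset top by blast
      moreover have "openin (zariski k ?M) U"
        using U GM unfolding open_iff[OF sG] open_iff[OF sM] by (meson order_trans)
      ultimately show "U \<subseteq> ?G \<and> openin (zariski k ?M) U" by blast
    next
      assume "U \<subseteq> ?G \<and> openin (zariski k ?M) U"
      then show "openin (zariski k ?G) U"
        unfolding open_iff[OF sG] open_iff[OF sM] by (meson order_trans)
    qed
    then show ?thesis using openin_open_subtopology[OF oM] by blast
  qed
  then have eq: "zariski k ?G = subtopology (zariski k ?M) ?G" by (simp add: topology_eq)
  have id: "kappa k C \<omega> x = x" if "x \<in> ?G" for x by (rule kappa_identity[OF nh that])
  then have im: "kappa k C \<omega> ` ?G = ?G" by force
  have "homeomorphic_map (zariski k ?G) (subtopology (zariski k ?M) ?G) id" using eq by simp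
  then have "homeomorphic_map (zariski k ?G) (subtopology (zariski k ?M) ?G) (kappa k C \<omega>)"
    by (rule homeomorphic_map_eq) (use id top in auto)
  then have "embedding_map (zariski k ?G) (zariski k ?M) (kappa k C \<omega>)"
    unfolding embedding_map_def top im .
  moreover have "is_morphism ?G ?M (kappa k C \<omega>)"
    unfolding is_morphism_def using id GM dominates_refl by auto
  ultimately show ?thesis unfolding open_embedding_def im using oM id by blast
qed

end

theorem theorem4p13:
  fixes k :: "'a::field set" and C :: "'a set set" and \<omega> :: "'a set \<Rightarrow> 'a set" and g :: nat
  assumes "alg_closed_subfield k"
    and "complete_integral_curve k C"
    and "has_arithmetic_genus k C g"
    and "g \<ge> 2"
    and "dualizing_sheaf k C \<omega>"
    and "\<not> hyperelliptic k C"
  shows "open_embedding k (gorenstein_locus k C \<omega>) (canonical_model k C \<omega>) (kappa k C \<omega>)"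
proof -
  interpret canonical_curve k C \<omega> g
    by unfold_locales (rule assms)+
  show ?thesis by (rule kappa_open_embedding[OF assms(6)])
qed

end
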